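(* Let $U_0\in\mathcal{S}$, and let $\{U_n\}$ be generated by the two-stage scheme with time steps $\tau_n\in[\tau_{\min},\tau_{\max}]$ for all $n$, where $\tau_{\min}>0$ and $\tau_{\max}$ is sufficiently small. Let $\hat\kappa=\kappa_{\max}^{1/4}\in(0,1)$, where $\kappa_{\max}=\sup_{\tau\in[\tau_{\min},\tau_{\max}]}\kappa(\tau)$ and $$\kappa(\tau)=1-2\tau\Big(\frac{1}{\lambda_N}-\frac{1}{\lambda_{N+1}}-\varepsilon\Big)+\mathcal{O}(\tau^2)\in(0,1)$$ is the contraction factor for the predictor step, with $\varepsilon\in\big(0,\frac1{\lambda_N}-\frac1{\lambda_{N+1}}\big)$. Then there exist a constant $C>0$ and an orthogonal matrix $Q_*\in\mathcal{O}^N$ such that for all sufficiently large $n$: $$\|\nabla_GE_{\mathcal{G}}(U_n)\|_a\leqslant C\hat\kappa^n,\qquad\|U_n-V_*Q_*\|_a\leqslant C\hat\kappa^n,\qquad E(U_n)-E(V_* )\leqslant C\hat\kappa^{2n}.$$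
   Context: $\Omega\subset\mathbb{R}^d$ is a bounded domain, and $(\cdot,\cdot)$ denotes the $L^2(\Omega)$ inner product. $\mathcal{V}:\Omega\to\mathbb{R}$ is a potential such that $a(u,v)=\int_\Omega(\nabla u\cdot\nabla v+\mathcal{V}uv)\,dx$ on $H_0^1(\Omega)$ is symmetric, bounded and coercive. Let $\lambda_1\leqslant\lambda_2\leqslant\cdots$ be the eigenvalues (with multiplicity) of $a(u,v)=\lambda(u,v)$ for all $v$. Assume $\lambda_N<\lambda_{N+1}$. Let $V_*=(v_1,\dots,v_N)$ be $L^2$-orthonormal eigenfunctions for $\lambda_1,\dots,\lambda_N$. $\mathcal{G}=(-\Delta+\mathcal{V})^{-1}$: $\mathcal{G}f\in H_0^1(\Omega)$ is the unique element with $a(\mathcal{G}f,v)=(f,v)$ for all $v$. For $N$-tuples: - $\mathcal{G}U=(\mathcal{G}u_1,\dots,\mathcal{G}u_N)$; - $UA$ has $j$-th entry $\sum_iu_iA_{ij}$; - $\langle U,V\rangle=((u_i,v_j))_{i,j}$ and $\langle U,V\rangle_a=(a(u_i,v_j))_{i,j}$; - $\|U\|_a^2=\operatorname{tr}\langle U,U\rangle_a$. $E(U)=\frac12\|U\|_a^2$ and $\nabla_GE_{\mathcal{G}}(U)=\mathcal{G}U-U\langle\mathcal{G}U,U\rangle$. $\mathcal{O}^N$ is the set of orthogonal matrices. The quasi-Stiefel set is $\mathcal{M}^N_{\geqslant}=\{U:\langle U,U\rangle-I_N\text{ positive semidefinite}\}$. Set $$E_{\mathrm{ES}}=\tfrac12\Big(\sum_{i=1}^{N-1}\lambda_i+\lambda_{N+1}\Big),\qquad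 E_1=\tfrac12\big(E(V_* )+E_{\mathrm{ES}}\big),$$ $$\mathcal{S}=\{U: UQ\in\mathcal{M}^N_{\geqslant}\text{ for some }Q\in\mathcal{O}^N,\ E(U)\leqslant E_1\}.$$ Define $\mathcal{A}_UV=\mathcal{G}U\langle U,V\rangle-U\langle U,\mathcal{G}V\rangle$. The two-stage scheme: $\hat U_{n+1}$ solves $$\hat U_{n+1}=U_n+\tau_n\mathcal{A}_{U_n}\Big(\tfrac{\hat U_{n+1}+U_n}{2}\Big),$$ and $$U_{n+1}=\hat U_{n+1}-\tau_n\mathcal{G}\hat U_{n+1}\big(\langle\hat U_{n+1},\hat U_{n+1}\rangle-I_N\big).$$ The contraction factor $\kappa(\tau_n)$ is the one for which, for sufficiently large $n$ and some $c>0$, $$\|\mathcal{A}_{\hat U_{n+1}}\hat U_{n+1}\|_a^2\leqslant\kappa(\tau_n)\|\mathcal{A}_{U_n}U_n\|_a^2+c\,\tau_n\|\langle U_n,U_n\rangle-I_N\|,$$ where the matrix norm is the Frobenius norm. *)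

theory Defs
  imports "HOL-Analysis.Analysis"
begin


type_synonym ('d) fn = "real^('d::finite) \<Rightarrow> real"
type_synonym 'd tuple = "nat \<Rightarrow> 'd fn"   \<comment> \<open>N-tuples, indices 1..N\<close>
type_synonym mat = "nat \<Rightarrow> nat \<Rightarrow> real"  \<comment> \<open>N x N matrices, indices 1..N\<close>

definition is_domain :: "(real^('d::finite)) set \<Rightarrow> bool" where
  "is_domain \<Omega> \<longleftrightarrow> open \<Omega> \<and> connected \<Omega> \<and> bounded \<Omega> \<and> \<Omega> \<noteq> {}"

fun pd :: "('d::finite) list \<Rightarrow> 'd fn \<Rightarrow> 'd fn" where
  "pd [] f = f"
| "pd (i # is) f = (\<lambda>x. frechet_derivative (pd is f) (at x) (axis i 1))"

definition smooth_fn :: "('d::finite) fn \<Rightarrow> bool" where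
  "smooth_fn f \<longleftrightarrow> (\<forall>is x. pd is f differentiable (at x))"

definition testfn :: "(real^('d::finite)) set \<Rightarrow> 'd fn \<Rightarrow> bool" where
  "testfn \<Omega> \<phi> \<longleftrightarrow> smooth_fn \<phi> \<and> compact (closure {x. \<phi> x \<noteq> 0})
      \<and> closure {x. \<phi> x \<noteq> 0} \<subseteq> \<Omega>"

definition cgrad :: "('d::finite) fn \<Rightarrow> real^'d \<Rightarrow> real^'d" where
  "cgrad \<phi> x = (\<chi> i. pd [i] \<phi> x)"

definition inL2 :: "(real^('d::finite)) set \<Rightarrow> 'd fn \<Rightarrow> bool" where
  "inL2 \<Omega> f \<longleftrightarrow> set_borel_measurable lebesgue \<Omega> f
      \<and> set_integrable lebesgue \<Omega> (\<lambda>x. (f x)^2)"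

definition l2ip :: "(real^('d::finite)) set \<Rightarrow> 'd fn \<Rightarrow> 'd fn \<Rightarrow> real" where
  "l2ip \<Omega> u v = (LINT x:\<Omega>|lebesgue. u x * v x)"

text \<open>H_0^1(Omega): closure of the test functions in the H^1 norm; g is the (weak) gradient.\<close>
definition H01pair :: "(real^('d::finite)) set \<Rightarrow> 'd fn \<Rightarrow> (real^'d \<Rightarrow> real^'d) \<Rightarrow> bool" where
  "H01pair \<Omega> u g \<longleftrightarrow> inL2 \<Omega> u \<and> (\<forall>i. inL2 \<Omega> (\<lambda>x. g x $ i)) \<and>
     (\<exists>\<phi>. (\<forall>k. testfn \<Omega> (\<phi> k)) \<and>
        (\<lambda>k. LINT x:\<Omega>|lebesgue. (\<phi> k x - u x)^2) \<longlonglongrightarrow> 0 \<and>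
        (\<lambda>k. LINT x:\<Omega>|lebesgue. (norm (cgrad (\<phi> k) x - g x))^2) \<longlonglongrightarrow> 0)"

definition H01 :: "(real^('d::finite)) set \<Rightarrow> 'd fn set" where
  "H01 \<Omega> = {u. \<exists>g. H01pair \<Omega> u g}"

definition wgrad :: "(real^('d::finite)) set \<Rightarrow> 'd fn \<Rightarrow> real^'d \<Rightarrow> real^'d" where
  "wgrad \<Omega> u = (SOME g. H01pair \<Omega> u g)"

definition H1norm :: "(real^('d::finite)) set \<Rightarrow> 'd fn \<Rightarrow> real" where
  "H1norm \<Omega> u = sqrt (l2ip \<Omega> u u + (LINT x:\<Omega>|lebesgue. (norm (wgrad \<Omega> u x))^2))"

definition aform :: "(real^('d::finite)) set \<Rightarrow> 'd fn \<Rightarrow> 'd fn \<Rightarrow> 'd fn \<Rightarrow> real" where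
  "aform \<Omega> V u v = (LINT x:\<Omega>|lebesgue. wgrad \<Omega> u x \<bullet> wgrad \<Omega> v x + V x * u x * v x)"

definition admissible_potential :: "(real^('d::finite)) set \<Rightarrow> 'd fn \<Rightarrow> bool" where
  "admissible_potential \<Omega> V \<longleftrightarrow>
     set_borel_measurable lebesgue \<Omega> V \<and>
     (\<forall>u\<in>H01 \<Omega>. \<forall>v\<in>H01 \<Omega>. set_integrable lebesgue \<Omega> (\<lambda>x. V x * u x * v x)) \<and>
     (\<forall>u\<in>H01 \<Omega>. \<forall>v\<in>H01 \<Omega>. aform \<Omega> V u v = aform \<Omega> V v u) \<and>
     (\<exists>M. \<forall>u\<in>H01 \<Omega>. \<forall>v\<in>H01 \<Omega>. \<bar>aform \<Omega> V u v\<bar> \<le> M * H1norm \<Omega> u * H1norm \<Omega> v) \<and>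
     (\<exists>\<alpha>>0. \<forall>u\<in>H01 \<Omega>. aform \<Omega> V u u \<ge> \<alpha> * (H1norm \<Omega> u)^2)"

definition is_eigfun :: "(real^('d::finite)) set \<Rightarrow> 'd fn \<Rightarrow> real \<Rightarrow> 'd fn \<Rightarrow> bool" where
  "is_eigfun \<Omega> V \<mu> u \<longleftrightarrow> u \<in> H01 \<Omega> \<and> (\<forall>v\<in>H01 \<Omega>. aform \<Omega> V u v = \<mu> * l2ip \<Omega> u v)"

definition orthonormal_set :: "(real^('d::finite)) set \<Rightarrow> 'd fn set \<Rightarrow> bool" where
  "orthonormal_set \<Omega> F \<longleftrightarrow> (\<forall>u\<in>F. \<forall>w\<in>F. l2ip \<Omega> u w = (if u = w then 1 else 0))"

text \<open>lam 1 <= lam 2 <= ... are the eigenvalues counted with multiplicity: each lam i is an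
  eigenvalue, and for every mu the number of indices i >= 1 with lam i = mu equals the maximal
  number of L^2-orthonormal eigenfunctions for mu (the multiplicity; 0 if mu is no eigenvalue).\<close>
definition eigenvalue_seq :: "(real^('d::finite)) set \<Rightarrow> 'd fn \<Rightarrow> (nat \<Rightarrow> real) \<Rightarrow> bool" where
  "eigenvalue_seq \<Omega> V lam \<longleftrightarrow>
     (\<forall>i j. 1 \<le> i \<longrightarrow> i \<le> j \<longrightarrow> lam i \<le> lam j) \<and>
     (\<forall>i\<ge>1. \<exists>u. is_eigfun \<Omega> V (lam i) u \<and> l2ip \<Omega> u u = 1) \<and>
     (\<forall>\<mu> F. finite F \<and> orthonormal_set \<Omega> F \<and> (\<forall>u\<in>F. is_eigfun \<Omega> V \<mu> u)
          \<longrightarrow> card F \<le> card {i. 1 \<le> i \<and> lam i = \<mu>}) \<and>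
     (\<forall>\<mu>. \<exists>F. finite F \<and> orthonormal_set \<Omega> F \<and> (\<forall>u\<in>F. is_eigfun \<Omega> V \<mu> u)
          \<and> card F = card {i. 1 \<le> i \<and> lam i = \<mu>})"

definition Gop :: "(real^('d::finite)) set \<Rightarrow> 'd fn \<Rightarrow> 'd fn \<Rightarrow> 'd fn" where
  "Gop \<Omega> V f = (SOME w. w \<in> H01 \<Omega> \<and> (\<forall>v\<in>H01 \<Omega>. aform \<Omega> V w v = l2ip \<Omega> f v))"

definition tGop :: "(real^('d::finite)) set \<Rightarrow> 'd fn \<Rightarrow> 'd tuple \<Rightarrow> 'd tuple" where
  "tGop \<Omega> V U = (\<lambda>i. Gop \<Omega> V (U i))"

definition tmul :: "nat \<Rightarrow> ('d::finite) tuple \<Rightarrow> mat \<Rightarrow> 'd tuple" where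
  "tmul N U A = (\<lambda>j x. \<Sum>i\<in>{1..N}. U i x * A i j)"

definition tadd :: "('d::finite) tuple \<Rightarrow> 'd tuple \<Rightarrow> 'd tuple" where
  "tadd U W = (\<lambda>i x. U i x + W i x)"

definition tdiff :: "('d::finite) tuple \<Rightarrow> 'd tuple \<Rightarrow> 'd tuple" where
  "tdiff U W = (\<lambda>i x. U i x - W i x)"

definition tscale :: "real \<Rightarrow> ('d::finite) tuple \<Rightarrow> 'd tuple" where
  "tscale c U = (\<lambda>i x. c * U i x)"

definition gram :: "(real^('d::finite)) set \<Rightarrow> 'd tuple \<Rightarrow> 'd tuple \<Rightarrow> mat" where
  "gram \<Omega> U W = (\<lambda>i j. l2ip \<Omega> (U i) (W j))"

definition anorm :: "(real^('d::finite)) set \<Rightarrow> 'd fn \<Rightarrow> nat \<Rightarrow> 'd tuple \<Rightarrow> real" where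
  "anorm \<Omega> V N U = sqrt (\<Sum>i\<in>{1..N}. aform \<Omega> V (U i) (U i))"

definition energy :: "(real^('d::finite)) set \<Rightarrow> 'd fn \<Rightarrow> nat \<Rightarrow> 'd tuple \<Rightarrow> real" where
  "energy \<Omega> V N U = (anorm \<Omega> V N U)^2 / 2"

definition idm :: mat where
  "idm = (\<lambda>i j. if i = j then 1 else 0)"

definition mdiff :: "mat \<Rightarrow> mat \<Rightarrow> mat" where
  "mdiff A B = (\<lambda>i j. A i j - B i j)"

definition frob :: "nat \<Rightarrow> mat \<Rightarrow> real" where
  "frob N A = sqrt (\<Sum>i\<in>{1..N}. \<Sum>j\<in>{1..N}. (A i j)^2)"

definition orthogonal_mat :: "nat \<Rightarrow> mat \<Rightarrow> bool" where
  "orthogonal_mat N Q \<longleftrightarrow> (\<forall>i\<in>{1..N}. \<forall>j\<in>{1..N}. (\<Sum>k\<in>{1..N}. Q k i * Q k j) = idm i j)"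

definition psd :: "nat \<Rightarrow> mat \<Rightarrow> bool" where
  "psd N A \<longleftrightarrow> (\<forall>x::nat \<Rightarrow> real. (\<Sum>i\<in>{1..N}. \<Sum>j\<in>{1..N}. x i * A i j * x j) \<ge> 0)"

definition gradE :: "(real^('d::finite)) set \<Rightarrow> 'd fn \<Rightarrow> nat \<Rightarrow> 'd tuple \<Rightarrow> 'd tuple" where
  "gradE \<Omega> V N U = tdiff (tGop \<Omega> V U) (tmul N U (gram \<Omega> (tGop \<Omega> V U) U))"

definition Aop :: "(real^('d::finite)) set \<Rightarrow> 'd fn \<Rightarrow> nat \<Rightarrow> 'd tuple \<Rightarrow> 'd tuple \<Rightarrow> 'd tuple" where
  "Aop \<Omega> V N U W = tdiff (tmul N (tGop \<Omega> V U) (gram \<Omega> U W)) (tmul N U (gram \<Omega> U (tGop \<Omega> V W)))"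

definition E_ES :: "nat \<Rightarrow> (nat \<Rightarrow> real) \<Rightarrow> real" where
  "E_ES N lam = ((\<Sum>i\<in>{1..N-1}. lam i) + lam (N+1)) / 2"

definition Sset :: "(real^('d::finite)) set \<Rightarrow> 'd fn \<Rightarrow> nat \<Rightarrow> (nat \<Rightarrow> real) \<Rightarrow> 'd tuple \<Rightarrow> 'd tuple set" where
  "Sset \<Omega> V N lam Vs = {U. (\<forall>i\<in>{1..N}. U i \<in> H01 \<Omega>) \<and>
      (\<exists>Q. orthogonal_mat N Q \<and> psd N (mdiff (gram \<Omega> (tmul N U Q) (tmul N U Q)) idm)) \<and>
      energy \<Omega> V N U \<le> (energy \<Omega> V N Vs + E_ES N lam) / 2}"

end

theory Submission
  imports Defs "HOL-Library.Function_Algebras"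
begin

text \<open>Split a tuple \<open>U\<close> along the eigenfunctions \<open>V\<^sub>*\<close>. Two quantities govern the scheme: the defect
  \<open>M = \<langle>U, U\<rangle> - I\<close>, and the slope \<open>R\<close> of the smallest cone around the span of \<open>V\<^sub>*\<close> that contains the span of
  \<open>U\<close>. The predictor is skew, so it keeps \<open>\<langle>U, U\<rangle>\<close>; the corrector contracts \<open>M\<close> by about \<open>1 - 2 \<tau> / \<lambda>\<^sub>N\<close>.
  Up to \<open>O(\<tau>\<^sup>2)\<close> one step maps \<open>U\<close> to \<open>(1 + \<tau> G) U (1 - \<tau> K)\<close>, which contracts the slope by about
  \<open>1 - \<tau> (1 / \<lambda>\<^sub>N - 1 / \<lambda>\<^sub>N\<^sub>+\<^sub>1)\<close>. Hence \<open>R\<close> decays like \<open>\<kappa>\<^sup>n\<close> and \<open>M\<close> faster, where \<open>\<kappa>\<close> is the fourth root of the worst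
  contraction factor. The gradient is linear and the energy gap quadratic in \<open>R\<close>, up to \<open>M\<close>, and the increments are
  summable. A Ky Fan argument bounds the initial slope on the energy sublevel set uniformly.\<close>

section \<open>Square-integrable functions\<close>

text \<open>The rate function and the step-size bound are quantified before the initial tuple and
  the step sizes, so every constant must come from the energy sublevel set alone; hence one common
  \<open>c\<close> and an initial slope bound uniform in the tuple. A cone condition and a defect
  bound describe the iterate because both survive a step with explicit errors, while the tuples are
  in general not orthonormal. The exponent 1/4 leaves room: the squared slope factor lies below the
  contraction factor, so the slope contracts by the square of the asserted rate, the defect by its
  fourth power, and the forcing of the slope by the defect is absorbed. The upper spectrum enters as
  the inequality \<open>lam (N+1) * b y y \<le> a y y\<close> on the complement of the
  eigenfunctions. It follows from the multiplicity clause of \<open>eigenvalue_seq\<close> once a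
  constrained minimiser of the Rayleigh quotient exists, and existence rests on Ehrling's
  inequality, proved by averaging over small cubes. Elements of \<open>H01\<close> are functions,
  not classes, so both forms are only semidefinite, and the abstract argument is written for such
  forms.\<close>

lemma quadratic_nonneg_imp:
  fixes A B C :: real
  assumes "\<And>t. 0 \<le> A + 2 * t * B + t^2 * C" and "0 \<le> C"
  shows "B^2 \<le> A * C"
proof (cases "C = 0")
  case True
  have "B = 0"
  proof (rule ccontr)
    assume "B \<noteq> 0"
    \<comment> \<open>This \<open>t\<close> turns the affine function of \<open>t\<close> into the
      constant -1.\<close>
    then show False
      using assms(1)[of "- (A + 1) / (2 * B)"] True by (simp add: field_simps)
  qed
  then show ?thesis using True by simp
next
  case False
  then have C: "C > 0" using assms(2) by simp
  have "0 \<le> A + 2 * (- B / C) * B + (- B / C)^2 * C" by (rule assms)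
  also have "\<dots> = (A * C - B^2) / C"
    using C by (simp add: field_simps power2_eq_square)
  finally show ?thesis using C by (simp add: zero_le_divide_iff)
qed

text \<open>Functions themselves, not classes modulo null sets, in agreement with
  \<open>inL2\<close>; accordingly \<open>nrm2\<close> is a seminorm, and two gradients of one
  function are compared only almost everywhere.\<close>

definition L2 :: "'a measure \<Rightarrow> ('a \<Rightarrow> real) set" where
  "L2 M = {f \<in> borel_measurable M. integrable M (\<lambda>x. (f x)^2)}"

definition nrm2 :: "'a measure \<Rightarrow> ('a \<Rightarrow> real) \<Rightarrow> real" where
  "nrm2 M f = sqrt (\<integral>x. (f x)^2 \<partial>M)"

lemma L2_meas [measurable_dest]: "f \<in> L2 M \<Longrightarrow> f \<in> borel_measurable M"
  by (simp add: L2_def)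

lemma L2_sq: "f \<in> L2 M \<Longrightarrow> integrable M (\<lambda>x. (f x)^2)"
  by (simp add: L2_def)

lemma L2_mult:
  assumes "f \<in> L2 M" "g \<in> L2 M" shows "integrable M (\<lambda>x. f x * g x)"
proof (rule Bochner_Integration.integrable_bound)
  show "integrable M (\<lambda>x. (f x)^2 + (g x)^2)"
    using assms by (auto intro: L2_sq)
  show "(\<lambda>x. f x * g x) \<in> borel_measurable M"
    using assms[THEN L2_meas] by measurable
  show "AE x in M. norm (f x * g x) \<le> norm ((f x)^2 + (g x)^2)"
  proof (rule AE_I2)
    fix x
    have "0 \<le> (\<bar>f x\<bar> - \<bar>g x\<bar>)^2" by simp
    then have "2 * (\<bar>f x\<bar> * \<bar>g x\<bar>) \<le> (f x)^2 + (g x)^2"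
      by (simp add: power2_diff)
    moreover have "0 \<le> \<bar>f x\<bar> * \<bar>g x\<bar>" by simp
    ultimately show "norm (f x * g x) \<le> norm ((f x)^2 + (g x)^2)"
      unfolding real_norm_def abs_mult by linarith
  qed
qed

lemma L2_lincomb:
  assumes "f \<in> L2 M" "g \<in> L2 M" shows "(\<lambda>x. f x + c * g x) \<in> L2 M"
proof -
  have "integrable M (\<lambda>x. (f x)^2 + (2 * c) * (f x * g x) + c^2 * (g x)^2)"
    using assms by (intro Bochner_Integration.integrable_add integrable_mult_right L2_mult L2_sq) auto
  then have "integrable M (\<lambda>x. (f x + c * g x)^2)"
    by (simp add: power2_sum power_mult_distrib algebra_simps)
  then show ?thesis using assms[THEN L2_meas] by (simp add: L2_def)
qed

lemma L2_add: "f \<in> L2 M \<Longrightarrow> g \<in> L2 M \<Longrightarrow> (\<lambda>x. f x + g x) \<in> L2 M"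
  using L2_lincomb[of f M g 1] by simp

lemma L2_diff: "f \<in> L2 M \<Longrightarrow> g \<in> L2 M \<Longrightarrow> (\<lambda>x. f x - g x) \<in> L2 M"
  using L2_lincomb[of f M g "-1"] by simp

lemma L2_zero: "(\<lambda>x. 0) \<in> L2 M"
  by (simp add: L2_def)

lemma nrm2_nonneg [simp]: "0 \<le> nrm2 M f"
  by (simp add: nrm2_def)

lemma nrm2_sq: "(nrm2 M f)^2 = (\<integral>x. (f x)^2 \<partial>M)"
  by (simp add: nrm2_def)

lemma nrm2_lincomb_sq:
  assumes "f \<in> L2 M" "g \<in> L2 M"
  shows "(nrm2 M (\<lambda>x. f x + c * g x))^2
    = (nrm2 M f)^2 + 2 * c * (\<integral>x. f x * g x \<partial>M) + c^2 * (nrm2 M g)^2"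
proof -
  have "(\<integral>x. (f x + c * g x)^2 \<partial>M) = (\<integral>x. (f x)^2 + (2 * c) * (f x * g x) + c^2 * (g x)^2 \<partial>M)"
    by (simp add: power2_sum power_mult_distrib algebra_simps)
  also have "\<dots> = (\<integral>x. (f x)^2 \<partial>M) + (2 * c) * (\<integral>x. f x * g x \<partial>M) + c^2 * (\<integral>x. (g x)^2 \<partial>M)"
    using assms by (subst Bochner_Integration.integral_add | intro Bochner_Integration.integrable_add integrable_mult_right L2_mult L2_sq | simp)+
  finally show ?thesis by (simp add: nrm2_sq)
qed

lemma L2_Cauchy_Schwarz:
  assumes "f \<in> L2 M" "g \<in> L2 M"
  shows "\<bar>\<integral>x. f x * g x \<partial>M\<bar> \<le> nrm2 M f * nrm2 M g"
proof -
  have "(\<integral>x. f x * g x \<partial>M)^2 \<le> (nrm2 M f)^2 * (nrm2 M g)^2"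
    by (rule quadratic_nonneg_imp) (metis nrm2_lincomb_sq[OF assms] zero_le_power2, simp)
  then have "(\<integral>x. f x * g x \<partial>M)^2 \<le> (nrm2 M f * nrm2 M g)^2"
    by (simp add: power_mult_distrib)
  then show ?thesis
    by (rule abs_le_square_iff[THEN iffD2, THEN order_trans]) simp
qed

lemma nrm2_triangle:
  assumes "f \<in> L2 M" "g \<in> L2 M"
  shows "nrm2 M (\<lambda>x. f x + g x) \<le> nrm2 M f + nrm2 M g"
proof (rule power2_le_imp_le)
  show "(nrm2 M (\<lambda>x. f x + g x))^2 \<le> (nrm2 M f + nrm2 M g)^2"
    using nrm2_lincomb_sq[OF assms, of 1] L2_Cauchy_Schwarz[OF assms]
    by (simp add: power2_sum)
qed simp

lemma nrm2_cmult: "nrm2 M (\<lambda>x. c * f x) = \<bar>c\<bar> * nrm2 M f"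
  by (simp add: nrm2_def power_mult_distrib real_sqrt_mult)

lemma nrm2_triangle_diff:
  assumes "f \<in> L2 M" "g \<in> L2 M" "h \<in> L2 M"
  shows "nrm2 M (\<lambda>x. f x - h x) \<le> nrm2 M (\<lambda>x. f x - g x) + nrm2 M (\<lambda>x. g x - h x)"
  using nrm2_triangle[OF L2_diff[OF assms(1,2)] L2_diff[OF assms(2,3)]] by simp

text \<open>Expanding the product around the limits leaves three terms, each with a factor that
  tends to 0 in norm.\<close>

lemma L2_tendsto_mult:
  assumes "\<And>n. f n \<in> L2 M" "f' \<in> L2 M" "\<And>n. g n \<in> L2 M" "g' \<in> L2 M"
    and f: "(\<lambda>n. nrm2 M (\<lambda>x. f n x - f' x)) \<longlonglongrightarrow> 0"
    and g: "(\<lambda>n. nrm2 M (\<lambda>x. g n x - g' x)) \<longlonglongrightarrow> 0"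
  shows "(\<lambda>n. \<integral>x. f n x * g n x \<partial>M) \<longlonglongrightarrow> (\<integral>x. f' x * g' x \<partial>M)"
proof -
  let ?F = "\<lambda>n. nrm2 M (\<lambda>x. f n x - f' x)" and ?G = "\<lambda>n. nrm2 M (\<lambda>x. g n x - g' x)"
  have "norm ((\<integral>x. f n x * g n x \<partial>M) - (\<integral>x. f' x * g' x \<partial>M))
     \<le> ?F n * ?G n + ?F n * nrm2 M g' + nrm2 M f' * ?G n" for n
  proof -
    have i: "(\<lambda>x. f n x - f' x) \<in> L2 M" "(\<lambda>x. g n x - g' x) \<in> L2 M"
      using assms L2_diff by blast+
    have "(\<integral>x. f n x * g n x \<partial>M) - (\<integral>x. f' x * g' x \<partial>M)
       = (\<integral>x. f n x * g n x - f' x * g' x \<partial>M)"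
      using assms by (simp add: L2_mult)
    also have "\<dots> = (\<integral>x. (f n x - f' x) * (g n x - g' x) + (f n x - f' x) * g' x + f' x * (g n x - g' x) \<partial>M)"
      by (simp add: algebra_simps)
    also have "\<dots> = (\<integral>x. (f n x - f' x) * (g n x - g' x) \<partial>M) + (\<integral>x. (f n x - f' x) * g' x \<partial>M)
        + (\<integral>x. f' x * (g n x - g' x) \<partial>M)"
      using L2_mult[OF i] L2_mult[OF i(1) assms(4)] L2_mult[OF assms(2) i(2)] by simp
    finally show ?thesis
      using L2_Cauchy_Schwarz[OF i] L2_Cauchy_Schwarz[OF i(1) assms(4)] L2_Cauchy_Schwarz[OF assms(2) i(2)]
      unfolding real_norm_def by linarith
  qed
  moreover have "(\<lambda>n. ?F n * ?G n + ?F n * nrm2 M g' + nrm2 M f' * ?G n) \<longlonglongrightarrow> 0 * 0 + 0 * nrm2 M g' + nrm2 M f' * 0"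
    by (intro tendsto_intros f g)
  ultimately have "(\<lambda>n. (\<integral>x. f n x * g n x \<partial>M) - (\<integral>x. f' x * g' x \<partial>M)) \<longlonglongrightarrow> 0"
    by (intro Lim_null_comparison[OF always_eventually, of "\<lambda>n. (\<integral>x. f n x * g n x \<partial>M) - (\<integral>x. f' x * g' x \<partial>M)"]) auto
  then show ?thesis by (simp add: LIM_zero_iff)
qed

lemma (in finite_measure) L2_const: "(\<lambda>x. c) \<in> L2 M"
  by (simp add: L2_def)

lemma (in finite_measure) L2_integrable: "f \<in> L2 M \<Longrightarrow> integrable M f"
  using L2_mult[of f M "\<lambda>x. 1"] L2_const[of 1] by simp

lemma L2_abs: "f \<in> L2 M \<Longrightarrow> (\<lambda>x. \<bar>f x\<bar>) \<in> L2 M"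
  by (auto simp: L2_def)

lemma (in finite_measure) integral_abs_le_nrm2:
  assumes "f \<in> L2 M"
  shows "(\<integral>x. \<bar>f x\<bar> \<partial>M) \<le> nrm2 M f * sqrt (measure M (space M))"
  using L2_Cauchy_Schwarz[OF L2_abs[OF assms] L2_const[of 1]]
  by (simp add: nrm2_def)

text \<open>Riesz-Fischer. On a finite measure space an L2-Cauchy sequence is L1-Cauchy, hence has
  an almost everywhere convergent subsequence; its pointwise limit is the L2 limit by Fatou's
  lemma.\<close>

lemma (in finite_measure) L2_complete:
  assumes f: "\<And>n. f n \<in> L2 M"
    and cauchy: "\<And>e. e > 0 \<Longrightarrow> \<exists>N. \<forall>m\<ge>N. \<forall>n\<ge>N. nrm2 M (\<lambda>x. f m x - f n x) < e"
  obtains g where "g \<in> L2 M" "(\<lambda>n. nrm2 M (\<lambda>x. f n x - g x)) \<longlonglongrightarrow> 0"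
proof -
  have fm [measurable]: "f n \<in> borel_measurable M" for n using f L2_meas by blast
  have cauchy1: "\<exists>N. \<forall>i\<ge>N. \<forall>j\<ge>N. (\<integral>x. norm (f i x - f j x) \<partial>M) < e" if e: "e > 0" for e
  proof -
    \<comment> \<open>The summand 1 keeps the divisor positive on a null space.\<close>
    let ?s = "sqrt (measure M (space M)) + 1"
    have s: "?s > 0" by (rule add_nonneg_pos) auto
    obtain N where N: "\<And>m n. m \<ge> N \<Longrightarrow> n \<ge> N \<Longrightarrow> nrm2 M (\<lambda>x. f m x - f n x) < e / ?s"
      using cauchy[of "e / ?s"] divide_pos_pos[OF e s] by blast
    have "(\<integral>x. norm (f i x - f j x) \<partial>M) < e" if "i \<ge> N" "j \<ge> N" for i j
    proof -
      have "(\<integral>x. norm (f i x - f j x) \<partial>M) \<le> nrm2 M (\<lambda>x. f i x - f j x) * sqrt (measure M (space M))"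
        using integral_abs_le_nrm2[OF L2_diff[OF f f]] by simp
      also have "\<dots> \<le> nrm2 M (\<lambda>x. f i x - f j x) * ?s"
        by (intro mult_left_mono) auto
      also have "\<dots> < e" using N[OF that] s by (simp add: pos_less_divide_eq)
      finally show ?thesis .
    qed
    then show ?thesis by blast
  qed
  obtain r where r: "strict_mono r" and ae: "AE x in M. Cauchy (\<lambda>i. f (r i) x)"
    using cauchy_L1_AE_cauchy_subseq[of M f, OF L2_integrable[OF f] cauchy1] by blast
  define g where "g x = lim (\<lambda>i. f (r i) x)" for x
  have gm [measurable]: "g \<in> borel_measurable M" unfolding g_def by measurable
  have lim: "AE x in M. (\<lambda>i. f (r i) x) \<longlonglongrightarrow> g x"
    using ae by eventually_elim (auto simp: g_def Cauchy_convergent_iff convergent_LIMSEQ_iff)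
  \<comment> \<open>Fatou along the subsequence: the Cauchy bound for \<open>f n - f (r i)\<close>
    passes to \<open>f n - g\<close>, which yields integrability and the estimate at once.\<close>
  have key: "integrable M (\<lambda>x. (f n x - g x)^2) \<and> nrm2 M (\<lambda>x. f n x - g x) \<le> e"
    if e: "e > 0" and N: "\<And>m. m \<ge> N \<Longrightarrow> nrm2 M (\<lambda>x. f n x - f m x) < e" for n N e
  proof -
    have "(\<integral>\<^sup>+x. ennreal ((f n x - g x)^2) \<partial>M) \<le> (\<integral>\<^sup>+x. liminf (\<lambda>i. ennreal ((f n x - f (r i) x)^2)) \<partial>M)"
    proof (rule nn_integral_mono_AE)
      show "AE x in M. ennreal ((f n x - g x)^2) \<le> liminf (\<lambda>i. ennreal ((f n x - f (r i) x)^2))"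
        using lim
      proof eventually_elim
        case (elim x)
        have "(\<lambda>i. ennreal ((f n x - f (r i) x)^2)) \<longlonglongrightarrow> ennreal ((f n x - g x)^2)"
          by (intro tendsto_ennrealI tendsto_intros elim)
        from lim_imp_Liminf[OF _ this] show ?case by (simp del: tendsto_ennreal_iff)
      qed
    qed
    also have "\<dots> \<le> liminf (\<lambda>i. \<integral>\<^sup>+x. ennreal ((f n x - f (r i) x)^2) \<partial>M)"
      by (rule nn_integral_liminf) measurable
    also have "\<dots> \<le> ennreal (e^2)"
    proof (rule Liminf_le)
      have "\<forall>\<^sub>F i in sequentially. i \<ge> N" by (rule eventually_ge_at_top)
      then show "\<forall>\<^sub>F i in sequentially. (\<integral>\<^sup>+x. ennreal ((f n x - f (r i) x)^2) \<partial>M) \<le> ennreal (e^2)"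
      proof eventually_elim
        case (elim i)
        have "r i \<ge> N" using elim seq_suble[OF r, of i] by linarith
        then have "nrm2 M (\<lambda>x. f n x - f (r i) x) \<le> e" using N by fastforce
        then have "(nrm2 M (\<lambda>x. f n x - f (r i) x))^2 \<le> e^2" by (intro power_mono) auto
        then show ?case
          using L2_sq[OF L2_diff[OF f f], of n "r i"]
          by (subst nn_integral_eq_integral) (auto simp: nrm2_sq)
      qed
    qed simp
    finally have b: "(\<integral>\<^sup>+x. ennreal ((f n x - g x)^2) \<partial>M) \<le> ennreal (e^2)" .
    have i: "integrable M (\<lambda>x. (f n x - g x)^2)"
    proof (rule integrableI_bounded)
      show "(\<integral>\<^sup>+x. ennreal (norm ((f n x - g x)^2)) \<partial>M) < \<infinity>"
        using b by (simp add: order_le_less_trans)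
    qed measurable
    then have "ennreal (\<integral>x. (f n x - g x)^2 \<partial>M) \<le> ennreal (e^2)"
      using b by (subst (asm) nn_integral_eq_integral) auto
    then have "(\<integral>x. (f n x - g x)^2 \<partial>M) \<le> e^2" by simp
    then have "nrm2 M (\<lambda>x. f n x - g x) \<le> e"
      using e unfolding nrm2_def by (metis real_sqrt_le_mono real_sqrt_abs abs_of_pos)
    with i show ?thesis by blast
  qed
  have "\<exists>N. \<forall>m\<ge>N. \<forall>n\<ge>N. nrm2 M (\<lambda>x. f m x - f n x) < 1" using cauchy by auto
  then obtain N1 where N1: "\<And>m n. m \<ge> N1 \<Longrightarrow> n \<ge> N1 \<Longrightarrow> nrm2 M (\<lambda>x. f m x - f n x) < 1" by blast
  have d1: "(\<lambda>x. f N1 x - g x) \<in> L2 M"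
    using key[of 1 N1 N1] N1 by (auto simp: L2_def)
  have gL: "g \<in> L2 M" using L2_diff[OF f[of N1] d1] by simp
  have "(\<lambda>n. nrm2 M (\<lambda>x. f n x - g x)) \<longlonglongrightarrow> 0"
  proof (rule LIMSEQ_I)
    fix e :: real assume "e > 0"
    then obtain N where N: "\<And>m n. m \<ge> N \<Longrightarrow> n \<ge> N \<Longrightarrow> nrm2 M (\<lambda>x. f m x - f n x) < e / 2"
      using cauchy[of "e/2"] by auto
    show "\<exists>no. \<forall>n\<ge>no. norm (nrm2 M (\<lambda>x. f n x - g x) - 0) < e"
      using key[of "e/2" N] N \<open>e > 0\<close> by (intro exI[of _ N]) force
  qed
  with gL show ?thesis by (rule that)
qed

section \<open>Test functions\<close>

text \<open>Set integrals over \<Omega> become plain integrals for this measure, so the L2 theory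
  above applies; boundedness of \<Omega> makes it finite.\<close>

abbreviation leb :: "(real^'d::finite) set \<Rightarrow> (real^'d) measure" where
  "leb \<Omega> \<equiv> restrict_space lebesgue \<Omega>"

lemma set_LINT_eq_leb:
  fixes f :: "real^'d::finite \<Rightarrow> real"
  assumes "\<Omega> \<in> sets lebesgue"
  shows "(LINT x:\<Omega>|lebesgue. f x) = integral\<^sup>L (leb \<Omega>) f"
  unfolding set_lebesgue_integral_def using assms by (subst integral_restrict_space) auto

lemma set_integrable_eq_leb:
  fixes f :: "real^'d::finite \<Rightarrow> real"
  assumes "\<Omega> \<in> sets lebesgue"
  shows "set_integrable lebesgue \<Omega> f \<longleftrightarrow> integrable (leb \<Omega>) f"
  unfolding set_integrable_def using assms by (subst integrable_restrict_space) auto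

lemma set_measurable_eq_leb:
  fixes f :: "real^'d::finite \<Rightarrow> real"
  assumes "\<Omega> \<in> sets lebesgue"
  shows "set_borel_measurable lebesgue \<Omega> f \<longleftrightarrow> f \<in> borel_measurable (leb \<Omega>)"
  unfolding set_borel_measurable_def using assms by (subst borel_measurable_restrict_space_iff) auto

lemma inL2_eq_leb:
  fixes f :: "real^'d::finite \<Rightarrow> real"
  assumes "\<Omega> \<in> sets lebesgue"
  shows "inL2 \<Omega> f \<longleftrightarrow> f \<in> L2 (leb \<Omega>)"
  by (simp add: inL2_def L2_def set_integrable_eq_leb[OF assms] set_measurable_eq_leb[OF assms])

text \<open>Moves integrals of functions that vanish off \<Omega> to the whole space, where Lebesgue
  measure is translation invariant. Borel measurability lets the completion of the measure be
  dropped.\<close>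

lemma integral_leb_supported:
  fixes f :: "real^'d::finite \<Rightarrow> real"
  assumes "\<Omega> \<in> sets lebesgue" "f \<in> borel_measurable borel" "\<And>x. x \<notin> \<Omega> \<Longrightarrow> f x = 0"
  shows "integral\<^sup>L (leb \<Omega>) f = integral\<^sup>L lborel f"
    and "integrable (leb \<Omega>) f = integrable lborel f"
proof -
  have e: "(\<lambda>x. indicat_real \<Omega> x *\<^sub>R f x) = f"
    using assms(3) by (auto simp: indicator_def fun_eq_iff)
  show "integral\<^sup>L (leb \<Omega>) f = integral\<^sup>L lborel f"
    using assms(1,2) by (subst integral_restrict_space) (auto simp: e[simplified] integral_completion)
  show "integrable (leb \<Omega>) f = integrable lborel f"
    using assms(1,2) by (subst integrable_restrict_space) (auto simp: e[simplified] integrable_completion)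
qed

lemma finite_measure_leb:
  fixes \<Omega> :: "(real^'d::finite) set"
  assumes "open \<Omega>" "bounded \<Omega>" shows "finite_measure (leb \<Omega>)"
proof -
  have "emeasure lborel \<Omega> < \<infinity>" using emeasure_bounded_finite[OF assms(2)] by simp
  then have "emeasure lebesgue \<Omega> \<noteq> \<infinity>" using assms(1) by simp
  then show ?thesis
    using assms(1) by (intro finite_measureI) (simp add: space_restrict_space emeasure_restrict_space)
qed

lemma integral_lborel_translation:
  fixes f :: "real^'d::finite \<Rightarrow> real"
  assumes [measurable]: "f \<in> borel_measurable borel"
  shows "(\<integral>x. f (x + c) \<partial>lborel) = (\<integral>x. f x \<partial>lborel)"
proof -
  have "(\<integral>x. f x \<partial>lborel) = (\<integral>x. f x \<partial>distr lborel borel ((+) c))"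
    by (simp add: lborel_distr_plus)
  also have "\<dots> = (\<integral>x. f (c + x) \<partial>lborel)"
    by (subst integral_distr) auto
  finally show ?thesis by (simp add: add.commute)
qed

lemma nn_integral_lborel_translation:
  fixes f :: "real^'d::finite \<Rightarrow> ennreal"
  assumes [measurable]: "f \<in> borel_measurable borel"
  shows "(\<integral>\<^sup>+x. f (x + c) \<partial>lborel) = (\<integral>\<^sup>+x. f x \<partial>lborel)"
proof -
  have "(\<integral>\<^sup>+x. f x \<partial>lborel) = (\<integral>\<^sup>+x. f x \<partial>distr lborel borel ((+) c))"
    by (simp add: lborel_distr_plus)
  also have "\<dots> = (\<integral>\<^sup>+x. f (c + x) \<partial>lborel)"
    by (subst nn_integral_distr) auto
  finally show ?thesis by (simp add: add.commute)
qed

lemma integrable_compact_support: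
  fixes f :: "real^'d::finite \<Rightarrow> real"
  assumes [measurable]: "f \<in> borel_measurable borel" and "\<And>x. \<bar>f x\<bar> \<le> B * indicator (ball 0 r) x"
  shows "integrable lborel f"
proof (rule Bochner_Integration.integrable_bound[of _ "\<lambda>x. B * indicator (ball 0 r) x"])
  show "integrable lborel (\<lambda>x::real^'d. B * indicator (ball 0 r) x)"
    by (intro integrable_mult_right integrable_real_indicator emeasure_lborel_ball_finite) simp
  show "AE x in lborel. norm (f x) \<le> norm (B * indicator (ball 0 r) x)"
    using assms(2) by (auto intro!: AE_I2 intro: order_trans[OF _ abs_ge_self])
qed simp

section \<open>Derivatives, supports and difference quotients of test functions\<close>

lemma smooth_fn_differentiable: "smooth_fn f \<Longrightarrow> f differentiable (at x)"
  unfolding smooth_fn_def by (metis pd.simps(1))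

lemma smooth_fn_has_derivative:
  assumes "smooth_fn f" shows "(f has_derivative (\<lambda>h. cgrad f x \<bullet> h)) (at x)"
proof -
  let ?D = "frechet_derivative f (at x)"
  have D: "(f has_derivative ?D) (at x)"
    using smooth_fn_differentiable[OF assms] frechet_derivative_works by blast
  then interpret linear ?D by (rule has_derivative_linear)
  have "?D h = cgrad f x \<bullet> h" for h
  proof -
    have "?D h = ?D (\<Sum>i\<in>UNIV. h $ i *\<^sub>R axis i 1)"
      by (metis basis_expansion scalar_mult_eq_scaleR)
    also have "\<dots> = cgrad f x \<bullet> h"
      by (simp add: sum scaleR inner_vec_def cgrad_def mult.commute)
    finally show ?thesis .
  qed
  then have "?D = (\<lambda>h. cgrad f x \<bullet> h)" by (rule ext)
  with D show ?thesis by simp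
qed

lemma smooth_fn_continuous: "smooth_fn f \<Longrightarrow> continuous_on UNIV f"
  by (meson continuous_at_imp_continuous_on differentiable_imp_continuous_within smooth_fn_differentiable)

lemma smooth_fn_continuous_cgrad: "smooth_fn f \<Longrightarrow> continuous_on UNIV (cgrad f)"
proof -
  assume f: "smooth_fn f"
  have "continuous_on UNIV (\<lambda>x. \<chi> i. pd [i] f x)"
    using f unfolding smooth_fn_def
    by (intro continuous_on_vec_lambda continuous_at_imp_continuous_on ballI differentiable_imp_continuous_within) blast
  moreover have "cgrad f = (\<lambda>x. \<chi> i. pd [i] f x)" by (rule ext) (simp only: cgrad_def)
  ultimately show ?thesis by simp
qed

lemma pd_lincomb:
  assumes "smooth_fn f" "smooth_fn g"
  shows "pd is (\<lambda>x. f x + c * g x) = (\<lambda>x. pd is f x + c * pd is g x)"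
proof (induction "is")
  case (Cons i js)
  have "frechet_derivative (\<lambda>x. pd js f x + c * pd js g x) (at x)
     = (\<lambda>h. frechet_derivative (pd js f) (at x) h + c * frechet_derivative (pd js g) (at x) h)" for x
    by (rule frechet_derivative_at[symmetric])
       (use assms in \<open>auto simp: smooth_fn_def frechet_derivative_works intro!: derivative_intros\<close>)
  then show ?case using Cons by simp
qed simp

lemma smooth_fn_lincomb:
  assumes "smooth_fn f" "smooth_fn g" shows "smooth_fn (\<lambda>x. f x + c * g x)"
  unfolding smooth_fn_def pd_lincomb[OF assms] using assms
  by (auto simp: smooth_fn_def intro!: derivative_intros)

lemma cgrad_lincomb:
  assumes "smooth_fn f" "smooth_fn g"
  shows "cgrad (\<lambda>x. f x + c * g x) x = cgrad f x + c *\<^sub>R cgrad g x"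
  unfolding cgrad_def pd_lincomb[OF assms] by (simp add: vec_eq_iff)

lemma smooth_fn_zero: "smooth_fn (\<lambda>x. 0)"
proof -
  have "pd is (\<lambda>x. 0) = (\<lambda>x. 0)" for "is" :: "'a::finite list"
    by (induction "is") (auto simp: frechet_derivative_const)
  then show ?thesis by (simp add: smooth_fn_def)
qed

lemma testfn_zero: "testfn \<Omega> (\<lambda>x. 0)"
  by (simp add: testfn_def smooth_fn_zero)

lemma testfn_smooth: "testfn \<Omega> f \<Longrightarrow> smooth_fn f"
  by (simp add: testfn_def)

lemma testfn_lincomb:
  assumes "testfn \<Omega> f" "testfn \<Omega> g" shows "testfn \<Omega> (\<lambda>x. f x + c * g x)"
proof -
  have "closure {x. f x + c * g x \<noteq> 0} \<subseteq> closure {x. f x \<noteq> 0} \<union> closure {x. g x \<noteq> 0}"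
    unfolding closure_Un[symmetric] by (rule closure_mono) auto
  then have 1: "closure {x. f x + c * g x \<noteq> 0} \<subseteq> \<Omega>"
    using assms unfolding testfn_def by blast
  have "{x. f x + c * g x \<noteq> 0} \<subseteq> {x. f x \<noteq> 0} \<union> {x. g x \<noteq> 0}" by auto
  moreover have "bounded ({x. f x \<noteq> 0} \<union> {x. g x \<noteq> 0})"
    using assms by (auto simp: testfn_def)
  ultimately have "compact (closure {x. f x + c * g x \<noteq> 0})"
    by (meson bounded_subset compact_closure)
  with 1 show ?thesis using assms smooth_fn_lincomb by (auto simp: testfn_def)
qed

text \<open>Off the closed support the function vanishes on an open neighbourhood, so its derivative
  there is 0; testing the derivative with \<open>cgrad f x\<close> itself kills the
  gradient.\<close>

lemma testfn_outside:
  assumes "testfn \<Omega> f" "x \<notin> \<Omega>"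
  shows "f x = 0" "cgrad f x = 0"
proof -
  let ?K = "closure {x. f x \<noteq> 0}"
  have "?K \<subseteq> \<Omega>" using assms(1) unfolding testfn_def by (elim conjE)
  then have K: "x \<notin> ?K" using assms(2) by (rule contra_subsetD)
  then have "x \<notin> {x. f x \<noteq> 0}" by (rule contra_subsetD[OF closure_subset])
  then show "f x = 0" by simp
  have "(f has_derivative (\<lambda>h. cgrad f x \<bullet> h)) (at x)"
    using assms by (intro smooth_fn_has_derivative testfn_smooth)
  moreover have "(f has_derivative (\<lambda>h. 0)) (at x)"
  proof (rule has_derivative_transform_within_open)
    show "((\<lambda>_. 0::real) has_derivative (\<lambda>h. 0)) (at x)" by (rule has_derivative_const)
    show "open (- ?K)" by (rule open_Compl[OF closed_closure])
    show "x \<in> - ?K" using K by simp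
    show "0 = f y" if "y \<in> - ?K" for y
    proof -
      have "y \<notin> ?K" using that by simp
      then have "y \<notin> {x. f x \<noteq> 0}" by (rule contra_subsetD[OF closure_subset])
      then show ?thesis by simp
    qed
  qed
  ultimately have "(\<lambda>h. cgrad f x \<bullet> h) = (\<lambda>h. 0)" by (rule has_derivative_unique)
  from fun_cong[OF this, of "cgrad f x"] have "cgrad f x \<bullet> cgrad f x = 0" .
  then show "cgrad f x = 0" by simp
qed

lemma testfn_bounds:
  assumes f: "testfn \<Omega> f"
  obtains B r where "B \<ge> 0" "r > 0" "\<And>x. \<bar>f x\<bar> \<le> B" "\<And>x. norm (cgrad f x) \<le> B"
    "\<And>x. norm x \<ge> r \<Longrightarrow> f x = 0" "\<And>x. norm x \<ge> r \<Longrightarrow> cgrad f x = 0"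
proof -
  define K where "K = closure {x. f x \<noteq> 0}"
  have K: "compact K" using f by (simp add: testfn_def K_def)
  \<comment> \<open>Regarding \<open>f\<close> as a test function on its own support makes
    \<open>testfn_outside\<close> applicable off the compact set \<open>K\<close>, not only off
    \<Omega>.\<close>
  have fK: "testfn K f" using f by (simp add: testfn_def K_def)
  have s: "smooth_fn f" using f by (rule testfn_smooth)
  have "bounded (f ` K)" "bounded (cgrad f ` K)"
    using continuous_on_subset[OF smooth_fn_continuous[OF s], of K]
      continuous_on_subset[OF smooth_fn_continuous_cgrad[OF s], of K] K
    by (simp_all add: compact_imp_bounded compact_continuous_image)
  then obtain B1 B2 where B: "\<And>x. x \<in> K \<Longrightarrow> \<bar>f x\<bar> \<le> B1" "\<And>x. x \<in> K \<Longrightarrow> norm (cgrad f x) \<le> B2"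
    unfolding bounded_iff by fastforce
  obtain r where r: "\<And>x. x \<in> K \<Longrightarrow> norm x \<le> r"
    using compact_imp_bounded[OF K] unfolding bounded_iff by blast
  show ?thesis
  proof (rule that[of "max 0 (max B1 B2)" "\<bar>r\<bar> + 1"])
    show "\<bar>f x\<bar> \<le> max 0 (max B1 B2)" for x
      using B(1)[of x] testfn_outside(1)[OF fK, of x] by (cases "x \<in> K") auto
    show "norm (cgrad f x) \<le> max 0 (max B1 B2)" for x
      using B(2)[of x] testfn_outside(2)[OF fK, of x] by (cases "x \<in> K") auto
    show "f x = 0" if "norm x \<ge> \<bar>r\<bar> + 1" for x
      using r[of x] that testfn_outside(1)[OF fK, of x] by (cases "x \<in> K") auto
    show "cgrad f x = 0" if "norm x \<ge> \<bar>r\<bar> + 1" for x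
      using r[of x] that testfn_outside(2)[OF fK, of x] by (cases "x \<in> K") auto
  qed auto
qed

lemma testfn_borel:
  assumes "testfn \<Omega> f" shows "f \<in> borel_measurable borel" "cgrad f \<in> borel_measurable borel"
  using assms testfn_smooth smooth_fn_continuous smooth_fn_continuous_cgrad
    borel_measurable_continuous_onI by blast+

lemma diff_quotient:
  assumes f: "testfn \<Omega> f"
  shows "(\<lambda>n. real (Suc n) * (f (x + h /\<^sub>R real (Suc n)) - f x)) \<longlonglongrightarrow> cgrad f x \<bullet> h"
proof -
  have "(f has_derivative (\<lambda>h. cgrad f x \<bullet> h)) (at x)"
    using f by (intro smooth_fn_has_derivative testfn_smooth)
  then have "((\<lambda>t. f (x + t *\<^sub>R h)) has_derivative (\<lambda>t. cgrad f x \<bullet> (t *\<^sub>R h))) (at 0)"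
    by (intro has_derivative_compose[of "\<lambda>t. x + t *\<^sub>R h" "\<lambda>t. t *\<^sub>R h" 0 UNIV f])
       (auto intro!: derivative_eq_intros)
  then have "((\<lambda>t. f (x + t *\<^sub>R h)) has_real_derivative cgrad f x \<bullet> h) (at 0)"
    by (rule has_derivative_imp_has_field_derivative) simp
  then have l: "(\<lambda>t. (f (x + t *\<^sub>R h) - f x) / t) \<midarrow>0\<rightarrow> cgrad f x \<bullet> h"
    by (simp add: DERIV_def)
  have "(\<lambda>n. (f (x + inverse (real (Suc n)) *\<^sub>R h) - f x) / inverse (real (Suc n))) \<longlonglongrightarrow> cgrad f x \<bullet> h"
    by (rule LIMSEQ_SEQ_conv[THEN iffD2, OF l, rule_format])
       (use LIMSEQ_inverse_real_of_nat in \<open>auto simp del: of_nat_Suc\<close>)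
  moreover have "(f (x + inverse (real (Suc n)) *\<^sub>R h) - f x) / inverse (real (Suc n))
      = real (Suc n) * (f (x + h /\<^sub>R real (Suc n)) - f x)" for n
    by (simp add: divide_inverse mult.commute del: of_nat_Suc)
  ultimately show ?thesis by simp
qed

text \<open>The Lipschitz bound from the gradient and the compact support give an integrable
  majorant that is the same for every \<open>n\<close>, as dominated convergence requires.\<close>

lemma diff_quotient_bound:
  assumes f: "testfn \<Omega> f"
  obtains B r where "B \<ge> 0" "\<And>n x h. \<bar>real (Suc n) * (f (x + h /\<^sub>R real (Suc n)) - f x)\<bar>
      \<le> B * norm h * indicator (ball 0 (r + norm h)) x"
proof -
  obtain B r where B: "B \<ge> 0" "r > 0" "\<And>x. norm (cgrad f x) \<le> B" "\<And>x. norm x \<ge> r \<Longrightarrow> f x = 0"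
    using testfn_bounds[OF f] by metis
  have lip: "\<bar>f y - f x\<bar> \<le> B * norm (y - x)" for x y
  proof -
    have "norm (f y - f x) \<le> norm (y - x) * B"
      by (subst mult.commute, rule differentiable_bound[of UNIV f "\<lambda>x h. cgrad f x \<bullet> h"])
         (auto intro!: onorm_bound B(1) smooth_fn_has_derivative testfn_smooth[OF f]
            order_trans[OF Cauchy_Schwarz_ineq2] mult_right_mono B(3))
    then show ?thesis by (simp add: mult.commute)
  qed
  show ?thesis
  proof (rule that[OF B(1), of r])
    fix n x h
    let ?m = "real (Suc n)"
    show "\<bar>?m * (f (x + h /\<^sub>R ?m) - f x)\<bar> \<le> B * norm h * indicator (ball 0 (r + norm h)) x"
    proof (cases "norm x < r + norm h")
      case True
      have "\<bar>?m * (f (x + h /\<^sub>R ?m) - f x)\<bar> \<le> ?m * (B * norm (h /\<^sub>R ?m))"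
        using lip[of "x + h /\<^sub>R ?m" x] by (simp add: abs_mult mult_left_mono del: of_nat_Suc)
      also have "\<dots> = B * norm h" by (simp del: of_nat_Suc)
      finally show ?thesis using True by (simp add: indicator_def)
    next
      case False
      have "norm (h /\<^sub>R ?m) \<le> norm h" by (simp add: field_simps)
      then have "norm (x + h /\<^sub>R ?m) \<ge> r"
        using False norm_triangle_ineq2[of x "- (h /\<^sub>R ?m)"] by simp
      moreover have "norm x \<ge> r" using False norm_ge_zero[of h] by linarith
      ultimately show ?thesis using B(1) B(4) by (simp add: indicator_def)
    qed
  qed
qed

section \<open>The space \<open>H01\<close>\<close>

text \<open>Integration by parts against a merely Lipschitz \<psi>: by translation invariance the
  difference quotient moves from \<phi> to \<psi>, where it is bounded by \<open>L * norm h\<close>.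
  Only the L1 norm of \<phi> remains on the right, so the pairing vanishes when \<phi> tends to
  0.\<close>

lemma testfn_grad_Lipschitz_bound:
  fixes \<phi> \<psi> :: "'d::finite fn"
  assumes f: "testfn \<Omega> \<phi>" and [measurable]: "\<psi> \<in> borel_measurable borel"
    and B': "\<And>x. \<bar>\<psi> x\<bar> \<le> B'" and L: "\<And>x y. \<bar>\<psi> x - \<psi> y\<bar> \<le> L * norm (x - y)"
  shows "\<bar>\<integral>x. (cgrad \<phi> x \<bullet> h) * \<psi> x \<partial>lborel\<bar> \<le> L * norm h * (\<integral>x. \<bar>\<phi> x\<bar> \<partial>lborel)"
proof -
  have [measurable]: "\<phi> \<in> borel_measurable borel" "cgrad \<phi> \<in> borel_measurable borel"
    using testfn_borel[OF f] by auto
  define D where "D n x = real (Suc n) * (\<phi> (x + h /\<^sub>R real (Suc n)) - \<phi> x)" for n x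
  obtain B r where B: "B \<ge> 0" "\<And>n x. \<bar>D n x\<bar> \<le> B * norm h * indicator (ball 0 (r + norm h)) x"
    using diff_quotient_bound[OF f] unfolding D_def by metis
  obtain C s where C: "C \<ge> 0" "\<And>x. \<bar>\<phi> x\<bar> \<le> C" "\<And>x. norm x \<ge> s \<Longrightarrow> \<phi> x = 0"
    using testfn_bounds[OF f] by metis
  have B'0: "B' \<ge> 0" using B'[of 0] by simp
  have lim: "(\<lambda>n. \<integral>x. D n x * \<psi> x \<partial>lborel) \<longlonglongrightarrow> (\<integral>x. (cgrad \<phi> x \<bullet> h) * \<psi> x \<partial>lborel)"
  proof (rule integral_dominated_convergence[where w="\<lambda>x. B * norm h * B' * indicator (ball 0 (r + norm h)) x"])
    show "integrable lborel (\<lambda>x::real^'d. B * norm h * B' * indicator (ball 0 (r + norm h)) x)"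
      by (intro integrable_mult_right integrable_real_indicator emeasure_lborel_ball_finite) simp
    show "AE x in lborel. (\<lambda>n. D n x * \<psi> x) \<longlonglongrightarrow> (cgrad \<phi> x \<bullet> h) * \<psi> x"
      unfolding D_def by (intro AE_I2 tendsto_intros diff_quotient[OF f])
    show "AE x in lborel. norm (D n x * \<psi> x) \<le> B * norm h * B' * indicator (ball 0 (r + norm h)) x" for n
    proof (rule AE_I2)
      fix x
      have "norm (D n x * \<psi> x) \<le> (B * norm h * indicator (ball 0 (r + norm h)) x) * B'"
        unfolding real_norm_def abs_mult by (rule mult_mono[OF B(2) B']) (use B(1) in auto)
      then show "norm (D n x * \<psi> x) \<le> B * norm h * B' * indicator (ball 0 (r + norm h)) x"
        by (simp add: ac_simps)
    qed
  qed (auto simp: D_def)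
  have i\<phi>: "integrable lborel (\<lambda>x. \<phi> x * w x)"
    if [measurable]: "w \<in> borel_measurable borel" and w: "\<And>x. \<bar>w x\<bar> \<le> W" for w W
  proof (rule integrable_compact_support[of _ "C * W" s])
    show "\<bar>\<phi> x * w x\<bar> \<le> C * W * indicator (ball 0 s) x" for x
      using C(2)[of x] C(1) C(3)[of x] w[of x]
      by (cases "norm x \<ge> s") (auto simp: abs_mult intro: mult_mono)
  qed simp
  have i\<phi>1: "integrable lborel (\<lambda>x. \<bar>\<phi> x\<bar>)"
    using i\<phi>[of "\<lambda>x. 1" 1] by (auto intro: integrable_abs)
  have "\<bar>\<integral>x. D n x * \<psi> x \<partial>lborel\<bar> \<le> L * norm h * (\<integral>x. \<bar>\<phi> x\<bar> \<partial>lborel)" for n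
  proof -
    let ?m = "real (Suc n)" and ?c = "h /\<^sub>R real (Suc n)"
    have m: "?m > 0" by simp
    \<comment> \<open>The shift passes from \<phi> to \<psi> here.\<close>
    have t: "(\<integral>x. \<phi> (x + ?c) * \<psi> x \<partial>lborel) = (\<integral>x. \<phi> x * \<psi> (x - ?c) \<partial>lborel)"
      using integral_lborel_translation[of "\<lambda>x. \<phi> x * \<psi> (x - ?c)" ?c] by simp
    have i1: "integrable lborel (\<lambda>x. \<phi> x * \<psi> (x - ?c))" "integrable lborel (\<lambda>x. \<phi> x * \<psi> x)"
      using B' by (auto intro!: i\<phi>[of _ B'])
    have i2: "integrable lborel (\<lambda>x. \<phi> (x + ?c) * \<psi> x)"
    proof (rule integrable_compact_support[of _ "C * B'" "\<bar>s\<bar> + norm ?c"])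
      show "\<bar>\<phi> (x + ?c) * \<psi> x\<bar> \<le> C * B' * indicator (ball 0 (\<bar>s\<bar> + norm ?c)) x" for x
      proof (cases "norm x < \<bar>s\<bar> + norm ?c")
        case True
        then show ?thesis using C(1,2) B' by (auto simp: abs_mult intro: mult_mono simp del: of_nat_Suc)
      next
        case False
        have "norm (x + ?c) \<ge> norm x - norm ?c"
          using norm_triangle_ineq2[of x "- ?c"] by simp
        then have "norm (x + ?c) \<ge> s" using False by linarith
        then show ?thesis using C(3) C(1) B'0 by simp
      qed
    qed simp
    have "(\<integral>x. D n x * \<psi> x \<partial>lborel) = (\<integral>x. ?m * (\<phi> (x + ?c) * \<psi> x - \<phi> x * \<psi> x) \<partial>lborel)"
      by (simp add: D_def algebra_simps)
    also have "\<dots> = ?m * ((\<integral>x. \<phi> (x + ?c) * \<psi> x \<partial>lborel) - (\<integral>x. \<phi> x * \<psi> x \<partial>lborel))"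
      using i1 i2 by simp
    also have "\<dots> = ?m * (\<integral>x. \<phi> x * \<psi> (x - ?c) - \<phi> x * \<psi> x \<partial>lborel)"
      unfolding t using i1 by simp
    finally have "\<bar>\<integral>x. D n x * \<psi> x \<partial>lborel\<bar> = ?m * \<bar>\<integral>x. \<phi> x * \<psi> (x - ?c) - \<phi> x * \<psi> x \<partial>lborel\<bar>"
      using m by (simp add: abs_mult)
    also have "\<dots> \<le> ?m * (\<integral>x. \<bar>\<phi> x * \<psi> (x - ?c) - \<phi> x * \<psi> x\<bar> \<partial>lborel)"
      using m by (intro mult_left_mono integral_abs_bound) auto
    also have "\<dots> \<le> ?m * (\<integral>x. (L * norm ?c) * \<bar>\<phi> x\<bar> \<partial>lborel)"
    proof (intro mult_left_mono integral_mono)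
      show "\<bar>\<phi> x * \<psi> (x - ?c) - \<phi> x * \<psi> x\<bar> \<le> L * norm ?c * \<bar>\<phi> x\<bar>" for x
        using mult_left_mono[OF L[of "x - ?c" x], of "\<bar>\<phi> x\<bar>"]
        by (simp add: abs_mult[symmetric] right_diff_distrib ac_simps del: of_nat_Suc)
    qed (use i1 i\<phi>1 m in auto)
    also have "\<dots> = L * norm h * (\<integral>x. \<bar>\<phi> x\<bar> \<partial>lborel)"
      using m by (simp add: ac_simps)
    finally show ?thesis .
  qed
  then show ?thesis
    using LIMSEQ_le_const2[OF tendsto_rabs[OF lim]] by blast
qed

text \<open>Lipschitz cut-offs decrease to the indicator of a closed set, so \<open>h\<close>
  integrates to 0 over every nonempty closed set; inner regularity then shows that the set where
  \<open>h\<close> is positive is null, and likewise for \<open>- h\<close>.\<close>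

lemma AE_zero_if_Lipschitz_orthogonal:
  fixes h :: "'d::finite fn"
  assumes \<Omega>: "\<Omega> \<in> sets lebesgue" and h: "integrable (leb \<Omega>) h"
    and orth: "\<And>\<psi> B L. \<psi> \<in> borel_measurable borel \<Longrightarrow> (\<And>x. \<bar>\<psi> x\<bar> \<le> B) \<Longrightarrow>
      (\<And>x y. \<bar>\<psi> x - \<psi> y\<bar> \<le> L * norm (x - y)) \<Longrightarrow> (\<integral>x. h x * \<psi> x \<partial>leb \<Omega>) = 0"
  shows "AE x in leb \<Omega>. h x = 0"
proof -
  have mb: "w \<in> borel_measurable (leb \<Omega>)" if "w \<in> borel_measurable borel" for w :: "'d fn"
    using that by (intro measurable_restrict_space1 measurable_completion) simp
  have closed0: "(\<integral>x. h x * indicator F x \<partial>leb \<Omega>) = 0" if F: "closed F" "F \<noteq> {}" for F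
  proof -
    \<comment> \<open>Equals 1 on \<open>F\<close> and drops to 0 within distance 1/(m+1), hence
      Lipschitz with constant m+1.\<close>
    define \<psi> where "\<psi> m x = max 0 (1 - real (Suc m) * infdist x F)" for m and x :: "real^'d"
    have lim: "(\<lambda>m. \<psi> m x) \<longlonglongrightarrow> indicator F x" for x
    proof (cases "x \<in> F")
      case False
      then have "infdist x F > 0"
        using F in_closed_iff_infdist_zero[of F x] infdist_nonneg[of x F] by auto
      then obtain N where N: "1 < real N * infdist x F"
        using ex_less_of_nat_mult by blast
      have "\<forall>\<^sub>F m in sequentially. \<psi> m x = 0"
      proof (rule eventually_sequentiallyI[of N])
        fix m assume "N \<le> m"
        then have "real N * infdist x F \<le> real (Suc m) * infdist x F"
          by (intro mult_right_mono infdist_nonneg) simp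
        then show "\<psi> m x = 0" using N by (simp add: \<psi>_def)
      qed
      then show ?thesis using False by (simp add: tendsto_eventually)
    qed (simp add: \<psi>_def)
    have m1: "\<psi> m \<in> borel_measurable borel" for m
      unfolding \<psi>_def by (intro borel_measurable_continuous_onI continuous_intros)
    have b1: "\<bar>\<psi> m x\<bar> \<le> 1" for m x
      using infdist_nonneg[of x F] by (simp add: \<psi>_def)
    have "\<bar>\<psi> m x - \<psi> m y\<bar> \<le> real (Suc m) * norm (x - y)" for m x y
    proof -
      have "\<bar>\<psi> m x - \<psi> m y\<bar> \<le> \<bar>real (Suc m) * infdist x F - real (Suc m) * infdist y F\<bar>"
        unfolding \<psi>_def by linarith
      also have "\<dots> = real (Suc m) * \<bar>infdist x F - infdist y F\<bar>"
        by (simp add: abs_mult right_diff_distrib[symmetric] del: of_nat_Suc)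
      also have "\<dots> \<le> real (Suc m) * norm (x - y)"
        using infdist_triangle_abs[of x F y] by (intro mult_left_mono) (auto simp: dist_norm)
      finally show ?thesis .
    qed
    then have z: "(\<integral>x. h x * \<psi> m x \<partial>leb \<Omega>) = 0" for m
      using orth[OF m1 b1] by blast
    have "(\<lambda>m. \<integral>x. h x * \<psi> m x \<partial>leb \<Omega>) \<longlonglongrightarrow> (\<integral>x. h x * indicator F x \<partial>leb \<Omega>)"
    proof (rule integral_dominated_convergence[where w="\<lambda>x. \<bar>h x\<bar>"])
      show "AE x in leb \<Omega>. (\<lambda>m. h x * \<psi> m x) \<longlonglongrightarrow> h x * indicator F x"
        by (intro AE_I2 tendsto_intros lim)
      show "AE x in leb \<Omega>. norm (h x * \<psi> m x) \<le> \<bar>h x\<bar>" for m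
        using b1 by (intro AE_I2) (simp add: abs_mult mult_left_le)
      have "indicator F \<in> borel_measurable borel" using F by simp
      from mb[OF this] show "(\<lambda>x. h x * indicator F x) \<in> borel_measurable (leb \<Omega>)"
        using h by (intro borel_measurable_times) auto
      show "(\<lambda>x. h x * \<psi> m x) \<in> borel_measurable (leb \<Omega>)" for m
        using h mb[OF m1] by (intro borel_measurable_times) auto
    qed (use h in auto)
    then show ?thesis unfolding z using LIMSEQ_unique tendsto_const by blast
  qed
  have pos: "AE x in leb \<Omega>. \<not> g x > 0"
    if g: "integrable (leb \<Omega>) g"
      and g0: "\<And>F. closed F \<Longrightarrow> F \<noteq> {} \<Longrightarrow> (\<integral>x. g x * indicator F x \<partial>leb \<Omega>) = 0" for g :: "'d fn"
  proof -
    define S where "S = {x \<in> space (leb \<Omega>). g x > 0}"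
    have SM: "S \<in> sets (leb \<Omega>)" 
    unfolding S_def using g borel_measurable_iff_greater[of g "leb \<Omega>"] by auto
    then have SL: "S \<in> sets lebesgue" and S\<Omega>: "S \<subseteq> \<Omega>"
      unfolding sets_restrict_space_iff[of \<Omega> lebesgue, simplified, OF \<Omega>] by simp_all
    have em: "emeasure (leb \<Omega>) A = emeasure lebesgue A" if "A \<subseteq> \<Omega>" for A
      using that \<Omega> by (intro emeasure_restrict_space) auto
    have eps: "emeasure lebesgue S \<le> 0 + ennreal e" if "e > 0" for e
    proof -
      obtain T where T: "closed T" "T \<subseteq> S" "S - T \<in> lmeasurable" "emeasure lebesgue (S - T) < ennreal e"
        using sets_lebesgue_inner_closed[OF SL \<open>e > 0\<close>] by metis
      have "emeasure lebesgue T = 0"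
      proof (cases "T = {}")
        case False
        have im: "integrable (leb \<Omega>) (\<lambda>x. g x * indicator T x)"
        proof (rule Bochner_Integration.integrable_bound[OF g])
          have "indicator T \<in> borel_measurable borel" using T by simp
          from mb[OF this] show "(\<lambda>x. g x * indicator T x) \<in> borel_measurable (leb \<Omega>)"
            using g by (intro borel_measurable_times) auto
        qed (auto simp: indicator_def)
        have "AE x in leb \<Omega>. 0 \<le> g x * indicator T x"
          using T(2) by (intro AE_I2) (auto simp: S_def indicator_def)
        then have "AE x in leb \<Omega>. g x * indicator T x = 0"
          using g0[OF T(1) False] integral_nonneg_eq_0_iff_AE[OF im] by simp
        then have "AE x in leb \<Omega>. x \<notin> T"
        proof eventually_elim
          case (elim x)
          then show ?case using subsetD[OF T(2), of x] by (cases "x \<in> T") (simp_all add: S_def)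
        qed
        moreover have TM: "T \<in> sets (leb \<Omega>)"
          unfolding sets_restrict_space_iff[of \<Omega> lebesgue, simplified, OF \<Omega>] using T(1,2) S\<Omega> by simp
        moreover have "{x \<in> space (leb \<Omega>). \<not> x \<notin> T} = T" using sets.sets_into_space[OF TM] by blast
        ultimately have "emeasure (leb \<Omega>) T = 0"
          using AE_iff_measurable[of T "leb \<Omega>" "\<lambda>x. x \<notin> T"] by simp
        moreover have "T \<subseteq> \<Omega>" using T(2) S\<Omega> by (rule order_trans)
        ultimately show ?thesis using em[of T] by simp
      qed simp
      moreover have "emeasure lebesgue S \<le> emeasure lebesgue T + emeasure lebesgue (S - T)"
      proof -
        have "T \<in> sets lebesgue" using T(1) by simp
        moreover have "S - T \<in> sets lebesgue" using T(3) by (rule fmeasurableD)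
        moreover have "T \<union> (S - T) = S" using T(2) by blast
        ultimately show ?thesis using emeasure_subadditive[of T lebesgue "S - T"] by simp
      qed
      ultimately show ?thesis using T(4) by (simp add: order_trans[OF _ less_imp_le])
    qed
    have "emeasure lebesgue S \<le> 0"
      by (rule ennreal_le_epsilon) (rule eps)
    then have "emeasure (leb \<Omega>) S = 0" using em[OF S\<Omega>] by simp
    then show ?thesis
      using SM by (intro AE_I[of _ _ S]) (simp_all add: S_def)
  qed
  have "AE x in leb \<Omega>. \<not> - h x > 0"
  proof (rule pos[of "\<lambda>x. - h x"])
    show "integrable (leb \<Omega>) (\<lambda>x. - h x)" using h by (rule Bochner_Integration.integrable_minus)
    show "(\<integral>x. - h x * indicator F x \<partial>leb \<Omega>) = 0" if "closed F" "F \<noteq> {}" for F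
      using closed0[OF that] by simp
  qed
  moreover have "AE x in leb \<Omega>. \<not> h x > 0"
    by (rule pos[OF h closed0])
  ultimately show ?thesis by eventually_elim linarith
qed

lemma borel_leb: "w \<in> borel_measurable borel \<Longrightarrow> w \<in> borel_measurable (leb \<Omega>)"
  by (intro measurable_restrict_space1 measurable_completion) simp

lemma testfn_L2:
  assumes \<Omega>: "\<Omega> \<in> sets lebesgue" and f: "testfn \<Omega> f"
  shows "f \<in> L2 (leb \<Omega>)" "(\<lambda>x. cgrad f x $ i) \<in> L2 (leb \<Omega>)"
proof -
  obtain B r where B: "B \<ge> 0" "\<And>x. \<bar>f x\<bar> \<le> B" "\<And>x. norm (cgrad f x) \<le> B"
    "\<And>x. norm x \<ge> r \<Longrightarrow> f x = 0" "\<And>x. norm x \<ge> r \<Longrightarrow> cgrad f x = 0"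
    using testfn_bounds[OF f] by metis
  have m [measurable]: "f \<in> borel_measurable borel" "cgrad f \<in> borel_measurable borel"
    using testfn_borel[OF f] by auto
  have m' [measurable]: "(\<lambda>x. cgrad f x $ i) \<in> borel_measurable borel"
    by (simp add: cart_eq_inner_axis)
  have "integrable lborel (\<lambda>x. (f x)^2)"
  proof (rule integrable_compact_support[of _ "B^2" r])
    show "\<bar>(f x)^2\<bar> \<le> B^2 * indicator (ball 0 r) x" for x
      using B(2)[of x] B(4)[of x] B(1) power_mono[of "\<bar>f x\<bar>" B 2]
      by (cases "norm x \<ge> r") auto
  qed simp
  then have "integrable (leb \<Omega>) (\<lambda>x. (f x)^2)"
    using integral_leb_supported(2)[OF \<Omega>, of "\<lambda>x. (f x)^2"] testfn_outside[OF f] by auto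
  then show "f \<in> L2 (leb \<Omega>)" using borel_leb[OF m(1)] by (simp add: L2_def)
  have "integrable lborel (\<lambda>x. (cgrad f x $ i)^2)"
  proof (rule integrable_compact_support[of _ "B^2" r])
    show "\<bar>(cgrad f x $ i)^2\<bar> \<le> B^2 * indicator (ball 0 r) x" for x
      using order_trans[OF component_le_norm_cart[of "cgrad f x" i] B(3)] B(5)[of x] B(1) power_mono[of "\<bar>cgrad f x $ i\<bar>" B 2]
      by (cases "norm x \<ge> r") auto
  qed simp
  then have "integrable (leb \<Omega>) (\<lambda>x. (cgrad f x $ i)^2)"
    using integral_leb_supported(2)[OF \<Omega>, of "\<lambda>x. (cgrad f x $ i)^2"] testfn_outside[OF f] by auto
  then show "(\<lambda>x. cgrad f x $ i) \<in> L2 (leb \<Omega>)" using borel_leb[OF m'] by (simp add: L2_def)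
qed

section \<open>Componentwise description of \<open>H01pair\<close> and its closure
  properties\<close>

lemma integral_norm_sq_vec:
  fixes g :: "'a \<Rightarrow> real^'d::finite"
  assumes "\<And>i. (\<lambda>x. g x $ i) \<in> L2 M"
  shows "(\<integral>x. (norm (g x))^2 \<partial>M) = (\<Sum>i\<in>UNIV. (nrm2 M (\<lambda>x. g x $ i))^2)"
    and "integrable M (\<lambda>x. (norm (g x))^2)"
proof -
  have e: "(norm (g x))^2 = (\<Sum>i\<in>UNIV. (g x $ i)^2)" for x
    by (simp add: norm_vec_def L2_set_def sum_nonneg)
  show "(\<integral>x. (norm (g x))^2 \<partial>M) = (\<Sum>i\<in>UNIV. (nrm2 M (\<lambda>x. g x $ i))^2)"
    unfolding e nrm2_sq using assms by (simp add: L2_sq)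
  show "integrable M (\<lambda>x. (norm (g x))^2)"
    unfolding e using assms by (simp add: L2_sq)
qed

lemma tendsto_sq_iff:
  fixes f :: "nat \<Rightarrow> real" assumes "\<And>n. f n \<ge> 0"
  shows "(\<lambda>n. (f n)^2) \<longlonglongrightarrow> 0 \<longleftrightarrow> f \<longlonglongrightarrow> 0"
proof
  assume "(\<lambda>n. (f n)^2) \<longlonglongrightarrow> 0"
  from tendsto_real_sqrt[OF this] show "f \<longlonglongrightarrow> 0" using assms by simp
next
  assume "f \<longlonglongrightarrow> 0"
  from tendsto_power[OF this, of 2] show "(\<lambda>n. (f n)^2) \<longlonglongrightarrow> 0" by simp
qed

lemma H01pair_iff:
  assumes "open \<Omega>"
  shows "H01pair \<Omega> u g \<longleftrightarrow> u \<in> L2 (leb \<Omega>) \<and> (\<forall>i. (\<lambda>x. g x $ i) \<in> L2 (leb \<Omega>)) \<and>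
    (\<exists>\<phi>. (\<forall>k. testfn \<Omega> (\<phi> k)) \<and> (\<lambda>k. nrm2 (leb \<Omega>) (\<lambda>x. \<phi> k x - u x)) \<longlonglongrightarrow> 0 \<and>
       (\<forall>i. (\<lambda>k. nrm2 (leb \<Omega>) (\<lambda>x. cgrad (\<phi> k) x $ i - g x $ i)) \<longlonglongrightarrow> 0))"
proof -
  have \<Omega>: "\<Omega> \<in> sets lebesgue" using assms by simp
  note s = set_LINT_eq_leb[OF \<Omega>] inL2_eq_leb[OF \<Omega>]
  have "((\<lambda>k. \<integral>x. (norm (cgrad (\<phi> k) x - g x))^2 \<partial>leb \<Omega>) \<longlonglongrightarrow> 0)
     \<longleftrightarrow> (\<forall>i. (\<lambda>k. nrm2 (leb \<Omega>) (\<lambda>x. cgrad (\<phi> k) x $ i - g x $ i)) \<longlonglongrightarrow> 0)"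
    if \<phi>: "\<forall>k. testfn \<Omega> (\<phi> k)" and g: "\<forall>i. (\<lambda>x. g x $ i) \<in> L2 (leb \<Omega>)" for \<phi>
  proof -
    let ?n = "\<lambda>k i. nrm2 (leb \<Omega>) (\<lambda>x. cgrad (\<phi> k) x $ i - g x $ i)"
    have e: "(\<integral>x. (norm (cgrad (\<phi> k) x - g x))^2 \<partial>leb \<Omega>) = (\<Sum>i\<in>UNIV. (?n k i)^2)" for k
      using integral_norm_sq_vec(1)[of "\<lambda>x. cgrad (\<phi> k) x - g x" "leb \<Omega>"] L2_diff[OF testfn_L2(2)[OF \<Omega>]] \<phi> g
      by simp
    show ?thesis unfolding e
    proof safe
      fix i assume l: "(\<lambda>k. \<Sum>i\<in>UNIV. (?n k i)^2) \<longlonglongrightarrow> 0"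
      have "(\<lambda>k. (?n k i)^2) \<longlonglongrightarrow> 0"
        by (rule tendsto_sandwich[OF _ _ tendsto_const l])
           (auto intro!: always_eventually member_le_sum)
      then show "(\<lambda>k. ?n k i) \<longlonglongrightarrow> 0" by (simp add: tendsto_sq_iff)
    next
      assume "\<forall>i. (\<lambda>k. ?n k i) \<longlonglongrightarrow> 0"
      then have "\<forall>i. (\<lambda>k. (?n k i)^2) \<longlonglongrightarrow> 0" by (simp add: tendsto_sq_iff)
      then show "(\<lambda>k. \<Sum>i\<in>UNIV. (?n k i)^2) \<longlonglongrightarrow> 0"
        by (intro tendsto_null_sum) auto
    qed
  qed
  then show ?thesis
    unfolding H01pair_def s nrm2_sq[symmetric] using tendsto_sq_iff[OF nrm2_nonneg] by auto
qed

lemma H01pair_lincomb: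
  assumes \<Omega>: "open \<Omega>" and u: "H01pair \<Omega> u g" and v: "H01pair \<Omega> v h"
  shows "H01pair \<Omega> (\<lambda>x. u x + c * v x) (\<lambda>x. g x + c *\<^sub>R h x)"
proof -
  have \<Omega>': "\<Omega> \<in> sets lebesgue" using assms by simp
  note iff = H01pair_iff[OF \<Omega>]
  obtain \<phi> \<psi> where f: "\<forall>k. testfn \<Omega> (\<phi> k)" "(\<lambda>k. nrm2 (leb \<Omega>) (\<lambda>x. \<phi> k x - u x)) \<longlonglongrightarrow> 0"
      "\<forall>i. (\<lambda>k. nrm2 (leb \<Omega>) (\<lambda>x. cgrad (\<phi> k) x $ i - g x $ i)) \<longlonglongrightarrow> 0"
    and p: "\<forall>k. testfn \<Omega> (\<psi> k)" "(\<lambda>k. nrm2 (leb \<Omega>) (\<lambda>x. \<psi> k x - v x)) \<longlonglongrightarrow> 0"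
      "\<forall>i. (\<lambda>k. nrm2 (leb \<Omega>) (\<lambda>x. cgrad (\<psi> k) x $ i - h x $ i)) \<longlonglongrightarrow> 0"
    using u v unfolding iff by auto
  have L: "u \<in> L2 (leb \<Omega>)" "v \<in> L2 (leb \<Omega>)" "\<And>i. (\<lambda>x. g x $ i) \<in> L2 (leb \<Omega>)" "\<And>i. (\<lambda>x. h x $ i) \<in> L2 (leb \<Omega>)"
    using u v unfolding iff by auto
  have lim: "(\<lambda>k. nrm2 (leb \<Omega>) (\<lambda>x. (a k x + c * b k x) - (a' x + c * b' x))) \<longlonglongrightarrow> 0"
    if a: "(\<lambda>k. nrm2 (leb \<Omega>) (\<lambda>x. a k x - a' x)) \<longlonglongrightarrow> 0" and b: "(\<lambda>k. nrm2 (leb \<Omega>) (\<lambda>x. b k x - b' x)) \<longlonglongrightarrow> 0"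
      and i: "\<And>k. a k \<in> L2 (leb \<Omega>)" "a' \<in> L2 (leb \<Omega>)" "\<And>k. b k \<in> L2 (leb \<Omega>)" "b' \<in> L2 (leb \<Omega>)"
    for a b :: "nat \<Rightarrow> 'a fn" and a' b'
  proof (rule tendsto_sandwich[OF _ _ tendsto_const])
    show "(\<lambda>k. nrm2 (leb \<Omega>) (\<lambda>x. a k x - a' x) + \<bar>c\<bar> * nrm2 (leb \<Omega>) (\<lambda>x. b k x - b' x)) \<longlonglongrightarrow> 0"
      using tendsto_add[OF a tendsto_mult_left[OF b, of "\<bar>c\<bar>"]] by simp
    have "nrm2 (leb \<Omega>) (\<lambda>x. (a k x + c * b k x) - (a' x + c * b' x))
       \<le> nrm2 (leb \<Omega>) (\<lambda>x. a k x - a' x) + \<bar>c\<bar> * nrm2 (leb \<Omega>) (\<lambda>x. b k x - b' x)" for k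
    proof -
      have "(\<lambda>x. (a k x + c * b k x) - (a' x + c * b' x)) = (\<lambda>x. (a k x - a' x) + c * (b k x - b' x))"
        by (auto simp: algebra_simps)
      moreover have "(\<lambda>x. c * (b k x - b' x)) \<in> L2 (leb \<Omega>)"
        using L2_lincomb[OF L2_zero L2_diff[OF i(3) i(4)], of c] by simp
      ultimately show ?thesis
        using nrm2_triangle[OF L2_diff[OF i(1,2), of k], of "\<lambda>x. c * (b k x - b' x)"]
        by (simp add: nrm2_cmult)
    qed
    then show "\<forall>\<^sub>F k in sequentially. nrm2 (leb \<Omega>) (\<lambda>x. (a k x + c * b k x) - (a' x + c * b' x))
       \<le> nrm2 (leb \<Omega>) (\<lambda>x. a k x - a' x) + \<bar>c\<bar> * nrm2 (leb \<Omega>) (\<lambda>x. b k x - b' x)"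
      by (intro always_eventually) auto
  qed auto
  have cg: "cgrad (\<lambda>x. \<phi> k x + c * \<psi> k x) x $ i = cgrad (\<phi> k) x $ i + c * cgrad (\<psi> k) x $ i" for k x i
    using cgrad_lincomb[OF testfn_smooth[OF f(1)[rule_format]] testfn_smooth[OF p(1)[rule_format]]] by simp
  show ?thesis unfolding iff
  proof (intro conjI allI exI[of _ "\<lambda>k x. \<phi> k x + c * \<psi> k x"])
    show "(\<lambda>x. u x + c * v x) \<in> L2 (leb \<Omega>)" using L L2_lincomb by blast
    show "(\<lambda>x. (g x + c *\<^sub>R h x) $ i) \<in> L2 (leb \<Omega>)" for i using L2_lincomb[OF L(3,4)] by simp
    show "testfn \<Omega> (\<lambda>x. \<phi> k x + c * \<psi> k x)" for k using f p testfn_lincomb by blast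
    show "(\<lambda>k. nrm2 (leb \<Omega>) (\<lambda>x. \<phi> k x + c * \<psi> k x - (u x + c * v x))) \<longlonglongrightarrow> 0"
      using lim[OF f(2) p(2)] f(1) p(1) L testfn_L2(1)[OF \<Omega>'] by blast
    show "(\<lambda>k. nrm2 (leb \<Omega>) (\<lambda>x. cgrad (\<lambda>x. \<phi> k x + c * \<psi> k x) x $ i - (g x + c *\<^sub>R h x) $ i)) \<longlonglongrightarrow> 0" for i
      using lim[OF f(3)[rule_format] p(3)[rule_format], of i i] f(1) p(1) L testfn_L2(2)[OF \<Omega>']
      unfolding cg by simp
  qed
qed

lemma H01pair_zero: "open \<Omega> \<Longrightarrow> H01pair \<Omega> (\<lambda>x. 0) (\<lambda>x. 0)"
proof -
  assume \<Omega>: "open \<Omega>"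
  have c: "cgrad (\<lambda>x::real^'a. 0::real) x = 0" for x
    using cgrad_lincomb[OF smooth_fn_zero smooth_fn_zero, of "-1" x] by simp
  show ?thesis unfolding H01pair_iff[OF \<Omega>]
    by (intro conjI exI[of _ "\<lambda>k x. 0"]) (auto simp: L2_zero testfn_zero c nrm2_def)
qed

text \<open>The gradient is closable: if test functions tend to 0 in L2 while their gradients
  converge, the limit pairs to 0 with every bounded Lipschitz function, because that pairing is
  controlled by the L1 norms of the test functions.\<close>

lemma H01pair_null_gradient:
  fixes g :: "real^'d::finite \<Rightarrow> real^'d"
  assumes \<Omega>: "open \<Omega>" "bounded \<Omega>" and p: "H01pair \<Omega> (\<lambda>x. 0) g"
  shows "AE x in leb \<Omega>. g x = 0"
proof -
  have \<Omega>': "\<Omega> \<in> sets lebesgue" using assms by simp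
  interpret finite_measure "leb \<Omega>" by (rule finite_measure_leb[OF \<Omega>])
  obtain \<phi> where f: "\<And>k. testfn \<Omega> (\<phi> k)" "(\<lambda>k. nrm2 (leb \<Omega>) (\<lambda>x. \<phi> k x - 0)) \<longlonglongrightarrow> 0"
      "\<And>i. (\<lambda>k. nrm2 (leb \<Omega>) (\<lambda>x. cgrad (\<phi> k) x $ i - g x $ i)) \<longlonglongrightarrow> 0"
    and g: "\<And>i. (\<lambda>x. g x $ i) \<in> L2 (leb \<Omega>)"
    using p unfolding H01pair_iff[OF \<Omega>(1)] by auto
  have "AE x in leb \<Omega>. g x $ i = 0" for i
  proof (rule AE_zero_if_Lipschitz_orthogonal[OF \<Omega>' L2_integrable[OF g]])
    fix \<psi> :: "'d fn" and B L
    assume m: "\<psi> \<in> borel_measurable borel" and B: "\<And>x. \<bar>\<psi> x\<bar> \<le> B"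
      and L: "\<And>x y. \<bar>\<psi> x - \<psi> y\<bar> \<le> L * norm (x - y)"
    have L0: "L \<ge> 0" using order_trans[OF abs_ge_zero L[of "axis i 1" 0]] by simp
    have \<psi>2: "\<psi> \<in> L2 (leb \<Omega>)"
    proof -
      have "integrable (leb \<Omega>) (\<lambda>x. (\<psi> x)^2)"
      proof (rule Bochner_Integration.integrable_bound[of _ "\<lambda>x. B^2"])
        show "(\<lambda>x. (\<psi> x)^2) \<in> borel_measurable (leb \<Omega>)" using borel_leb[OF m] by simp
        show "AE x in leb \<Omega>. norm ((\<psi> x)^2) \<le> norm (B^2)"
          using power_mono[OF B abs_ge_zero, of _ 2] by (intro AE_I2) simp
      qed simp
      then show ?thesis using borel_leb[OF m] by (simp add: L2_def)
    qed
    have "(\<lambda>k. \<integral>x. cgrad (\<phi> k) x $ i * \<psi> x \<partial>leb \<Omega>) \<longlonglongrightarrow> (\<integral>x. g x $ i * \<psi> x \<partial>leb \<Omega>)"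
      using f(1,3) testfn_L2(2)[OF \<Omega>'] g \<psi>2
      by (intro L2_tendsto_mult) (auto simp: nrm2_def)
    moreover have "(\<lambda>k. \<integral>x. cgrad (\<phi> k) x $ i * \<psi> x \<partial>leb \<Omega>) \<longlonglongrightarrow> 0"
    proof (rule Lim_null_comparison)
      let ?s = "sqrt (measure (leb \<Omega>) (space (leb \<Omega>)))"
      have "norm (\<integral>x. cgrad (\<phi> k) x $ i * \<psi> x \<partial>leb \<Omega>) \<le> L * (nrm2 (leb \<Omega>) (\<lambda>x. \<phi> k x - 0) * ?s)" for k
      proof -
        have mk: "\<phi> k \<in> borel_measurable borel" "(\<lambda>x. cgrad (\<phi> k) x $ i) \<in> borel_measurable borel"
          using testfn_borel[OF f(1)] by (auto simp: cart_eq_inner_axis)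
        have "(\<integral>x. cgrad (\<phi> k) x $ i * \<psi> x \<partial>leb \<Omega>) = (\<integral>x. cgrad (\<phi> k) x $ i * \<psi> x \<partial>lborel)"
          using mk m testfn_outside(2)[OF f(1)] by (intro integral_leb_supported(1)[OF \<Omega>']) auto
        also have "\<dots> = (\<integral>x. (cgrad (\<phi> k) x \<bullet> axis i 1) * \<psi> x \<partial>lborel)"
          by (simp add: cart_eq_inner_axis)
        finally have "norm (\<integral>x. cgrad (\<phi> k) x $ i * \<psi> x \<partial>leb \<Omega>) \<le> L * norm (axis i 1 :: real^'d) * (\<integral>x. \<bar>\<phi> k x\<bar> \<partial>lborel)"
          using testfn_grad_Lipschitz_bound[OF f(1) m B L, of k "axis i 1"] by (simp add: norm_axis_1)
        also have "\<dots> = L * (\<integral>x. \<bar>\<phi> k x\<bar> \<partial>leb \<Omega>)"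
          using mk testfn_outside(1)[OF f(1)] by (subst integral_leb_supported(1)[OF \<Omega>']) auto
        also have "\<dots> \<le> L * (nrm2 (leb \<Omega>) (\<phi> k) * ?s)"
          using L0 by (intro mult_left_mono integral_abs_le_nrm2 testfn_L2(1)[OF \<Omega>'] f)
        finally show ?thesis by simp
      qed
      then show "\<forall>\<^sub>F k in sequentially. norm (\<integral>x. cgrad (\<phi> k) x $ i * \<psi> x \<partial>leb \<Omega>)
          \<le> L * (nrm2 (leb \<Omega>) (\<lambda>x. \<phi> k x - 0) * ?s)" by (rule always_eventually[OF allI])
      show "(\<lambda>k. L * (nrm2 (leb \<Omega>) (\<lambda>x. \<phi> k x - 0) * ?s)) \<longlonglongrightarrow> 0"
        using tendsto_mult_left[OF tendsto_mult_right[OF f(2), of ?s], of L] by simp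
    qed
    ultimately show "(\<integral>x. g x $ i * \<psi> x \<partial>leb \<Omega>) = 0" using LIMSEQ_unique by blast
  qed
  then have "AE x in leb \<Omega>. \<forall>i. g x $ i = 0" by (simp add: AE_all_countable)
  then show ?thesis by eventually_elim (simp add: vec_eq_iff)
qed

lemma H01pair_gradient_unique:
  assumes \<Omega>: "open \<Omega>" "bounded \<Omega>" and "H01pair \<Omega> u g" "H01pair \<Omega> u h"
  shows "AE x in leb \<Omega>. g x = h x"
proof -
  have "H01pair \<Omega> (\<lambda>x. 0) (\<lambda>x. g x - h x)"
    using H01pair_lincomb[OF \<Omega>(1) assms(3,4), of "-1"] by simp
  from H01pair_null_gradient[OF \<Omega> this] show ?thesis by simp
qed

text \<open>Each pair is replaced by a test function within 1/(n+1) of it; these test functions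
  approximate the L2 limits of the functions and of the gradient components, so the limits form a
  pair.\<close>

lemma H01pair_complete:
  fixes g :: "nat \<Rightarrow> real^'d::finite \<Rightarrow> real^'d"
  assumes \<Omega>: "open \<Omega>" "bounded \<Omega>" and p: "\<And>n. H01pair \<Omega> (u n) (g n)"
    and cu: "\<And>e. e > 0 \<Longrightarrow> \<exists>N. \<forall>m\<ge>N. \<forall>n\<ge>N. nrm2 (leb \<Omega>) (\<lambda>x. u m x - u n x) < e"
    and cg: "\<And>i e. e > 0 \<Longrightarrow> \<exists>N. \<forall>m\<ge>N. \<forall>n\<ge>N. nrm2 (leb \<Omega>) (\<lambda>x. g m x $ i - g n x $ i) < e"
  obtains w h where "H01pair \<Omega> w h" "(\<lambda>n. nrm2 (leb \<Omega>) (\<lambda>x. u n x - w x)) \<longlonglongrightarrow> 0"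
    "\<And>i. (\<lambda>n. nrm2 (leb \<Omega>) (\<lambda>x. g n x $ i - h x $ i)) \<longlonglongrightarrow> 0"
proof -
  have \<Omega>': "\<Omega> \<in> sets lebesgue" using assms by simp
  interpret finite_measure "leb \<Omega>" by (rule finite_measure_leb[OF \<Omega>])
  note iff = H01pair_iff[OF \<Omega>(1)]
  have L: "\<And>n. u n \<in> L2 (leb \<Omega>)" "\<And>n i. (\<lambda>x. g n x $ i) \<in> L2 (leb \<Omega>)" using p unfolding iff by auto
  obtain w where w: "w \<in> L2 (leb \<Omega>)" "(\<lambda>n. nrm2 (leb \<Omega>) (\<lambda>x. u n x - w x)) \<longlonglongrightarrow> 0"
    using L2_complete[OF L(1) cu] by blast
  have "\<forall>i. \<exists>k. k \<in> L2 (leb \<Omega>) \<and> (\<lambda>n. nrm2 (leb \<Omega>) (\<lambda>x. g n x $ i - k x)) \<longlonglongrightarrow> 0"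
    using L2_complete[of "\<lambda>n x. g n x $ i" for i, OF L(2) cg] by blast
  from choice[OF this] obtain K where
    "\<forall>i. K i \<in> L2 (leb \<Omega>) \<and> (\<lambda>n. nrm2 (leb \<Omega>) (\<lambda>x. g n x $ i - K i x)) \<longlonglongrightarrow> 0"
    by (rule exE)
  then have K: "\<And>i. K i \<in> L2 (leb \<Omega>)" "\<And>i. (\<lambda>n. nrm2 (leb \<Omega>) (\<lambda>x. g n x $ i - K i x)) \<longlonglongrightarrow> 0"
    by simp_all
  define h where "h x = (\<chi> i. K i x)" for x
  have "\<forall>n. \<exists>\<phi>. testfn \<Omega> \<phi> \<and> nrm2 (leb \<Omega>) (\<lambda>x. \<phi> x - u n x) < inverse (real (Suc n)) \<and>
      (\<forall>i. nrm2 (leb \<Omega>) (\<lambda>x. cgrad \<phi> x $ i - g n x $ i) < inverse (real (Suc n)))"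
  proof
    fix n
    obtain \<phi> where f: "\<And>k. testfn \<Omega> (\<phi> k)" "(\<lambda>k. nrm2 (leb \<Omega>) (\<lambda>x. \<phi> k x - u n x)) \<longlonglongrightarrow> 0"
        "\<And>i. (\<lambda>k. nrm2 (leb \<Omega>) (\<lambda>x. cgrad (\<phi> k) x $ i - g n x $ i)) \<longlonglongrightarrow> 0"
      using p[of n] unfolding iff by auto
    have e: "inverse (real (Suc n)) > 0" by simp
    have "\<forall>\<^sub>F k in sequentially. nrm2 (leb \<Omega>) (\<lambda>x. \<phi> k x - u n x) < inverse (real (Suc n)) \<and>
      (\<forall>i. nrm2 (leb \<Omega>) (\<lambda>x. cgrad (\<phi> k) x $ i - g n x $ i) < inverse (real (Suc n)))"
      using order_tendstoD(2)[OF f(2) e] order_tendstoD(2)[OF f(3) e]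
      by (intro eventually_conj eventually_all_finite)
    then obtain N where "nrm2 (leb \<Omega>) (\<lambda>x. \<phi> N x - u n x) < inverse (real (Suc n)) \<and>
      (\<forall>i. nrm2 (leb \<Omega>) (\<lambda>x. cgrad (\<phi> N) x $ i - g n x $ i) < inverse (real (Suc n)))"
      unfolding eventually_sequentially by blast
    then show "\<exists>\<phi>. testfn \<Omega> \<phi> \<and> nrm2 (leb \<Omega>) (\<lambda>x. \<phi> x - u n x) < inverse (real (Suc n)) \<and>
      (\<forall>i. nrm2 (leb \<Omega>) (\<lambda>x. cgrad \<phi> x $ i - g n x $ i) < inverse (real (Suc n)))"
      using f(1) by (intro exI[of _ "\<phi> N"] conjI) simp_all
  qed
  from choice[OF this] obtain \<phi> where
    "\<forall>n. testfn \<Omega> (\<phi> n) \<and> nrm2 (leb \<Omega>) (\<lambda>x. \<phi> n x - u n x) < inverse (real (Suc n)) \<and>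
      (\<forall>i. nrm2 (leb \<Omega>) (\<lambda>x. cgrad (\<phi> n) x $ i - g n x $ i) < inverse (real (Suc n)))"
    by (rule exE)
  then have f: "\<And>n. testfn \<Omega> (\<phi> n)" "\<And>n. nrm2 (leb \<Omega>) (\<lambda>x. \<phi> n x - u n x) < inverse (real (Suc n))"
      "\<And>n i. nrm2 (leb \<Omega>) (\<lambda>x. cgrad (\<phi> n) x $ i - g n x $ i) < inverse (real (Suc n))"
    by simp_all
  have lim: "(\<lambda>n. nrm2 (leb \<Omega>) (\<lambda>x. a n x - c x)) \<longlonglongrightarrow> 0"
    if a: "\<And>n. nrm2 (leb \<Omega>) (\<lambda>x. a n x - b n x) < inverse (real (Suc n))"
      and b: "(\<lambda>n. nrm2 (leb \<Omega>) (\<lambda>x. b n x - c x)) \<longlonglongrightarrow> 0"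
      and l: "\<And>n. a n \<in> L2 (leb \<Omega>)" "\<And>n. b n \<in> L2 (leb \<Omega>)" "c \<in> L2 (leb \<Omega>)" for a b :: "nat \<Rightarrow> 'd fn" and c
  proof (rule tendsto_sandwich[OF _ _ tendsto_const])
    show "(\<lambda>n. inverse (real (Suc n)) + nrm2 (leb \<Omega>) (\<lambda>x. b n x - c x)) \<longlonglongrightarrow> 0"
      using tendsto_add[OF LIMSEQ_inverse_real_of_nat b] by simp
    show "\<forall>\<^sub>F n in sequentially. nrm2 (leb \<Omega>) (\<lambda>x. a n x - c x) \<le> inverse (real (Suc n)) + nrm2 (leb \<Omega>) (\<lambda>x. b n x - c x)"
    proof (intro always_eventually allI)
      show "nrm2 (leb \<Omega>) (\<lambda>x. a n x - c x) \<le> inverse (real (Suc n)) + nrm2 (leb \<Omega>) (\<lambda>x. b n x - c x)" for n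
        using nrm2_triangle_diff[OF l(1)[of n] l(2)[of n] l(3)] a[of n] by linarith
    qed
  qed auto
  have "H01pair \<Omega> w h" unfolding iff
  proof (intro conjI allI exI[of _ \<phi>])
    show "(\<lambda>k. nrm2 (leb \<Omega>) (\<lambda>x. \<phi> k x - w x)) \<longlonglongrightarrow> 0"
      by (rule lim[OF f(2) w(2)]) (use L w f testfn_L2[OF \<Omega>'] in auto)
    show "(\<lambda>k. nrm2 (leb \<Omega>) (\<lambda>x. cgrad (\<phi> k) x $ i - h x $ i)) \<longlonglongrightarrow> 0" for i
      unfolding h_def vec_lambda_beta
      by (rule lim[OF f(3) K(2)]) (use L K f testfn_L2[OF \<Omega>'] in auto)
  qed (use w K f in \<open>auto simp: h_def\<close>)
  then show ?thesis using that w(2) K(2) by (simp add: h_def)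
qed

section \<open>Ehrling's inequality\<close>

lemma nrm2_sum:
  fixes m :: nat
  assumes "\<And>j. j < m \<Longrightarrow> f j \<in> L2 M"
  shows "nrm2 M (\<lambda>x. \<Sum>j<m. f j x) \<le> (\<Sum>j<m. nrm2 M (f j)) \<and> (\<lambda>x. \<Sum>j<m. f j x) \<in> L2 M"
  using assms
proof (induction m)
  case 0
  then show ?case by (simp add: L2_zero nrm2_def)
next
  case (Suc m)
  then show ?case using nrm2_triangle[of "\<lambda>x. \<Sum>j<m. f j x" M "f m"] L2_add[of "\<lambda>x. \<Sum>j<m. f j x" M "f m"]
    by fastforce
qed

lemma testfn_shift_L2:
  assumes f: "testfn \<Omega> \<phi>"
  shows "(\<lambda>x. \<phi> (x + c)) \<in> L2 lborel"
proof -
  obtain B r where B: "B \<ge> 0" "r > 0" "\<And>x. \<bar>\<phi> x\<bar> \<le> B" "\<And>x. norm x \<ge> r \<Longrightarrow> \<phi> x = 0"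
    using testfn_bounds[OF f] by metis
  have [measurable]: "\<phi> \<in> borel_measurable borel" using testfn_borel[OF f] by auto
  have "integrable lborel (\<lambda>x. (\<phi> (x + c))^2)"
  proof (rule integrable_compact_support[of _ "B^2" "r + norm c"])
    show "\<bar>(\<phi> (x + c))^2\<bar> \<le> B^2 * indicator (ball 0 (r + norm c)) x" for x
    proof (cases "norm x < r + norm c")
      case True
      then show ?thesis using power_mono[OF B(3) abs_ge_zero, of "x + c" 2] by simp
    next
      case False
      then have "norm (x + c) \<ge> r" using norm_triangle_ineq2[of x "- c"] by simp
      then show ?thesis using B(4) by simp
    qed
  qed simp
  then show ?thesis by (simp add: L2_def)
qed

lemma integrable_sq_testfn_grad:
  assumes f: "testfn \<Omega> \<phi>"
  shows "integrable lborel (\<lambda>x. (norm (cgrad \<phi> x))^2)"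
proof -
  obtain B r where B: "B \<ge> 0" "\<And>x. norm (cgrad \<phi> x) \<le> B" "\<And>x. norm x \<ge> r \<Longrightarrow> cgrad \<phi> x = 0"
    using testfn_bounds[OF f] by metis
  have [measurable]: "cgrad \<phi> \<in> borel_measurable borel" using testfn_borel[OF f] by auto
  show ?thesis
  proof (rule integrable_compact_support[of _ "B^2" r])
    show "\<bar>(norm (cgrad \<phi> x))^2\<bar> \<le> B^2 * indicator (ball 0 r) x" for x
      using power_mono[OF B(2) norm_ge_zero, of x 2] B(3)[of x] by (cases "norm x \<ge> r") auto
  qed simp
qed

text \<open>The shift by \<open>h\<close> is cut into n+1 equal shifts; by translation invariance
  each contributes the same L2 norm, and n+1 times that norm is the norm of the difference quotient.
  Letting \<open>n\<close> grow turns it into the directional derivative.\<close>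

lemma testfn_translation_estimate:
  assumes f: "testfn \<Omega> \<phi>"
  shows "(\<integral>x. (\<phi> (x + h) - \<phi> x)^2 \<partial>lborel) \<le> (norm h)^2 * (\<integral>x. (norm (cgrad \<phi> x))^2 \<partial>lborel)"
proof -
  have [measurable]: "\<phi> \<in> borel_measurable borel" "cgrad \<phi> \<in> borel_measurable borel"
    using testfn_borel[OF f] by auto
  define D where "D n x = real (Suc n) * (\<phi> (x + h /\<^sub>R real (Suc n)) - \<phi> x)" for n x
  obtain B r where B: "B \<ge> 0" "\<And>n x. \<bar>D n x\<bar> \<le> B * norm h * indicator (ball 0 (r + norm h)) x"
    using diff_quotient_bound[OF f] unfolding D_def by metis
  have "(\<lambda>n. \<integral>x. (D n x)^2 \<partial>lborel) \<longlonglongrightarrow> (\<integral>x. (cgrad \<phi> x \<bullet> h)^2 \<partial>lborel)"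
  proof (rule integral_dominated_convergence[where w="\<lambda>x. (B * norm h)^2 * indicator (ball 0 (r + norm h)) x"])
    show "integrable lborel (\<lambda>x. (B * norm h)^2 * indicator (ball 0 (r + norm h)) x)"
      by (intro integrable_mult_right integrable_real_indicator emeasure_lborel_ball_finite) simp
    show "AE x in lborel. (\<lambda>n. (D n x)^2) \<longlonglongrightarrow> (cgrad \<phi> x \<bullet> h)^2"
      unfolding D_def by (intro AE_I2 tendsto_intros diff_quotient[OF f])
    show "AE x in lborel. norm ((D n x)^2) \<le> (B * norm h)^2 * indicator (ball 0 (r + norm h)) x" for n
    proof (rule AE_I2)
      fix x show "norm ((D n x)^2) \<le> (B * norm h)^2 * indicator (ball 0 (r + norm h)) x"
        using power_mono[OF B(2) abs_ge_zero, of n x 2]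
        by (cases "norm x < r + norm h") (simp_all add: power_mult_distrib)
    qed
  qed (auto simp: D_def)
  moreover have "(\<integral>x. (\<phi> (x + h) - \<phi> x)^2 \<partial>lborel) \<le> (\<integral>x. (D n x)^2 \<partial>lborel)" for n
  proof -
    let ?m = "Suc n" and ?c = "h /\<^sub>R real (Suc n)"
    define F where "F j x = \<phi> (x + real j *\<^sub>R ?c + ?c) - \<phi> (x + real j *\<^sub>R ?c)" for j x
    have FL: "F j \<in> L2 lborel" for j
      unfolding F_def using L2_diff[OF testfn_shift_L2[OF f, of "real j *\<^sub>R ?c + ?c"] testfn_shift_L2[OF f, of "real j *\<^sub>R ?c"]]
      by (simp add: add.assoc)
    have Fj: "nrm2 lborel (F j) = nrm2 lborel (F 0)" for j
    proof -
      have "(\<integral>x. (F j x)^2 \<partial>lborel) = (\<integral>x. (F 0 (x + real j *\<^sub>R ?c))^2 \<partial>lborel)"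
        by (simp add: F_def)
      also have "\<dots> = (\<integral>x. (F 0 x)^2 \<partial>lborel)"
        by (rule integral_lborel_translation) (simp add: F_def)
      finally show ?thesis by (simp add: nrm2_def)
    qed
    have tel: "(\<Sum>j<m. F j x) = \<phi> (x + real m *\<^sub>R ?c) - \<phi> x" for m x
    proof (induction m)
      case (Suc m)
      have "real (Suc m) *\<^sub>R ?c = real m *\<^sub>R ?c + ?c"
        unfolding of_nat_Suc[of m] scaleR_left_distrib scaleR_one by (rule add.commute)
      then have "F m x = \<phi> (x + real (Suc m) *\<^sub>R ?c) - \<phi> (x + real m *\<^sub>R ?c)"
        unfolding F_def by (metis add.assoc)
      then show ?case unfolding sum.lessThan_Suc Suc.IH by linarith
    qed simp
    have "nrm2 lborel (\<lambda>x. \<phi> (x + h) - \<phi> x) = nrm2 lborel (\<lambda>x. \<Sum>j<?m. F j x)"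
      unfolding tel by (simp del: of_nat_Suc)
    also have "\<dots> \<le> (\<Sum>j<?m. nrm2 lborel (F j))" using nrm2_sum[of ?m F] FL by blast
    also have "\<dots> = (\<Sum>j<?m. nrm2 lborel (F 0))" by (intro sum.cong refl Fj)
    also have "\<dots> = real ?m * nrm2 lborel (F 0)" by simp
    also have "\<dots> = nrm2 lborel (D n)"
      using nrm2_cmult[of lborel "real ?m" "F 0"] by (simp add: F_def D_def[abs_def] del: of_nat_Suc)
    finally have "(nrm2 lborel (\<lambda>x. \<phi> (x + h) - \<phi> x))^2 \<le> (nrm2 lborel (D n))^2"
      by (rule power_mono) simp
    then show ?thesis by (simp add: nrm2_sq)
  qed
  ultimately have "(\<integral>x. (\<phi> (x + h) - \<phi> x)^2 \<partial>lborel) \<le> (\<integral>x. (cgrad \<phi> x \<bullet> h)^2 \<partial>lborel)"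
    by (intro LIMSEQ_le_const) auto
  also have "\<dots> \<le> (\<integral>x. (norm h)^2 * (norm (cgrad \<phi> x))^2 \<partial>lborel)"
  proof (rule integral_mono_AE')
    show "integrable lborel (\<lambda>x. (norm h)^2 * (norm (cgrad \<phi> x))^2)"
      using integrable_sq_testfn_grad[OF f] by simp
    show "AE x in lborel. (cgrad \<phi> x \<bullet> h)^2 \<le> (norm h)^2 * (norm (cgrad \<phi> x))^2"
    proof (rule AE_I2)
      fix x
      show "(cgrad \<phi> x \<bullet> h)^2 \<le> (norm h)^2 * (norm (cgrad \<phi> x))^2"
        using power_mono[OF Cauchy_Schwarz_ineq2[of "cgrad \<phi> x" h] abs_ge_zero, of 2]
        by (simp add: power_mult_distrib mult.commute)
    qed
  qed auto
  finally show ?thesis by simp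
qed

text \<open>Variance identity: the square integral over \<open>Q\<close> splits into the squared
  integral and the double integral of squared differences, written without division by the measure
  of \<open>Q\<close>.\<close>

lemma integral_sq_split_mean:
  fixes f :: "'a \<Rightarrow> real"
  assumes "integrable M (\<lambda>x. f x * indicator Q x)" "integrable M (\<lambda>x. (f x)^2 * indicator Q x)"
    and Q: "integrable M (indicator Q :: 'a \<Rightarrow> real)"
  shows "2 * (\<integral>x. indicator Q x \<partial>M) * (\<integral>x. (f x)^2 * indicator Q x \<partial>M)
    = 2 * (\<integral>x. f x * indicator Q x \<partial>M)^2
      + (\<integral>x. (\<integral>y. indicator Q x * indicator Q y * (f x - f y)^2 \<partial>M) \<partial>M)"
    and "integrable M (\<lambda>x. \<integral>y. indicator Q x * indicator Q y * (f x - f y)^2 \<partial>M)"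
    and "integrable M (\<lambda>y. indicator Q x * indicator Q y * (f x - f y)^2)"
proof -
  let ?m = "\<integral>x. indicator Q x \<partial>M" and ?I = "\<integral>x. f x * indicator Q x \<partial>M" and ?J = "\<integral>x. (f x)^2 * indicator Q x \<partial>M"
  have e: "indicator Q x * indicator Q y * (f x - f y)^2 = indicator Q x * (f x)^2 * indicator Q y
      - 2 * indicator Q x * f x * (f y * indicator Q y) + indicator Q x * ((f y)^2 * indicator Q y)" for x y
    by (simp add: power2_diff algebra_simps)
  show "integrable M (\<lambda>y. indicator Q x * indicator Q y * (f x - f y)^2)" for x
    unfolding e using assms by (intro Bochner_Integration.integrable_add Bochner_Integration.integrable_diff integrable_mult_right)
  have i: "(\<integral>y. indicator Q x * indicator Q y * (f x - f y)^2 \<partial>M)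
     = (f x)^2 * indicator Q x * ?m - 2 * ?I * (f x * indicator Q x) + indicator Q x * ?J" for x
    unfolding e using assms by simp
  show "integrable M (\<lambda>x. \<integral>y. indicator Q x * indicator Q y * (f x - f y)^2 \<partial>M)"
    unfolding i using assms by (intro Bochner_Integration.integrable_add Bochner_Integration.integrable_diff integrable_mult_right integrable_mult_left)
  have "(\<integral>x. (\<integral>y. indicator Q x * indicator Q y * (f x - f y)^2 \<partial>M) \<partial>M) = ?J * ?m - 2 * ?I * ?I + ?m * ?J"
    unfolding i using assms by simp
  then show "2 * ?m * ?J = 2 * ?I^2 + (\<integral>x. (\<integral>y. indicator Q x * indicator Q y * (f x - f y)^2 \<partial>M) \<partial>M)"
    by (simp add: power2_eq_square algebra_simps)
qed

section \<open>Averages over a grid of cubes\<close>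

definition grid :: "real \<Rightarrow> real^'d::finite \<Rightarrow> 'd \<Rightarrow> int" where
  "grid s x = (\<lambda>i. \<lfloor>x $ i / s\<rfloor>)"

text \<open>The half-open cube of side \<open>s\<close> with index \<open>k\<close>. As fibres of
  \<open>grid\<close> the cells partition the space.\<close>

definition cell :: "real \<Rightarrow> ('d::finite \<Rightarrow> int) \<Rightarrow> (real^'d) set" where
  "cell s k = {x. grid s x = k}"

lemma cell_borel: "cell s k \<in> sets borel"
proof -
  have "cell s k = (\<Inter>i. {x \<in> space borel. \<lfloor>x $ i / s\<rfloor> = k i})"
    by (auto simp: cell_def grid_def fun_eq_iff)
  also have "\<dots> \<in> sets borel"
  proof (rule sets.finite_INT)
    fix i
    have [measurable]: "(\<lambda>x::real^'a. x $ i) \<in> borel_measurable borel" by (simp add: cart_eq_inner_axis)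
    show "{x \<in> space borel. \<lfloor>x $ i / s\<rfloor> = k i} \<in> sets (borel :: (real^'a) measure)" by measurable
  qed auto
  finally show ?thesis .
qed

lemma cell_coord:
  assumes "s > 0" "x \<in> cell s k" shows "of_int (k i) * s \<le> x $ i" "x $ i < (of_int (k i) + 1) * s"
proof -
  have "\<lfloor>x $ i / s\<rfloor> = k i" using assms by (auto simp: cell_def grid_def)
  then show "of_int (k i) * s \<le> x $ i" "x $ i < (of_int (k i) + 1) * s"
    using floor_correct[of "x $ i / s"] assms(1) by (simp_all add: field_simps)
qed

lemma measure_cell:
  fixes k :: "'d::finite \<Rightarrow> int"
  assumes s: "s > 0"
  shows "emeasure lborel (cell s k) < \<infinity>" "measure lborel (cell s k) \<ge> s ^ CARD('d)"
proof -
  define a b :: "real^'d" where "a = (\<chi> i. of_int (k i) * s)" and "b = (\<chi> i. (of_int (k i) + 1) * s)"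
  have ab: "a $ i \<le> b $ i" for i using s by (simp add: a_def b_def algebra_simps)
  have 1: "cell s k \<subseteq> cbox a b"
    using cell_coord(1)[OF s] order_less_imp_le[OF cell_coord(2)[OF s]] by (auto simp: mem_box_cart a_def b_def)
  have 2: "box a b \<subseteq> cell s k"
  proof
    fix x assume x: "x \<in> box a b"
    have "\<lfloor>x $ i / s\<rfloor> = k i" for i
    proof -
      have "of_int (k i) * s < x $ i" "x $ i < (of_int (k i) + 1) * s"
        using x by (auto simp: mem_box_cart a_def b_def)
      then show ?thesis using s by (simp add: floor_eq_iff field_simps less_imp_le)
    qed
    then show "x \<in> cell s k" by (simp add: cell_def grid_def fun_eq_iff)
  qed
  show fin: "emeasure lborel (cell s k) < \<infinity>"
    by (rule order_le_less_trans[OF emeasure_mono[OF 1] emeasure_lborel_cbox_finite]) simp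
  have "s ^ CARD('d) = measure lborel (cbox a b)"
    by (subst content_cbox_cart) (auto simp: interval_ne_empty_cart ab a_def b_def algebra_simps s less_imp_le)
  also have "\<dots> = measure lborel (box a b)" by (simp add: measure_lborel_box_eq measure_lborel_cbox_eq)
  also have "\<dots> \<le> measure lborel (cell s k)"
    using 2 fin cell_borel by (intro measure_mono_fmeasurable fmeasurableI) auto
  finally show "measure lborel (cell s k) \<ge> s ^ CARD('d)" .
qed


text \<open>Two points of one cell differ by a vector of the box \<open>H\<close> of side 2s.
  Substituting h = y - x bounds the double integrals by the integral over \<open>H\<close> of
  translation differences, which the gradient controls. Each \<open>x\<close> lies in one cell only,
  so the bound is independent of the number of cells.\<close>

lemma cell_energy_bound:
  fixes \<phi> :: "'d::finite fn"
  assumes f: "testfn \<Omega> \<phi>" and s: "s > 0" and K: "finite K"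
  shows "(\<Sum>k\<in>K. \<integral>x. (\<integral>y. indicator (cell s k) x * indicator (cell s k) y * (\<phi> x - \<phi> y)^2 \<partial>lborel) \<partial>lborel)
    \<le> (2 * s) ^ CARD('d) * (real CARD('d) * s)^2 * (\<integral>x. (norm (cgrad \<phi> x))^2 \<partial>lborel)"
proof -
  have [measurable]: "\<phi> \<in> borel_measurable borel" using testfn_borel[OF f] by auto
  have [measurable]: "cell s k \<in> sets borel" for k by (rule cell_borel)
  define H :: "(real^'d) set" where "H = cbox (\<chi> i. - s) (\<chi> i. s)"
  have [measurable]: "H \<in> sets borel" by (simp add: H_def)
  define G where "G = (\<integral>x. (norm (cgrad \<phi> x))^2 \<partial>lborel)"
  have G0: "G \<ge> 0" by (simp add: G_def)
  let ?E = "\<lambda>k. \<integral>x. (\<integral>y. indicator (cell s k) x * indicator (cell s k) y * (\<phi> x - \<phi> y)^2 \<partial>lborel) \<partial>lborel"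
  have Hm: "emeasure lborel H = ennreal ((2 * s) ^ CARD('d))"
  proof -
    have "measure lborel H = (2 * s) ^ CARD('d)"
      unfolding H_def using s by (subst content_cbox_cart) (auto simp: interval_ne_empty_cart)
    then show ?thesis
      unfolding H_def by (metis emeasure_eq_ennreal_measure emeasure_lborel_cbox_finite less_irrefl infinity_ennreal_def)
  qed
  have Hn: "norm h \<le> real CARD('d) * s" if "h \<in> H" for h
  proof -
    have "norm h \<le> (\<Sum>i\<in>UNIV. \<bar>h $ i\<bar>)" by (rule norm_le_l1_cart)
    also have "\<dots> \<le> (\<Sum>i\<in>(UNIV::'d set). s)"
      using that by (intro sum_mono) (auto simp: H_def mem_box_cart abs_le_iff minus_le_iff)
    finally show ?thesis by simp
  qed
  have L: "\<phi> \<in> L2 lborel" using testfn_shift_L2[OF f, of 0] by simp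
  have cf: "integrable lborel (indicator (cell s k) :: real^'d \<Rightarrow> real)" for k
    using measure_cell(1)[OF s] by (intro integrable_real_indicator) auto
  have c2: "(indicator (cell s k) :: real^'d \<Rightarrow> real) \<in> L2 lborel" for k
  proof -
    have "(\<lambda>x. (indicator (cell s k) x)^2) = (indicator (cell s k) :: real^'d \<Rightarrow> real)"
      by (auto simp: indicator_def fun_eq_iff)
    then show ?thesis using cf by (simp add: L2_def)
  qed
  have i1: "integrable lborel (\<lambda>x. \<phi> x * indicator (cell s k) x)" for k
    by (rule L2_mult[OF L c2])
  have i2: "integrable lborel (\<lambda>x. (\<phi> x)^2 * indicator (cell s k) x)" for k
    by (rule integrable_real_mult_indicator[OF _ L2_sq[OF L]]) simp
  note sm = integral_sq_split_mean[OF i1 i2 cf]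
  \<comment> \<open>With nonnegative integrals the order of integration may be exchanged without
    integrability conditions.\<close>
  have nnE: "ennreal (?E k) = (\<integral>\<^sup>+x. \<integral>\<^sup>+y. ennreal (indicator (cell s k) x * indicator (cell s k) y * (\<phi> x - \<phi> y)^2) \<partial>lborel \<partial>lborel)" for k
  proof -
    have "(\<integral>\<^sup>+x. \<integral>\<^sup>+y. ennreal (indicator (cell s k) x * indicator (cell s k) y * (\<phi> x - \<phi> y)^2) \<partial>lborel \<partial>lborel)
      = (\<integral>\<^sup>+x. ennreal (\<integral>y. indicator (cell s k) x * indicator (cell s k) y * (\<phi> x - \<phi> y)^2 \<partial>lborel) \<partial>lborel)"
      by (intro nn_integral_cong nn_integral_eq_integral sm(3) AE_I2) simp
    also have "\<dots> = ennreal (?E k)"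
      by (intro nn_integral_eq_integral sm(2) AE_I2 Bochner_Integration.integral_nonneg) simp
    finally show ?thesis by simp
  qed
  have "ennreal (\<Sum>k\<in>K. ?E k) = (\<Sum>k\<in>K. ennreal (?E k))"
    by (intro sum_ennreal[symmetric] Bochner_Integration.integral_nonneg) simp
  also have "\<dots> = (\<integral>\<^sup>+x. \<integral>\<^sup>+y. (\<Sum>k\<in>K. ennreal (indicator (cell s k) x * indicator (cell s k) y * (\<phi> x - \<phi> y)^2)) \<partial>lborel \<partial>lborel)"
  proof -
    let ?f = "\<lambda>k x y. ennreal (indicator (cell s k) x * indicator (cell s k) y * (\<phi> x - \<phi> y)^2)"
    have "(\<Sum>k\<in>K. ennreal (?E k)) = (\<integral>\<^sup>+x. (\<Sum>k\<in>K. \<integral>\<^sup>+y. ?f k x y \<partial>lborel) \<partial>lborel)"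
      unfolding nnE by (rule nn_integral_sum[symmetric]) measurable
    also have "\<dots> = (\<integral>\<^sup>+x. \<integral>\<^sup>+y. (\<Sum>k\<in>K. ?f k x y) \<partial>lborel \<partial>lborel)"
      by (rule nn_integral_cong, rule nn_integral_sum[symmetric]) measurable
    finally show ?thesis .
  qed
  also have "\<dots> \<le> (\<integral>\<^sup>+x. \<integral>\<^sup>+y. indicator H (y - x) * ennreal ((\<phi> y - \<phi> x)^2) \<partial>lborel \<partial>lborel)"
  proof (intro nn_integral_mono)
    fix x y :: "real^'d"
    have "(\<Sum>k\<in>K. ennreal (indicator (cell s k) x * indicator (cell s k) y * (\<phi> x - \<phi> y)^2))
      = (\<Sum>k\<in>K. if k = grid s x then ennreal (indicator (cell s k) y * (\<phi> x - \<phi> y)^2) else 0)"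
      by (intro sum.cong) (auto simp: cell_def)
    also have "\<dots> \<le> ennreal (indicator (cell s (grid s x)) y * (\<phi> x - \<phi> y)^2)"
      using K by simp
    also have "\<dots> \<le> indicator H (y - x) * ennreal ((\<phi> y - \<phi> x)^2)"
    proof (cases "y \<in> cell s (grid s x)")
      case True
      have x: "x \<in> cell s (grid s x)" by (simp add: cell_def)
      have "y $ i - x $ i \<le> s" "- s \<le> y $ i - x $ i" for i
        using cell_coord[OF s True, of i] cell_coord[OF s x, of i] by (simp_all add: algebra_simps)
      then have "y - x \<in> H" by (simp add: H_def mem_box_cart)
      then show ?thesis using True by (simp add: power2_commute)
    qed simp
    finally show "(\<Sum>k\<in>K. ennreal (indicator (cell s k) x * indicator (cell s k) y * (\<phi> x - \<phi> y)^2))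
      \<le> indicator H (y - x) * ennreal ((\<phi> y - \<phi> x)^2)" .
  qed
  also have "\<dots> = (\<integral>\<^sup>+x. \<integral>\<^sup>+h. indicator H h * ennreal ((\<phi> (x + h) - \<phi> x)^2) \<partial>lborel \<partial>lborel)"
  proof (rule nn_integral_cong)
    fix x :: "real^'d"
    show "(\<integral>\<^sup>+y. indicator H (y - x) * ennreal ((\<phi> y - \<phi> x)^2) \<partial>lborel) = (\<integral>\<^sup>+h. indicator H h * ennreal ((\<phi> (x + h) - \<phi> x)^2) \<partial>lborel)"
      using nn_integral_lborel_translation[of "\<lambda>y. indicator H (y - x) * ennreal ((\<phi> y - \<phi> x)^2)" x]
      by (simp add: add.commute)
  qed
  also have "\<dots> = (\<integral>\<^sup>+h. \<integral>\<^sup>+x. indicator H h * ennreal ((\<phi> (x + h) - \<phi> x)^2) \<partial>lborel \<partial>lborel)"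
    by (rule lborel_pair.Fubini') simp
  also have "\<dots> = (\<integral>\<^sup>+h. indicator H h * (\<integral>\<^sup>+x. ennreal ((\<phi> (x + h) - \<phi> x)^2) \<partial>lborel) \<partial>lborel)"
    by (intro nn_integral_cong nn_integral_cmult) simp
  also have "\<dots> \<le> (\<integral>\<^sup>+h. ennreal ((real CARD('d) * s)^2 * G) * indicator H h \<partial>lborel)"
  proof (intro nn_integral_mono)
    fix h :: "real^'d"
    show "indicator H h * (\<integral>\<^sup>+x. ennreal ((\<phi> (x + h) - \<phi> x)^2) \<partial>lborel) \<le> ennreal ((real CARD('d) * s)^2 * G) * indicator H h"
    proof (cases "h \<in> H")
      case True
      have "(\<integral>\<^sup>+x. ennreal ((\<phi> (x + h) - \<phi> x)^2) \<partial>lborel) = ennreal (\<integral>x. (\<phi> (x + h) - \<phi> x)^2 \<partial>lborel)"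
        by (intro nn_integral_eq_integral L2_sq L2_diff testfn_shift_L2[OF f] L) simp
      also have "\<dots> \<le> ennreal ((norm h)^2 * G)"
        unfolding G_def by (intro ennreal_leI testfn_translation_estimate[OF f])
      also have "\<dots> \<le> ennreal ((real CARD('d) * s)^2 * G)"
        by (intro ennreal_leI mult_right_mono power_mono Hn True G0) simp
      finally show ?thesis using True by simp
    qed simp
  qed
  also have "\<dots> = ennreal ((real CARD('d) * s)^2 * G) * emeasure lborel H"
    by (rule nn_integral_cmult_indicator) simp
  also have "\<dots> = ennreal ((2 * s) ^ CARD('d) * (real CARD('d) * s)^2 * G)"
    unfolding Hm using G0 s by (simp add: ennreal_mult[symmetric] ac_simps)
  finally show ?thesis
    using G0 s unfolding G_def[symmetric] by (subst (asm) ennreal_le_iff) auto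
qed


text \<open>On each cube the variance identity compares the square integral with the squared mean,
  and the remainder is a gradient term of order s^2. The side is chosen with
  \<open>c * s^2 = \<epsilon>\<close>, and boundedness of \<Omega> leaves finitely many cubes. This
  is the quantitative form of the compact embedding into L2.\<close>

lemma testfn_Ehrling:
  fixes \<Omega> :: "(real^'d::finite) set"
  assumes \<Omega>: "open \<Omega>" "bounded \<Omega>" and e: "\<epsilon> > 0"
  obtains K :: "('d \<Rightarrow> int) set" and s :: real where "finite K" "s > 0"
    "\<And>\<phi>. testfn \<Omega> \<phi> \<Longrightarrow> (nrm2 (leb \<Omega>) \<phi>)^2
      \<le> (\<Sum>k\<in>K. (\<integral>x. \<phi> x * indicator (cell s k) x \<partial>leb \<Omega>)^2 / s ^ CARD('d))
        + \<epsilon> * (\<Sum>i\<in>UNIV. (nrm2 (leb \<Omega>) (\<lambda>x. cgrad \<phi> x $ i))^2)"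
proof -
  have \<Omega>': "\<Omega> \<in> sets lebesgue" using \<Omega> by simp
  \<comment> \<open>The factor 2^d is the volume of the box relative to the cube, and d^2 comes from
    bounding the Euclidean norm on the box by d times s.\<close>
  define c where "c = 2 ^ CARD('d) * (real CARD('d))^2"
  have c: "c > 0" by (simp add: c_def)
  define s where "s = sqrt (\<epsilon> / c)"
  have s: "s > 0" using e c by (simp add: s_def)
  have s2: "c * s^2 = \<epsilon>" using e c by (simp add: s_def)
  obtain r where r: "\<And>x. x \<in> \<Omega> \<Longrightarrow> norm x \<le> r" using \<Omega>(2) unfolding bounded_iff by blast
  define K where "K = PiE (UNIV::'d set) (\<lambda>_. {\<lfloor>- r / s\<rfloor>..\<lfloor>r / s\<rfloor>})"
  have K: "finite K" unfolding K_def by (intro finite_PiE) auto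
  have cover: "grid s x \<in> K" if "x \<in> \<Omega>" for x
  proof -
    have "- r / s \<le> x $ i / s" "x $ i / s \<le> r / s" for i
      using r[OF that] component_le_norm_cart[of x i] s
        divide_right_mono[of "- r" "x $ i" s] divide_right_mono[of "x $ i" r s] by auto
    then show ?thesis by (auto simp: K_def grid_def intro!: floor_mono)
  qed
  show ?thesis
  proof (rule that[OF K s])
    fix \<phi> assume f: "testfn \<Omega> \<phi>"
    have [measurable]: "\<phi> \<in> borel_measurable borel" "cgrad \<phi> \<in> borel_measurable borel" using testfn_borel[OF f] by auto
    have [measurable]: "cell s k \<in> sets borel" for k by (rule cell_borel)
    define G where "G = (\<integral>x. (norm (cgrad \<phi> x))^2 \<partial>lborel)"
    have G: "G = (\<Sum>i\<in>UNIV. (nrm2 (leb \<Omega>) (\<lambda>x. cgrad \<phi> x $ i))^2)"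
      unfolding G_def using testfn_outside(2)[OF f]
      by (subst integral_norm_sq_vec(1)[symmetric, OF testfn_L2(2)[OF \<Omega>' f]], subst integral_leb_supported(1)[OF \<Omega>']) auto
    have L: "\<phi> \<in> L2 lborel" using testfn_shift_L2[OF f, of 0] by simp
    have cf: "integrable lborel (indicator (cell s k) :: real^'d \<Rightarrow> real)" for k
      using measure_cell(1)[OF s] by (intro integrable_real_indicator) auto
    have i2: "integrable lborel (\<lambda>x. (\<phi> x)^2 * indicator (cell s k) x)" for k
      by (rule integrable_real_mult_indicator[OF _ L2_sq[OF L]]) simp
    have i1: "integrable lborel (\<lambda>x. \<phi> x * indicator (cell s k) x)" for k
    proof (rule L2_mult[OF L])
      have "(\<lambda>x. (indicator (cell s k) x)^2) = (indicator (cell s k) :: real^'d \<Rightarrow> real)"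
        by (auto simp: indicator_def fun_eq_iff)
      then show "(indicator (cell s k) :: real^'d \<Rightarrow> real) \<in> L2 lborel" using cf by (simp add: L2_def)
    qed
    let ?I = "\<lambda>k. \<integral>x. \<phi> x * indicator (cell s k) x \<partial>lborel"
      and ?J = "\<lambda>k. \<integral>x. (\<phi> x)^2 * indicator (cell s k) x \<partial>lborel"
      and ?E = "\<lambda>k. \<integral>x. (\<integral>y. indicator (cell s k) x * indicator (cell s k) y * (\<phi> x - \<phi> y)^2 \<partial>lborel) \<partial>lborel"
    have E0: "?E k \<ge> 0" for k by (intro Bochner_Integration.integral_nonneg) simp
    have J: "?J k \<le> (?I k)^2 / s ^ CARD('d) + ?E k / (2 * s ^ CARD('d))" for k
    proof -
      have "2 * measure lborel (cell s k) * ?J k = 2 * (?I k)^2 + ?E k"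
        using integral_sq_split_mean(1)[OF i1 i2 cf, of k] by simp
      moreover have "2 * s ^ CARD('d) * ?J k \<le> 2 * measure lborel (cell s k) * ?J k"
        using measure_cell(2)[OF s, of k] by (intro mult_right_mono Bochner_Integration.integral_nonneg) auto
      ultimately have "2 * s ^ CARD('d) * ?J k \<le> 2 * (?I k)^2 + ?E k" by simp
      then show ?thesis using s by (simp add: field_simps)
    qed
    have "(nrm2 (leb \<Omega>) \<phi>)^2 = (\<integral>x. (\<phi> x)^2 \<partial>lborel)"
      unfolding nrm2_sq using testfn_outside(1)[OF f] by (intro integral_leb_supported(1)[OF \<Omega>']) auto
    also have "\<dots> = (\<integral>x. (\<Sum>k\<in>K. (\<phi> x)^2 * indicator (cell s k) x) \<partial>lborel)"
    proof (rule Bochner_Integration.integral_cong)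
      fix x
      show "(\<phi> x)^2 = (\<Sum>k\<in>K. (\<phi> x)^2 * indicator (cell s k) x)"
      proof (cases "x \<in> \<Omega>")
        case True
        have "(\<Sum>k\<in>K. (\<phi> x)^2 * indicator (cell s k) x) = (\<Sum>k\<in>K. if k = grid s x then (\<phi> x)^2 else 0)"
          by (intro sum.cong) (auto simp: cell_def indicator_def)
        then show ?thesis using K cover[OF True] by simp
      qed (use testfn_outside(1)[OF f] in simp)
    qed simp
    also have "\<dots> = (\<Sum>k\<in>K. ?J k)" using i2 by simp
    also have "\<dots> \<le> (\<Sum>k\<in>K. (?I k)^2 / s ^ CARD('d) + ?E k / (2 * s ^ CARD('d)))"
      by (intro sum_mono J)
    also have "\<dots> = (\<Sum>k\<in>K. (?I k)^2 / s ^ CARD('d)) + (\<Sum>k\<in>K. ?E k) / (2 * s ^ CARD('d))"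
      by (simp add: sum.distrib sum_divide_distrib)
    also have "(\<Sum>k\<in>K. ?E k) / (2 * s ^ CARD('d)) \<le> \<epsilon> * G"
    proof -
      have G0: "G \<ge> 0" by (simp add: G_def)
      have "(\<Sum>k\<in>K. ?E k) \<le> (2 * s) ^ CARD('d) * (real CARD('d) * s)^2 * G"
        unfolding G_def by (rule cell_energy_bound[OF f s K])
      also have "\<dots> = s ^ CARD('d) * (\<epsilon> * G)"
        unfolding s2[symmetric] by (simp add: c_def power_mult_distrib)
      also have "\<dots> \<le> \<epsilon> * G * (2 * s ^ CARD('d))"
        using G0 e s by simp
      finally show ?thesis using s by (simp add: pos_divide_le_eq)
    qed
    also have "(\<Sum>k\<in>K. (?I k)^2 / s ^ CARD('d)) = (\<Sum>k\<in>K. (\<integral>x. \<phi> x * indicator (cell s k) x \<partial>leb \<Omega>)^2 / s ^ CARD('d))"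
      using testfn_outside(1)[OF f] by (intro sum.cong refl, subst integral_leb_supported(1)[OF \<Omega>']) auto
    finally show "(nrm2 (leb \<Omega>) \<phi>)^2
      \<le> (\<Sum>k\<in>K. (\<integral>x. \<phi> x * indicator (cell s k) x \<partial>leb \<Omega>)^2 / s ^ CARD('d))
        + \<epsilon> * (\<Sum>i\<in>UNIV. (nrm2 (leb \<Omega>) (\<lambda>x. cgrad \<phi> x $ i))^2)"
      unfolding G by simp
  qed
qed

lemma nrm2_tendsto:
  assumes "\<And>n. f n \<in> L2 M" "g \<in> L2 M" "(\<lambda>n. nrm2 M (\<lambda>x. f n x - g x)) \<longlonglongrightarrow> 0"
  shows "(\<lambda>n. (nrm2 M (f n))^2) \<longlonglongrightarrow> (nrm2 M g)^2"
  using L2_tendsto_mult[OF assms(1,2) assms(1,2) assms(3,3)] unfolding nrm2_sq by (simp add: power2_eq_square)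

lemma indicator_L2_leb:
  assumes "open \<Omega>" "bounded \<Omega>" "A \<in> sets borel"
  shows "(indicator A :: real^'d::finite \<Rightarrow> real) \<in> L2 (leb \<Omega>)"
proof -
  interpret finite_measure "leb \<Omega>" by (rule finite_measure_leb[OF assms(1,2)])
  have m: "(indicator A :: real^'d \<Rightarrow> real) \<in> borel_measurable (leb \<Omega>)"
    by (rule borel_leb) (use assms(3) in simp)
  have "integrable (leb \<Omega>) (\<lambda>x. (indicator A x :: real)^2)"
    by (rule integrable_const_bound[of _ 1]) (use borel_measurable_power[OF m] in \<open>auto simp: indicator_def\<close>)
  with m show ?thesis by (simp add: L2_def)
qed

lemma H01pair_Ehrling:
  fixes \<Omega> :: "(real^'d::finite) set"
  assumes \<Omega>: "open \<Omega>" "bounded \<Omega>" and e: "\<epsilon> > 0"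
  obtains K :: "('d \<Rightarrow> int) set" and s :: real where "finite K" "s > 0"
    "\<And>u g. H01pair \<Omega> u g \<Longrightarrow> (nrm2 (leb \<Omega>) u)^2
      \<le> (\<Sum>k\<in>K. (\<integral>x. u x * indicator (cell s k) x \<partial>leb \<Omega>)^2 / s ^ CARD('d))
        + \<epsilon> * (\<Sum>i\<in>UNIV. (nrm2 (leb \<Omega>) (\<lambda>x. g x $ i))^2)"
proof -
  have \<Omega>': "\<Omega> \<in> sets lebesgue" using \<Omega> by simp
  show ?thesis
  proof (rule testfn_Ehrling[OF \<Omega> e])
    fix K :: "('d \<Rightarrow> int) set" and s :: real
    assume K: "finite K" "s > 0"
    and ineq: "\<And>\<phi>. testfn \<Omega> \<phi> \<Longrightarrow> (nrm2 (leb \<Omega>) \<phi>)^2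
      \<le> (\<Sum>k\<in>K. (\<integral>x. \<phi> x * indicator (cell s k) x \<partial>leb \<Omega>)^2 / s ^ CARD('d))
        + \<epsilon> * (\<Sum>i\<in>UNIV. (nrm2 (leb \<Omega>) (\<lambda>x. cgrad \<phi> x $ i))^2)"
  show ?thesis
  proof (rule that[OF K])
    fix u g assume "H01pair \<Omega> u g"
    then obtain \<phi> where f: "\<And>k. testfn \<Omega> (\<phi> k)" "(\<lambda>k. nrm2 (leb \<Omega>) (\<lambda>x. \<phi> k x - u x)) \<longlonglongrightarrow> 0"
        "\<And>i. (\<lambda>k. nrm2 (leb \<Omega>) (\<lambda>x. cgrad (\<phi> k) x $ i - g x $ i)) \<longlonglongrightarrow> 0"
      and L: "u \<in> L2 (leb \<Omega>)" "\<And>i. (\<lambda>x. g x $ i) \<in> L2 (leb \<Omega>)"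
      unfolding H01pair_iff[OF \<Omega>(1)] by auto
    have c: "(indicator (cell s k) :: real^'d \<Rightarrow> real) \<in> L2 (leb \<Omega>)" for k
      by (rule indicator_L2_leb[OF \<Omega> cell_borel])
    show "(nrm2 (leb \<Omega>) u)^2
      \<le> (\<Sum>k\<in>K. (\<integral>x. u x * indicator (cell s k) x \<partial>leb \<Omega>)^2 / s ^ CARD('d))
        + \<epsilon> * (\<Sum>i\<in>UNIV. (nrm2 (leb \<Omega>) (\<lambda>x. g x $ i))^2)"
    proof (rule LIMSEQ_le)
      show "(\<lambda>n. (nrm2 (leb \<Omega>) (\<phi> n))^2) \<longlonglongrightarrow> (nrm2 (leb \<Omega>) u)^2"
        by (rule nrm2_tendsto[OF testfn_L2(1)[OF \<Omega>' f(1)] L(1) f(2)])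
      have "(\<lambda>n. \<integral>x. \<phi> n x * indicator (cell s k) x \<partial>leb \<Omega>) \<longlonglongrightarrow> (\<integral>x. u x * indicator (cell s k) x \<partial>leb \<Omega>)" for k
        by (rule L2_tendsto_mult[OF testfn_L2(1)[OF \<Omega>' f(1)] L(1) c c f(2)]) (simp add: nrm2_def)
      moreover have "(\<lambda>n. (nrm2 (leb \<Omega>) (\<lambda>x. cgrad (\<phi> n) x $ i))^2) \<longlonglongrightarrow> (nrm2 (leb \<Omega>) (\<lambda>x. g x $ i))^2" for i
        by (rule nrm2_tendsto[OF testfn_L2(2)[OF \<Omega>' f(1)] L(2) f(3)])
      ultimately show "(\<lambda>n. (\<Sum>k\<in>K. (\<integral>x. \<phi> n x * indicator (cell s k) x \<partial>leb \<Omega>)^2 / s ^ CARD('d))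
        + \<epsilon> * (\<Sum>i\<in>UNIV. (nrm2 (leb \<Omega>) (\<lambda>x. cgrad (\<phi> n) x $ i))^2)) \<longlonglongrightarrow>
        (\<Sum>k\<in>K. (\<integral>x. u x * indicator (cell s k) x \<partial>leb \<Omega>)^2 / s ^ CARD('d))
        + \<epsilon> * (\<Sum>i\<in>UNIV. (nrm2 (leb \<Omega>) (\<lambda>x. g x $ i))^2)"
        using K(2) by (intro tendsto_add tendsto_sum tendsto_mult_left tendsto_divide[OF tendsto_power tendsto_const]) auto
    qed (use ineq[OF f(1)] in auto)
  qed
  qed
qed

section \<open>Riesz representation and constrained minimisers\<close>

text \<open>Semidefinite only: null functions in \<open>H01\<close> have length 0 without being the
  zero function. The carrier \<open>S\<close> is a subspace of the full function type.\<close>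

locale sip =
  fixes S :: "'v::real_vector set" and f :: "'v \<Rightarrow> 'v \<Rightarrow> real"
  assumes subsp: "subspace S"
    and sym: "u \<in> S \<Longrightarrow> v \<in> S \<Longrightarrow> f u v = f v u"
    and lin: "u \<in> S \<Longrightarrow> v \<in> S \<Longrightarrow> w \<in> S \<Longrightarrow> f (u + c *\<^sub>R v) w = f u w + c * f v w"
    and nonneg: "u \<in> S \<Longrightarrow> 0 \<le> f u u"
begin

lemma mem [simp, intro]:
  "0 \<in> S" "u \<in> S \<Longrightarrow> v \<in> S \<Longrightarrow> u + v \<in> S" "u \<in> S \<Longrightarrow> c *\<^sub>R u \<in> S"
  "u \<in> S \<Longrightarrow> v \<in> S \<Longrightarrow> u - v \<in> S" "u \<in> S \<Longrightarrow> - u \<in> S" "(\<And>i. i \<in> I \<Longrightarrow> h i \<in> S) \<Longrightarrow> sum h I \<in> S"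
  by (rule subspace_0[OF subsp], rule subspace_add[OF subsp], assumption+, rule subspace_scale[OF subsp], assumption,
      rule subspace_diff[OF subsp], assumption+, rule subspace_neg[OF subsp], assumption,
      rule subspace_sum[OF subsp], assumption)

lemma zero_left [simp]: "v \<in> S \<Longrightarrow> f 0 v = 0"
  using lin[of 0 0 v 1] by simp

lemma zero_right [simp]: "v \<in> S \<Longrightarrow> f v 0 = 0"
  using zero_left[of v] sym[of v 0] by simp

lemma add_left: "u \<in> S \<Longrightarrow> v \<in> S \<Longrightarrow> w \<in> S \<Longrightarrow> f (u + v) w = f u w + f v w"
  using lin[of u v w 1] by simp

lemma scale_left: "u \<in> S \<Longrightarrow> w \<in> S \<Longrightarrow> f (c *\<^sub>R u) w = c * f u w"
  using lin[of 0 u w c] by simp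

lemma minus_left: "u \<in> S \<Longrightarrow> w \<in> S \<Longrightarrow> f (- u) w = - f u w"
  using scale_left[of u w "-1"] by simp

lemma diff_left: "u \<in> S \<Longrightarrow> v \<in> S \<Longrightarrow> w \<in> S \<Longrightarrow> f (u - v) w = f u w - f v w"
  using lin[of u v w "-1"] by simp

lemma add_right: "u \<in> S \<Longrightarrow> v \<in> S \<Longrightarrow> w \<in> S \<Longrightarrow> f w (u + v) = f w u + f w v"
  using add_left[of u v w] by (simp add: sym[of w])

lemma scale_right: "u \<in> S \<Longrightarrow> w \<in> S \<Longrightarrow> f w (c *\<^sub>R u) = c * f w u"
  using scale_left[of u w c] by (simp add: sym[of w])

lemma minus_right: "u \<in> S \<Longrightarrow> w \<in> S \<Longrightarrow> f w (- u) = - f w u"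
  using minus_left[of u w] by (simp add: sym[of w])

lemma diff_right: "u \<in> S \<Longrightarrow> v \<in> S \<Longrightarrow> w \<in> S \<Longrightarrow> f w (u - v) = f w u - f w v"
  using diff_left[of u v w] by (simp add: sym[of w])

lemma sum_left: "(\<And>i. i \<in> I \<Longrightarrow> h i \<in> S) \<Longrightarrow> w \<in> S \<Longrightarrow> f (sum h I) w = (\<Sum>i\<in>I. f (h i) w)"
  by (induction I rule: infinite_finite_induct) (auto simp: add_left)

lemma sum_right: "(\<And>i. i \<in> I \<Longrightarrow> h i \<in> S) \<Longrightarrow> w \<in> S \<Longrightarrow> f w (sum h I) = (\<Sum>i\<in>I. f w (h i))"
  by (induction I rule: infinite_finite_induct) (auto simp: add_right)

lemmas expand = add_left add_right diff_left diff_right scale_left scale_right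

definition nm :: "'v \<Rightarrow> real" where "nm u = sqrt (f u u)"

lemma nm_nonneg [simp]: "u \<in> S \<Longrightarrow> 0 \<le> nm u"
  by (simp add: nm_def nonneg)

lemma nm_sq: "u \<in> S \<Longrightarrow> (nm u)^2 = f u u"
  by (simp add: nm_def nonneg)

lemma Cauchy_Schwarz_sq: "u \<in> S \<Longrightarrow> v \<in> S \<Longrightarrow> (f u v)^2 \<le> f u u * f v v"
proof (rule quadratic_nonneg_imp)
  fix t assume *: "u \<in> S" "v \<in> S"
  have "0 \<le> f (u + t *\<^sub>R v) (u + t *\<^sub>R v)" using * by (intro nonneg) auto
  also have "\<dots> = f u u + 2 * t * f u v + t^2 * f v v"
    using * by (simp add: expand sym[of v u] power2_eq_square algebra_simps)
  finally show "0 \<le> f u u + 2 * t * f u v + t^2 * f v v" .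
qed (simp add: nonneg)

lemma Cauchy_Schwarz: "u \<in> S \<Longrightarrow> v \<in> S \<Longrightarrow> \<bar>f u v\<bar> \<le> nm u * nm v"
  using real_sqrt_le_mono[OF Cauchy_Schwarz_sq[of u v]] by (simp add: nm_def real_sqrt_mult)

lemma nm_triangle: "u \<in> S \<Longrightarrow> v \<in> S \<Longrightarrow> nm (u + v) \<le> nm u + nm v"
proof (rule power2_le_imp_le)
  assume *: "u \<in> S" "v \<in> S"
  have "(nm (u + v))^2 = (nm u)^2 + 2 * f u v + (nm v)^2"
    using * by (simp add: nm_sq expand sym[of v u])
  then show "(nm (u + v))^2 \<le> (nm u + nm v)^2"
    using Cauchy_Schwarz[OF *] by (simp add: power2_sum)
qed auto

lemma nm_scale: "u \<in> S \<Longrightarrow> nm (c *\<^sub>R u) = \<bar>c\<bar> * nm u"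
  by (simp add: nm_def scale_left scale_right real_sqrt_mult mult.assoc[symmetric])

lemma nm_minus: "u \<in> S \<Longrightarrow> nm (- u) = nm u"
  using nm_scale[of u "-1"] by simp

lemma nm_zero [simp]: "nm 0 = 0"
  by (simp add: nm_def)

lemma nm_triangle_diff: "u \<in> S \<Longrightarrow> v \<in> S \<Longrightarrow> nm (u - v) \<le> nm u + nm v"
  using nm_triangle[of u "- v"] by (simp add: nm_minus)

lemma nm_sum: "(\<And>i. i \<in> I \<Longrightarrow> h i \<in> S) \<Longrightarrow> nm (sum h I) \<le> (\<Sum>i\<in>I. nm (h i))"
proof (induction I rule: infinite_finite_induct)
  case (insert i I)
  then show ?case using nm_triangle[of "h i" "sum h I"] by fastforce
qed auto

lemma tendsto_left:
  assumes "\<And>n. u n \<in> S" "w \<in> S" "v \<in> S" "(\<lambda>n. f (u n - w) (u n - w)) \<longlonglongrightarrow> 0"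
  shows "(\<lambda>n. f (u n) v) \<longlonglongrightarrow> f w v"
proof -
  have "(\<lambda>n. nm (u n - w) * nm v) \<longlonglongrightarrow> 0"
    using tendsto_mult_right[OF tendsto_real_sqrt[OF assms(4)]] by (simp add: nm_def)
  moreover have "norm (f (u n) v - f w v) \<le> nm (u n - w) * nm v" for n
    using Cauchy_Schwarz[of "u n - w" v] assms(1)[of n] assms(2,3) by (simp add: diff_left)
  ultimately have "(\<lambda>n. f (u n) v - f w v) \<longlonglongrightarrow> 0"
    using Lim_null_comparison[of "\<lambda>n. f (u n) v - f w v" "\<lambda>n. nm (u n - w) * nm v" sequentially]
    by (simp add: always_eventually)
  then show ?thesis by (simp add: LIM_zero_iff)
qed

lemma tendsto_sq:
  assumes "\<And>n. u n \<in> S" "w \<in> S" "(\<lambda>n. f (u n - w) (u n - w)) \<longlonglongrightarrow> 0"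
  shows "(\<lambda>n. f (u n) (u n)) \<longlonglongrightarrow> f w w"
proof -
  have "f (u n) (u n) = f (u n - w) (u n - w) + 2 * f (u n) w - f w w" for n
    using assms by (simp add: expand sym[of w "u n"])
  moreover have "(\<lambda>n. f (u n - w) (u n - w) + 2 * f (u n) w - f w w) \<longlonglongrightarrow> 0 + 2 * f w w - f w w"
    using assms by (intro tendsto_intros tendsto_left)
  ultimately show ?thesis by simp
qed

end

text \<open>Bolzano-Weierstrass once per sequence; it serves the finitely many functionals of the
  Ehrling inequality.\<close>

lemma finite_convergent_subseq:
  fixes x :: "nat \<Rightarrow> nat \<Rightarrow> real"
  assumes "\<And>k. k < m \<Longrightarrow> bounded (range (x k))"
  shows "\<exists>r. strict_mono r \<and> (\<forall>k<m. convergent (\<lambda>n. x k (r n)))"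
  using assms
proof (induction m)
  case 0
  show ?case by (rule exI[of _ id]) (auto simp: strict_mono_def)
next
  case (Suc m)
  have "\<exists>r. strict_mono r \<and> (\<forall>k<m. convergent (\<lambda>n. x k (r n)))"
    by (rule Suc.IH, rule Suc.prems) simp
  then obtain r where r: "strict_mono r" "\<forall>k<m. convergent (\<lambda>n. x k (r n))" by blast
  have "bounded (range (\<lambda>n. x m (r n)))"
    by (rule bounded_subset[OF Suc.prems[of m]]) auto
  then obtain l q where q: "strict_mono q" "((\<lambda>n. x m (r n)) \<circ> q) \<longlonglongrightarrow> l"
    using bounded_imp_convergent_subsequence by blast
  show ?case
  proof (intro exI[of _ "r \<circ> q"] conjI allI impI)
    show "strict_mono (r \<circ> q)" using r q by (simp add: strict_mono_o)
    fix k assume "k < Suc m"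
    then consider "k < m" | "k = m" by linarith
    then show "convergent (\<lambda>n. x k ((r \<circ> q) n))"
    proof cases
      case 1
      then show ?thesis using convergent_subseq_convergent[OF _ q(1), of "\<lambda>n. x k (r n)"] r by (simp add: o_def)
    next
      case 2
      then show ?thesis using q(2) by (auto simp: convergent_def o_def)
    qed
  qed
qed

text \<open>\<open>Ehrling\<close> encodes compactness of the embedding of the energy space: up to
  \<epsilon> times the energy, \<open>b\<close> is governed by finitely many additive functionals
  that are bounded with respect to \<open>b\<close>.\<close>

locale form_space = A: sip S a + B: sip S b
  for S :: "'v::real_vector set" and a b +
  fixes \<alpha> :: real
  assumes \<alpha>: "\<alpha> > 0" and coercive: "u \<in> S \<Longrightarrow> \<alpha> * b u u \<le> a u u"
    and complete: "(\<And>n::nat. x n \<in> S) \<Longrightarrow>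
      (\<And>e. e > 0 \<Longrightarrow> \<exists>N. \<forall>m\<ge>N. \<forall>n\<ge>N. a (x m - x n) (x m - x n) < e) \<Longrightarrow>
      \<exists>w\<in>S. (\<lambda>n. a (x n - w) (x n - w)) \<longlonglongrightarrow> 0"
    and Ehrling: "\<epsilon> > 0 \<Longrightarrow> \<exists>(m::nat) l. (\<forall>k<m. (\<forall>u\<in>S. \<forall>v\<in>S. l k (u - v) = l k u - l k v) \<and>
        (\<exists>C. \<forall>u\<in>S. (l k u)^2 \<le> C * b u u)) \<and> (\<forall>u\<in>S. b u u \<le> (\<Sum>k<m. (l k u)^2) + \<epsilon> * a u u)"
begin

lemma b_tendsto_0:
  assumes "\<And>n. u n \<in> S" "w \<in> S" "(\<lambda>n. a (u n - w) (u n - w)) \<longlonglongrightarrow> 0"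
  shows "(\<lambda>n. b (u n - w) (u n - w)) \<longlonglongrightarrow> 0"
proof (rule tendsto_sandwich[OF _ _ tendsto_const])
  show "(\<lambda>n. inverse \<alpha> * a (u n - w) (u n - w)) \<longlonglongrightarrow> 0"
    using tendsto_mult_left[OF assms(3), of "inverse \<alpha>"] by simp
  show "\<forall>\<^sub>F n in sequentially. b (u n - w) (u n - w) \<le> inverse \<alpha> * a (u n - w) (u n - w)"
  proof (intro always_eventually allI)
    fix n
    have "\<alpha> * b (u n - w) (u n - w) \<le> a (u n - w) (u n - w)"
      by (rule coercive) (simp add: assms(1,2))
    then show "b (u n - w) (u n - w) \<le> inverse \<alpha> * a (u n - w) (u n - w)"
      using \<alpha> by (simp add: field_simps)
  qed
qed (use assms in \<open>auto intro!: always_eventually B.nonneg\<close>)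

text \<open>Direct method: \<open>J\<close> is bounded below by coercivity, the parallelogram law
  makes a minimising sequence Cauchy in the energy, and the first variation at its limit is the
  claim.\<close>

lemma Riesz:
  assumes f: "f \<in> S"
  shows "\<exists>w\<in>S. \<forall>v\<in>S. a w v = b f v"
proof -
  define J where "J w = a w w - 2 * b f w" for w
  have lb: "J w \<ge> - (b f f / \<alpha>)" if w: "w \<in> S" for w
  proof -
    have "0 \<le> b (f - \<alpha> *\<^sub>R w) (f - \<alpha> *\<^sub>R w)" using f w by (intro B.nonneg) auto
    also have "\<dots> = b f f - 2 * \<alpha> * b f w + \<alpha> * (\<alpha> * b w w)"
      using f w by (simp add: B.expand B.sym[of w f] algebra_simps)
    also have "\<dots> \<le> b f f - 2 * \<alpha> * b f w + \<alpha> * a w w"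
      using coercive[OF w] \<alpha> by simp
    finally have "0 \<le> (b f f - 2 * \<alpha> * b f w + \<alpha> * a w w) / \<alpha>" using \<alpha> by simp
    also have "\<dots> = b f f / \<alpha> + J w" using \<alpha> by (simp add: J_def field_simps)
    finally show ?thesis by simp
  qed
  define m where "m = Inf (J ` S)"
  have bdd: "bdd_below (J ` S)" using lb by (auto simp: bdd_below_def)
  have mle: "m \<le> J w" if "w \<in> S" for w unfolding m_def using that bdd by (intro cInf_lower) auto
  have "\<exists>w\<in>S. J w < m + inverse (real (Suc n))" for n
    using cInf_lessD[of "J ` S" "m + inverse (real (Suc n))"] A.mem(1) unfolding m_def by fastforce
  then obtain w where w: "\<And>n. w n \<in> S" "\<And>n. J (w n) < m + inverse (real (Suc n))" by metis
  have par: "a (w i - w j) (w i - w j) \<le> 2 * inverse (real (Suc i)) + 2 * inverse (real (Suc j))" for i j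
  proof -
    have "a (w i - w j) (w i - w j) = 2 * J (w i) + 2 * J (w j) - 4 * J ((1/2) *\<^sub>R (w i + w j))"
      using w(1) f by (simp add: J_def A.expand B.expand A.sym[of "w j" "w i"] algebra_simps)
    then show ?thesis using mle[of "(1/2) *\<^sub>R (w i + w j)"] w(1) w(2)[of i] w(2)[of j] by fastforce
  qed
  have "\<exists>z\<in>S. (\<lambda>n. a (w n - z) (w n - z)) \<longlonglongrightarrow> 0"
  proof (rule complete[OF w(1)])
    fix e :: real assume "e > 0"
    then obtain N where N: "inverse (real (Suc N)) < e / 4" using reals_Archimedean[of "e/4"] by auto
    have "a (w m - w n) (w m - w n) < e" if "m \<ge> N" "n \<ge> N" for m n
    proof -
      have "inverse (real (Suc m)) \<le> inverse (real (Suc N))" "inverse (real (Suc n)) \<le> inverse (real (Suc N))"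
        using that by auto
      then show ?thesis using par[of m n] N by linarith
    qed
    then show "\<exists>N. \<forall>m\<ge>N. \<forall>n\<ge>N. a (w m - w n) (w m - w n) < e" by blast
  qed
  then obtain z where z: "z \<in> S" "(\<lambda>n. a (w n - z) (w n - z)) \<longlonglongrightarrow> 0" by blast
  have "a z v = b f v" if v: "v \<in> S" for v
  proof -
    \<comment> \<open>A nonnegative quadratic in \<open>t\<close> with constant term 0 has no linear
      term: the first variation vanishes.\<close>
    have "(a z v - b f v)^2 \<le> 0 * a v v"
    proof (rule quadratic_nonneg_imp)
      fix t
      have "(\<lambda>n. inverse (real (Suc n)) + 2 * t * (a (w n) v - b f v) + t^2 * a v v)
         \<longlonglongrightarrow> 0 + 2 * t * (a z v - b f v) + t^2 * a v v"
        by (intro tendsto_intros LIMSEQ_inverse_real_of_nat A.tendsto_left[OF w(1) z(1) v z(2)])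
      moreover have "0 \<le> inverse (real (Suc n)) + 2 * t * (a (w n) v - b f v) + t^2 * a v v" for n
      proof -
        have "J (w n + t *\<^sub>R v) = J (w n) + 2 * t * (a (w n) v - b f v) + t^2 * a v v"
          using w(1) v f by (simp add: J_def A.expand B.expand A.sym[of v "w n"] power2_eq_square algebra_simps)
        then show ?thesis using mle[of "w n + t *\<^sub>R v"] w(1) v w(2)[of n] by fastforce
      qed
      ultimately show "0 \<le> 0 + 2 * t * (a z v - b f v) + t^2 * a v v"
        by (intro LIMSEQ_le_const) auto
    qed (simp add: A.nonneg v)
    then show ?thesis by simp
  qed
  with z(1) show ?thesis by blast
qed

text \<open>The Rayleigh quotient is minimised on the complement of the given eigenvectors, and the
  Ehrling inequality makes a subsequence of a minimising sequence Cauchy in the energy. The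
  minimiser is stationary on the complement, and stationarity extends to \<open>S\<close> because
  the removed directions are eigenvectors. The trial vector \<open>y0\<close> puts the minimum below
  \<Lambda>.\<close>

lemma constrained_eigenvector:
  assumes I: "finite I" and v: "\<And>k. k \<in> I \<Longrightarrow> v k \<in> S"
    and on: "\<And>j k. j \<in> I \<Longrightarrow> k \<in> I \<Longrightarrow> b (v j) (v k) = (if j = k then 1 else 0)"
    and ev: "\<And>k u. k \<in> I \<Longrightarrow> u \<in> S \<Longrightarrow> a (v k) u = l k * b (v k) u"
    and y0: "y0 \<in> S" "\<And>k. k \<in> I \<Longrightarrow> b (v k) y0 = 0" "a y0 y0 < \<Lambda> * b y0 y0"
  shows "\<exists>w \<mu>. w \<in> S \<and> (\<forall>k\<in>I. b (v k) w = 0) \<and> b w w = 1 \<and> \<mu> < \<Lambda> \<and> (\<forall>u\<in>S. a w u = \<mu> * b w u)"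
proof -
  define T where "T = {y \<in> S. \<forall>k\<in>I. b (v k) y = 0}"
  have TS: "y \<in> T \<Longrightarrow> y \<in> S" for y by (simp add: T_def)
  have Tadd: "y + c *\<^sub>R z \<in> T" if "y \<in> T" "z \<in> T" for y z c
    using that v by (auto simp: T_def B.expand)
  have y0T: "y0 \<in> T" using y0 by (simp add: T_def)
  have Tscale: "c *\<^sub>R y \<in> T" if "y \<in> T" for y c
    using that v by (auto simp: T_def B.expand)
  have b0: "b y0 y0 > 0"
  proof (rule ccontr)
    assume "\<not> b y0 y0 > 0"
    then have "b y0 y0 = 0" using B.nonneg[OF y0(1)] by simp
    then show False using y0(3) A.nonneg[OF y0(1)] by simp
  qed
  define R where "R = {a y y | y. y \<in> T \<and> b y y = 1}"
  define \<mu> where "\<mu> = Inf R"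
  have R0: "r \<ge> 0" if "r \<in> R" for r using that A.nonneg TS by (auto simp: R_def)
  have bdd: "bdd_below R" using R0 by (auto simp: bdd_below_def)
  have norm1: "a y y / b y y \<in> R" if "y \<in> T" "b y y > 0" for y
  proof -
    let ?y = "(1 / sqrt (b y y)) *\<^sub>R y"
    have "b ?y ?y = 1" "a ?y ?y = a y y / b y y"
      using that TS by (simp_all add: A.expand B.expand power2_eq_square[symmetric] power_divide)
    then show ?thesis using Tscale[OF that(1)] unfolding R_def by force
  qed
  have \<mu>le: "\<mu> * b y y \<le> a y y" if "y \<in> T" for y
  proof (cases "b y y > 0")
    case True
    have "\<mu> \<le> a y y / b y y" unfolding \<mu>_def by (rule cInf_lower[OF norm1[OF that True] bdd])
    then show ?thesis using True by (simp add: pos_le_divide_eq)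
  next
    case False
    then have "b y y = 0" using B.nonneg[of y] TS that by force
    then show ?thesis using A.nonneg[of y] TS that by simp
  qed
  have ne: "R \<noteq> {}" using norm1[OF y0T b0] by auto
  have \<mu>0: "\<mu> \<ge> 0" unfolding \<mu>_def using R0 by (intro cInf_greatest[OF ne])
  have "\<mu> \<le> a y0 y0 / b y0 y0" unfolding \<mu>_def by (rule cInf_lower[OF norm1[OF y0T b0] bdd])
  also have "\<dots> < \<Lambda>" using y0(3) b0 by (simp add: pos_divide_less_eq)
  finally have \<mu>\<Lambda>: "\<mu> < \<Lambda>" .
  have "\<exists>y. y \<in> T \<and> b y y = 1 \<and> a y y < \<mu> + inverse (real (Suc n))" for n
    using cInf_lessD[OF ne, of "\<mu> + inverse (real (Suc n))"] unfolding \<mu>_def R_def by auto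
  then obtain y where y: "\<And>n. y n \<in> T" "\<And>n. b (y n) (y n) = 1" "\<And>n. a (y n) (y n) < \<mu> + inverse (real (Suc n))"
    by metis
  have yS: "y n \<in> S" for n using y TS by blast
  \<comment> \<open>Chosen so that \<mu> * \<epsilon> is at most 1/2; the energy of the difference
    can then be absorbed on the left in \<open>est\<close>.\<close>
  define \<epsilon> where "\<epsilon> = 1 / (2 * (\<mu> + 1))"
  have \<epsilon>: "\<epsilon> > 0" "\<mu> * \<epsilon> \<le> 1 / 2" using \<mu>0 by (auto simp: \<epsilon>_def field_simps)
  obtain m :: nat and q where q: "\<And>k u v. k < m \<Longrightarrow> u \<in> S \<Longrightarrow> v \<in> S \<Longrightarrow> q k (u - v) = q k u - q k v"
      "\<And>k. k < m \<Longrightarrow> \<exists>C. \<forall>u\<in>S. (q k u)^2 \<le> C * b u u"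
      "\<And>u. u \<in> S \<Longrightarrow> b u u \<le> (\<Sum>k<m. (q k u)^2) + \<epsilon> * a u u"
    using Ehrling[OF \<epsilon>(1)] by blast
  have "bounded (range (\<lambda>n. q k (y n)))" if "k < m" for k
  proof -
    obtain C where C: "\<And>u. u \<in> S \<Longrightarrow> (q k u)^2 \<le> C * b u u" using q(2)[OF \<open>k < m\<close>] by blast
    have "\<bar>q k (y n)\<bar> \<le> sqrt C" for n
      using real_sqrt_le_mono[OF C[OF yS[of n]]] y(2) by simp
    then show ?thesis by (intro boundedI[of _ "sqrt C"]) auto
  qed
  then obtain r where r: "strict_mono r" "\<forall>k<m. convergent (\<lambda>n. q k (y (r n)))"
    using finite_convergent_subseq[of m "\<lambda>k n. q k (y n)"] by blast
  define z where "z n = y (r n)" for n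
  have zS: "z n \<in> S" for n using yS by (simp add: z_def)
  have za: "a (z n) (z n) \<le> \<mu> + inverse (real (Suc n))" for n
  proof -
    have "inverse (real (Suc (r n))) \<le> inverse (real (Suc n))"
      using seq_suble[OF r(1), of n] by simp
    then show ?thesis using y(3)[of "r n"] unfolding z_def by linarith
  qed
  \<comment> \<open>Parallelogram law with the lower bound \<mu> on the sum. The
    \<open>b\<close>-size of the difference is split by Ehrling into finitely many convergent
    functionals and half of the left-hand side.\<close>
  have est: "a (z i - z j) (z i - z j) \<le> 4 * inverse (real (Suc i)) + 4 * inverse (real (Suc j))
      + 2 * \<mu> * (\<Sum>k<m. (q k (z i) - q k (z j))^2)" for i j
  proof -
    have ij: "z i - z j \<in> S" "z i + z j \<in> T"
      using zS Tadd[of "z i" "z j" 1] y(1) by (auto simp: z_def)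
    have "a (z i - z j) (z i - z j) = 2 * a (z i) (z i) + 2 * a (z j) (z j) - a (z i + z j) (z i + z j)"
      using zS by (simp add: A.expand A.sym[of "z j" "z i"])
    also have "\<dots> \<le> 2 * a (z i) (z i) + 2 * a (z j) (z j) - \<mu> * b (z i + z j) (z i + z j)"
      using \<mu>le[OF ij(2)] by simp
    also have "b (z i + z j) (z i + z j) = 4 - b (z i - z j) (z i - z j)"
      using zS y(2) by (simp add: B.expand B.sym[of "z j" "z i"]) (simp add: z_def)
    also have "2 * a (z i) (z i) + 2 * a (z j) (z j) - \<mu> * (4 - b (z i - z j) (z i - z j))
      \<le> 2 * inverse (real (Suc i)) + 2 * inverse (real (Suc j)) + \<mu> * b (z i - z j) (z i - z j)"
      using za[of i] za[of j] by (simp add: algebra_simps)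
    also have "\<mu> * b (z i - z j) (z i - z j) \<le> \<mu> * ((\<Sum>k<m. (q k (z i) - q k (z j))^2) + \<epsilon> * a (z i - z j) (z i - z j))"
      using q(3)[OF ij(1)] q(1) zS \<mu>0 by (intro mult_left_mono) auto
    also have "\<mu> * ((\<Sum>k<m. (q k (z i) - q k (z j))^2) + \<epsilon> * a (z i - z j) (z i - z j))
      \<le> \<mu> * (\<Sum>k<m. (q k (z i) - q k (z j))^2) + 1/2 * a (z i - z j) (z i - z j)"
      using mult_right_mono[OF \<epsilon>(2) A.nonneg[OF ij(1)]] by (simp add: algebra_simps)
    finally show ?thesis by simp
  qed
  have "\<exists>w\<in>S. (\<lambda>n. a (z n - w) (z n - w)) \<longlonglongrightarrow> 0"
  proof (rule complete[OF zS])
    fix e :: real assume e: "e > 0"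
    define \<eta> where "\<eta> = sqrt (e / (4 * (\<mu> + 1) * (real m + 1)))"
    have \<eta>: "\<eta> > 0" using e \<mu>0 by (simp add: \<eta>_def)
    have \<eta>2: "\<eta>^2 * (4 * (\<mu> + 1) * (real m + 1)) = e" using e \<mu>0 by (simp add: \<eta>_def)
    obtain N where N: "inverse (real (Suc N)) < e / 16" using reals_Archimedean[of "e/16"] e by auto
    have "\<forall>k<m. \<exists>N. \<forall>i\<ge>N. \<forall>j\<ge>N. \<bar>q k (z i) - q k (z j)\<bar> < \<eta>"
    proof (intro allI impI)
      fix k assume "k < m"
      then have "Cauchy (\<lambda>n. q k (z n))" using r(2) by (auto simp: z_def intro: convergent_Cauchy)
      then show "\<exists>N. \<forall>i\<ge>N. \<forall>j\<ge>N. \<bar>q k (z i) - q k (z j)\<bar> < \<eta>"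
        using \<eta> unfolding Cauchy_iff by auto
    qed
    then obtain M where M: "\<And>k i j. k < m \<Longrightarrow> i \<ge> M k \<Longrightarrow> j \<ge> M k \<Longrightarrow> \<bar>q k (z i) - q k (z j)\<bar> < \<eta>"
      by metis
    define M' where "M' = N + (\<Sum>k<m. M k)"
    have M': "N \<le> M'" "\<And>k. k < m \<Longrightarrow> M k \<le> M'"
    proof -
      show "N \<le> M'" by (simp add: M'_def)
      show "M k \<le> M'" if "k < m" for k
        using member_le_sum[of k "{..<m}" M] that unfolding M'_def by simp
    qed
    have "a (z i - z j) (z i - z j) < e" if ij: "i \<ge> M'" "j \<ge> M'" for i j
    proof -
      have 1: "inverse (real (Suc i)) \<le> inverse (real (Suc N))" "inverse (real (Suc j)) \<le> inverse (real (Suc N))"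
        using ij M'(1) by auto
      have "(\<Sum>k<m. (q k (z i) - q k (z j))^2) \<le> (\<Sum>k<m. \<eta>^2)"
      proof (rule sum_mono)
        fix k assume "k \<in> {..<m}"
        then have "\<bar>q k (z i) - q k (z j)\<bar> \<le> \<eta>" using M[of k i j] M'(2)[of k] ij by fastforce
        then show "(q k (z i) - q k (z j))^2 \<le> \<eta>^2" using power_mono[OF _ abs_ge_zero, of "q k (z i) - q k (z j)" \<eta> 2] by simp
      qed
      then have "2 * \<mu> * (\<Sum>k<m. (q k (z i) - q k (z j))^2) \<le> 2 * \<mu> * (real m * \<eta>^2)"
        using \<mu>0 by (intro mult_left_mono) auto
      also have "\<dots> \<le> 2 * (\<mu> + 1) * ((real m + 1) * \<eta>^2)"
        using \<mu>0 by (intro mult_mono) (auto intro: mult_right_mono)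
      also have "\<dots> = e / 2" using \<eta>2 by (simp add: algebra_simps)
      finally show ?thesis using est[of i j] 1 N by linarith
    qed
    then show "\<exists>N. \<forall>m\<ge>N. \<forall>n\<ge>N. a (z m - z n) (z m - z n) < e" by blast
  qed
  then obtain w where w: "w \<in> S" "(\<lambda>n. a (z n - w) (z n - w)) \<longlonglongrightarrow> 0" by blast
  have wb: "(\<lambda>n. b (z n - w) (z n - w)) \<longlonglongrightarrow> 0" by (rule b_tendsto_0[OF zS w])
  have orth: "b (v k) w = 0" if "k \<in> I" for k
  proof -
    have "(\<lambda>n. b (z n) (v k)) \<longlonglongrightarrow> b w (v k)" by (rule B.tendsto_left[OF zS w(1) v[OF that] wb])
    moreover have "b (z n) (v k) = 0" for n
      using y(1) that v zS B.sym[of "z n" "v k"] by (auto simp: z_def T_def)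
    ultimately show ?thesis using LIMSEQ_unique[of "\<lambda>n. 0::real" 0] B.sym[OF w(1) v[OF that]] by simp
  qed
  have wT: "w \<in> T" using w orth by (simp add: T_def)
  have ww: "b w w = 1"
    using B.tendsto_sq[OF zS w(1) wb] y(2) LIMSEQ_unique[of "\<lambda>n. 1::real" 1] by (simp add: z_def)
  have "a w w \<le> \<mu> + 0"
    by (rule LIMSEQ_le[OF A.tendsto_sq[OF zS w] tendsto_add[OF tendsto_const LIMSEQ_inverse_real_of_nat]]) (use za in auto)
  then have aw: "a w w = \<mu>" using \<mu>le[OF wT] ww by simp
  have onT: "a w u = \<mu> * b w u" if u: "u \<in> T" for u
  proof -
    \<comment> \<open>The form a - \<mu> b is nonnegative on \<open>T\<close> and vanishes at
      \<open>w\<close>, so its first variation along \<open>T\<close> vanishes.\<close>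
    have "(a w u - \<mu> * b w u)^2 \<le> 0 * (a u u - \<mu> * b u u)"
    proof (rule quadratic_nonneg_imp)
      fix t
      have "\<mu> * b (w + t *\<^sub>R u) (w + t *\<^sub>R u) \<le> a (w + t *\<^sub>R u) (w + t *\<^sub>R u)"
        by (rule \<mu>le[OF Tadd[OF wT u]])
      then show "0 \<le> 0 + 2 * t * (a w u - \<mu> * b w u) + t^2 * (a u u - \<mu> * b u u)"
        using w(1) TS[OF u] aw ww
        by (simp add: A.expand B.expand A.sym[of u w] B.sym[of u w] power2_eq_square algebra_simps)
    qed (use \<mu>le[OF u] in simp)
    then show ?thesis by simp
  qed
  have "a w u = \<mu> * b w u" if u: "u \<in> S" for u
  proof -
    \<comment> \<open>The component of \<open>u\<close> along the given eigenvectors. Both forms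
      vanish between \<open>w\<close> and \<open>p\<close>, so the identity on \<open>T\<close>
      covers all of \<open>S\<close>.\<close>
    define p where "p = (\<Sum>k\<in>I. b (v k) u *\<^sub>R v k)"
    have p: "p \<in> S" using v by (auto simp: p_def)
    have "b (v j) p = b (v j) u" if "j \<in> I" for j
    proof -
      have "b (v j) p = (\<Sum>k\<in>I. b (v k) u * b (v j) (v k))"
        unfolding p_def using v that by (subst B.sum_right) (auto simp: B.scale_right intro!: sum.cong)
      also have "\<dots> = (\<Sum>k\<in>I. if k = j then b (v k) u else 0)"
        using that by (intro sum.cong) (auto simp: on)
      finally show ?thesis using I that by simp
    qed
    then have "u - p \<in> T" using u p v by (auto simp: T_def B.expand)
    then have 1: "a w (u - p) = \<mu> * b w (u - p)" by (rule onT)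
    have wv: "b w (v k) = 0" "a w (v k) = 0" if "k \<in> I" for k
      using orth[OF that] ev[OF that w(1)] B.sym[OF w(1) v[OF that]] A.sym[OF w(1) v[OF that]] by auto
    have "b w p = 0" "a w p = 0"
      unfolding p_def using v w(1) wv
      by (auto simp: A.sum_right B.sum_right A.scale_right B.scale_right)
    then show ?thesis using 1 u p w(1) by (simp add: A.expand B.expand)
  qed
  then show ?thesis using w orth ww \<mu>\<Lambda> by blast
qed

end

section \<open>The Schroedinger form\<close>

text \<open>Pointwise operations turn functions, tuples of functions and curried matrices into real
  vector spaces, so one set of locales serves all three.\<close>

instantiation "fun" :: (type, real_vector) real_vector
begin
definition scaleR_fun :: "real \<Rightarrow> ('a \<Rightarrow> 'b) \<Rightarrow> 'a \<Rightarrow> 'b" where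
  "scaleR_fun c f = (\<lambda>x. c *\<^sub>R f x)"
instance
  by standard (simp_all add: scaleR_fun_def fun_eq_iff scaleR_add_right scaleR_add_left)
end

lemma scaleR_fun_apply [simp]: "(c *\<^sub>R f) x = c *\<^sub>R f x"
  by (simp add: scaleR_fun_def)

lemma nrm2_cong_AE:
  assumes "f \<in> borel_measurable M" "g \<in> borel_measurable M" "AE x in M. f x = g x"
  shows "nrm2 M f = nrm2 M g"
  unfolding nrm2_def using assms by (intro arg_cong[of _ _ sqrt] integral_cong_AE) auto

locale schroedinger =
  fixes \<Omega> :: "(real^'d::finite) set" and V :: "'d fn"
  assumes dom: "is_domain \<Omega>" and pot: "admissible_potential \<Omega> V"
begin

lemma \<Omega>: "open \<Omega>" "bounded \<Omega>"
  using dom by (auto simp: is_domain_def)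

lemma \<Omega>_sets: "\<Omega> \<in> sets lebesgue"
  using \<Omega> by simp

lemma wgrad_pair: "u \<in> H01 \<Omega> \<Longrightarrow> H01pair \<Omega> u (wgrad \<Omega> u)"
proof -
  assume "u \<in> H01 \<Omega>"
  then have "\<exists>g. H01pair \<Omega> u g" by (simp add: H01_def)
  from someI_ex[OF this] show ?thesis by (simp add: wgrad_def)
qed

lemma H01_I: "H01pair \<Omega> u g \<Longrightarrow> u \<in> H01 \<Omega>"
  by (auto simp: H01_def)

text \<open>\<open>wgrad\<close> is a choice among gradients; closability fixes it up to null sets,
  which is all that integrals see.\<close>

lemma wgrad_eq: "H01pair \<Omega> u g \<Longrightarrow> AE x in leb \<Omega>. wgrad \<Omega> u x = g x"
  using H01pair_gradient_unique[OF \<Omega> wgrad_pair[OF H01_I]] by blast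

lemma H01_L2: "u \<in> H01 \<Omega> \<Longrightarrow> u \<in> L2 (leb \<Omega>)"
  using wgrad_pair[of u] unfolding H01pair_iff[OF \<Omega>(1)] by blast

lemma wgrad_L2: "u \<in> H01 \<Omega> \<Longrightarrow> (\<lambda>x. wgrad \<Omega> u x $ i) \<in> L2 (leb \<Omega>)"
  using wgrad_pair[of u] unfolding H01pair_iff[OF \<Omega>(1)] by blast

lemma pair_lincomb:
  assumes "u \<in> H01 \<Omega>" "v \<in> H01 \<Omega>"
  shows "H01pair \<Omega> (u + c *\<^sub>R v) (\<lambda>x. wgrad \<Omega> u x + c *\<^sub>R wgrad \<Omega> v x)"
proof -
  have "u + c *\<^sub>R v = (\<lambda>x. u x + c * v x)" by (simp add: fun_eq_iff)
  then show ?thesis using H01pair_lincomb[OF \<Omega>(1) wgrad_pair[OF assms(1)] wgrad_pair[OF assms(2)]] by simp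
qed

lemma H01_lincomb: "u \<in> H01 \<Omega> \<Longrightarrow> v \<in> H01 \<Omega> \<Longrightarrow> u + c *\<^sub>R v \<in> H01 \<Omega>"
  using pair_lincomb H01_I by blast

lemma H01_subspace: "subspace (H01 \<Omega>)"
proof -
  have 0: "0 \<in> H01 \<Omega>" using H01_I[OF H01pair_zero[OF \<Omega>(1)]] by (simp add: zero_fun_def)
  have "u + v \<in> H01 \<Omega>" if "u \<in> H01 \<Omega>" "v \<in> H01 \<Omega>" for u v using H01_lincomb[OF that, of 1] by simp
  moreover have "c *\<^sub>R v \<in> H01 \<Omega>" if "v \<in> H01 \<Omega>" for v c using H01_lincomb[OF 0 that, of c] by simp
  ultimately show ?thesis using 0 by (simp add: subspace_def)
qed

lemma l2ip_eq: "l2ip \<Omega> u v = (\<integral>x. u x * v x \<partial>leb \<Omega>)"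
  unfolding l2ip_def by (rule set_LINT_eq_leb[OF \<Omega>_sets])

lemma l2ip_sym: "l2ip \<Omega> u v = l2ip \<Omega> v u"
  by (simp add: l2ip_eq mult.commute)

lemma l2ip_nrm2: "l2ip \<Omega> u u = (nrm2 (leb \<Omega>) u)^2"
  unfolding l2ip_eq nrm2_sq by (simp add: power2_eq_square)

lemma aform_eq: "aform \<Omega> V u v = (\<integral>x. wgrad \<Omega> u x \<bullet> wgrad \<Omega> v x + V x * u x * v x \<partial>leb \<Omega>)"
  unfolding aform_def by (rule set_LINT_eq_leb[OF \<Omega>_sets])

lemma grad_integrable: 
  assumes "u \<in> H01 \<Omega>" "v \<in> H01 \<Omega>" shows "integrable (leb \<Omega>) (\<lambda>x. wgrad \<Omega> u x \<bullet> wgrad \<Omega> v x)"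
  unfolding inner_vec_def using L2_mult[OF wgrad_L2[OF assms(1)] wgrad_L2[OF assms(2)]] by simp

lemma pot_integrable:
  assumes "u \<in> H01 \<Omega>" "v \<in> H01 \<Omega>" shows "integrable (leb \<Omega>) (\<lambda>x. V x * u x * v x)"
  using pot assms unfolding admissible_potential_def set_integrable_eq_leb[OF \<Omega>_sets] by blast

lemma aform_integrable:
  assumes "u \<in> H01 \<Omega>" "v \<in> H01 \<Omega>"
  shows "integrable (leb \<Omega>) (\<lambda>x. wgrad \<Omega> u x \<bullet> wgrad \<Omega> v x + V x * u x * v x)"
  by (intro Bochner_Integration.integrable_add grad_integrable pot_integrable assms)

lemma aform_lincomb:
  assumes u: "u \<in> H01 \<Omega>" and v: "v \<in> H01 \<Omega>" and w: "w \<in> H01 \<Omega>"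
  shows "aform \<Omega> V (u + c *\<^sub>R v) w = aform \<Omega> V u w + c * aform \<Omega> V v w"
proof -
  note i = aform_integrable[OF u w] aform_integrable[OF v w] aform_integrable[OF H01_lincomb[OF u v, of c] w]
  have "aform \<Omega> V (u + c *\<^sub>R v) w = (\<integral>x. (wgrad \<Omega> u x \<bullet> wgrad \<Omega> w x + V x * u x * w x)
      + c * (wgrad \<Omega> v x \<bullet> wgrad \<Omega> w x + V x * v x * w x) \<partial>leb \<Omega>)"
    unfolding aform_eq
  proof (rule integral_cong_AE)
    show "AE x in leb \<Omega>. wgrad \<Omega> (u + c *\<^sub>R v) x \<bullet> wgrad \<Omega> w x + V x * (u + c *\<^sub>R v) x * w x
      = (wgrad \<Omega> u x \<bullet> wgrad \<Omega> w x + V x * u x * w x) + c * (wgrad \<Omega> v x \<bullet> wgrad \<Omega> w x + V x * v x * w x)"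
      using wgrad_eq[OF pair_lincomb[OF u v, of c]]
      by eventually_elim (simp add: inner_add_left algebra_simps)
  qed (use i in auto)
  also have "\<dots> = aform \<Omega> V u w + c * aform \<Omega> V v w"
    unfolding aform_eq using i by simp
  finally show ?thesis .
qed

lemma aform_sym: "u \<in> H01 \<Omega> \<Longrightarrow> v \<in> H01 \<Omega> \<Longrightarrow> aform \<Omega> V u v = aform \<Omega> V v u"
  using pot unfolding admissible_potential_def by blast

lemma l2ip_lincomb:
  assumes "u \<in> H01 \<Omega>" "v \<in> H01 \<Omega>" "w \<in> H01 \<Omega>"
  shows "l2ip \<Omega> (u + c *\<^sub>R v) w = l2ip \<Omega> u w + c * l2ip \<Omega> v w"
proof -
  have "l2ip \<Omega> (u + c *\<^sub>R v) w = (\<integral>x. u x * w x + c * (v x * w x) \<partial>leb \<Omega>)"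
    unfolding l2ip_eq by (simp add: algebra_simps)
  then show ?thesis
    unfolding l2ip_eq using L2_mult[OF H01_L2[OF assms(1)] H01_L2[OF assms(3)]] L2_mult[OF H01_L2[OF assms(2)] H01_L2[OF assms(3)]]
    by simp
qed

definition gn :: "'d fn \<Rightarrow> real" where
  "gn u = (\<Sum>i\<in>UNIV. (nrm2 (leb \<Omega>) (\<lambda>x. wgrad \<Omega> u x $ i))^2)"

lemma H1norm_sq:
  assumes "u \<in> H01 \<Omega>" shows "(H1norm \<Omega> u)^2 = (nrm2 (leb \<Omega>) u)^2 + gn u"
proof -
  have "(LINT x:\<Omega>|lebesgue. (norm (wgrad \<Omega> u x))^2) = gn u"
    unfolding gn_def set_LINT_eq_leb[OF \<Omega>_sets] by (rule integral_norm_sq_vec(1)[OF wgrad_L2[OF assms]])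
  moreover have "gn u \<ge> 0" by (simp add: gn_def sum_nonneg)
  ultimately show ?thesis by (simp add: H1norm_def l2ip_nrm2)
qed

lemma gn_diff:
  assumes "u \<in> H01 \<Omega>" "H01pair \<Omega> w h"
  shows "gn (u - w) = (\<Sum>i\<in>UNIV. (nrm2 (leb \<Omega>) (\<lambda>x. wgrad \<Omega> u x $ i - h x $ i))^2)"
proof -
  have uw: "u + (-1) *\<^sub>R w = u - w" by simp
  have w: "w \<in> H01 \<Omega>" by (rule H01_I[OF assms(2)])
  have p: "H01pair \<Omega> (u - w) (\<lambda>x. wgrad \<Omega> u x + (-1) *\<^sub>R h x)"
    using H01pair_lincomb[OF \<Omega>(1) wgrad_pair[OF assms(1)] assms(2), of "-1"] by (simp add: fun_diff_def)
  have d: "u - w \<in> H01 \<Omega>" by (rule H01_I[OF p])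
  have "nrm2 (leb \<Omega>) (\<lambda>x. wgrad \<Omega> (u - w) x $ i) = nrm2 (leb \<Omega>) (\<lambda>x. wgrad \<Omega> u x $ i - h x $ i)" for i
  proof (rule nrm2_cong_AE)
    show "(\<lambda>x. wgrad \<Omega> (u - w) x $ i) \<in> borel_measurable (leb \<Omega>)"
      by (rule L2_meas[OF wgrad_L2[OF d]])
    have "(\<lambda>x. h x $ i) \<in> L2 (leb \<Omega>)" using assms(2) unfolding H01pair_iff[OF \<Omega>(1)] by blast
    then show "(\<lambda>x. wgrad \<Omega> u x $ i - h x $ i) \<in> borel_measurable (leb \<Omega>)"
      using L2_meas[OF L2_diff[OF wgrad_L2[OF assms(1)]]] by blast
    show "AE x in leb \<Omega>. wgrad \<Omega> (u - w) x $ i = wgrad \<Omega> u x $ i - h x $ i"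
      using wgrad_eq[OF p] by eventually_elim simp
  qed
  then show ?thesis unfolding gn_def by simp
qed

text \<open>Coercivity turns an energy-Cauchy sequence into Cauchy sequences of functions and
  gradient components; boundedness of the form turns convergence of these back into convergence in
  energy.\<close>

lemma aform_complete:
  assumes \<alpha>: "\<alpha> > 0" "\<And>u. u \<in> H01 \<Omega> \<Longrightarrow> \<alpha> * (H1norm \<Omega> u)^2 \<le> aform \<Omega> V u u"
    and x: "\<And>n. x n \<in> H01 \<Omega>"
    and cauchy: "\<And>e. e > 0 \<Longrightarrow> \<exists>N. \<forall>m\<ge>N. \<forall>n\<ge>N. aform \<Omega> V (x m - x n) (x m - x n) < e"
  shows "\<exists>w\<in>H01 \<Omega>. (\<lambda>n. aform \<Omega> V (x n - w) (x n - w)) \<longlonglongrightarrow> 0"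
proof -
  have d: "x m - x n \<in> H01 \<Omega>" for m n using H01_subspace x subspace_diff by blast
  have e2: "\<exists>N. \<forall>m\<ge>N. \<forall>n\<ge>N. (nrm2 (leb \<Omega>) (x m - x n))^2 + gn (x m - x n) < e^2" if e: "e > 0" for e
  proof -
    obtain N where N: "\<And>m n. m \<ge> N \<Longrightarrow> n \<ge> N \<Longrightarrow> aform \<Omega> V (x m - x n) (x m - x n) < \<alpha> * e^2"
      using cauchy[of "\<alpha> * e^2"] \<alpha>(1) e by auto
    have "(nrm2 (leb \<Omega>) (x m - x n))^2 + gn (x m - x n) < e^2" if "m \<ge> N" "n \<ge> N" for m n
      using N[OF that] \<alpha>(2)[OF d[of m n]] \<alpha>(1) unfolding H1norm_sq[OF d]
      by (meson linorder_not_le mult_le_cancel_left_pos order_le_less_trans)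
    then show ?thesis by blast
  qed
  have gn0: "gn u \<ge> 0" for u by (simp add: gn_def sum_nonneg)
  have gnm: "(nrm2 (leb \<Omega>) (\<lambda>y. wgrad \<Omega> (x m) y $ i - wgrad \<Omega> (x n) y $ i))^2 \<le> gn (x m - x n)" for m n i
    unfolding gn_diff[OF x wgrad_pair[OF x]] by (rule member_le_sum) auto
  have "\<exists>w h. H01pair \<Omega> w h \<and> (\<lambda>n. nrm2 (leb \<Omega>) (\<lambda>y. x n y - w y)) \<longlonglongrightarrow> 0 \<and>
    (\<forall>i. (\<lambda>n. nrm2 (leb \<Omega>) (\<lambda>y. wgrad \<Omega> (x n) y $ i - h y $ i)) \<longlonglongrightarrow> 0)"
  proof (rule H01pair_complete[OF \<Omega> wgrad_pair[OF x]])
    fix e :: real assume e: "e > 0"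
    obtain N where N: "\<And>m n. m \<ge> N \<Longrightarrow> n \<ge> N \<Longrightarrow> (nrm2 (leb \<Omega>) (x m - x n))^2 + gn (x m - x n) < e^2"
      using e2[OF e] by blast
    have "nrm2 (leb \<Omega>) (\<lambda>y. x m y - x n y) < e" if "m \<ge> N" "n \<ge> N" for m n
    proof (rule power2_less_imp_less)
      show "(nrm2 (leb \<Omega>) (\<lambda>y. x m y - x n y))^2 < e^2"
        using N[OF that] gn0[of "x m - x n"] by (simp add: fun_diff_def)
    qed (use e in simp)
    then show "\<exists>N. \<forall>m\<ge>N. \<forall>n\<ge>N. nrm2 (leb \<Omega>) (\<lambda>y. x m y - x n y) < e" by blast
    have "nrm2 (leb \<Omega>) (\<lambda>y. wgrad \<Omega> (x m) y $ i - wgrad \<Omega> (x n) y $ i) < e" if "m \<ge> N" "n \<ge> N" for m n i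
    proof (rule power2_less_imp_less)
      show "(nrm2 (leb \<Omega>) (\<lambda>y. wgrad \<Omega> (x m) y $ i - wgrad \<Omega> (x n) y $ i))^2 < e^2"
        using N[OF that] gnm[of m i n] zero_le_power2[of "nrm2 (leb \<Omega>) (x m - x n)"] by linarith
    qed (use e in simp)
    then show "\<exists>N. \<forall>m\<ge>N. \<forall>n\<ge>N. nrm2 (leb \<Omega>) (\<lambda>y. wgrad \<Omega> (x m) y $ i - wgrad \<Omega> (x n) y $ i) < e" for i by blast
  qed (intro exI conjI allI, assumption+)
  then obtain w h where "H01pair \<Omega> w h \<and> (\<lambda>n. nrm2 (leb \<Omega>) (\<lambda>y. x n y - w y)) \<longlonglongrightarrow> 0 \<and>
    (\<forall>i. (\<lambda>n. nrm2 (leb \<Omega>) (\<lambda>y. wgrad \<Omega> (x n) y $ i - h y $ i)) \<longlonglongrightarrow> 0)"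
    by (elim exE)
  then have w: "H01pair \<Omega> w h" "(\<lambda>n. nrm2 (leb \<Omega>) (\<lambda>y. x n y - w y)) \<longlonglongrightarrow> 0"
    "\<And>i. (\<lambda>n. nrm2 (leb \<Omega>) (\<lambda>y. wgrad \<Omega> (x n) y $ i - h y $ i)) \<longlonglongrightarrow> 0"
    by simp_all
  have wH: "w \<in> H01 \<Omega>" by (rule H01_I[OF w(1)])
  have xw: "x n - w \<in> H01 \<Omega>" for n using H01_subspace x wH subspace_diff by blast
  obtain M where M: "\<And>u. u \<in> H01 \<Omega> \<Longrightarrow> \<bar>aform \<Omega> V u u\<bar> \<le> M * (H1norm \<Omega> u)^2"
    using pot unfolding admissible_potential_def power2_eq_square mult.assoc[symmetric] by blast
  have "(\<lambda>n. aform \<Omega> V (x n - w) (x n - w)) \<longlonglongrightarrow> 0"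
  proof (rule Lim_null_comparison)
    show "\<forall>\<^sub>F n in sequentially. norm (aform \<Omega> V (x n - w) (x n - w)) \<le> M * ((nrm2 (leb \<Omega>) (\<lambda>y. x n y - w y))^2
       + (\<Sum>i\<in>UNIV. (nrm2 (leb \<Omega>) (\<lambda>y. wgrad \<Omega> (x n) y $ i - h y $ i))^2))"
      using M[OF xw] unfolding H1norm_sq[OF xw] gn_diff[OF x w(1)]
      by (intro always_eventually) (simp add: fun_diff_def)
    have "(\<lambda>n. M * ((nrm2 (leb \<Omega>) (\<lambda>y. x n y - w y))^2
       + (\<Sum>i\<in>UNIV. (nrm2 (leb \<Omega>) (\<lambda>y. wgrad \<Omega> (x n) y $ i - h y $ i))^2))) \<longlonglongrightarrow> M * (0^2 + (\<Sum>i\<in>(UNIV::'d set). 0^2))"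
      by (intro tendsto_mult_left tendsto_add tendsto_power tendsto_sum w)
    then show "(\<lambda>n. M * ((nrm2 (leb \<Omega>) (\<lambda>y. x n y - w y))^2
       + (\<Sum>i\<in>UNIV. (nrm2 (leb \<Omega>) (\<lambda>y. wgrad \<Omega> (x n) y $ i - h y $ i))^2))) \<longlonglongrightarrow> 0" by simp
  qed
  with wH show ?thesis by blast
qed

text \<open>The functionals are the cell integrals divided by s^(d/2), enumerated by natural
  numbers. Coercivity bounds the gradient term by the energy, hence
  \<open>\<epsilon> * \<alpha>\<close> in the inequality that is invoked.\<close>

lemma aform_Ehrling:
  assumes \<alpha>: "\<alpha> > 0" "\<And>u. u \<in> H01 \<Omega> \<Longrightarrow> \<alpha> * (H1norm \<Omega> u)^2 \<le> aform \<Omega> V u u" and e: "\<epsilon> > 0"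
  shows "\<exists>(m::nat) l. (\<forall>k<m. (\<forall>u\<in>H01 \<Omega>. \<forall>v\<in>H01 \<Omega>. l k (u - v) = l k u - l k v) \<and>
        (\<exists>C. \<forall>u\<in>H01 \<Omega>. (l k u)^2 \<le> C * l2ip \<Omega> u u)) \<and> (\<forall>u\<in>H01 \<Omega>. l2ip \<Omega> u u \<le> (\<Sum>k<m. (l k u)^2) + \<epsilon> * aform \<Omega> V u u)"
proof (rule H01pair_Ehrling[OF \<Omega>, of "\<epsilon> * \<alpha>"])
  show "\<epsilon> * \<alpha> > 0" using e \<alpha> by simp
  fix K :: "('d \<Rightarrow> int) set" and s :: real
  assume K: "finite K" and s: "s > 0" and ineq: "\<And>u g. H01pair \<Omega> u g \<Longrightarrow> (nrm2 (leb \<Omega>) u)^2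
      \<le> (\<Sum>k\<in>K. (\<integral>x. u x * indicator (cell s k) x \<partial>leb \<Omega>)^2 / s ^ CARD('d))
        + \<epsilon> * \<alpha> * (\<Sum>i\<in>UNIV. (nrm2 (leb \<Omega>) (\<lambda>x. g x $ i))^2)"
  obtain e where bij: "bij_betw e {..<card K} K"
    using ex_bij_betw_nat_finite[OF K] by (auto simp: atLeast0LessThan)
  define l where "l k u = (\<integral>x. u x * indicator (cell s (e k)) x \<partial>leb \<Omega>) / sqrt (s ^ CARD('d))" for k and u :: "'d fn"
  have c: "(indicator (cell s k) :: real^'d \<Rightarrow> real) \<in> L2 (leb \<Omega>)" for k
    by (rule indicator_L2_leb[OF \<Omega> cell_borel])
  show ?thesis
  proof (intro exI[of _ "card K"] exI[of _ l] conjI allI impI ballI)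
    fix k u v assume u: "u \<in> H01 \<Omega>" and v: "v \<in> H01 \<Omega>"
    show "l k (u - v) = l k u - l k v"
      using L2_mult[OF H01_L2[OF u] c] L2_mult[OF H01_L2[OF v] c]
      by (simp add: l_def fun_diff_def left_diff_distrib diff_divide_distrib)
  next
    fix k
    show "\<exists>C. \<forall>u\<in>H01 \<Omega>. (l k u)^2 \<le> C * l2ip \<Omega> u u"
    proof (intro exI ballI)
      fix u assume u: "u \<in> H01 \<Omega>"
      let ?I = "\<integral>x. u x * indicator (cell s (e k)) x \<partial>leb \<Omega>"
      have "?I^2 \<le> (nrm2 (leb \<Omega>) u * nrm2 (leb \<Omega>) (indicator (cell s (e k))))^2"
        using power_mono[OF L2_Cauchy_Schwarz[OF H01_L2[OF u] c] abs_ge_zero, of "e k" 2] by simp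
      then have "?I^2 / s ^ CARD('d) \<le> (nrm2 (leb \<Omega>) u * nrm2 (leb \<Omega>) (indicator (cell s (e k))))^2 / s ^ CARD('d)"
        using s by (intro divide_right_mono) auto
      then show "(l k u)^2 \<le> ((nrm2 (leb \<Omega>) (indicator (cell s (e k))))^2 / s ^ CARD('d)) * l2ip \<Omega> u u"
        using s by (simp add: l_def power_divide l2ip_nrm2 power_mult_distrib mult.commute)
    qed
  next
    fix u assume u: "u \<in> H01 \<Omega>"
    have "(\<Sum>k<card K. (l k u)^2) = (\<Sum>k<card K. (\<integral>x. u x * indicator (cell s (e k)) x \<partial>leb \<Omega>)^2 / s ^ CARD('d))"
      using s by (simp add: l_def power_divide)
    also have "\<dots> = (\<Sum>k\<in>K. (\<integral>x. u x * indicator (cell s k) x \<partial>leb \<Omega>)^2 / s ^ CARD('d))"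
      by (rule sum.reindex_bij_betw[OF bij])
    finally have 1: "(nrm2 (leb \<Omega>) u)^2 \<le> (\<Sum>k<card K. (l k u)^2) + \<epsilon> * (\<alpha> * gn u)"
      using ineq[OF wgrad_pair[OF u]] by (simp add: gn_def mult.assoc)
    have "\<alpha> * gn u \<le> \<alpha> * (H1norm \<Omega> u)^2" unfolding H1norm_sq[OF u] using \<alpha>(1) by simp
    then have "\<epsilon> * (\<alpha> * gn u) \<le> \<epsilon> * aform \<Omega> V u u"
      using \<alpha>(2)[OF u] assms(3) by (intro mult_left_mono) auto
    with 1 show "l2ip \<Omega> u u \<le> (\<Sum>k<card K. (l k u)^2) + \<epsilon> * aform \<Omega> V u u" by (simp add: l2ip_nrm2)
  qed
qed

lemma form_space_ex: "\<exists>\<alpha>. form_space (H01 \<Omega>) (aform \<Omega> V) (l2ip \<Omega>) \<alpha>"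
proof -
  obtain \<alpha> where \<alpha>: "\<alpha> > 0" "\<And>u. u \<in> H01 \<Omega> \<Longrightarrow> \<alpha> * (H1norm \<Omega> u)^2 \<le> aform \<Omega> V u u"
    using pot unfolding admissible_potential_def by blast
  have nn: "0 \<le> aform \<Omega> V u u" if "u \<in> H01 \<Omega>" for u
    using \<alpha>(2)[OF that] \<alpha>(1) by (meson mult_nonneg_nonneg less_imp_le order_trans zero_le_power2)
  interpret A: sip "H01 \<Omega>" "aform \<Omega> V"
    by unfold_locales (auto simp: H01_subspace aform_sym aform_lincomb nn)
  interpret B: sip "H01 \<Omega>" "l2ip \<Omega>"
    by unfold_locales (auto simp: H01_subspace l2ip_lincomb l2ip_nrm2 intro: l2ip_sym)
  have gn0: "gn u \<ge> 0" for u by (simp add: gn_def sum_nonneg)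
  have "form_space (H01 \<Omega>) (aform \<Omega> V) (l2ip \<Omega>) \<alpha>"
  proof unfold_locales
    show "\<alpha> * l2ip \<Omega> u u \<le> aform \<Omega> V u u" if "u \<in> H01 \<Omega>" for u
    proof -
      have "\<alpha> * l2ip \<Omega> u u \<le> \<alpha> * (H1norm \<Omega> u)^2"
        unfolding H1norm_sq[OF that] l2ip_nrm2 using \<alpha>(1) gn0[of u] by simp
      then show ?thesis using \<alpha>(2)[OF that] by linarith
    qed
  qed (use \<alpha> aform_complete[OF \<alpha>] aform_Ehrling[OF \<alpha>] in blast)+
  then show ?thesis by blast
qed

lemma Gop:
  assumes "f \<in> H01 \<Omega>"
  shows "Gop \<Omega> V f \<in> H01 \<Omega>" "v \<in> H01 \<Omega> \<Longrightarrow> aform \<Omega> V (Gop \<Omega> V f) v = l2ip \<Omega> f v"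
proof -
  obtain \<alpha> where "form_space (H01 \<Omega>) (aform \<Omega> V) (l2ip \<Omega>) \<alpha>" using form_space_ex by blast
  then interpret form_space "H01 \<Omega>" "aform \<Omega> V" "l2ip \<Omega>" \<alpha> .
  have "\<exists>w. w \<in> H01 \<Omega> \<and> (\<forall>v\<in>H01 \<Omega>. aform \<Omega> V w v = l2ip \<Omega> f v)" using Riesz[OF assms] by blast
  from someI_ex[OF this] show "Gop \<Omega> V f \<in> H01 \<Omega>" "v \<in> H01 \<Omega> \<Longrightarrow> aform \<Omega> V (Gop \<Omega> V f) v = l2ip \<Omega> f v"
    unfolding Gop_def by auto
qed

text \<open>Otherwise the constrained minimiser would be a normalised eigenfunction for some \<mu>
  below \<open>lam (N+1)\<close>, orthogonal to all \<open>Vs k\<close>. By monotonicity every index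
  with eigenvalue \<mu> lies in \<open>{1..N}\<close>, so adding it to the corresponding
  \<open>Vs i\<close> exceeds the multiplicity of \<mu>.\<close>

lemma spectral_gap:
  assumes eig: "eigenvalue_seq \<Omega> V lam"
    and Vs_eig: "\<forall>i\<in>{1..N}. is_eigfun \<Omega> V (lam i) (Vs i)"
    and Vs_on: "\<forall>i\<in>{1..N}. \<forall>j\<in>{1..N}. l2ip \<Omega> (Vs i) (Vs j) = idm i j"
    and y: "y \<in> H01 \<Omega>" "\<And>k. k \<in> {1..N} \<Longrightarrow> l2ip \<Omega> (Vs k) y = 0"
  shows "lam (N+1) * l2ip \<Omega> y y \<le> aform \<Omega> V y y"
proof (rule ccontr)
  assume neg: "\<not> lam (N+1) * l2ip \<Omega> y y \<le> aform \<Omega> V y y"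
  obtain \<alpha> where "form_space (H01 \<Omega>) (aform \<Omega> V) (l2ip \<Omega>) \<alpha>" using form_space_ex by blast
  then interpret form_space "H01 \<Omega>" "aform \<Omega> V" "l2ip \<Omega>" \<alpha> .
  have "\<exists>w \<mu>. w \<in> H01 \<Omega> \<and> (\<forall>k\<in>{1..N}. l2ip \<Omega> (Vs k) w = 0) \<and> l2ip \<Omega> w w = 1 \<and> \<mu> < lam (N+1) \<and>
      (\<forall>u\<in>H01 \<Omega>. aform \<Omega> V w u = \<mu> * l2ip \<Omega> w u)"
    by (rule constrained_eigenvector[of "{1..N}" Vs lam y])
       (use Vs_eig Vs_on y neg in \<open>auto simp: is_eigfun_def idm_def\<close>)
  then obtain w \<mu> where w: "w \<in> H01 \<Omega>" "\<And>k. k \<in> {1..N} \<Longrightarrow> l2ip \<Omega> (Vs k) w = 0" "l2ip \<Omega> w w = 1"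
      "\<mu> < lam (N+1)" "\<And>u. u \<in> H01 \<Omega> \<Longrightarrow> aform \<Omega> V w u = \<mu> * l2ip \<Omega> w u"
    by blast
  define J where "J = {i. 1 \<le> i \<and> lam i = \<mu>}"
  have mono: "lam i \<le> lam j" if "1 \<le> i" "i \<le> j" for i j
    using eig that unfolding eigenvalue_seq_def by blast
  have J: "J \<subseteq> {1..N}"
  proof
    fix i assume i: "i \<in> J"
    show "i \<in> {1..N}"
    proof (rule ccontr)
      assume "i \<notin> {1..N}"
      then have "lam (N+1) \<le> lam i" using i by (intro mono) (auto simp: J_def)
      then show False using i w(4) by (simp add: J_def)
    qed
  qed
  have fin: "finite J" using J finite_subset by blast
  have VJ: "Vs i \<in> H01 \<Omega>" if "i \<in> {1..N}" for i using Vs_eig that by (simp add: is_eigfun_def)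
  have inj: "inj_on Vs J"
  proof (rule inj_onI)
    fix i j assume "i \<in> J" "j \<in> J" "Vs i = Vs j"
    then have "idm i j = idm j j" using Vs_on J by (metis subsetD)
    then show "i = j" by (simp add: idm_def split: if_splits)
  qed
  have wn: "w \<notin> Vs ` J" using w(2,3) J by fastforce
  let ?F = "insert w (Vs ` J)"
  have "orthonormal_set \<Omega> ?F"
    unfolding orthonormal_set_def
  proof (intro ballI)
    fix u z assume u: "u \<in> ?F" and z: "z \<in> ?F"
    have V0: "l2ip \<Omega> (Vs i) w = 0" "l2ip \<Omega> w (Vs i) = 0" if "i \<in> J" for i
      using that J w(1,2) VJ B.sym[of w "Vs i"] by auto
    have VV: "l2ip \<Omega> (Vs i) (Vs j) = (if Vs i = Vs j then 1 else 0)" if "i \<in> J" "j \<in> J" for i j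
      using Vs_on[rule_format, of i j] subsetD[OF J that(1)] subsetD[OF J that(2)] inj_on_eq_iff[OF inj that]
      by (simp add: idm_def)
    show "l2ip \<Omega> u z = (if u = z then 1 else 0)"
      using u z wn w(3) V0 VV by (elim insertE imageE) auto
  qed
  moreover have "\<forall>u\<in>?F. is_eigfun \<Omega> V \<mu> u"
    using w(1,5) Vs_eig J by (auto simp: is_eigfun_def J_def)
  ultimately have "card ?F \<le> card J"
    using eig fin unfolding eigenvalue_seq_def J_def by blast
  moreover have "card ?F = Suc (card J)" using fin wn card_image[OF inj] by simp
  ultimately show False by simp
qed

end

section \<open>Tuples and matrices\<close>

text \<open>Forms on the full type: no membership premises burden the long estimates. The forms on
  \<open>H01\<close> are brought here at the end by composing them with a linear projection.\<close>

locale psd_form =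
  fixes f :: "'v::real_vector \<Rightarrow> 'v \<Rightarrow> real"
  assumes psd_sym: "f u v = f v u"
    and psd_lin: "f (u + c *\<^sub>R v) w = f u w + c * f v w"
    and psd_nonneg: "0 \<le> f u u"
begin

sublocale S: sip UNIV f
  by unfold_locales (simp, rule psd_sym, rule psd_lin, rule psd_nonneg)

abbreviation "nm \<equiv> S.nm"

lemmas add_left = S.add_left[simplified] and add_right = S.add_right[simplified]
  and diff_left = S.diff_left[simplified] and diff_right = S.diff_right[simplified]
  and scale_left = S.scale_left[simplified] and scale_right = S.scale_right[simplified]
  and minus_left = S.minus_left[simplified] and minus_right = S.minus_right[simplified]
  and zero_left = S.zero_left[simplified] and zero_right = S.zero_right[simplified]
  and sum_left = S.sum_left[simplified] and sum_right = S.sum_right[simplified]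
  and nm_sq = S.nm_sq[simplified] and Cauchy_Schwarz = S.Cauchy_Schwarz[simplified]
  and nm_triangle = S.nm_triangle[simplified] and nm_triangle_diff = S.nm_triangle_diff[simplified]
  and nm_scale = S.nm_scale[simplified] and nm_minus = S.nm_minus[simplified]
  and nm_sum = S.nm_sum[simplified] and nm_zero = S.nm_zero

lemma nm_nonneg [simp]: "0 \<le> nm u"
  by simp

lemmas expand = add_left add_right diff_left diff_right scale_left scale_right

lemma nm_reverse: "nm u - nm v \<le> nm (u + v)"
  using nm_triangle[of "u + v" "- v"] by (simp add: nm_minus)

end

text \<open>Sums a form over the index set. Applied twice to multiplication of reals it yields the
  Frobenius product, so vectors, matrices and tuples share one norm theory.\<close>

definition tform :: "nat set \<Rightarrow> ('v \<Rightarrow> 'v \<Rightarrow> real) \<Rightarrow> (nat \<Rightarrow> 'v) \<Rightarrow> (nat \<Rightarrow> 'v) \<Rightarrow> real" where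
  "tform I f U W = (\<Sum>i\<in>I. f (U i) (W i))"

lemma psd_tform:
  assumes "psd_form f" shows "psd_form (tform I f)"
proof -
  interpret psd_form f by fact
  show ?thesis
    by unfold_locales
       (auto simp: tform_def psd_lin sum.distrib sum_distrib_left psd_nonneg intro: sum_nonneg sum.cong psd_sym)
qed

lemma psd_times: "psd_form ((*) :: real \<Rightarrow> real \<Rightarrow> real)"
  by unfold_locales (auto simp: algebra_simps)

text \<open>The product \<open>UA\<close>, set to 0 outside \<open>I\<close> so that equations
  between tuples are equalities of functions on all indices.\<close>

definition tm :: "nat set \<Rightarrow> (nat \<Rightarrow> 'v::real_vector) \<Rightarrow> (nat \<Rightarrow> nat \<Rightarrow> real) \<Rightarrow> nat \<Rightarrow> 'v" where
  "tm I U A = (\<lambda>j. if j \<in> I then \<Sum>i\<in>I. A i j *\<^sub>R U i else 0)"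

text \<open>A tuple viewed as a linear map on coefficient vectors; its range is the span on which
  the slope is measured.\<close>

definition ap :: "nat set \<Rightarrow> (nat \<Rightarrow> 'v::real_vector) \<Rightarrow> (nat \<Rightarrow> real) \<Rightarrow> 'v" where
  "ap I U \<xi> = (\<Sum>i\<in>I. \<xi> i *\<^sub>R U i)"

definition mm :: "nat set \<Rightarrow> (nat \<Rightarrow> nat \<Rightarrow> real) \<Rightarrow> (nat \<Rightarrow> nat \<Rightarrow> real) \<Rightarrow> nat \<Rightarrow> nat \<Rightarrow> real" where
  "mm I A B = (\<lambda>i j. \<Sum>k\<in>I. A i k * B k j)"

definition mv :: "nat set \<Rightarrow> (nat \<Rightarrow> nat \<Rightarrow> real) \<Rightarrow> (nat \<Rightarrow> real) \<Rightarrow> nat \<Rightarrow> real" where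
  "mv I A \<xi> = (\<lambda>i. if i \<in> I then \<Sum>j\<in>I. A i j * \<xi> j else 0)"

definition gr :: "('v \<Rightarrow> 'v \<Rightarrow> real) \<Rightarrow> (nat \<Rightarrow> 'v) \<Rightarrow> (nat \<Rightarrow> 'v) \<Rightarrow> nat \<Rightarrow> nat \<Rightarrow> real" where
  "gr b U W = (\<lambda>i j. b (U i) (W j))"

definition mid :: "nat set \<Rightarrow> nat \<Rightarrow> nat \<Rightarrow> real" where
  "mid I = (\<lambda>i j. if i = j \<and> i \<in> I then 1 else 0)"

lemma tm_add_left: "tm I (U + W) A = tm I U A + tm I W A"
  by (auto simp: tm_def fun_eq_iff scaleR_add_right sum.distrib)

lemma tm_diff_left: "tm I (U - W) A = tm I U A - tm I W A"
  by (auto simp: tm_def fun_eq_iff scaleR_diff_right sum_subtractf)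

lemma tm_scale_left: "tm I (c *\<^sub>R U) A = c *\<^sub>R tm I U A"
  by (auto simp: tm_def fun_eq_iff scaleR_sum_right intro: sum.cong)

lemma tm_add_right: "tm I U (A + B) = tm I U A + tm I U B"
  by (auto simp: tm_def fun_eq_iff scaleR_add_left sum.distrib)

lemma tm_diff_right: "tm I U (A - B) = tm I U A - tm I U B"
  by (auto simp: tm_def fun_eq_iff scaleR_diff_left sum_subtractf)

lemma tm_scale_right: "tm I U (c *\<^sub>R A) = c *\<^sub>R tm I U A"
  by (auto simp: tm_def fun_eq_iff scaleR_sum_right intro: sum.cong)

lemma tm_mid: "finite I \<Longrightarrow> (\<And>i. i \<notin> I \<Longrightarrow> U i = 0) \<Longrightarrow> tm I U (mid I) = U"
proof
  fix j assume *: "finite I" "\<And>i. i \<notin> I \<Longrightarrow> U i = 0"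
  have "(\<Sum>i\<in>I. mid I i j *\<^sub>R U i) = (\<Sum>i\<in>I. if i = j then U i else 0)"
    by (intro sum.cong) (auto simp: mid_def)
  then show "tm I U (mid I) j = U j" using * by (simp add: tm_def)
qed

lemma ap_add: "ap I (U + W) \<xi> = ap I U \<xi> + ap I W \<xi>"
  by (simp add: ap_def scaleR_add_right sum.distrib)

lemma ap_diff: "ap I (U - W) \<xi> = ap I U \<xi> - ap I W \<xi>"
  by (simp add: ap_def scaleR_diff_right sum_subtractf)

lemma ap_scale: "ap I (c *\<^sub>R U) \<xi> = c *\<^sub>R ap I U \<xi>"
  by (simp add: ap_def scaleR_sum_right mult.commute)

lemma ap_diff_right: "ap I U (\<xi> - \<eta>) = ap I U \<xi> - ap I U \<eta>"
  by (simp add: ap_def scaleR_diff_left sum_subtractf)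

lemma ap_scale_right: "ap I U (c *\<^sub>R \<xi>) = c *\<^sub>R ap I U \<xi>"
  by (simp add: ap_def scaleR_sum_right)

lemma ap_tm: "ap I (tm I U A) \<xi> = ap I U (mv I A \<xi>)"
proof -
  have "ap I (tm I U A) \<xi> = (\<Sum>j\<in>I. \<Sum>i\<in>I. (A i j * \<xi> j) *\<^sub>R U i)"
    by (simp add: ap_def tm_def scaleR_sum_right mult.commute)
  also have "\<dots> = (\<Sum>i\<in>I. \<Sum>j\<in>I. (A i j * \<xi> j) *\<^sub>R U i)" by (rule sum.swap)
  also have "\<dots> = ap I U (mv I A \<xi>)" by (simp add: ap_def mv_def scaleR_sum_left)
  finally show ?thesis .
qed

lemma tm_eq_ap: "j \<in> I \<Longrightarrow> tm I U A j = ap I U (\<lambda>i. A i j)"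
  by (simp add: tm_def ap_def)

abbreviation "vdot I \<equiv> tform I ((*) :: real \<Rightarrow> real \<Rightarrow> real)"
abbreviation "mdot I \<equiv> tform I (vdot I)"

interpretation VD: psd_form "vdot I" for I by (intro psd_tform psd_times)
interpretation MD: psd_form "mdot I" for I by (intro psd_tform psd_times)

lemma vdot_self: "vdot I \<xi> \<xi> = (\<Sum>i\<in>I. (\<xi> i)^2)"
  by (simp add: tform_def power2_eq_square)

lemma mdot_self: "mdot I A A = (\<Sum>i\<in>I. \<Sum>j\<in>I. (A i j)^2)"
  by (simp add: tform_def power2_eq_square)

lemma mdot_self': "mdot I A A = (\<Sum>i\<in>I. (VD.nm I (A i))^2)"
  by (simp add: tform_def VD.nm_sq)

lemma mdot_transpose: "mdot I (\<lambda>i j. A j i) (\<lambda>i j. B j i) = mdot I A B"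
  by (simp add: tform_def) (rule sum.swap)

lemma mdot_cols: "mdot I A A = (\<Sum>j\<in>I. (VD.nm I (\<lambda>i. A i j))^2)"
  using mdot_self'[of I "\<lambda>i j. A j i"] mdot_transpose[of I A A] by simp

lemma mnm_transpose: "MD.nm I (\<lambda>i j. A j i) = MD.nm I A"
  unfolding MD.S.nm_def by (simp only: mdot_transpose[of I A A])

section \<open>Norm bounds for products of tuples and matrices\<close>

context psd_form
begin

interpretation T: psd_form "tform I f" for I by (intro psd_tform) unfold_locales

lemma tnm_sq: "(T.nm I U)^2 = (\<Sum>i\<in>I. (nm (U i))^2)"
  by (simp add: T.nm_sq tform_def nm_sq)

lemma nm_ap: "nm (ap I U \<xi>) \<le> T.nm I U * VD.nm I \<xi>"
proof -
  have "nm (ap I U \<xi>) \<le> (\<Sum>i\<in>I. \<bar>\<xi> i\<bar> * nm (U i))"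
    unfolding ap_def using nm_sum[of "\<lambda>i. \<xi> i *\<^sub>R U i" I] by (simp add: nm_scale)
  also have "\<dots> = vdot I (\<lambda>i. \<bar>\<xi> i\<bar>) (\<lambda>i. nm (U i))" by (simp add: tform_def)
  also have "\<dots> \<le> VD.nm I (\<lambda>i. \<bar>\<xi> i\<bar>) * VD.nm I (\<lambda>i. nm (U i))"
    using VD.Cauchy_Schwarz[of I "\<lambda>i. \<bar>\<xi> i\<bar>" "\<lambda>i. nm (U i)"] by simp
  also have "VD.nm I (\<lambda>i. \<bar>\<xi> i\<bar>) = VD.nm I \<xi>" by (simp add: VD.S.nm_def tform_def)
  also have "VD.nm I (\<lambda>i. nm (U i)) = T.nm I U"
    by (simp add: VD.S.nm_def T.S.nm_def tform_def nm_sq flip: power2_eq_square)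
  finally show ?thesis by (simp add: mult.commute)
qed

lemma tnm_tm: "T.nm I (tm I U A) \<le> T.nm I U * MD.nm I A"
proof (rule power2_le_imp_le)
  have "(T.nm I (tm I U A))^2 = (\<Sum>j\<in>I. (nm (ap I U (\<lambda>i. A i j)))^2)"
    by (simp add: tnm_sq tm_eq_ap)
  also have "\<dots> \<le> (\<Sum>j\<in>I. (T.nm I U * VD.nm I (\<lambda>i. A i j))^2)"
    by (intro sum_mono power_mono nm_ap) simp
  also have "\<dots> = (T.nm I U)^2 * (\<Sum>j\<in>I. (VD.nm I (\<lambda>i. A i j))^2)"
    by (simp add: power_mult_distrib sum_distrib_left)
  also have "(\<Sum>j\<in>I. (VD.nm I (\<lambda>i. A i j))^2) = (MD.nm I A)^2"
    by (simp add: MD.nm_sq mdot_cols)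
  finally show "(T.nm I (tm I U A))^2 \<le> (T.nm I U * MD.nm I A)^2" by (simp add: power_mult_distrib)
qed simp

lemma mnm_gr: "MD.nm I (gr f U W) \<le> T.nm I U * T.nm I W"
proof (rule power2_le_imp_le)
  have "(MD.nm I (gr f U W))^2 = (\<Sum>i\<in>I. \<Sum>j\<in>I. (f (U i) (W j))^2)"
    by (simp add: MD.nm_sq mdot_self gr_def)
  also have "\<dots> \<le> (\<Sum>i\<in>I. \<Sum>j\<in>I. (nm (U i))^2 * (nm (W j))^2)"
    by (intro sum_mono) (simp add: nm_sq S.Cauchy_Schwarz_sq)
  also have "\<dots> = (T.nm I U)^2 * (T.nm I W)^2"
    by (simp add: tnm_sq sum_product)
  finally show "(MD.nm I (gr f U W))^2 \<le> (T.nm I U * T.nm I W)^2" by (simp add: power_mult_distrib)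
qed simp

lemma gr_add_left: "gr f (U + W) Z = gr f U Z + gr f W Z"
  and gr_add_right: "gr f Z (U + W) = gr f Z U + gr f Z W"
  and gr_diff_left: "gr f (U - W) Z = gr f U Z - gr f W Z"
  and gr_diff_right: "gr f Z (U - W) = gr f Z U - gr f Z W"
  and gr_scale_left: "gr f (c *\<^sub>R U) Z = c *\<^sub>R gr f U Z"
  and gr_scale_right: "gr f Z (c *\<^sub>R U) = c *\<^sub>R gr f Z U"
  by (simp_all add: gr_def fun_eq_iff expand)

lemma f_ap_ap: "f (ap I U \<xi>) (ap I W \<zeta>) = vdot I \<xi> (mv I (gr f U W) \<zeta>)"
proof -
  have 1: "f (ap I U \<xi>) w = (\<Sum>i\<in>I. \<xi> i * f (U i) w)" for w
    by (simp add: ap_def sum_left scale_left)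
  have 2: "f u (ap I W \<zeta>) = (\<Sum>j\<in>I. f u (W j) * \<zeta> j)" for u
    by (simp add: ap_def sum_right scale_right mult.commute)
  show ?thesis
    unfolding 1[of "ap I W \<zeta>"] 2[of "U i" for i] by (simp add: tform_def mv_def gr_def)
qed

end

lemma vnm_mv: "VD.nm I (mv I A \<xi>) \<le> MD.nm I A * VD.nm I \<xi>"
proof (rule power2_le_imp_le)
  have "(VD.nm I (mv I A \<xi>))^2 = (\<Sum>i\<in>I. (vdot I (A i) \<xi>)^2)"
    unfolding VD.nm_sq vdot_self by (simp add: mv_def tform_def)
  also have "\<dots> \<le> (\<Sum>i\<in>I. (VD.nm I (A i))^2 * (VD.nm I \<xi>)^2)"
    by (intro sum_mono) (simp add: VD.nm_sq VD.S.Cauchy_Schwarz_sq)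
  also have "\<dots> = (MD.nm I A * VD.nm I \<xi>)^2"
    by (simp add: MD.nm_sq mdot_self' power_mult_distrib sum_distrib_right)
  finally show "(VD.nm I (mv I A \<xi>))^2 \<le> (MD.nm I A * VD.nm I \<xi>)^2" .
qed simp

lemma mnm_mm: "MD.nm I (mm I A B) \<le> MD.nm I A * MD.nm I B"
proof (rule power2_le_imp_le)
  have "(MD.nm I (mm I A B))^2 = (\<Sum>j\<in>I. (VD.nm I (mv I A (\<lambda>k. B k j)))^2)"
    unfolding MD.nm_sq mdot_cols by (intro sum.cong refl arg_cong[where f="\<lambda>x. x^2"])
      (simp add: VD.S.nm_def tform_def mm_def mv_def)
  also have "\<dots> \<le> (\<Sum>j\<in>I. (MD.nm I A * VD.nm I (\<lambda>k. B k j))^2)"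
    by (intro sum_mono power_mono vnm_mv) simp
  also have "\<dots> = (MD.nm I A * MD.nm I B)^2"
    by (simp add: power_mult_distrib MD.nm_sq mdot_cols[of I B] sum_distrib_left)
  finally show "(MD.nm I (mm I A B))^2 \<le> (MD.nm I A * MD.nm I B)^2" .
qed simp

lemma mv_add: "mv I (A + B) \<xi> = mv I A \<xi> + mv I B \<xi>"
  by (auto simp: mv_def fun_eq_iff algebra_simps sum.distrib)

lemma mv_diff: "mv I (A - B) \<xi> = mv I A \<xi> - mv I B \<xi>"
  by (auto simp: mv_def fun_eq_iff algebra_simps sum_subtractf)

lemma mv_scale: "mv I (c *\<^sub>R A) \<xi> = c *\<^sub>R mv I A \<xi>"
  by (auto simp: mv_def fun_eq_iff sum_distrib_left mult.assoc)

lemma mv_mm: "mv I (mm I A B) \<xi> = mv I A (mv I B \<xi>)"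
proof
  fix i
  have "(\<Sum>j\<in>I. (\<Sum>k\<in>I. A i k * B k j) * \<xi> j) = (\<Sum>j\<in>I. \<Sum>k\<in>I. A i k * (B k j * \<xi> j))"
    by (simp add: sum_distrib_right mult.assoc)
  also have "\<dots> = (\<Sum>k\<in>I. \<Sum>j\<in>I. A i k * (B k j * \<xi> j))" by (rule sum.swap)
  finally show "mv I (mm I A B) \<xi> i = mv I A (mv I B \<xi>) i"
    by (simp add: mv_def mm_def sum_distrib_left)
qed

lemma mv_mid: "finite I \<Longrightarrow> i \<in> I \<Longrightarrow> mv I (mid I) \<xi> i = \<xi> i"
proof -
  assume *: "finite I" "i \<in> I"
  have "(\<Sum>j\<in>I. mid I i j * \<xi> j) = (\<Sum>j\<in>I. if j = i then \<xi> j else 0)"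
    using * by (intro sum.cong) (auto simp: mid_def)
  then show ?thesis using * by (simp add: mv_def)
qed

lemma vdot_mv_sym: "(\<And>i j. A i j = A j i) \<Longrightarrow> vdot I \<xi> (mv I A \<zeta>) = vdot I (mv I A \<xi>) \<zeta>"
proof -
  assume A: "\<And>i j. A i j = A j i"
  have "vdot I \<xi> (mv I A \<zeta>) = (\<Sum>i\<in>I. \<Sum>j\<in>I. \<xi> i * (A i j * \<zeta> j))"
    by (simp add: tform_def mv_def sum_distrib_left)
  also have "\<dots> = (\<Sum>j\<in>I. \<Sum>i\<in>I. \<xi> i * (A i j * \<zeta> j))" by (rule sum.swap)
  also have "\<dots> = vdot I (mv I A \<xi>) \<zeta>"
    using A by (simp add: tform_def mv_def sum_distrib_right mult.assoc mult.left_commute)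
  finally show ?thesis .
qed

lemma vdot_mv_le: "\<bar>vdot I \<xi> (mv I A \<xi>)\<bar> \<le> MD.nm I A * (VD.nm I \<xi>)^2"
proof -
  have "\<bar>vdot I \<xi> (mv I A \<xi>)\<bar> \<le> VD.nm I \<xi> * VD.nm I (mv I A \<xi>)" by (rule VD.Cauchy_Schwarz)
  also have "\<dots> \<le> VD.nm I \<xi> * (MD.nm I A * VD.nm I \<xi>)" by (intro mult_left_mono vnm_mv) simp
  finally show ?thesis by (simp add: power2_eq_square ac_simps)
qed

section \<open>The spectral setting\<close>


declare One_nat_def [simp del]

lemma square_cancel: "0 \<le> (x::real) \<Longrightarrow> 0 \<le> y \<Longrightarrow> x * x \<le> y * x \<Longrightarrow> x \<le> y"
  by (cases "x = 0") (auto simp: mult_le_cancel_right)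

text \<open>All that the dynamics sees of the operator: the first \<open>N\<close> eigenpairs and
  the inequality \<open>gap\<close> on their complement. Both forms may be degenerate;
  \<open>aG\<close> determines \<open>G\<close> only up to null vectors, hence linearity is an
  assumption.\<close>

locale spectral = A: psd_form a + B: psd_form b for a b :: "'v::real_vector \<Rightarrow> 'v \<Rightarrow> real" +
  fixes G :: "'v \<Rightarrow> 'v" and N :: nat and l :: "nat \<Rightarrow> real" and v :: "nat \<Rightarrow> 'v"
  assumes G_lin: "G (u + c *\<^sub>R w) = G u + c *\<^sub>R G w"
    and aG: "a (G u) w = b u w"
    and N1: "1 \<le> N"
    and av: "k \<in> {1..N} \<Longrightarrow> a (v k) u = l k * b (v k) u"
    and bv: "j \<in> {1..N} \<Longrightarrow> k \<in> {1..N} \<Longrightarrow> b (v j) (v k) = (if j = k then 1 else 0)"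
    and l_pos: "0 < l 1"
    and l_mono: "k \<in> {1..N} \<Longrightarrow> l 1 \<le> l k \<and> l k \<le> l N"
    and l_gap: "l N < l (N+1)"
    and gap: "(\<And>k. k \<in> {1..N} \<Longrightarrow> b (v k) y = 0) \<Longrightarrow> l (N+1) * b y y \<le> a y y"
begin

abbreviation "I \<equiv> {1..N}"

lemma l_pos': "k \<in> I \<Longrightarrow> 0 < l k" "0 < l N" "0 < l (N+1)" "l 1 \<le> l N"
proof -
  show "k \<in> I \<Longrightarrow> 0 < l k" using l_mono[of k] l_pos by simp
  show "l 1 \<le> l N" using l_mono[of N] N1 by simp
  then show "0 < l N" "0 < l (N+1)" using l_pos l_gap by auto
qed

lemma G_add: "G (u + w) = G u + G w"
  using G_lin[of u 1 w] by simp

lemma G_zero [simp]: "G 0 = 0"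
  using G_add[of 0 0] by simp

lemma G_scale: "G (c *\<^sub>R w) = c *\<^sub>R G w"
  using G_lin[of 0 c w] by simp

lemma G_diff: "G (u - w) = G u - G w"
  using G_lin[of u "-1" w] by simp

lemma G_sum: "G (sum h J) = (\<Sum>i\<in>J. G (h i))"
  by (induction J rule: infinite_finite_induct) (auto simp: G_add)

lemma bG: "b (G u) w = b u (G w)"
  using aG[of w "G u"] aG[of u "G w"] A.psd_sym[of "G u" "G w"] B.psd_sym[of w "G u"] by simp

lemma aG_right: "a w (G u) = b w u"
  using aG[of u w] A.psd_sym[of w "G u"] B.psd_sym[of u w] by simp

text \<open>\<open>pr\<close> projects onto the eigenspace and \<open>yy\<close> is the remainder.
  \<open>PX\<close> measures the first in \<open>b\<close>, \<open>PY\<close> the second in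
  \<open>a\<close>; the ratio of these two seminorms is the slope.\<close>

definition xc :: "nat \<Rightarrow> 'v \<Rightarrow> real" where "xc k u = b (v k) u"
definition pr :: "'v \<Rightarrow> 'v" where "pr u = (\<Sum>k\<in>I. xc k u *\<^sub>R v k)"
definition yy :: "'v \<Rightarrow> 'v" where "yy u = u - pr u"
definition PX :: "'v \<Rightarrow> 'v \<Rightarrow> real" where "PX u w = (\<Sum>k\<in>I. xc k u * xc k w)"
definition PY :: "'v \<Rightarrow> 'v \<Rightarrow> real" where "PY u w = a (yy u) (yy w)"

lemma xc_lin: "xc k (u + c *\<^sub>R w) = xc k u + c * xc k w"
  by (simp add: xc_def B.expand)

lemma xc_add: "xc k (u + w) = xc k u + xc k w" and xc_diff: "xc k (u - w) = xc k u - xc k w"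
  and xc_scale: "xc k (c *\<^sub>R w) = c * xc k w"
  by (simp_all add: xc_def B.expand)

lemma pr_lin: "pr (u + c *\<^sub>R w) = pr u + c *\<^sub>R pr w"
  by (simp add: pr_def xc_lin scaleR_add_left sum.distrib scaleR_sum_right)

lemma yy_lin: "yy (u + c *\<^sub>R w) = yy u + c *\<^sub>R yy w"
  by (simp add: yy_def pr_lin scaleR_diff_right)

lemma xc_pr: "k \<in> I \<Longrightarrow> xc k (pr u) = xc k u"
proof -
  assume k: "k \<in> I"
  have "xc k (pr u) = (\<Sum>j\<in>I. if j = k then xc j u else 0)"
    unfolding pr_def xc_def[of k] B.sum_right by (intro sum.cong) (auto simp: B.scale_right bv[OF k])
  then show ?thesis using k by simp
qed

lemma xc_yy: "k \<in> I \<Longrightarrow> xc k (yy u) = 0"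
  by (simp add: yy_def xc_diff xc_pr)

lemma a_pr: "a (pr u) w = (\<Sum>k\<in>I. l k * xc k u * xc k w)"
  unfolding pr_def A.sum_left by (intro sum.cong) (auto simp: A.scale_left av xc_def)

lemma b_pr: "b (pr u) w = PX u w"
  unfolding pr_def B.sum_left PX_def by (intro sum.cong) (auto simp: B.scale_left xc_def)

lemma a_decomp: "a u w = (\<Sum>k\<in>I. l k * xc k u * xc k w) + PY u w"
proof -
  have 1: "a (pr u) (yy w) = 0" for u w using a_pr[of u "yy w"] by (simp add: xc_yy)
  have 2: "a (pr u) (pr w) = (\<Sum>k\<in>I. l k * xc k u * xc k w)" unfolding a_pr by (simp add: xc_pr)
  have "a u w = a (yy u + pr u) (yy w + pr w)" by (simp add: yy_def)
  also have "\<dots> = PY u w + a (pr u) (pr w)"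
    using 1[of u w] 1[of w u] A.psd_sym[of "yy u" "pr w"] by (simp only: A.expand PY_def)
  finally show ?thesis using 2 by simp
qed

lemma b_decomp: "b u w = PX u w + b (yy u) (yy w)"
proof -
  have 1: "b (pr u) (yy w) = 0" for u w using b_pr[of u "yy w"] by (simp add: PX_def xc_yy)
  have 2: "b (pr u) (pr w) = PX u w" unfolding b_pr by (simp add: PX_def xc_pr)
  have "b u w = b (yy u + pr u) (yy w + pr w)" by (simp add: yy_def)
  also have "\<dots> = b (yy u) (yy w) + b (pr u) (pr w)"
    using 1[of u w] 1[of w u] B.psd_sym[of "yy u" "pr w"] by (simp only: B.expand)
  finally show ?thesis using 2 by simp
qed

sublocale PX: psd_form PX
  by unfold_locales (auto simp: PX_def xc_lin algebra_simps sum.distrib sum_distrib_left intro: sum_nonneg)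

sublocale PY: psd_form PY
proof unfold_locales
  show "PY u w = PY w u" for u w unfolding PY_def by (rule A.psd_sym)
  show "PY (u + c *\<^sub>R w) z = PY u z + c * PY w z" for u w z c by (simp add: PY_def yy_lin A.psd_lin)
  show "0 \<le> PY u u" for u by (simp add: PY_def A.psd_nonneg)
qed

sublocale TA: psd_form "tform I a" by (intro psd_tform) unfold_locales
sublocale TB: psd_form "tform I b" by (intro psd_tform) unfold_locales
sublocale TX: psd_form "tform I PX" by (intro psd_tform) unfold_locales
sublocale TY: psd_form "tform I PY" by (intro psd_tform) unfold_locales

lemma b_yy: "l (N+1) * b (yy u) (yy u) \<le> PY u u"
  unfolding PY_def by (rule gap) (simp add: xc_yy flip: xc_def)

lemma PX_le_b: "PX u u \<le> b u u"
  using b_decomp[of u u] B.psd_nonneg[of "yy u"] by simp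

lemma b_le: "b u u \<le> PX u u + PY u u / l (N+1)"
  using b_decomp[of u u] b_yy[of u] l_pos'(3) by (simp add: field_simps)

lemma PY_le_a: "PY u u \<le> a u u"
  using a_decomp[of u u] sum_nonneg[of I "\<lambda>k. l k * xc k u * xc k u"] l_pos'(1)
  by (simp add: mult.assoc less_imp_le)

lemma l1_PX: "l 1 * PX u u \<le> (\<Sum>k\<in>I. l k * xc k u * xc k u)"
  unfolding PX_def sum_distrib_left mult.assoc by (intro sum_mono mult_right_mono) (use l_mono in auto)

lemma lN_PX: "(\<Sum>k\<in>I. l k * xc k u * xc k u) \<le> l N * PX u u"
  unfolding PX_def sum_distrib_left mult.assoc by (intro sum_mono mult_right_mono) (use l_mono in auto)

lemma b_le_a: "l 1 * b u u \<le> a u u"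
proof -
  have "l 1 * b u u = l 1 * PX u u + l 1 * b (yy u) (yy u)" using b_decomp[of u u] by (simp add: algebra_simps)
  also have "l 1 * b (yy u) (yy u) \<le> l (N+1) * b (yy u) (yy u)"
    using l_pos'(4) l_gap B.psd_nonneg by (intro mult_right_mono) auto
  also have "\<dots> \<le> PY u u" by (rule b_yy)
  also have "l 1 * PX u u + PY u u \<le> a u u" using a_decomp[of u u] l1_PX[of u] by simp
  finally show ?thesis by simp
qed

lemma a_le: "a u u \<le> l N * PX u u + PY u u"
  using a_decomp[of u u] lN_PX[of u] by simp

text \<open>At least 1 and at least the reciprocal of every eigenvalue that occurs, so it bounds
  \<open>G\<close> and the passage from \<open>a\<close> to \<open>b\<close> at the same
  time.\<close>

definition g :: real where "g = 1 + 1 / l 1"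

lemma g1: "1 \<le> g"
  using l_pos by (simp add: g_def)

lemma inv_l1: "1 / l 1 \<le> g" "1 / l (N+1) \<le> g" "k \<in> I \<Longrightarrow> 1 / l k \<le> g"
proof -
  show 1: "1 / l 1 \<le> g" by (simp add: g_def)
  show "1 / l (N+1) \<le> g" using l_pos l_pos'(4) l_gap by (intro order_trans[OF _ 1] divide_left_mono) auto
  show "1 / l k \<le> g" if "k \<in> I" using l_pos l_mono[OF that] by (intro order_trans[OF _ 1] divide_left_mono) auto
qed

lemma b_le_ga: "b u u \<le> g^2 * a u u"
proof -
  have "b u u \<le> (1 / l 1) * a u u" using b_le_a[of u] l_pos by (simp add: field_simps)
  also have "\<dots> \<le> g^2 * a u u"
    using g1 inv_l1(1) by (intro mult_right_mono A.psd_nonneg) (simp add: power2_eq_square order_trans[OF _ mult_right_mono[of 1 g g]])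
  finally show ?thesis .
qed

lemma nb_le: "B.nm u \<le> g * A.nm u"
  using real_sqrt_le_mono[OF b_le_ga[of u]] g1 by (simp add: B.S.nm_def A.S.nm_def real_sqrt_mult)

lemma na_G: "A.nm (G u) \<le> g * A.nm u"
proof -
  have "(A.nm (G u))^2 = b u (G u)" by (simp add: A.nm_sq aG)
  also have "\<dots> \<le> B.nm u * B.nm (G u)" using B.Cauchy_Schwarz[of u "G u"] by linarith
  also have "B.nm u * B.nm (G u) \<le> (sqrt (1 / l 1) * A.nm u) * (sqrt (1 / l 1) * A.nm (G u))"
  proof (intro mult_mono)
    have *: "B.nm u \<le> sqrt (1 / l 1) * A.nm u" for u
      using real_sqrt_le_mono[of "b u u" "(1 / l 1) * a u u"] b_le_a[of u] l_pos
      by (simp add: B.S.nm_def A.S.nm_def real_sqrt_mult[symmetric] field_simps)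
    show "B.nm u \<le> sqrt (1 / l 1) * A.nm u" "B.nm (G u) \<le> sqrt (1 / l 1) * A.nm (G u)" by (rule *)+
  qed (use l_pos in auto)
  also have "\<dots> = (1 / l 1) * A.nm u * A.nm (G u)"
    using l_pos by (simp add: real_sqrt_divide)
  finally have "A.nm (G u) * A.nm (G u) \<le> (1 / l 1 * A.nm u) * A.nm (G u)" by (simp add: power2_eq_square)
  then have "A.nm (G u) \<le> 1 / l 1 * A.nm u"
    by (rule square_cancel[rotated 2]) (use l_pos in auto)
  also have "\<dots> \<le> g * A.nm u" by (intro mult_right_mono inv_l1) simp
  finally show ?thesis .
qed

lemma xc_G: "k \<in> I \<Longrightarrow> xc k (G u) = xc k u / l k"
  using av[of k "G u"] aG_right[of "v k" u] l_pos'(1)[of k] by (simp add: xc_def field_simps)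

text \<open>On the complement \<open>G\<close> has energy norm at most 1/\<open>l (N+1)\<close>:
  Cauchy-Schwarz for \<open>a (G y) (G y) = b y (G y)\<close>, with the gap applied to both factors.
  \<open>yy (G u)\<close> and \<open>G (yy u)\<close> agree up to the null vector
  \<open>z\<close>.\<close>

lemma PY_G: "PY.nm (G u) \<le> PY.nm u / l (N+1)"
proof -
  define y where "y = yy u"
  define z where "z = yy (G u) - G y"
  have y: "xc k y = 0" if "k \<in> I" for k using that by (simp add: y_def xc_yy)
  have az: "a z w = 0" for w
  proof -
    have "a (pr (G u)) w = PX u w"
      unfolding a_pr PX_def
    proof (intro sum.cong refl)
      fix k assume k: "k \<in> I"
      show "l k * xc k (G u) * xc k w = xc k u * xc k w" using l_pos'(1)[OF k] by (simp add: xc_G[OF k])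
    qed
    moreover have "a (G y) w = b u w - PX u w"
      by (simp add: aG y_def yy_def B.expand b_pr)
    ultimately show ?thesis by (simp add: z_def yy_def[of "G u"] A.expand aG)
  qed
  have "A.nm z = 0" by (simp add: A.S.nm_def az)
  moreover have "yy (G u) = G y + z" by (simp add: z_def)
  ultimately have 1: "PY.nm (G u) \<le> A.nm (G y)"
    using A.nm_triangle[of "G y" z] by (simp add: PY.S.nm_def PY_def A.S.nm_def)
  let ?L = "l (N+1)"
  have L: "?L > 0" by (rule l_pos')
  have gy: "?L * b y y \<le> a y y" by (rule gap) (simp add: y flip: xc_def)
  have gGy: "?L * b (G y) (G y) \<le> a (G y) (G y)" by (rule gap) (simp add: xc_G y flip: xc_def)
  have nb: "sqrt ?L * B.nm w \<le> A.nm w" if "?L * b w w \<le> a w w" for w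
    using real_sqrt_le_mono[OF that] by (simp add: B.S.nm_def A.S.nm_def real_sqrt_mult)
  have "?L * (A.nm (G y) * A.nm (G y)) = ?L * b y (G y)" by (simp add: A.nm_sq aG flip: power2_eq_square)
  also have "\<dots> \<le> ?L * (B.nm y * B.nm (G y))"
    using B.Cauchy_Schwarz[of y "G y"] L by (intro mult_left_mono) auto
  also have "\<dots> = (sqrt ?L * B.nm y) * (sqrt ?L * B.nm (G y))" using L by (simp add: algebra_simps)
  also have "\<dots> \<le> A.nm y * A.nm (G y)" by (intro mult_mono nb gy gGy) (use L in auto)
  finally have "(?L * A.nm (G y)) * A.nm (G y) \<le> A.nm y * A.nm (G y)" by simp
  then have "?L * A.nm (G y) \<le> A.nm y"
    using L A.nm_nonneg[of "G y"] A.nm_nonneg[of y]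
    by (cases "A.nm (G y) = 0") (auto simp: mult_le_cancel_right)
  moreover have "A.nm y = PY.nm u" by (simp add: PY.S.nm_def PY_def A.S.nm_def y_def)
  moreover have "?L * PY.nm (G u) \<le> ?L * A.nm (G y)" using 1 L by (intro mult_left_mono) auto
  ultimately have "PY.nm (G u) * ?L \<le> PY.nm u" by (simp add: mult.commute)
  then show ?thesis using L by (simp add: pos_le_divide_eq)
qed

lemma px_le_nb: "PX.nm u \<le> B.nm u"
  using real_sqrt_le_mono[OF PX_le_b[of u]] by (simp add: PX.S.nm_def B.S.nm_def)

lemma py_le_na: "PY.nm u \<le> A.nm u"
  using real_sqrt_le_mono[OF PY_le_a[of u]] by (simp add: PY.S.nm_def A.S.nm_def)

lemma px_G: "PX.nm (G u) \<le> g * PX.nm u"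
proof -
  have "PX (G u) (G u) \<le> (\<Sum>k\<in>I. (g * xc k u)^2)"
    unfolding PX_def power2_eq_square[symmetric]
  proof (rule sum_mono)
    fix k assume k: "k \<in> I"
    have "\<bar>xc k u / l k\<bar> \<le> \<bar>g * xc k u\<bar>"
      using mult_right_mono[OF inv_l1(3)[OF k] abs_ge_zero, of "xc k u"] l_pos'(1)[OF k] g1 by (simp add: abs_mult)
    then show "(xc k (G u))^2 \<le> (g * xc k u)^2" unfolding xc_G[OF k] abs_le_square_iff .
  qed
  also have "\<dots> = g^2 * PX u u" by (simp add: PX_def power2_eq_square sum_distrib_left ac_simps)
  finally show ?thesis using real_sqrt_le_mono[of "PX (G u) (G u)" "g^2 * PX u u"] g1
    by (simp add: PX.S.nm_def real_sqrt_mult)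
qed

text \<open>Coordinate \<open>k\<close> is multiplied by 1 + \<tau>/\<open>l k\<close>, which is at
  least 1 + \<tau>/\<open>l N\<close>. Together with \<open>py_growth\<close> this is the source of
  the slope contraction.\<close>

lemma px_growth: "\<tau> \<ge> 0 \<Longrightarrow> (1 + \<tau> / l N) * PX.nm u \<le> PX.nm (u + \<tau> *\<^sub>R G u)"
proof -
  assume \<tau>: "\<tau> \<ge> 0"
  have "(1 + \<tau> / l N)^2 * PX u u \<le> PX (u + \<tau> *\<^sub>R G u) (u + \<tau> *\<^sub>R G u)"
    unfolding PX_def sum_distrib_left
  proof (rule sum_mono)
    fix k assume k: "k \<in> I"
    have "1 + \<tau> / l N \<le> 1 + \<tau> / l k"
      using \<tau> l_mono[OF k] l_pos'(1)[OF k] by (auto intro!: divide_left_mono)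
    then have "(1 + \<tau> / l N)^2 \<le> (1 + \<tau> / l k)^2"
      using \<tau> l_pos' by (intro power_mono) (auto intro!: add_nonneg_nonneg divide_nonneg_nonneg less_imp_le)
    then have "(1 + \<tau> / l N)^2 * (xc k u * xc k u) \<le> (1 + \<tau> / l k)^2 * (xc k u * xc k u)"
      by (intro mult_right_mono) auto
    also have "\<dots> = xc k (u + \<tau> *\<^sub>R G u) * xc k (u + \<tau> *\<^sub>R G u)"
      using l_pos'(1)[OF k] by (simp add: xc_lin xc_G[OF k] power2_eq_square field_simps)
    finally show "(1 + \<tau> / l N)^2 * (xc k u * xc k u) \<le> xc k (u + \<tau> *\<^sub>R G u) * xc k (u + \<tau> *\<^sub>R G u)" .
  qed
  from real_sqrt_le_mono[OF this] show ?thesis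
    using \<tau> l_pos'(2) by (simp add: PX.S.nm_def real_sqrt_mult)
qed

lemma py_growth: "\<tau> \<ge> 0 \<Longrightarrow> PY.nm (u + \<tau> *\<^sub>R G u) \<le> (1 + \<tau> / l (N+1)) * PY.nm u"
  using PY.nm_triangle[of u "\<tau> *\<^sub>R G u"] mult_left_mono[OF PY_G[of u], of \<tau>]
  by (simp add: PY.nm_scale algebra_simps)

lemma bG_lower: "PX u u / l N \<le> b u (G u)"
proof -
  have "PX u u / l N \<le> (\<Sum>k\<in>I. l k * xc k (G u) * xc k (G u))"
    unfolding PX_def sum_divide_distrib
  proof (rule sum_mono)
    fix k assume k: "k \<in> I"
    have "xc k u * xc k u / l N \<le> xc k u * xc k u / l k"
      using l_mono[OF k] l_pos'(1)[OF k] by (intro divide_left_mono) auto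
    also have "\<dots> = l k * xc k (G u) * xc k (G u)" using l_pos'(1)[OF k] by (simp add: xc_G[OF k])
    finally show "xc k u * xc k u / l N \<le> l k * xc k (G u) * xc k (G u)" .
  qed
  also have "\<dots> \<le> a (G u) (G u)" using a_decomp[of "G u" "G u"] PY.psd_nonneg[of "G u"] by simp
  finally show ?thesis by (simp add: aG)
qed

definition GT :: "(nat \<Rightarrow> 'v) \<Rightarrow> nat \<Rightarrow> 'v" where "GT U = (\<lambda>i. G (U i))"

lemma GT_add: "GT (U + W) = GT U + GT W" and GT_diff: "GT (U - W) = GT U - GT W"
  and GT_scale: "GT (c *\<^sub>R U) = c *\<^sub>R GT U"
  by (auto simp: GT_def G_add G_diff G_scale)

lemma ap_GT: "ap J (GT U) \<xi> = G (ap J U \<xi>)"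
  by (simp add: ap_def GT_def G_sum G_scale)

lemma GT_nth [simp]: "GT U i = G (U i)" by (simp add: GT_def)

lemma tnm_mono:
  assumes "psd_form f" "psd_form h" "c \<ge> 0" "\<And>u. sip.nm f u \<le> c * sip.nm h u"
  shows "sip.nm (tform I f) U \<le> c * sip.nm (tform I h) U"
proof -
  interpret f: psd_form f by fact
  interpret h: psd_form h by fact
  interpret Tf: psd_form "tform I f" by (intro psd_tform) unfold_locales
  interpret Th: psd_form "tform I h" by (intro psd_tform) unfold_locales
  show ?thesis
  proof (rule power2_le_imp_le)
    have "(Tf.nm U)^2 = (\<Sum>i\<in>I. (f.nm (U i))^2)" by (rule f.tnm_sq)
    also have "\<dots> \<le> (\<Sum>i\<in>I. (c * h.nm (U i))^2)" by (intro sum_mono power_mono assms(4)) simp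
    also have "\<dots> = (c * Th.nm U)^2" by (simp add: power_mult_distrib sum_distrib_left h.tnm_sq)
    finally show "(Tf.nm U)^2 \<le> (c * Th.nm U)^2" .
  qed (rule mult_nonneg_nonneg[OF assms(3) Th.nm_nonneg])
qed

abbreviation "nA \<equiv> TA.nm" abbreviation "nB \<equiv> TB.nm" abbreviation "nX \<equiv> TX.nm" abbreviation "nY \<equiv> TY.nm"
abbreviation "fn \<equiv> MD.nm I" abbreviation "vn \<equiv> VD.nm I"

lemma psds: "psd_form a" "psd_form b" "psd_form PX" "psd_form PY" by unfold_locales

lemma nB_le: "nB U \<le> g * nA U"
  using tnm_mono[OF psds(2,1) _ nb_le] g1 by simp

lemma nX_le: "nX U \<le> nB U"
  using tnm_mono[OF psds(3,2), of 1] px_le_nb by simp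

lemma nY_le: "nY U \<le> nA U"
  using tnm_mono[OF psds(4,1), of 1] py_le_na by simp

lemma nA_GT: "nA (GT U) \<le> g * nA U"
proof (rule power2_le_imp_le)
  have "(nA (GT U))^2 = (\<Sum>i\<in>I. (A.nm (G (U i)))^2)" by (simp add: A.tnm_sq)
  also have "\<dots> \<le> (\<Sum>i\<in>I. (g * A.nm (U i))^2)" by (intro sum_mono power_mono na_G) simp
  also have "\<dots> = (g * nA U)^2" by (simp add: power_mult_distrib sum_distrib_left A.tnm_sq)
  finally show "(nA (GT U))^2 \<le> (g * nA U)^2" .
qed (use g1 in simp)

lemma nY_GT: "nY (GT U) \<le> g * nY U"
proof (rule power2_le_imp_le)
  have *: "PY.nm (G u) \<le> g * PY.nm u" for u
    using PY_G[of u] mult_right_mono[OF inv_l1(2), of "PY.nm u"] by simp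
  have "(nY (GT U))^2 = (\<Sum>i\<in>I. (PY.nm (G (U i)))^2)" by (simp add: PY.tnm_sq)
  also have "\<dots> \<le> (\<Sum>i\<in>I. (g * PY.nm (U i))^2)" by (intro sum_mono power_mono *) simp
  also have "\<dots> = (g * nY U)^2" by (simp add: power_mult_distrib sum_distrib_left PY.tnm_sq)
  finally show "(nY (GT U))^2 \<le> (g * nY U)^2" .
qed (use g1 in simp)

lemma nA_sq_le: "(nA U)^2 \<le> l N * (nX U)^2 + (nY U)^2"
proof -
  have "(nA U)^2 = (\<Sum>i\<in>I. a (U i) (U i))" by (simp add: A.tnm_sq A.nm_sq)
  also have "\<dots> \<le> (\<Sum>i\<in>I. l N * PX (U i) (U i) + PY (U i) (U i))" by (intro sum_mono a_le)
  also have "\<dots> = l N * (nX U)^2 + (nY U)^2"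
    by (simp add: PX.tnm_sq PX.nm_sq PY.tnm_sq PY.nm_sq sum.distrib sum_distrib_left)
  finally show ?thesis .
qed

text \<open>The share of a \<open>b\<close>-Gram matrix that comes from the complement. For the
  iterate itself it is quadratic in the slope.\<close>

definition Yg :: "(nat \<Rightarrow> 'v) \<Rightarrow> (nat \<Rightarrow> 'v) \<Rightarrow> nat \<Rightarrow> nat \<Rightarrow> real" where
  "Yg U W = (\<lambda>i j. b (yy (U i)) (yy (W j)))"

lemma fn_Yg: "fn (Yg U W) \<le> g * nY U * nY W"
proof -
  define f where "f u w = b (yy u) (yy w)" for u w
  have f: "psd_form f"
    by unfold_locales (auto simp: f_def yy_lin B.psd_lin B.psd_nonneg intro: B.psd_sym)
  interpret f: psd_form f by (rule f)
  have "f u u \<le> g * PY u u" for u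
  proof -
    have "f u u \<le> 1 / l (N+1) * PY u u" using b_yy[of u] l_pos'(3) by (simp add: f_def field_simps)
    also have "\<dots> \<le> g * PY u u" by (intro mult_right_mono inv_l1 PY.psd_nonneg)
    finally show ?thesis .
  qed
  then have *: "f.nm u \<le> sqrt g * PY.nm u" for u
    unfolding f.S.nm_def PY.S.nm_def real_sqrt_mult[symmetric] by (intro real_sqrt_le_mono)
  have "fn (gr f U W) \<le> sip.nm (tform I f) U * sip.nm (tform I f) W" by (rule f.mnm_gr)
  also have "\<dots> \<le> (sqrt g * nY U) * (sqrt g * nY W)"
    using g1 by (intro mult_mono tnm_mono[OF f psds(4) _ *])
      (auto intro: psd_form.nm_nonneg[OF psd_tform[OF f]])
  also have "\<dots> = g * nY U * nY W" using g1 by simp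
  finally show ?thesis by (simp add: gr_def f_def Yg_def)
qed

text \<open>Coordinates against the eigenvectors, with rows for eigenvectors and columns for tuple
  entries. Along the iteration this matrix converges to the orthogonal matrix of the
  theorem.\<close>

definition Xm :: "(nat \<Rightarrow> 'v) \<Rightarrow> nat \<Rightarrow> nat \<Rightarrow> real" where "Xm U = (\<lambda>k i. xc k (U i))"

lemma fn_Xm: "fn (Xm U) = nX U"
proof -
  have "(\<Sum>k\<in>I. \<Sum>i\<in>I. (xc k (U i))^2) = (\<Sum>i\<in>I. \<Sum>k\<in>I. (xc k (U i))^2)" by (rule sum.swap)
  then show ?thesis
    by (simp add: MD.S.nm_def TX.S.nm_def mdot_self Xm_def tform_def PX_def power2_eq_square)
qed

end

section \<open>Estimates at a single tuple\<close>

text \<open>Cyclicity of the trace: a left factor crosses the Frobenius product transposed. The next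
  lemma does the same for a right factor.\<close>

lemma mdot_mm_left: "mdot I A (mm I B C) = mdot I (mm I (\<lambda>i j. B j i) A) C"
proof -
  have "mdot I A (mm I B C) = (\<Sum>i\<in>I. \<Sum>j\<in>I. \<Sum>k\<in>I. A i j * (B i k * C k j))"
    by (simp add: tform_def mm_def sum_distrib_left)
  also have "\<dots> = (\<Sum>i\<in>I. \<Sum>k\<in>I. \<Sum>j\<in>I. A i j * (B i k * C k j))"
    by (intro sum.cong refl sum.swap)
  also have "\<dots> = (\<Sum>k\<in>I. \<Sum>i\<in>I. \<Sum>j\<in>I. A i j * (B i k * C k j))" by (rule sum.swap)
  also have "\<dots> = (\<Sum>k\<in>I. \<Sum>j\<in>I. \<Sum>i\<in>I. A i j * (B i k * C k j))"
    by (intro sum.cong refl sum.swap)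
  also have "\<dots> = mdot I (mm I (\<lambda>i j. B j i) A) C"
    by (simp add: tform_def mm_def sum_distrib_left sum_distrib_right ac_simps)
  finally show ?thesis .
qed

lemma mdot_mm_right: "mdot I A (mm I B C) = mdot I (mm I A (\<lambda>i j. C j i)) B"
proof -
  have "mdot I A (mm I B C) = (\<Sum>i\<in>I. \<Sum>j\<in>I. \<Sum>k\<in>I. A i j * (B i k * C k j))"
    by (simp add: tform_def mm_def sum_distrib_left)
  also have "\<dots> = (\<Sum>i\<in>I. \<Sum>k\<in>I. \<Sum>j\<in>I. A i j * (B i k * C k j))"
    by (intro sum.cong refl sum.swap)
  also have "\<dots> = mdot I (mm I A (\<lambda>i j. C j i)) B"
    by (simp add: tform_def mm_def sum_distrib_left sum_distrib_right ac_simps)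
  finally show ?thesis .
qed

lemma mm_assoc: "mm I (mm I A B) C = mm I A (mm I B C)"
proof (intro ext)
  fix i j
  have "(\<Sum>k\<in>I. (\<Sum>m\<in>I. A i m * B m k) * C k j) = (\<Sum>k\<in>I. \<Sum>m\<in>I. A i m * (B m k * C k j))"
    by (simp add: sum_distrib_right mult.assoc)
  also have "\<dots> = (\<Sum>m\<in>I. \<Sum>k\<in>I. A i m * (B m k * C k j))" by (rule sum.swap)
  finally show "mm I (mm I A B) C i j = mm I A (mm I B C) i j" by (simp add: mm_def sum_distrib_left)
qed

lemma mm_add_left: "mm I (A + B) C = mm I A C + mm I B C"
  and mm_add_right: "mm I C (A + B) = mm I C A + mm I C B"
  and mm_diff_left: "mm I (A - B) C = mm I A C - mm I B C"
  and mm_diff_right: "mm I C (A - B) = mm I C A - mm I C B"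
  and mm_scale_left: "mm I (c *\<^sub>R A) C = c *\<^sub>R mm I A C"
  and mm_scale_right: "mm I C (c *\<^sub>R A) = c *\<^sub>R mm I C A"
  by (auto simp: mm_def fun_eq_iff algebra_simps sum.distrib sum_subtractf sum_distrib_left)

lemma mdot_mid: "finite I \<Longrightarrow> mdot I A (mid I) = (\<Sum>i\<in>I. A i i)"
proof -
  assume "finite I"
  have "mdot I A (mid I) = (\<Sum>i\<in>I. \<Sum>j\<in>I. if i = j then A i j else 0)"
    unfolding tform_def by (intro sum.cong refl) (auto simp: mid_def)
  then show ?thesis using \<open>finite I\<close> by simp
qed

text \<open>The nonzero eigenvalues of \<open>X X\<^sup>T\<close> and \<open>X\<^sup>T X\<close> agree, in the form that avoids eigenvalues.\<close>
lemma mnm_gram_commute: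
  assumes "finite I"
  shows "MD.nm I (mm I X (\<lambda>i j. X j i) - mid I) = MD.nm I (mm I (\<lambda>i j. X j i) X - mid I)"
proof -
  let ?T = "\<lambda>i j. X j i"
  have 1: "mdot I (mm I X ?T) (mm I X ?T) = mdot I (mm I ?T X) (mm I ?T X)"
  proof -
    have "mdot I (mm I X ?T) (mm I X ?T) = mdot I (mm I ?T (mm I X ?T)) ?T"
      by (subst mdot_mm_left) simp
    also have "\<dots> = mdot I ?T (mm I (mm I ?T X) ?T)" by (simp add: MD.psd_sym mm_assoc)
    also have "\<dots> = mdot I (mm I ?T X) (mm I ?T X)" by (subst mdot_mm_right) simp
    finally show ?thesis .
  qed
  have 2: "mdot I (mm I X ?T) (mid I) = mdot I (mm I ?T X) (mid I)"
    unfolding mdot_mid[OF assms] mm_def by (subst sum.swap) simp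
  have "mdot I (A - mid I) (A - mid I) = mdot I A A - 2 * mdot I A (mid I) + mdot I (mid I) (mid I)" for A
    by (simp add: MD.expand MD.psd_sym[of I "mid I" A])
  then show ?thesis unfolding MD.S.nm_def using 1 2 by simp
qed

lemma mnm_cong: "(\<And>i j. i \<in> I \<Longrightarrow> j \<in> I \<Longrightarrow> A i j = B i j) \<Longrightarrow> MD.nm I A = MD.nm I B"
  by (simp add: MD.S.nm_def mdot_self)

lemma mnm_entry: "finite I \<Longrightarrow> i \<in> I \<Longrightarrow> j \<in> I \<Longrightarrow> \<bar>A i j\<bar> \<le> MD.nm I A"
proof -
  assume *: "finite I" "i \<in> I" "j \<in> I"
  have "(A i j)^2 \<le> (\<Sum>j\<in>I. (A i j)^2)" using * by (intro member_le_sum) auto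
  also have "\<dots> \<le> (\<Sum>i\<in>I. \<Sum>j\<in>I. (A i j)^2)"
    using * by (intro member_le_sum[of i I "\<lambda>i. \<Sum>j\<in>I. (A i j)^2"]) (auto intro: sum_nonneg)
  finally show ?thesis using real_sqrt_le_mono[of "(A i j)^2"] by (simp add: MD.S.nm_def mdot_self)
qed

lemma ap_unit: "finite I \<Longrightarrow> i \<in> I \<Longrightarrow> ap I U (\<lambda>j. if j = i then 1 else 0) = U i"
proof -
  assume *: "finite I" "i \<in> I"
  have "ap I U (\<lambda>j. if j = i then 1 else 0) = (\<Sum>j\<in>I. if j = i then U j else 0)"
    unfolding ap_def by (intro sum.cong) auto
  then show ?thesis using * by simp
qed

lemma vdot_mv_mid: "finite I \<Longrightarrow> vdot I \<xi> (mv I (mid I) \<xi>) = (VD.nm I \<xi>)^2"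
  unfolding VD.nm_sq tform_def by (intro sum.cong) (auto simp: mv_mid)

context spectral
begin

definition Aop :: "(nat \<Rightarrow> 'v) \<Rightarrow> (nat \<Rightarrow> 'v) \<Rightarrow> nat \<Rightarrow> 'v" where
  "Aop U W = tm I (GT U) (gr b U W) - tm I U (gr b U (GT W))"

lemma Aop_lin: "Aop U (W + s *\<^sub>R Z) = Aop U W + s *\<^sub>R Aop U Z"
  by (simp add: Aop_def GT_add GT_scale B.gr_add_right B.gr_scale_right tm_add_right tm_scale_right scaleR_diff_right)

lemma gr_G: "gr b (GT U) W = gr b U (GT W)"
  by (simp add: gr_def fun_eq_iff bG)

end

text \<open>All constants are absorbed into the single bound \<open>c\<close>, so that every estimate below is a power of \<open>c\<close> times
  \<open>m\<close>, \<open>R\<close> and the step size.\<close>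
locale state = spectral a b G N l v for a b :: "'v::real_vector \<Rightarrow> 'v \<Rightarrow> real" and G N l v +
  fixes c R :: real and U :: "nat \<Rightarrow> 'v"
  assumes c1: "1 \<le> c" and cg: "g \<le> c" and cN: "real N \<le> c" and clN: "l N \<le> c"
    and U0: "i \<notin> I \<Longrightarrow> U i = 0"
    and nAU: "nA U \<le> c"
    and R0: "0 \<le> R" and Rc: "R \<le> c"
    and cone: "PY.nm (ap I U \<xi>) \<le> R * PX.nm (ap I U \<xi>)"
    and low: "vn \<xi> \<le> c * PX.nm (ap I U \<xi>)"
begin

lemma c0 [simp]: "0 \<le> c" "0 < c" "0 \<le> c ^ n"
  using c1 by auto

lemma cp: "m \<le> n \<Longrightarrow> c ^ m \<le> c ^ n"
  by (rule power_increasing[OF _ c1])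

lemma nBc: "nB W \<le> c * nA W"
  by (rule order_trans[OF nB_le]) (intro mult_right_mono cg, simp)

lemma nAGc: "nA (GT W) \<le> c * nA W"
  by (rule order_trans[OF nA_GT]) (intro mult_right_mono cg, simp)

lemma nYGc: "nY (GT W) \<le> c * nY W"
  by (rule order_trans[OF nY_GT]) (intro mult_right_mono cg, simp)

lemma grc: "fn (gr b W Z) \<le> c^2 * nA W * nA Z"
proof -
  have "fn (gr b W Z) \<le> nB W * nB Z" by (rule B.mnm_gr)
  also have "\<dots> \<le> (c * nA W) * (c * nA Z)" by (intro mult_mono nBc) auto
  finally show ?thesis by (simp add: power2_eq_square ac_simps)
qed

lemma tmc: "nA W \<le> x \<Longrightarrow> fn A \<le> y \<Longrightarrow> nA (tm I W A) \<le> x * y"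
  by (rule order_trans[OF A.tnm_tm], rule mult_mono) (auto intro: order_trans[OF TA.nm_nonneg])

lemma grc': "nA W \<le> x \<Longrightarrow> nA Z \<le> y \<Longrightarrow> fn (gr b W Z) \<le> c^2 * x * y"
  by (rule order_trans[OF grc], intro mult_mono mult_nonneg_nonneg) (auto intro: order_trans[OF TA.nm_nonneg])

lemma nAGU: "nA (GT U) \<le> c^2"
  using order_trans[OF nAGc mult_left_mono[OF nAU c0(1)]] by (simp add: power2_eq_square)

abbreviation "P \<equiv> gr b U U"
abbreviation "K \<equiv> gr b U (GT U)"
abbreviation "M \<equiv> gr b U U - mid I"
abbreviation "F \<equiv> Aop U U"
abbreviation "H \<equiv> GT U - tm I U (gr b U (GT U))"
abbreviation "m \<equiv> fn M"
abbreviation "X \<equiv> Xm U"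
abbreviation "XT \<equiv> (\<lambda>i j. Xm U j i)"

lemma Aop_bound: "nA (Aop U W) \<le> 2 * c^5 * nA W"
proof -
  have 1: "nA (tm I (GT U) (gr b U W)) \<le> c^2 * (c^2 * c * nA W)"
    by (intro tmc nAGU grc' nAU order_refl)
  have 2: "nA (tm I U (gr b U (GT W))) \<le> c * (c^2 * c * (c * nA W))"
    by (intro tmc grc' nAU nAGc)
  have "nA (Aop U W) \<le> c^2 * (c^2 * c * nA W) + c * (c^2 * c * (c * nA W))"
    unfolding Aop_def using TA.nm_triangle_diff 1 2 by (meson add_mono order_trans)
  also have "\<dots> = 2 * c^5 * nA W" by algebra
  finally show ?thesis .
qed

lemma nAF: "nA F \<le> 2 * c^6"
proof -
  have "nA F \<le> 2 * c^5 * c" by (rule order_trans[OF Aop_bound]) (intro mult_left_mono nAU, simp)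
  also have "\<dots> = 2 * c^6" by algebra
  finally show ?thesis .
qed

lemma fnK: "fn K \<le> c^5"
proof -
  have "fn K \<le> c^2 * c * c^2" by (intro grc' nAU nAGU)
  also have "\<dots> = c^5" by algebra
  finally show ?thesis .
qed

lemma fnP: "fn P \<le> c^4"
proof -
  have "fn P \<le> c^2 * c * c" by (intro grc' nAU)
  also have "\<dots> = c^4" by algebra
  finally show ?thesis .
qed

lemma fn_mid: "fn (mid I) \<le> c"
proof (rule power2_le_imp_le)
  have "(fn (mid I))^2 = real N" by (simp add: MD.nm_sq mdot_mid) (simp add: mid_def)
  also have "\<dots> \<le> c * c" using cN mult_left_mono[OF c1 c0(1)] by linarith
  finally show "(fn (mid I))^2 \<le> c^2" by (simp add: power2_eq_square)
qed simp

lemma mle: "m \<le> 2 * c^4"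
proof -
  have "m \<le> fn P + fn (mid I)" by (rule MD.nm_triangle_diff)
  also have "\<dots> \<le> c^4 + c^1" using fnP fn_mid by simp
  also have "\<dots> \<le> c^4 + c^4" by (intro add_left_mono cp) simp
  finally show ?thesis by simp
qed

lemma K_sym: "K i j = K j i" "P i j = P j i" "M i j = M j i"
proof -
  show "K i j = K j i" using bG[of "U i" "U j"] by (simp add: gr_def B.psd_sym)
  show "P i j = P j i" by (simp add: gr_def B.psd_sym)
  then show "M i j = M j i" by (simp add: mid_def)
qed

section \<open>Gradient, Gram matrices and energy in eigencoordinates\<close>

lemma tm_GP: "tm I (GT U) P = GT U + tm I (GT U) M"
proof -
  have "tm I (GT U) P = tm I (GT U) (mid I + M)" by simp
  also have "\<dots> = GT U + tm I (GT U) M"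
    unfolding tm_add_right by (subst tm_mid) (auto simp: U0)
  finally show ?thesis .
qed

text \<open>The predictor field differs from the gradient \<open>H\<close> by a term with the defect
  \<open>M\<close>, and the corrector removes exactly this term to first order in the step
  size.\<close>

lemma F_eq: "F = H + tm I (GT U) M"
  unfolding Aop_def tm_GP by simp

lemma nXU: "nX U \<le> c^2"
proof -
  have "nX U \<le> c * nA U" using nX_le nBc order_trans by blast
  also have "\<dots> \<le> c * c" by (intro mult_left_mono nAU) simp
  finally show ?thesis by (simp add: power2_eq_square)
qed

lemma nYU: "nY U \<le> R * c^2"
proof -
  have "nY U \<le> R * nX U"
  proof (rule power2_le_imp_le)
    have u: "PY.nm (U i) \<le> R * PX.nm (U i)" if "i \<in> I" for i
      using cone[of "\<lambda>j. if j = i then 1 else 0"] that by (simp add: ap_unit)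
    have "(nY U)^2 = (\<Sum>i\<in>I. (PY.nm (U i))^2)" by (rule PY.tnm_sq)
    also have "\<dots> \<le> (\<Sum>i\<in>I. (R * PX.nm (U i))^2)" by (intro sum_mono power_mono u) auto
    also have "\<dots> = (R * nX U)^2" by (simp add: power_mult_distrib sum_distrib_left PX.tnm_sq)
    finally show "(nY U)^2 \<le> (R * nX U)^2" .
  qed (simp add: R0)
  also have "\<dots> \<le> R * c^2" by (intro mult_left_mono nXU R0)
  finally show ?thesis .
qed

lemma R2: "R^2 \<le> c * R"
  using mult_right_mono[OF Rc R0] by (simp add: power2_eq_square)

lemma nYU2: "nY U * nY U \<le> c^4 * R^2"
proof -
  have "nY U * nY U \<le> (R * c^2) * (R * c^2)" by (intro mult_mono nYU) (auto simp: R0)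
  also have "\<dots> = c^4 * R^2" by algebra
  finally show ?thesis .
qed

text \<open>The coordinate matrix is orthogonal up to the defect and a term quadratic in the
  slope.\<close>

lemma gram_split: "mm I XT X - mid I = M - Yg U U"
proof (intro ext)
  fix i j
  show "(mm I XT X - mid I) i j = (M - Yg U U) i j"
    using b_decomp[of "U i" "U j"] by (simp add: mm_def Xm_def Yg_def gr_def PX_def)
qed

lemma fnYg: "fn (Yg U U) \<le> c^5 * R^2"
proof -
  have "fn (Yg U U) \<le> g * (nY U * nY U)" using fn_Yg[of U U] by (simp add: mult.assoc)
  also have "\<dots> \<le> c * (c^4 * R^2)" using g1 by (intro mult_mono cg nYU2) auto
  also have "\<dots> = c^5 * R^2" by algebra
  finally show ?thesis .
qed

text \<open>The gradient and the energy depend on X X^T rather than X^T X;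
  \<open>mnm_gram_commute\<close> transfers the first bound to the second product.\<close>

lemma fnS: "fn (mm I XT X - mid I) \<le> m + c^5 * R^2" "fn (mm I X XT - mid I) \<le> m + c^5 * R^2"
proof -
  show 1: "fn (mm I XT X - mid I) \<le> m + c^5 * R^2"
    unfolding gram_split using MD.nm_triangle_diff fnYg by (meson add_left_mono order_trans)
  have fin: "finite I" by simp
  show "fn (mm I X XT - mid I) \<le> m + c^5 * R^2"
    using 1 mnm_gram_commute[OF fin, of X] by simp
qed

lemma c5R2: "c^5 * R^2 \<le> c^6 * R"
proof -
  have "c^5 * R^2 \<le> c^5 * (c * R)" by (intro mult_left_mono R2) simp
  also have "\<dots> = c^6 * R" by algebra
  finally show ?thesis .
qed

text \<open>The eigencoordinates of \<open>G U\<close>: row \<open>k\<close> of \<open>X\<close>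
  divided by \<open>l k\<close>. \<open>Ky\<close> is the complement's share of
  \<open>K\<close>.\<close>

definition Lx :: "nat \<Rightarrow> nat \<Rightarrow> real" where "Lx = (\<lambda>k i. if k \<in> I then X k i / l k else 0)"
definition Ky :: "nat \<Rightarrow> nat \<Rightarrow> real" where "Ky = Yg U (GT U)"

lemma K_split: "K = mm I XT Lx + Ky"
proof (intro ext)
  fix i j
  have "PX (U i) (G (U j)) = mm I XT Lx i j"
    unfolding PX_def mm_def by (intro sum.cong refl) (auto simp: Lx_def Xm_def xc_G)
  then show "K i j = (mm I XT Lx + Ky) i j"
    using b_decomp[of "U i" "G (U j)"] by (simp add: gr_def Ky_def Yg_def)
qed

lemma fnKy: "fn Ky \<le> c^6 * R^2"
proof -
  have "fn Ky \<le> g * (nY U * nY (GT U))" unfolding Ky_def using fn_Yg[of U "GT U"] by (simp add: mult.assoc)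
  also have "\<dots> \<le> c * (nY U * (c * nY U))" using g1 by (intro mult_mono cg nYGc) auto
  also have "\<dots> = c^2 * (nY U * nY U)" by algebra
  also have "\<dots> \<le> c^2 * (c^4 * R^2)" by (intro mult_left_mono nYU2) simp
  also have "\<dots> = c^6 * R^2" by algebra
  finally show ?thesis .
qed

lemma fnLx: "fn Lx \<le> c^3"
proof -
  have "fn Lx \<le> c * fn X"
  proof (rule power2_le_imp_le)
    have "(fn Lx)^2 \<le> (\<Sum>k\<in>I. \<Sum>i\<in>I. (c * X k i)^2)"
      unfolding MD.nm_sq mdot_self
    proof (intro sum_mono)
      fix k i assume k: "k \<in> I" and i: "i \<in> I"
      have "1 / l k \<le> c" using inv_l1(3)[OF k] cg by linarith
      then have "\<bar>Lx k i\<bar> \<le> \<bar>c * X k i\<bar>"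
        using mult_right_mono[of "1 / l k" c "\<bar>X k i\<bar>"] k l_pos'(1)[OF k] by (simp add: Lx_def abs_mult)
      then show "(Lx k i)^2 \<le> (c * X k i)^2" unfolding abs_le_square_iff .
    qed
    also have "\<dots> = (c * fn X)^2"
      by (simp add: power_mult_distrib MD.nm_sq mdot_self sum_distrib_left)
    finally show "(fn Lx)^2 \<le> (c * fn X)^2" .
  qed simp
  also have "\<dots> \<le> c * c^2" unfolding fn_Xm by (intro mult_left_mono nXU) simp
  also have "\<dots> = c^3" by algebra
  finally show ?thesis .
qed

text \<open>In coordinates \<open>H\<close> equals (I - X X^T) Lx - X Ky. The first term is small
  because X X^T is near the identity, the second because \<open>Ky\<close> is quadratic in
  \<open>R\<close>.\<close>

lemma nXH: "nX H \<le> c^3 * m + 2 * c^9 * R"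
proof -
  have "nX H = fn (mm I (mid I - mm I X XT) Lx - mm I X Ky)"
    unfolding fn_Xm[symmetric]
  proof (rule mnm_cong)
    fix k i assume k: "k \<in> I" and i: "i \<in> I"
    have "xc k (tm I U K i) = (\<Sum>j\<in>I. xc k (K j i *\<^sub>R U j))"
      using i by (simp add: tm_def xc_def B.sum_right)
    also have "\<dots> = mm I X K k i"
      unfolding mm_def by (intro sum.cong refl) (simp add: xc_scale Xm_def mult.commute)
    finally have 1: "Xm H k i = X k i / l k - mm I X K k i"
      by (simp add: Xm_def xc_diff xc_G[OF k])
    have "mm I (mid I) Lx k i = Lx k i"
      using mv_mid[of I k "\<lambda>k. Lx k i"] k by (simp add: mv_def mm_def)
    then have "mm I (mid I - mm I X XT) Lx k i = X k i / l k - mm I X (mm I XT Lx) k i"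
      using k by (simp add: mm_diff_left mm_assoc Lx_def)
    then show "Xm H k i = (mm I (mid I - mm I X XT) Lx - mm I X Ky) k i"
      unfolding 1 by (simp add: arg_cong[OF K_split, of "mm I X"] mm_add_right)
  qed
  also have "\<dots> \<le> fn (mm I (mid I - mm I X XT) Lx) + fn (mm I X Ky)" by (rule MD.nm_triangle_diff)
  also have "\<dots> \<le> (m + c^6 * R) * c^3 + c^2 * (c^7 * R)"
  proof (intro add_mono)
    have 1: "fn (mid I - mm I X XT) \<le> m + c^6 * R"
      using fnS(2) c5R2 MD.nm_minus[of I "mm I X XT - mid I"] by simp
    show "fn (mm I (mid I - mm I X XT) Lx) \<le> (m + c^6 * R) * c^3"
      by (rule order_trans[OF mnm_mm], rule mult_mono[OF 1 fnLx]) (auto simp: R0)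
    have 2: "fn Ky \<le> c^7 * R"
    proof -
      have "c^6 * R^2 \<le> c^6 * (c * R)" by (intro mult_left_mono R2) simp
      also have "\<dots> = c^7 * R" by algebra
      finally show ?thesis using fnKy by linarith
    qed
    have 3: "fn X \<le> c^2" unfolding fn_Xm by (rule nXU)
    show "fn (mm I X Ky) \<le> c^2 * (c^7 * R)"
      by (rule order_trans[OF mnm_mm], rule mult_mono[OF 3 2]) auto
  qed
  also have "\<dots> = c^3 * m + 2 * c^9 * R" by algebra
  finally show ?thesis .
qed

lemma nYH: "nY H \<le> 2 * c^7 * R"
proof -
  have 1: "nY (tm I U K) \<le> (R * c^2) * c^5"
    by (rule order_trans[OF PY.tnm_tm], rule mult_mono[OF nYU fnK]) (auto simp: R0)
  have "nY (GT U) \<le> c * (R * c^2)" using nYGc[of U] mult_left_mono[OF nYU c0(1)] by linarith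
  then have "nY H \<le> c * (R * c^2) + (R * c^2) * c^5"
    using TY.nm_triangle_diff[of "GT U" "tm I U K"] 1 by linarith
  also have "\<dots> = c^3 * R + c^7 * R" by algebra
  also have "\<dots> \<le> c^7 * R + c^7 * R" by (intro add_right_mono mult_right_mono cp R0) simp
  finally show ?thesis by (simp add: ac_simps)
qed

lemma nA_le_XY: "nA W \<le> c * nX W + nY W"
proof (rule power2_le_imp_le)
  have "l N \<le> c^2" using clN cp[of 1 2] by simp
  then have "(nA W)^2 \<le> c^2 * (nX W)^2 + (nY W)^2"
    using nA_sq_le[of W] mult_right_mono[of "l N" "c^2" "(nX W)^2"] by simp
  also have "\<dots> \<le> (c * nX W + nY W)^2" by (simp add: power2_sum power_mult_distrib)
  finally show "(nA W)^2 \<le> (c * nX W + nY W)^2" .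
qed simp

lemma nAH: "nA H \<le> 4 * c^10 * (m + R)"
proof -
  have "nA H \<le> c * (c^3 * m + 2 * c^9 * R) + 2 * c^7 * R"
    using nA_le_XY[of H] mult_left_mono[OF nXH c0(1)] nYH by linarith
  also have "\<dots> = c^4 * m + 2 * (c^10 * R) + 2 * (c^7 * R)" by algebra
  also have "\<dots> \<le> c^10 * m + 2 * (c^10 * R) + 2 * (c^10 * R)"
    by (intro add_mono mult_right_mono mult_left_mono cp R0) auto
  also have "\<dots> \<le> 4 * c^10 * (m + R)" by (simp add: algebra_simps)
  finally show ?thesis .
qed

lemma nAF_small: "nA F \<le> 5 * c^10 * (m + R)"
proof -
  have "nA (tm I (GT U) M) \<le> c^2 * m" by (intro tmc nAGU order_refl)
  also have "\<dots> \<le> c^10 * (m + R)"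
    by (intro mult_mono cp) (auto simp: R0)
  finally show ?thesis
    unfolding F_eq using TA.nm_triangle[of H "tm I (GT U) M"] nAH by simp
qed

text \<open>The sum of the eigenvalues is the trace of the diagonal matrix Lambda, so what remains
  is the trace of Lambda (X X^T - I) plus the energy in the complement. No term is linear in
  \<open>R\<close>, which gives the doubled exponent for the energy.\<close>

lemma energy_bound: "\<bar>(nA U)^2 - (\<Sum>k\<in>I. l k)\<bar> \<le> 2 * c^7 * (m + R^2)"
proof -
  let ?S = "mm I X XT - mid I"
  have fin: "finite I" by simp
  have "(nA U)^2 = (\<Sum>i\<in>I. (\<Sum>k\<in>I. l k * xc k (U i) * xc k (U i)) + PY (U i) (U i))"
    unfolding TA.nm_sq tform_def by (intro sum.cong refl a_decomp)
  also have "\<dots> = (\<Sum>i\<in>I. \<Sum>k\<in>I. l k * (X k i * X k i)) + (nY U)^2"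
    by (simp add: sum.distrib TY.nm_sq tform_def Xm_def mult.assoc)
  also have "(\<Sum>i\<in>I. \<Sum>k\<in>I. l k * (X k i * X k i)) = (\<Sum>k\<in>I. \<Sum>i\<in>I. l k * (X k i * X k i))"
    by (rule sum.swap)
  also have "\<dots> = (\<Sum>k\<in>I. l k * mm I X XT k k)" by (simp add: mm_def sum_distrib_left)
  finally have 1: "(nA U)^2 - (\<Sum>k\<in>I. l k) = (\<Sum>k\<in>I. l k * ?S k k) + (nY U)^2"
    by (simp add: mid_def right_diff_distrib sum_subtractf)
  have "\<bar>\<Sum>k\<in>I. l k * ?S k k\<bar> \<le> (\<Sum>k\<in>I. c * fn ?S)"
  proof (rule order_trans[OF sum_abs], rule sum_mono)
    fix k assume k: "k \<in> I"
    have "\<bar>l k * ?S k k\<bar> = l k * \<bar>?S k k\<bar>" using l_pos'(1)[OF k] by (simp add: abs_mult)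
    also have "\<dots> \<le> c * fn ?S"
      using l_mono[OF k] clN mnm_entry[OF fin k k, of ?S] by (intro mult_mono) auto
    finally show "\<bar>l k * ?S k k\<bar> \<le> c * fn ?S" .
  qed
  also have "\<dots> = real N * (c * fn ?S)" by simp
  also have "\<dots> \<le> c * (c * (m + c^5 * R^2))" by (intro mult_mono mult_left_mono cN fnS(2)) auto
  finally have "\<bar>\<Sum>k\<in>I. l k * ?S k k\<bar> \<le> c * (c * (m + c^5 * R^2))" .
  moreover have "(nY U)^2 \<le> c^4 * R^2" using nYU2 by (simp add: power2_eq_square)
  ultimately have "\<bar>(nA U)^2 - (\<Sum>k\<in>I. l k)\<bar> \<le> c * (c * (m + c^5 * R^2)) + c^4 * R^2"
    unfolding 1 using zero_le_power2[of "nY U"] by linarith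
  also have "\<dots> = c^2 * m + c^7 * R^2 + c^4 * R^2" by algebra
  also have "\<dots> \<le> c^7 * m + c^7 * R^2 + c^7 * R^2" by (intro add_mono mult_right_mono cp) auto
  also have "\<dots> \<le> 2 * c^7 * (m + R^2)" by (simp add: algebra_simps)
  finally show ?thesis .
qed

lemma K_quad: "vdot I \<xi> (mv I K \<xi>) = b (ap I U \<xi>) (G (ap I U \<xi>))"
  using B.f_ap_ap[of I U \<xi> "GT U" \<xi>] by (simp add: ap_GT)

text \<open>A crude bound for every state, which starts the decay of the defect.
  \<open>K_lower_sharp\<close> approaches 1/\<open>l N\<close> as defect and slope vanish and
  settles the asymptotic rate.\<close>

lemma K_lower: "vn \<xi> ^ 2 / c^3 \<le> vdot I \<xi> (mv I K \<xi>)"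
proof -
  let ?p = "PX.nm (ap I U \<xi>)"
  have "(vn \<xi>)^2 \<le> (c * ?p)^2" by (intro power_mono low) simp
  then have "vn \<xi> ^ 2 / c^3 \<le> (c * ?p)^2 / c^3" by (intro divide_right_mono) auto
  also have "\<dots> = ?p^2 / c"
    using c0(2) by (simp add: power2_eq_square power3_eq_cube)
  also have "\<dots> \<le> ?p^2 / l N" using clN l_pos'(2) by (intro divide_left_mono) auto
  also have "\<dots> \<le> b (ap I U \<xi>) (G (ap I U \<xi>))" using bG_lower[of "ap I U \<xi>"] by (simp add: PX.nm_sq)
  finally show ?thesis unfolding K_quad .
qed

lemma nb_ap: "B.nm (ap I U \<xi>) \<le> c^2 * vn \<xi>"
proof -
  have "nB U \<le> c * c" using nBc[of U] mult_left_mono[OF nAU c0(1)] by linarith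
  then have "nB U * vn \<xi> \<le> c^2 * vn \<xi>" by (intro mult_right_mono) (auto simp: power2_eq_square)
  then show ?thesis using B.nm_ap[of I U \<xi>] by linarith
qed

lemma px_lower: "(1 - m - c^5 * R^2) * (vn \<xi>)^2 \<le> PX (ap I U \<xi>) (ap I U \<xi>)"
proof -
  let ?u = "ap I U \<xi>"
  have "b ?u ?u = vdot I \<xi> (mv I (mid I) \<xi>) + vdot I \<xi> (mv I M \<xi>)"
    using B.f_ap_ap[of I U \<xi> U \<xi>] by (simp add: VD.add_right[symmetric] mv_add[symmetric])
  also have "\<dots> \<ge> (vn \<xi>)^2 - m * (vn \<xi>)^2"
    using vdot_mv_le[of I \<xi> M] by (simp add: vdot_mv_mid)
  finally have 1: "(vn \<xi>)^2 - m * (vn \<xi>)^2 \<le> b ?u ?u" .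
  have "PY ?u ?u / l (N+1) = (1 / l (N+1)) * (PY.nm ?u)^2" by (simp add: PY.nm_sq)
  also have "\<dots> \<le> c * (R * (c^2 * vn \<xi>))^2"
  proof (intro mult_mono power_mono)
    show "PY.nm ?u \<le> R * (c^2 * vn \<xi>)"
      using cone[of \<xi>] mult_left_mono[OF order_trans[OF px_le_nb nb_ap] R0] order_trans by blast
    show "1 / l (N+1) \<le> c" using inv_l1(2) cg by linarith
  qed auto
  also have "\<dots> = c^5 * R^2 * (vn \<xi>)^2" by algebra
  finally show ?thesis using b_le[of ?u] 1 by (simp add: algebra_simps)
qed

lemma K_lower_sharp: "(1 - m - c^5 * R^2) / l N * (vn \<xi>)^2 \<le> vdot I \<xi> (mv I K \<xi>)"
proof -
  have "(1 - m - c^5 * R^2) / l N * (vn \<xi>)^2 \<le> PX (ap I U \<xi>) (ap I U \<xi>) / l N"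
    using divide_right_mono[OF px_lower[of \<xi>], of "l N"] l_pos'(2) by simp
  also have "\<dots> \<le> vdot I \<xi> (mv I K \<xi>)" unfolding K_quad by (rule bG_lower)
  finally show ?thesis .
qed

text \<open>\<open>tm I v X\<close> is the projection of \<open>U\<close> onto the eigenspace, so
  the difference consists of the components \<open>yy\<close>.\<close>

lemma dist_to_rotation: "nA (U - tm I v X) \<le> c^2 * R"
proof -
  have "nA (U - tm I v X) = nY U"
    unfolding TA.S.nm_def TY.S.nm_def tform_def PY_def
    by (intro arg_cong[where f=sqrt] sum.cong refl) (simp add: yy_def pr_def tm_def Xm_def)
  then show ?thesis using nYU by (simp add: mult.commute)
qed

end

section \<open>One step of the scheme\<close>

lemma mdot_mm_cols: "mdot I A (mm I B A) = (\<Sum>j\<in>I. vdot I (\<lambda>i. A i j) (mv I B (\<lambda>i. A i j)))"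
proof -
  have "mdot I A (mm I B A) = (\<Sum>i\<in>I. \<Sum>j\<in>I. A i j * mv I B (\<lambda>i. A i j) i)"
    by (simp add: tform_def mm_def mv_def)
  also have "\<dots> = (\<Sum>j\<in>I. vdot I (\<lambda>i. A i j) (mv I B (\<lambda>i. A i j)))"
    unfolding tform_def by (rule sum.swap)
  finally show ?thesis .
qed

lemma mdot_mm_sym:
  assumes A: "\<And>i j. A i j = A j i" and B: "\<And>i j. B i j = B j i"
  shows "mdot I A (mm I A B) = mdot I A (mm I B A)"
proof -
  have "(\<lambda>i j. A j i) = A" by (intro ext) (rule A)
  moreover have "(\<lambda>i j. mm I A B j i) = mm I B A"
  proof (intro ext)
    fix i j
    show "mm I A B j i = mm I B A i j"
      unfolding mm_def by (intro sum.cong refl) (subst A, subst B, rule mult.commute)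
  qed
  ultimately show ?thesis using mdot_transpose[of I A "mm I A B"] by simp
qed

lemma real_rearrange: "(p::real) - t * (r + s) + x - q = p - q - t * (s + r) + x"
  by (simp add: algebra_simps)

lemma vector_rearrange:
  fixes u f h x y z :: "'w::real_vector"
  assumes "f = h + y"
  shows "u + t *\<^sub>R (f + (t / 2) *\<^sub>R x) - t *\<^sub>R (y + t *\<^sub>R z) = u + t *\<^sub>R h + t^2 *\<^sub>R ((1/2) *\<^sub>R x - z)"
  unfolding assms by (simp add: algebra_simps power2_eq_square)

lemma mat_lincomb_apply:
  fixes A B C E :: "nat \<Rightarrow> nat \<Rightarrow> real"
  shows "(A - t *\<^sub>R (B + C) + s *\<^sub>R E) i j = A i j - t * (B i j + C i j) + s * E i j"
  by simp

text \<open>The linear part of the corrector acting on the defect \<open>A\<close>. Pairing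
  \<open>A\<close> with A B + B A gives at least 2k times its squared norm, so the square contracts
  by 1 - 4kt + O(t^2), and 1 + 2x \<le> (1 + x)^2 removes the square.\<close>

lemma sym_contraction:
  fixes k t \<beta> :: real
  assumes A: "\<And>i j. A i j = A j i" and B: "\<And>i j. B i j = B j i"
    and low: "\<And>\<xi>. k * (VD.nm I \<xi>)^2 \<le> vdot I \<xi> (mv I B \<xi>)"
    and \<beta>: "MD.nm I B \<le> \<beta>" and t: "0 \<le> t" "2 * t * k \<le> 1"
  shows "MD.nm I (A - t *\<^sub>R (mm I A B + mm I B A)) \<le> (1 - 2 * k * t + 2 * \<beta>^2 * t^2) * MD.nm I A"
proof -
  let ?S = "mm I A B + mm I B A"
  let ?m = "MD.nm I A"
  have m0: "0 \<le> ?m" by simp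
  have \<beta>0: "0 \<le> \<beta>" using order_trans[OF MD.nm_nonneg \<beta>] .
  have fS: "MD.nm I ?S \<le> 2 * \<beta> * ?m"
  proof -
    have "MD.nm I (mm I A B) \<le> ?m * \<beta>" by (rule order_trans[OF mnm_mm]) (intro mult_left_mono \<beta> m0)
    moreover have "MD.nm I (mm I B A) \<le> \<beta> * ?m" by (rule order_trans[OF mnm_mm]) (intro mult_right_mono \<beta> m0)
    ultimately show ?thesis using MD.nm_triangle[of I "mm I A B" "mm I B A"] by (simp add: mult.commute)
  qed
  have AS: "2 * (k * ?m^2) \<le> mdot I A ?S"
  proof -
    have "k * ?m^2 = (\<Sum>j\<in>I. k * (VD.nm I (\<lambda>i. A i j))^2)"
      unfolding sum_distrib_left[symmetric] MD.nm_sq mdot_cols by simp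
    also have "\<dots> \<le> mdot I A (mm I B A)" unfolding mdot_mm_cols by (intro sum_mono low)
    finally show ?thesis using mdot_mm_sym[OF A B, of I] by (simp add: MD.add_right)
  qed
  define q where "q = 1 - 2 * k * t + 2 * \<beta>^2 * t^2"
  have q0: "0 \<le> q"
  proof -
    have "0 \<le> 2 * \<beta>^2 * t^2" by simp
    then show ?thesis unfolding q_def using t(2) by (simp add: ac_simps)
  qed
  have "(MD.nm I (A - t *\<^sub>R ?S))^2 = ?m^2 - 2 * t * mdot I A ?S + t^2 * (MD.nm I ?S)^2"
    unfolding MD.nm_sq MD.diff_left MD.diff_right MD.scale_left MD.scale_right MD.psd_sym[of I ?S A]
    by (simp add: power2_eq_square algebra_simps)
  also have "\<dots> \<le> ?m^2 - 2 * t * (2 * (k * ?m^2)) + t^2 * (2 * \<beta> * ?m)^2"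
    using AS t(1) fS by (intro add_mono diff_left_mono mult_left_mono power_mono) auto
  also have "\<dots> = (1 + 2 * (- 2 * k * t + 2 * \<beta>^2 * t^2)) * ?m^2" by algebra
  also have "\<dots> \<le> q^2 * ?m^2"
  proof (rule mult_right_mono)
    have "1 + 2 * x \<le> (1 + x)^2" for x :: real by (simp add: power2_sum)
    from this[of "- 2 * k * t + 2 * \<beta>^2 * t^2"]
    show "1 + 2 * (- 2 * k * t + 2 * \<beta>^2 * t^2) \<le> q^2" by (simp add: q_def algebra_simps)
  qed simp
  finally have "(MD.nm I (A - t *\<^sub>R ?S))^2 \<le> (q * ?m)^2" by (simp only: power_mult_distrib)
  then show ?thesis unfolding q_def[symmetric] by (rule power2_le_imp_le) (simp add: q0)
qed

text \<open>A congruence: the matrix on the right equals (I - tB) A (I - tB) - t^2 B A B + t^2 A C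
  A, and the last term is nonnegative. It carries a lower bound for the quadratic form of the defect
  through the corrector.\<close>

lemma sym_lower:
  fixes t :: real
  assumes A: "\<And>i j. A i j = A j i" and B: "\<And>i j. B i j = B j i"
    and C: "\<And>x. 0 \<le> vdot I x (mv I C x)"
  shows "vdot I (\<xi> - t *\<^sub>R mv I B \<xi>) (mv I A (\<xi> - t *\<^sub>R mv I B \<xi>)) - t^2 * vdot I (mv I B \<xi>) (mv I A (mv I B \<xi>))
    \<le> vdot I \<xi> (mv I (A - t *\<^sub>R (mm I A B + mm I B A) + t^2 *\<^sub>R mm I A (mm I C A)) \<xi>)"
proof -
  define z where "z = mv I B \<xi>"
  have symA: "vdot I x (mv I A y) = vdot I (mv I A x) y" for x y by (rule vdot_mv_sym) (rule A)
  have symB: "vdot I x (mv I B y) = vdot I (mv I B x) y" for x y by (rule vdot_mv_sym) (rule B)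
  have 1: "vdot I \<xi> (mv I (mm I A B) \<xi>) = vdot I (mv I A \<xi>) z" by (simp only: mv_mm symA z_def)
  have 2: "vdot I \<xi> (mv I (mm I B A) \<xi>) = vdot I (mv I A \<xi>) z"
    unfolding mv_mm symB z_def[symmetric] by (rule VD.psd_sym)
  have 3: "0 \<le> vdot I \<xi> (mv I (mm I A (mm I C A)) \<xi>)"
    unfolding mv_mm symA[of \<xi>] by (rule C)
  have e: "vdot I \<xi> (mv I (A - t *\<^sub>R (mm I A B + mm I B A) + t^2 *\<^sub>R mm I A (mm I C A)) \<xi>)
      = vdot I \<xi> (mv I A \<xi>) - 2 * t * vdot I (mv I A \<xi>) z + t^2 * vdot I \<xi> (mv I (mm I A (mm I C A)) \<xi>)"
    unfolding mv_add mv_diff mv_scale VD.add_right VD.diff_right VD.scale_right 1 2 by simp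
  have m\<eta>: "mv I A (\<xi> - t *\<^sub>R z) = mv I A \<xi> - t *\<^sub>R mv I A z"
    by (auto simp: mv_def fun_eq_iff algebra_simps sum_subtractf sum_distrib_left)
  have "vdot I \<xi> (mv I A z) = vdot I (mv I A \<xi>) z" by (rule symA)
  moreover have "vdot I z (mv I A \<xi>) = vdot I (mv I A \<xi>) z" by (rule VD.psd_sym)
  ultimately have "vdot I (\<xi> - t *\<^sub>R z) (mv I A (\<xi> - t *\<^sub>R z))
      = vdot I \<xi> (mv I A \<xi>) - 2 * t * vdot I (mv I A \<xi>) z + t^2 * vdot I z (mv I A z)"
    unfolding m\<eta> VD.diff_left VD.diff_right VD.scale_left VD.scale_right by (simp add: power2_eq_square algebra_simps)
  then show ?thesis unfolding e z_def[symmetric] using 3 by simp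
qed

text \<open>\<open>D\<close> is the difference quotient of the predictor, whose implicit equation reads \<open>D = A\<^sub>U (U + (\<tau> / 2) D)\<close>.\<close>
locale step = state a b G N l v c R U for a b :: "'v::real_vector \<Rightarrow> 'v \<Rightarrow> real" and G N l v c R U +
  fixes \<tau> :: real and D :: "nat \<Rightarrow> 'v"
  assumes t0: "0 \<le> \<tau>" and ts: "\<tau> * (10^6 * c^40) \<le> 1"
    and D: "D = Aop U (U + (\<tau> / 2) *\<^sub>R D)"
begin

lemma tc: "n \<le> 40 \<Longrightarrow> \<tau> * c^n * 10^6 \<le> 1"
  using mult_left_mono[OF mult_right_mono[OF cp[of n 40], of "10^6"] t0] ts by (simp add: ac_simps)

lemma tcx: "n \<le> 40 \<Longrightarrow> 0 \<le> x \<Longrightarrow> \<tau> * c^n * x \<le> x / 10^6"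
  using mult_right_mono[OF tc[of n], of "x / 10^6"] by simp

lemma t1: "\<tau> \<le> 1"
  using tc[of 0] t0 by simp

abbreviation "Uh \<equiv> U + \<tau> *\<^sub>R D"
abbreviation "W \<equiv> U + (\<tau> / 2) *\<^sub>R D"
abbreviation "K' \<equiv> gr b (U + \<tau> *\<^sub>R D) (GT (U + \<tau> *\<^sub>R D))"
abbreviation "U' \<equiv> U + \<tau> *\<^sub>R D - \<tau> *\<^sub>R tm I (GT (U + \<tau> *\<^sub>R D)) (gr b U U - mid I)"
abbreviation "M' \<equiv> gr b U' U' - mid I"

lemma D_supp: "i \<notin> I \<Longrightarrow> D i = 0"
  by (subst D) (auto simp: Aop_def tm_def)

lemma D_F: "D = F + (\<tau> / 2) *\<^sub>R Aop U D"
  by (subst D) (rule Aop_lin)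

text \<open>The implicit term has size at most \<open>\<tau> * c^5 * nA D\<close>, which the
  step-size bound absorbs into the left-hand side.\<close>

lemma nD: "nA D \<le> 2 * nA F"
proof -
  have "nA D \<le> nA F + nA ((\<tau> / 2) *\<^sub>R Aop U D)"
    by (subst D_F) (rule TA.nm_triangle)
  also have "nA ((\<tau> / 2) *\<^sub>R Aop U D) = \<tau> / 2 * nA (Aop U D)"
    using t0 by (simp add: TA.nm_scale)
  also have "\<dots> \<le> \<tau> / 2 * (2 * c^5 * nA D)" using t0 by (intro mult_left_mono Aop_bound) simp
  also have "\<dots> = \<tau> * c^5 * nA D" by simp
  also have "\<dots> \<le> nA D / 10^6" by (intro tcx) auto
  also have "\<dots> \<le> nA D / 2" by simp
  finally show ?thesis by linarith
qed

lemma nDF: "nA (D - F) \<le> \<tau> * (2 * c^5 * nA F)"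
proof -
  have "D - F = (\<tau> / 2) *\<^sub>R Aop U D" using D_F by (metis add_diff_cancel_left')
  then have "nA (D - F) = \<tau> / 2 * nA (Aop U D)" using t0 by (simp add: TA.nm_scale)
  also have "\<dots> \<le> \<tau> / 2 * (2 * c^5 * (2 * nA F))"
    using t0 by (intro mult_left_mono order_trans[OF Aop_bound mult_left_mono[OF nD]]) auto
  finally show ?thesis by (simp add: algebra_simps)
qed

lemma tD: "\<tau> * nA D \<le> 1 / 1000"
proof -
  have "\<tau> * nA D \<le> \<tau> * (2 * (2 * c^6))" using t0 nD nAF by (intro mult_left_mono) auto
  also have "\<dots> \<le> 1 / 1000" using tc[of 6] by simp
  finally show ?thesis .
qed

lemma nAUh: "nA Uh \<le> 2 * c"
  using TA.nm_triangle[of U "\<tau> *\<^sub>R D"] nAU tD c1 t0 by (simp add: TA.nm_scale)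

text \<open>\<open>D\<close> is the field at the midpoint \<open>W\<close>; the two sums cancel when
  \<open>i\<close> and \<open>j\<close> are exchanged.\<close>

lemma skew: "b (D i) (W j) + b (D j) (W i) = 0"
proof -
  have W0: "W i = 0" if "i \<notin> I" for i using that by (simp add: U0 D_supp)
  show ?thesis
  proof (cases "i \<in> I \<and> j \<in> I")
    case True
    have "b (D i) (W j) = (\<Sum>k\<in>I. b (U k) (W i) * b (U k) (G (W j)) - b (U k) (G (W i)) * b (U k) (W j))" if "i \<in> I" for i j
      using that by (subst D) (simp add: Aop_def tm_def gr_def B.diff_left B.sum_left B.scale_left bG sum_subtractf)
    then show ?thesis using True by (simp add: sum.distrib[symmetric])
  next
    case False
    then show ?thesis using W0[of i] W0[of j] D_supp[of i] D_supp[of j] by (auto simp: B.zero_left B.zero_right)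
  qed
qed

text \<open>The increment of the Gram matrix is \<tau> times the symmetrised product of
  \<open>D\<close> with the midpoint, so the implicit midpoint rule conserves this quadratic
  invariant.\<close>

lemma gram_preserved: "gr b Uh Uh = P"
proof (intro ext)
  fix i j
  have "b (Uh i) (Uh j) = b (U i) (U j) + \<tau> * (b (D i) (W j) + b (D j) (W i))"
    by (simp add: B.expand B.psd_sym[of "U i" "D j"] B.psd_sym[of "D j" "D i"] field_simps)
  then show "gr b Uh Uh i j = P i j" using skew[of i j] by (simp add: gr_def)
qed

section \<open>Change of \<open>K\<close> and of the defect in one step\<close>

lemma K'_diff: "K' - K = \<tau> *\<^sub>R (gr b D (GT U) + gr b U (GT D)) + \<tau>^2 *\<^sub>R gr b D (GT D)"
  by (simp add: GT_add GT_scale B.gr_add_left B.gr_add_right B.gr_scale_left B.gr_scale_right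
      scaleR_add_right power2_eq_square)

lemma fn_gr_DGD: "\<tau>^2 * fn (gr b D (GT D)) \<le> \<tau>^2 * (8 * c^9 * nA F)"
proof -
  have "fn (gr b D (GT D)) \<le> c^2 * (2 * nA F) * (c * (2 * nA F))"
    by (intro grc' nD order_trans[OF nAGc] mult_left_mono) auto
  also have "\<dots> = 4 * c^3 * nA F * nA F" by algebra
  also have "\<dots> \<le> 4 * c^3 * nA F * (2 * c^6)" by (intro mult_left_mono nAF) auto
  also have "\<dots> = 8 * c^9 * nA F" by algebra
  finally show ?thesis by (intro mult_left_mono) auto
qed

lemma fn_K'_diff: "fn (K' - K) \<le> 5 * c^4 * (\<tau> * nA F)"
proof -
  have 1: "fn (gr b D (GT U)) \<le> c^2 * (2 * nA F) * c^2" by (intro grc' nD nAGU)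
  have 2: "fn (gr b U (GT D)) \<le> c^2 * c * (c * (2 * nA F))"
    by (intro grc' nAU order_trans[OF nAGc] mult_left_mono nD) auto
  have "fn (K' - K) \<le> \<tau> * (fn (gr b D (GT U)) + fn (gr b U (GT D))) + \<tau>^2 * fn (gr b D (GT D))"
    unfolding K'_diff using t0
    by (intro order_trans[OF MD.nm_triangle] add_mono) (auto simp: MD.nm_scale intro!: mult_left_mono MD.nm_triangle)
  also have "\<dots> \<le> \<tau> * (c^2 * (2 * nA F) * c^2 + c^2 * c * (c * (2 * nA F))) + \<tau>^2 * (8 * c^9 * nA F)"
    by (intro add_mono mult_left_mono 1 2 t0 fn_gr_DGD)
  also have "\<dots> = 4 * c^4 * (\<tau> * nA F) + (\<tau> * c^9 * 8) * (\<tau> * nA F)" by algebra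
  also have "\<dots> \<le> 4 * c^4 * (\<tau> * nA F) + c^4 * (\<tau> * nA F)"
  proof (intro add_left_mono mult_right_mono)
    show "\<tau> * c^9 * 8 \<le> c^4" using tcx[of 9 8] cp[of 0 4] by simp
  qed (use t0 in simp)
  finally show ?thesis by (simp add: ac_simps)
qed

lemma fn_K'_diff': "fn (K' - K) \<le> 10 * c^10 * \<tau>"
proof -
  have "5 * c^4 * (\<tau> * nA F) \<le> 5 * c^4 * (\<tau> * (2 * c^6))" using t0 by (intro mult_left_mono nAF) auto
  also have "\<dots> = 10 * c^10 * \<tau>" by algebra
  finally show ?thesis using fn_K'_diff by linarith
qed

lemma nAGUh: "nA (GT Uh) \<le> c * (2 * c)"
  using order_trans[OF nAGc mult_left_mono[OF nAUh c0(1)]] .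

lemma fnK': "fn K' \<le> 4 * c^5"
proof -
  have "fn K' \<le> c^2 * (2 * c) * (c * (2 * c))" by (rule grc'[OF nAUh nAGUh])
  also have "\<dots> = 4 * c^5" by algebra
  finally show ?thesis .
qed

lemma K'_sym: "K' i j = K' j i"
  using bG[of "Uh i" "Uh j"] by (simp add: gr_def B.psd_sym)

lemma K'_lower:
  assumes "k * (vn \<xi>)^2 \<le> vdot I \<xi> (mv I K \<xi>)"
  shows "(k - 10 * c^10 * \<tau>) * (vn \<xi>)^2 \<le> vdot I \<xi> (mv I K' \<xi>)"
proof -
  have e: "K' = K + (K' - K)" by simp
  have "vdot I \<xi> (mv I K' \<xi>) = vdot I \<xi> (mv I K \<xi>) + vdot I \<xi> (mv I (K' - K) \<xi>)"
    by (subst e) (simp only: mv_add VD.add_right)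
  moreover have "\<bar>vdot I \<xi> (mv I (K' - K) \<xi>)\<bar> \<le> 10 * c^10 * \<tau> * (vn \<xi>)^2"
    by (rule order_trans[OF vdot_mv_le]) (intro mult_right_mono fn_K'_diff', simp)
  ultimately show ?thesis using assms by (simp add: left_diff_distrib)
qed

abbreviation "G2 \<equiv> gr b (GT (U + \<tau> *\<^sub>R D)) (GT (U + \<tau> *\<^sub>R D))"

lemma fnG2: "fn G2 \<le> 4 * c^6"
proof -
  have "fn G2 \<le> c^2 * (c * (2 * c)) * (c * (2 * c))" by (rule grc'[OF nAGUh nAGUh])
  also have "\<dots> = 4 * c^6" by algebra
  finally show ?thesis .
qed

lemma b_tm_right: "j \<in> I \<Longrightarrow> b u (tm I Z A j) = (\<Sum>k\<in>I. A k j * b u (Z k))"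
  by (simp add: tm_def B.sum_right B.scale_right)

lemma b_tm_left: "j \<in> I \<Longrightarrow> b (tm I Z A j) u = (\<Sum>k\<in>I. A k j * b (Z k) u)"
  by (simp add: tm_def B.sum_left B.scale_left)

text \<open>Exact, not an expansion: the predictor has kept the Gram matrix and the correction is
  linear in \<open>M\<close>, so the new defect is a quadratic polynomial in \<open>M\<close> with
  coefficients \<open>K'\<close> and \<open>G2\<close>.\<close>

lemma M'_eq:
  assumes "i \<in> I" "j \<in> I"
  shows "M' i j = (M - \<tau> *\<^sub>R (mm I M K' + mm I K' M) + \<tau>^2 *\<^sub>R mm I M (mm I G2 M)) i j"
proof -
  let ?V = "tm I (GT Uh) M"
  have V: "b u (?V j) = (\<Sum>k\<in>I. M k j * b u (G (Uh k)))" if "j \<in> I" for u j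
    unfolding b_tm_right[OF that] by (simp only: GT_nth)
  have 1: "b (Uh i) (?V j) = mm I K' M i j"
    unfolding V[OF assms(2)] mm_def by (simp only: gr_def GT_nth mult.commute)
  have V': "b (?V i) u = (\<Sum>k\<in>I. M k i * b (G (Uh k)) u)" for u
    unfolding b_tm_left[OF assms(1)] by (simp only: GT_nth)
  have 2: "b (?V i) (Uh j) = mm I M K' i j"
    unfolding V' mm_def
  proof (intro sum.cong refl)
    fix k
    have "M k i = M i k" by (rule K_sym(3))
    moreover have "b (G (Uh k)) (Uh j) = K' k j" by (simp only: gr_def GT_nth bG)
    ultimately show "M k i * b (G (Uh k)) (Uh j) = M i k * K' k j" by (simp only:)
  qed
  have 3: "b (?V i) (?V j) = mm I M (mm I G2 M) i j"
    unfolding V' mm_def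
  proof (intro sum.cong refl)
    fix q
    have "M q i = M i q" by (rule K_sym(3))
    moreover have "b (G (Uh q)) (?V j) = (\<Sum>k\<in>I. G2 q k * M k j)"
      unfolding V[OF assms(2)] by (intro sum.cong refl) (simp only: gr_def GT_nth mult.commute)
    ultimately show "M q i * b (G (Uh q)) (?V j) = M i q * (\<Sum>k\<in>I. G2 q k * M k j)" by (simp only:)
  qed
  have ex: "b (p - \<tau> *\<^sub>R r) (q - \<tau> *\<^sub>R s) = b p q - \<tau> * (b p s + b r q) + \<tau>^2 * b r s" for p q r s
    by (simp add: B.expand algebra_simps power2_eq_square)
  have u: "U' i = Uh i - \<tau> *\<^sub>R ?V i" for i by (simp only: minus_apply scaleR_fun_apply)
  have "M' i j = b (U' i) (U' j) - mid I i j" by (simp only: minus_apply gr_def)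
  also have "\<dots> = (b (Uh i) (Uh j) - mid I i j) - \<tau> * (mm I M K' i j + mm I K' M i j) + \<tau>^2 * mm I M (mm I G2 M) i j"
    unfolding u ex 1 2 3 by (rule real_rearrange)
  also have "b (Uh i) (Uh j) - mid I i j = M i j"
    using fun_cong[OF fun_cong[OF gram_preserved, of i], of j] by (simp only: gr_def minus_apply)
  finally show ?thesis unfolding mat_lincomb_apply .
qed

text \<open>\<open>sym_contraction\<close> with \<open>K'\<close>, whose lower bound is that of
  \<open>K\<close> less \<open>10 * c^10 * \<tau>\<close>. The constant 60 collects 20 from this
  loss, 32 from the squared bound on \<open>K'\<close> and 8 from the term quadratic in
  \<open>M\<close>.\<close>

lemma M'_contraction:
  assumes k: "\<And>\<xi>. k * (vn \<xi>)^2 \<le> vdot I \<xi> (mv I K \<xi>)" and kc: "0 \<le> k" "k \<le> c^5"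
  shows "fn M' \<le> (1 - 2 * k * \<tau> + 60 * c^10 * \<tau>^2) * m"
proof -
  define k' where "k' = k - 10 * c^10 * \<tau>"
  have k': "k' * (vn \<xi>)^2 \<le> vdot I \<xi> (mv I K' \<xi>)" for \<xi> unfolding k'_def by (rule K'_lower[OF k])
  let ?N = "M - \<tau> *\<^sub>R (mm I M K' + mm I K' M)"
  have tk: "2 * \<tau> * k' \<le> 1"
  proof -
    have "0 \<le> 10 * c^10 * \<tau>" using t0 by simp
    then have "k' \<le> c^5" using kc unfolding k'_def by linarith
    then have "\<tau> * k' \<le> \<tau> * c^5" using t0 by (rule mult_left_mono)
    then show ?thesis using tc[of 5] by simp
  qed
  have fN: "fn ?N \<le> (1 - 2 * k' * \<tau> + 2 * (4 * c^5)^2 * \<tau>^2) * m"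
    by (rule sym_contraction[OF K_sym(3) K'_sym k' fnK' t0 tk])
  have f3: "fn (mm I M (mm I G2 M)) \<le> m * ((4 * c^6) * (2 * c^4))"
    by (intro order_trans[OF mnm_mm] mult_mono order_refl fnG2 mle) auto
  have "fn M' = fn (?N + \<tau>^2 *\<^sub>R mm I M (mm I G2 M))" by (rule mnm_cong) (rule M'_eq)
  also have "\<dots> \<le> fn ?N + fn (\<tau>^2 *\<^sub>R mm I M (mm I G2 M))" by (rule MD.nm_triangle)
  also have "fn (\<tau>^2 *\<^sub>R mm I M (mm I G2 M)) = \<tau>^2 * fn (mm I M (mm I G2 M))"
    unfolding MD.nm_scale abs_power2 ..
  also have "fn ?N + \<tau>^2 * fn (mm I M (mm I G2 M))
      \<le> (1 - 2 * k' * \<tau> + 2 * (4 * c^5)^2 * \<tau>^2) * m + \<tau>^2 * (m * ((4 * c^6) * (2 * c^4)))"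
    by (intro add_mono fN mult_left_mono f3) simp
  also have "\<dots> = (1 - 2 * k * \<tau> + 60 * c^10 * \<tau>^2) * m" unfolding k'_def by algebra
  finally show ?thesis .
qed

text \<open>Keeps the Gram matrix uniformly positive along the iteration, from which
  \<open>low\<close> in \<open>state\<close> is recovered. The bound passes through the congruence
  because I - \<tau> K' does not lengthen vectors; the cost is of order \<tau>^2 m.\<close>

lemma M'_lower:
  assumes \<mu>: "0 \<le> \<mu>" "\<And>\<xi>. - \<mu> * (vn \<xi>)^2 \<le> vdot I \<xi> (mv I M \<xi>)"
  shows "- (\<mu> + 16 * c^10 * \<tau>^2 * m) * (vn \<xi>)^2 \<le> vdot I \<xi> (mv I M' \<xi>)"
proof -
  define z where "z = mv I K' \<xi>"
  define \<eta> where "\<eta> = \<xi> - \<tau> *\<^sub>R z"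
  have z: "vn z \<le> 4 * c^5 * vn \<xi>" unfolding z_def
    by (rule order_trans[OF vnm_mv], intro mult_right_mono fnK') simp
  have z2: "(vn z)^2 \<le> 16 * c^10 * (vn \<xi>)^2"
  proof -
    have "(vn z)^2 \<le> (4 * c^5 * vn \<xi>)^2" by (intro power_mono z) simp
    also have "\<dots> = 16 * c^10 * (vn \<xi>)^2" by algebra
    finally show ?thesis .
  qed
  \<comment> \<open>The linear gain from \<open>K_lower\<close> outweighs the loss
    \<open>16 * c^10 * \<tau>^2\<close>, since \<tau> is far below c^(-13).\<close>
  have \<eta>: "(vn \<eta>)^2 \<le> (vn \<xi>)^2"
  proof -
    have "(1 / c^3 - 10 * c^10 * \<tau>) * (vn \<xi>)^2 \<le> vdot I \<xi> z"
      unfolding z_def by (rule K'_lower) (use K_lower[of \<xi>] in simp)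
    moreover have "18 * c^10 * \<tau> \<le> 1 / c^3"
    proof -
      have "18 * c^10 * \<tau> * c^3 = 18 * (\<tau> * c^13)" by algebra
      also have "\<dots> \<le> 1" using tc[of 13] by simp
      finally show ?thesis by (simp add: pos_le_divide_eq)
    qed
    then have "8 * c^10 * \<tau> * (vn \<xi>)^2 \<le> (1 / c^3 - 10 * c^10 * \<tau>) * (vn \<xi>)^2"
      by (intro mult_right_mono) (linarith, simp)
    ultimately have 1: "8 * c^10 * \<tau> * (vn \<xi>)^2 \<le> vdot I \<xi> z" by linarith
    have "(vn \<eta>)^2 = (vn \<xi>)^2 - 2 * \<tau> * vdot I \<xi> z + \<tau>^2 * (vn z)^2"
      unfolding VD.nm_sq \<eta>_def VD.diff_left VD.diff_right VD.scale_left VD.scale_right VD.psd_sym[of I z \<xi>]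
      by (simp add: power2_eq_square algebra_simps)
    also have "\<dots> \<le> (vn \<xi>)^2 - 2 * \<tau> * (8 * c^10 * \<tau> * (vn \<xi>)^2) + \<tau>^2 * (16 * c^10 * (vn \<xi>)^2)"
      using 1 t0 z2 by (intro add_mono diff_left_mono mult_left_mono) auto
    also have "\<dots> = (vn \<xi>)^2" by algebra
    finally show ?thesis .
  qed
  have G2: "0 \<le> vdot I x (mv I G2 x)" for x
    unfolding B.f_ap_ap[symmetric] by (rule B.psd_nonneg)
  have e: "vdot I \<xi> (mv I M' \<xi>) = vdot I \<xi> (mv I (M - \<tau> *\<^sub>R (mm I M K' + mm I K' M) + \<tau>^2 *\<^sub>R mm I M (mm I G2 M)) \<xi>)"
    unfolding tform_def mv_def by (intro sum.cong refl) (simp only: M'_eq if_True cong: sum.cong)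
  have "vdot I \<eta> (mv I M \<eta>) - \<tau>^2 * vdot I z (mv I M z) \<le> vdot I \<xi> (mv I M' \<xi>)"
    unfolding e \<eta>_def z_def by (rule sym_lower[OF K_sym(3) K'_sym G2])
  moreover have "- \<mu> * (vn \<xi>)^2 \<le> vdot I \<eta> (mv I M \<eta>)"
    using mult_left_mono[OF \<eta> \<mu>(1)] \<mu>(2)[of \<eta>] by linarith
  moreover have "\<tau>^2 * vdot I z (mv I M z) \<le> \<tau>^2 * (m * (16 * c^10 * (vn \<xi>)^2))"
  proof (intro mult_left_mono)
    have "vdot I z (mv I M z) \<le> m * (vn z)^2" using vdot_mv_le[of I z M] by linarith
    also have "\<dots> \<le> m * (16 * c^10 * (vn \<xi>)^2)" by (intro mult_left_mono z2) simp
    finally show "vdot I z (mv I M z) \<le> m * (16 * c^10 * (vn \<xi>)^2)" .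
  qed simp
  ultimately have "- \<mu> * (vn \<xi>)^2 - \<tau>^2 * (m * (16 * c^10 * (vn \<xi>)^2)) \<le> vdot I \<xi> (mv I M' \<xi>)"
    by linarith
  moreover have "- (\<mu> + 16 * c^10 * \<tau>^2 * m) * (vn \<xi>)^2 = - \<mu> * (vn \<xi>)^2 - \<tau>^2 * (m * (16 * c^10 * (vn \<xi>)^2))"
    by algebra
  ultimately show ?thesis by (simp only:)
qed

text \<open>The second-order remainder of a whole step: the implicit part of the predictor, and the
  corrector evaluated at the predicted instead of the old tuple. Its bound contains the factor
  \<open>nA F\<close>, hence vanishes with defect and slope.\<close>

abbreviation "err \<equiv> (1/2) *\<^sub>R Aop U D - tm I (GT D) (gr b U U - mid I)"

lemma U'_eq: "U' = U + \<tau> *\<^sub>R H + \<tau>^2 *\<^sub>R err"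
proof -
  have "tm I (GT Uh) M = tm I (GT U) M + \<tau> *\<^sub>R tm I (GT D) M"
    by (simp only: GT_add GT_scale tm_add_left tm_scale_left)
  then have "U' = U + \<tau> *\<^sub>R (F + (\<tau> / 2) *\<^sub>R Aop U D) - \<tau> *\<^sub>R (tm I (GT U) M + \<tau> *\<^sub>R tm I (GT D) M)"
    using D_F by simp
  also have "\<dots> = U + \<tau> *\<^sub>R H + \<tau>^2 *\<^sub>R err" by (rule vector_rearrange) (rule F_eq)
  finally show ?thesis .
qed

lemma nerr: "nA err \<le> 6 * c^5 * nA F"
proof -
  have 1: "nA (Aop U D) \<le> 2 * c^5 * (2 * nA F)"
    by (intro order_trans[OF Aop_bound] mult_left_mono nD) simp
  have 2: "nA (tm I (GT D) M) \<le> (c * (2 * nA F)) * (2 * c^4)"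
    by (intro tmc mle order_trans[OF nAGc] mult_left_mono nD) simp
  have "nA err \<le> nA ((1/2) *\<^sub>R Aop U D) + nA (tm I (GT D) M)" by (rule TA.nm_triangle_diff)
  also have "nA ((1/2) *\<^sub>R Aop U D) = 1/2 * nA (Aop U D)" by (simp add: TA.nm_scale)
  finally have "nA err \<le> 1/2 * (2 * c^5 * (2 * nA F)) + (c * (2 * nA F)) * (2 * c^4)" using 1 2 by linarith
  also have "\<dots> = 6 * c^5 * nA F" by algebra
  finally show ?thesis .
qed

lemma increment: "nA (U' - U) \<le> 5 * c^10 * \<tau> * (m + R)"
proof -
  have mR: "0 \<le> m + R" using R0 by simp
  have "U' - U = \<tau> *\<^sub>R H + \<tau>^2 *\<^sub>R err" unfolding U'_eq by simp
  then have "nA (U' - U) \<le> nA (\<tau> *\<^sub>R H) + nA (\<tau>^2 *\<^sub>R err)" using TA.nm_triangle by metis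
  also have "\<dots> = \<tau> * nA H + \<tau>^2 * nA err" using t0 by (simp only: TA.nm_scale) simp
  also have "\<dots> \<le> \<tau> * (4 * c^10 * (m + R)) + \<tau>^2 * (6 * c^5 * (5 * c^10 * (m + R)))"
    using t0 by (intro add_mono mult_left_mono nAH order_trans[OF nerr] nAF_small) auto
  also have "\<dots> = 4 * c^10 * \<tau> * (m + R) + (\<tau> * c^5 * 30) * (c^10 * \<tau> * (m + R))" by algebra
  also have "\<dots> \<le> 4 * c^10 * \<tau> * (m + R) + 1 * (c^10 * \<tau> * (m + R))"
  proof (intro add_left_mono mult_right_mono)
    show "\<tau> * c^5 * 30 \<le> 1" using tc[of 5] by simp
  qed (use t0 mR in auto)
  finally show ?thesis by (simp add: algebra_simps)
qed


text \<open>With \<eta> = (I - \<tau> K) \<xi> the combination u = U \<eta> stays in the old span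
  and obeys the old cone bound, and the new combination is u + \<tau> G u up to \<tau>^2. The
  complement is stretched by at most 1 + \<tau>/\<open>l (N+1)\<close>, the eigenspace by at least 1
  + \<tau>/\<open>l N\<close> up to \<tau>^2. The error contains \<open>nA F\<close>, hence m + R;
  its \<open>m\<close> part becomes the forcing term.\<close>

lemma cone_step:
  defines "C \<equiv> 400 * c^30" and "\<delta> \<equiv> 1 / l N - 1 / l (N+1)"
  shows "PY.nm (ap I U' \<xi>) \<le> ((1 - \<tau> * \<delta> + C * \<tau>^2) * R + C * \<tau>^2 * m) * PX.nm (ap I U' \<xi>)"
proof -
  define \<zeta> where "\<zeta> = mv I K \<xi>"
  define \<eta> where "\<eta> = \<xi> - \<tau> *\<^sub>R \<zeta>"
  define u where "u = ap I U \<eta>"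
  define w where "w = ap I U \<zeta>"
  define e where "e = ap I err \<xi>"
  have m0: "0 \<le> m" by simp
  have vz: "vn \<zeta> \<le> c^5 * vn \<xi>" unfolding \<zeta>_def
    by (rule order_trans[OF vnm_mv], intro mult_right_mono fnK) simp
  have "vn \<xi> \<le> vn \<eta> + \<tau> * vn \<zeta>"
    using VD.nm_triangle[of I \<eta> "\<tau> *\<^sub>R \<zeta>"] t0 by (simp add: \<eta>_def VD.nm_scale)
  also have "\<tau> * vn \<zeta> \<le> \<tau> * (c^5 * vn \<xi>)" by (intro mult_left_mono vz t0)
  also have "\<tau> * (c^5 * vn \<xi>) \<le> vn \<xi> / 2"
  proof -
    have "\<tau> * c^5 \<le> 1 / 2" using tc[of 5] by simp
    then have "\<tau> * c^5 * vn \<xi> \<le> 1 / 2 * vn \<xi>" by (rule mult_right_mono) simp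
    then show ?thesis by (simp add: mult.assoc)
  qed
  finally have v\<xi>: "vn \<xi> \<le> 2 * vn \<eta>" by simp
  also have "\<dots> \<le> 2 * (c * PX.nm u)" unfolding u_def by (intro mult_left_mono low) simp
  finally have vu: "vn \<xi> \<le> 2 * c * PX.nm u" by simp
  \<comment> \<open>\<open>H\<close> acts as G U - U K. Writing U \<xi> = u + \<tau> w cancels the
    terms with w and leaves \<tau>^2 (G w + e).\<close>
  have U'ap: "ap I U' \<xi> = (u + \<tau> *\<^sub>R G u) + \<tau>^2 *\<^sub>R (G w + e)"
  proof -
    have "ap I U' \<xi> = ap I U \<xi> + \<tau> *\<^sub>R (G (ap I U \<xi>) - w) + \<tau>^2 *\<^sub>R e"
      unfolding U'_eq ap_add ap_diff[of I "GT U"] ap_scale ap_tm ap_GT w_def \<zeta>_def e_def ..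
    moreover have "ap I U \<xi> = u + \<tau> *\<^sub>R w"
      unfolding u_def \<eta>_def w_def ap_diff_right ap_scale_right by simp
    ultimately show ?thesis
      by (simp add: G_add G_scale algebra_simps power2_eq_square)
  qed
  have nw: "PX.nm w \<le> c^7 * vn \<xi>"
  proof -
    have "PX.nm w \<le> c^2 * vn \<zeta>" unfolding w_def using px_le_nb nb_ap order_trans by blast
    also have "\<dots> \<le> c^2 * (c^5 * vn \<xi>)" by (intro mult_left_mono vz) simp
    also have "\<dots> = c^7 * vn \<xi>" by algebra
    finally show ?thesis .
  qed
  have nae: "A.nm e \<le> 6 * c^5 * nA F * vn \<xi>"
    unfolding e_def by (rule order_trans[OF A.nm_ap], intro mult_right_mono nerr) simp
  have pxe: "PX.nm e \<le> 12 * c^12 * vn \<xi>"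
  proof -
    have "PX.nm e \<le> g * A.nm e" using px_le_nb nb_le order_trans by blast
    also have "\<dots> \<le> c * (6 * c^5 * (2 * c^6) * vn \<xi>)"
      using g1 by (intro mult_mono cg order_trans[OF nae] mult_left_mono nAF mult_right_mono) auto
    also have "\<dots> = 12 * c^12 * vn \<xi>" by algebra
    finally show ?thesis .
  qed
  have pxG: "PX.nm (G w) \<le> c^8 * vn \<xi>"
  proof -
    have "PX.nm (G w) \<le> g * PX.nm w" by (rule px_G)
    also have "\<dots> \<le> c * (c^7 * vn \<xi>)" using g1 by (intro mult_mono cg nw) auto
    also have "\<dots> = c^8 * vn \<xi>" by algebra
    finally show ?thesis .
  qed
  have lowpx: "(1 + \<tau> / l N - 26 * c^13 * \<tau>^2) * PX.nm u \<le> PX.nm (ap I U' \<xi>)"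
  proof -
    have "PX.nm (\<tau>^2 *\<^sub>R (G w + e)) \<le> \<tau>^2 * (26 * c^13 * PX.nm u)"
    proof -
      have "PX.nm (G w + e) \<le> c^8 * vn \<xi> + 12 * c^12 * vn \<xi>"
        using PX.nm_triangle[of "G w" e] pxG pxe by linarith
      also have "\<dots> \<le> c^12 * vn \<xi> + 12 * c^12 * vn \<xi>" by (intro add_right_mono mult_right_mono cp) auto
      also have "\<dots> = 13 * c^12 * vn \<xi>" by simp
      also have "\<dots> \<le> 13 * c^12 * (2 * c * PX.nm u)" by (intro mult_left_mono vu) simp
      also have "\<dots> = 26 * c^13 * PX.nm u" by algebra
      finally show ?thesis by (simp add: PX.nm_scale mult_left_mono)
    qed
    then have "(1 + \<tau> / l N) * PX.nm u - \<tau>^2 * (26 * c^13 * PX.nm u) \<le> PX.nm (ap I U' \<xi>)"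
      unfolding U'ap using PX.nm_reverse[of "u + \<tau> *\<^sub>R G u" "\<tau>^2 *\<^sub>R (G w + e)"] px_growth[OF t0, of u] by linarith
    then show ?thesis by (simp add: algebra_simps)
  qed
  have upy: "PY.nm (ap I U' \<xi>) \<le> ((1 + \<tau> / l (N+1)) * R + \<tau>^2 * (62 * c^17) * (R + m)) * PX.nm u"
  proof -
    have pyu: "PY.nm u \<le> R * PX.nm u" unfolding u_def by (rule cone)
    have pyw: "PY.nm (G w) \<le> 2 * c^9 * R * PX.nm u"
    proof -
      have "PY.nm (G w) \<le> 1 / l (N+1) * PY.nm w" using PY_G[of w] by simp
      also have "\<dots> \<le> c * (R * (c^7 * (2 * c * PX.nm u)))"
      proof (intro mult_mono)
        show "1 / l (N+1) \<le> c" using inv_l1(2) cg by linarith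
        have "PY.nm w \<le> R * PX.nm w" unfolding w_def by (rule cone)
        also have "\<dots> \<le> R * (c^7 * (2 * c * PX.nm u))"
          by (intro mult_left_mono order_trans[OF nw] vu R0) simp
        finally show "PY.nm w \<le> R * (c^7 * (2 * c * PX.nm u))" .
      qed auto
      also have "\<dots> = 2 * c^9 * R * PX.nm u" by algebra
      finally show ?thesis .
    qed
    have pye: "PY.nm e \<le> 60 * c^16 * (R + m) * PX.nm u"
    proof -
      have "PY.nm e \<le> 6 * c^5 * nA F * vn \<xi>" using py_le_na nae order_trans by blast
      also have "\<dots> \<le> 6 * c^5 * (5 * c^10 * (m + R)) * (2 * c * PX.nm u)"
        using R0 m0 by (intro mult_mono mult_left_mono nAF_small vu mult_nonneg_nonneg add_nonneg_nonneg) auto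
      also have "\<dots> = 60 * c^16 * (R + m) * PX.nm u" by algebra
      finally show ?thesis .
    qed
    have "PY.nm (ap I U' \<xi>) \<le> PY.nm (u + \<tau> *\<^sub>R G u) + PY.nm (\<tau>^2 *\<^sub>R (G w + e))"
      unfolding U'ap by (rule PY.nm_triangle)
    also have "PY.nm (u + \<tau> *\<^sub>R G u) \<le> (1 + \<tau> / l (N+1)) * (R * PX.nm u)"
      using l_pos'(3) t0 by (intro order_trans[OF py_growth[OF t0]] mult_left_mono pyu) auto
    also have "PY.nm (\<tau>^2 *\<^sub>R (G w + e)) \<le> \<tau>^2 * (2 * c^9 * R * PX.nm u + 60 * c^16 * (R + m) * PX.nm u)"
      unfolding PY.nm_scale abs_power2 using PY.nm_triangle[of "G w" e] pyw pye by (intro mult_left_mono) auto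
    also have "\<tau>^2 * (2 * c^9 * R * PX.nm u + 60 * c^16 * (R + m) * PX.nm u)
        \<le> \<tau>^2 * (2 * c^17 * (R + m) * PX.nm u + 60 * c^17 * (R + m) * PX.nm u)"
      using R0 m0 by (intro add_mono mult_right_mono mult_mono mult_left_mono[of _ _ "\<tau>^2"] mult_left_mono cp) auto
    finally show ?thesis by (simp add: algebra_simps)
  qed
  have lN: "1 / l N \<le> c" using inv_l1(3)[of N] N1 cg by auto
  have \<delta>: "0 \<le> \<delta>" "\<delta> \<le> c"
  proof -
    show "0 \<le> \<delta>" unfolding \<delta>_def using l_gap l_pos' by (simp add: frac_le)
    have "0 \<le> 1 / l (N+1)" using l_pos'(3) by simp
    then show "\<delta> \<le> c" unfolding \<delta>_def using lN by linarith
  qed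
  let ?R' = "(1 - \<tau> * \<delta> + C * \<tau>^2) * R + C * \<tau>^2 * m"
  let ?q = "1 + \<tau> / l N - 26 * c^13 * \<tau>^2"
  have tC: "26 * c^13 * \<tau>^2 \<le> 1/2" "C * \<tau>^2 \<le> 1" "\<tau> * \<delta> \<le> 1 / 2"
  proof -
    have "26 * c^13 * \<tau>^2 = (\<tau> * c^13 * 26) * \<tau>" by algebra
    also have "\<dots> \<le> (1/2) * 1" using tc[of 13] t1 t0 by (intro mult_mono) auto
    finally show "26 * c^13 * \<tau>^2 \<le> 1/2" by simp
    have "C * \<tau>^2 = (\<tau> * c^30 * 400) * \<tau>" unfolding C_def by algebra
    also have "\<dots> \<le> 1 * 1" using tc[of 30] t1 t0 by (intro mult_mono) auto
    finally show "C * \<tau>^2 \<le> 1" by simp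
    have "\<tau> * \<delta> \<le> \<tau> * c^1" using \<delta> t0 by (intro mult_left_mono) auto
    then show "\<tau> * \<delta> \<le> 1 / 2" using tc[of 1] by simp
  qed
  have C0: "0 \<le> C" by (simp add: C_def)
  have q: "1/2 \<le> ?q"
  proof -
    have "0 \<le> \<tau> / l N" using t0 l_pos'(2) by simp
    then show ?thesis using tC(1) by linarith
  qed
  have Rm: "0 \<le> ?R'"
  proof -
    have "0 \<le> C * \<tau>^2" using C0 by simp
    then show ?thesis using tC(3) R0 m0 C0 by (intro add_nonneg_nonneg mult_nonneg_nonneg) auto
  qed
  \<comment> \<open>To first order (1 - \<tau> \<delta>) (1 + \<tau>/\<open>l N\<close>) reproduces
    1 + \<tau>/\<open>l (N+1)\<close>. The second-order coefficients 1, 26 and 62 stay below the 200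
    that half of \<open>C\<close> supplies.\<close>
  have key: "(1 + \<tau> / l (N+1)) * R + \<tau>^2 * (62 * c^17) * (R + m) \<le> ?R' * ?q"
  proof -
    have c17: "c^13 \<le> c^17" "c^17 \<le> c^30" by (auto intro: cp)
    have d2: "\<delta> / l N \<le> c^17"
    proof -
      have "\<delta> / l N = \<delta> * (1 / l N)" by simp
      also have "\<dots> \<le> c * c" using \<delta> lN l_pos'(2) by (intro mult_mono) auto
      also have "\<dots> = c^2" by algebra
      also have "\<dots> \<le> c^17" by (rule cp) simp
      finally show ?thesis .
    qed
    have A: "1 + \<tau> / l (N+1) - \<tau>^2 * (\<delta> / l N) - 26 * c^13 * \<tau>^2 \<le> (1 - \<tau> * \<delta>) * ?q"
    proof -
      have "(1 - \<tau> * \<delta>) * ?q = 1 + \<tau> * (1 / l N - \<delta>) - \<tau>^2 * (\<delta> / l N) - 26 * c^13 * \<tau>^2 + \<tau> * \<delta> * (26 * c^13 * \<tau>^2)"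
        using l_pos'(2) by (simp add: field_simps power2_eq_square)
      moreover have "1 / l N - \<delta> = 1 / l (N+1)" by (simp add: \<delta>_def)
      moreover have "0 \<le> \<tau> * \<delta> * (26 * c^13 * \<tau>^2)" using t0 \<delta> by simp
      ultimately show ?thesis by simp
    qed
    have B: "C * \<tau>^2 * (1/2) \<le> C * \<tau>^2 * ?q" using q C0 by (intro mult_left_mono) auto
    have Chalf: "200 * c^17 * \<tau>^2 \<le> C * \<tau>^2 * (1/2)"
    proof -
      have "200 * c^17 * \<tau>^2 \<le> 200 * c^30 * \<tau>^2" using c17 by (intro mult_right_mono mult_left_mono) auto
      then show ?thesis unfolding C_def by (simp add: mult.commute)
    qed
    have t2: "\<tau>^2 * (\<delta> / l N) \<le> \<tau>^2 * c^17" "26 * c^13 * \<tau>^2 \<le> 26 * c^17 * \<tau>^2"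
    proof -
      show "\<tau>^2 * (\<delta> / l N) \<le> \<tau>^2 * c^17" by (rule mult_left_mono[OF d2]) simp
      show "26 * c^13 * \<tau>^2 \<le> 26 * c^17 * \<tau>^2" using c17(1) by (intro mult_right_mono mult_left_mono) auto
    qed
    have p0: "0 \<le> c^17 * \<tau>^2" by simp
    have "1 + \<tau> / l (N+1) + 62 * c^17 * \<tau>^2 \<le> (1 - \<tau> * \<delta>) * ?q + C * \<tau>^2 * ?q"
    proof -
      have "1 + \<tau> / l (N+1) + 62 * c^17 * \<tau>^2
          \<le> (1 + \<tau> / l (N+1) - \<tau>^2 * (\<delta> / l N) - 26 * c^13 * \<tau>^2) + 200 * c^17 * \<tau>^2"
      proof -
        define w where "w = c^17 * \<tau>^2"
        have e: "\<tau>^2 * c^17 = w" "26 * c^17 * \<tau>^2 = 26 * w" "62 * c^17 * \<tau>^2 = 62 * w" "200 * c^17 * \<tau>^2 = 200 * w" "0 \<le> w"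
          by (simp_all add: w_def)
        have t2': "\<tau>^2 * (\<delta> / l N) \<le> w" "26 * c^13 * \<tau>^2 \<le> 26 * w"
          using t2 unfolding e by auto
        show ?thesis unfolding e using t2' e(5) by argo
      qed
      also have "\<dots> \<le> (1 - \<tau> * \<delta>) * ?q + C * \<tau>^2 * ?q"
        by (rule add_mono[OF A order_trans[OF Chalf B]])
      finally show ?thesis .
    qed
    then have 1: "(1 + \<tau> / l (N+1) + 62 * c^17 * \<tau>^2) * R \<le> ((1 - \<tau> * \<delta>) * ?q + C * \<tau>^2 * ?q) * R"
      by (rule mult_right_mono) (rule R0)
    have "62 * c^17 * \<tau>^2 \<le> 200 * c^17 * \<tau>^2" using p0 by linarith
    then have "62 * c^17 * \<tau>^2 \<le> C * \<tau>^2 * ?q" using B Chalf by (meson order_trans)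
    then have 2: "62 * c^17 * \<tau>^2 * m \<le> C * \<tau>^2 * ?q * m" by (rule mult_right_mono) (rule m0)
    have "(1 + \<tau> / l (N+1)) * R + \<tau>^2 * (62 * c^17) * (R + m)
        = (1 + \<tau> / l (N+1) + 62 * c^17 * \<tau>^2) * R + 62 * c^17 * \<tau>^2 * m" by algebra
    also have "\<dots> \<le> ((1 - \<tau> * \<delta>) * ?q + C * \<tau>^2 * ?q) * R + C * \<tau>^2 * ?q * m" using 1 2 by (rule add_mono)
    also have "\<dots> = ?R' * ?q" by algebra
    finally show ?thesis .
  qed
  have "PY.nm (ap I U' \<xi>) \<le> ?R' * ?q * PX.nm u"
    by (rule order_trans[OF upy], rule mult_right_mono[OF key]) simp
  also have "\<dots> = ?R' * (?q * PX.nm u)" by simp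
  also have "\<dots> \<le> ?R' * PX.nm (ap I U' \<xi>)" by (rule mult_left_mono[OF lowpx Rm])
  finally show ?thesis .
qed


section \<open>The predictor field after the predictor step\<close>

lemma F_predictor: "Aop Uh Uh = tm I (GT Uh) P - tm I Uh K'"
  unfolding Aop_def gram_preserved ..

abbreviation "L \<equiv> F + \<tau> *\<^sub>R (GT F - tm I F K)"
abbreviation "rest \<equiv> \<tau> *\<^sub>R (tm I (GT (D - F)) P + tm I (GT F) M - tm I (D - F) K' - tm I F (K' - K)) - tm I U (K' - K)"

lemma F_supp: "i \<notin> I \<Longrightarrow> F i = 0"
  by (auto simp: Aop_def tm_def)

lemma tm_GFP: "tm I (GT F) P = GT F + tm I (GT F) M"
proof -
  have "tm I (GT F) P = tm I (GT F) (mid I + M)" by simp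
  also have "\<dots> = GT F + tm I (GT F) M"
    unfolding tm_add_right by (subst tm_mid) (auto simp: F_supp)
  finally show ?thesis .
qed

lemma predictor_vector_identity:
  fixes f :: "'w::real_vector"
  assumes "f = gp - uk" "gP = gf + gfm"
  shows "(gp + t *\<^sub>R (gP + gep)) - ((uk + ukd) + t *\<^sub>R ((fk + fkd) + ek)) = f + t *\<^sub>R (gf - fk) + (t *\<^sub>R (gep + gfm - ek - fkd) - ukd)"
  unfolding assms by (simp add: algebra_simps)

text \<open>\<open>L\<close> is the linearisation F + \<tau> (G F - F K), whose two first-order
  terms carry the rates 1/\<open>l (N+1)\<close> and 1/\<open>l N\<close>. \<open>rest\<close>
  collects what is of second order in \<tau>, carries the defect, or comes from the change of
  \<open>K\<close>.\<close>

lemma predictor_split: "Aop Uh Uh = L + rest"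
proof -
  have D1: "tm I (GT D) P = tm I (GT F) P + tm I (GT (D - F)) P"
    by (simp add: GT_diff tm_diff_left)
  have K1: "tm I U K' = tm I U K + tm I U (K' - K)" by (simp only: tm_diff_right) simp
  have K2: "tm I D K' = (tm I F K + tm I F (K' - K)) + tm I (D - F) K'"
    by (simp only: tm_diff_right tm_diff_left) simp
  have "Aop Uh Uh = (tm I (GT U) P + \<tau> *\<^sub>R tm I (GT D) P) - (tm I U K' + \<tau> *\<^sub>R tm I D K')"
    unfolding F_predictor by (simp only: GT_add GT_scale tm_add_left tm_scale_left)
  also have "\<dots> = L + rest"
    unfolding D1 K1 K2 by (rule predictor_vector_identity[OF Aop_def tm_GFP])
  finally show ?thesis .
qed

lemma fn_mm_comm: "fn (mm I M K - mm I K M) \<le> 2 * c^5 * m"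
proof -
  have "fn (mm I M K) \<le> m * c^5" by (rule order_trans[OF mnm_mm]) (intro mult_left_mono fnK, simp)
  moreover have "fn (mm I K M) \<le> c^5 * m" by (rule order_trans[OF mnm_mm]) (intro mult_right_mono fnK, simp)
  ultimately show ?thesis using MD.nm_triangle_diff[of I "mm I M K" "mm I K M"] by (simp add: mult.commute)
qed

text \<open>Pairing F = G U P - U K with \<open>U\<close> gives a commutator of \<open>P\<close> and
  \<open>K\<close>; as P = I + M, it is the commutator with the defect. Hence \<open>F\<close> is
  almost orthogonal to \<open>U\<close>.\<close>

lemma gr_FU: "i \<in> I \<Longrightarrow> gr b F U i j = (mm I P K - mm I K P) i j"
proof -
  assume i: "i \<in> I"
  have "gr b F U i j = b (tm I (GT U) P i) (U j) - b (tm I U K i) (U j)"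
    by (simp only: gr_def Aop_def minus_apply B.diff_left)
  also have "\<dots> = (\<Sum>k\<in>I. P k i * b (GT U k) (U j)) - (\<Sum>k\<in>I. K k i * b (U k) (U j))"
    unfolding b_tm_left[OF i] ..
  also have "(\<Sum>k\<in>I. P k i * b (GT U k) (U j)) = mm I P K i j"
    unfolding mm_def
  proof (intro sum.cong refl)
    fix k
    have "b (GT U k) (U j) = K k j" by (simp only: gr_def GT_nth bG)
    then show "P k i * b (GT U k) (U j) = P i k * K k j" using K_sym(2)[of k i] by (simp only:)
  qed
  also have "(\<Sum>k\<in>I. K k i * b (U k) (U j)) = mm I K P i j"
    unfolding mm_def
  proof (intro sum.cong refl)
    fix k
    have "b (U k) (U j) = P k j" by (simp only: gr_def)
    then show "K k i * b (U k) (U j) = K i k * P k j" using K_sym(1)[of k i] by (simp only:)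
  qed
  finally show ?thesis by (simp only: minus_apply)
qed

lemma fn_gr_FU: "fn (gr b F U) \<le> 2 * c^5 * m"
proof -
  have "fn (gr b F U) = fn (mm I M K - mm I K M)"
  proof (rule mnm_cong)
    fix i j assume ij: "i \<in> I" "j \<in> I"
    have l: "mm I (mid I) K i j = K i j"
      using mv_mid[of I i "\<lambda>k. K k j"] ij by (simp add: mv_def mm_def)
    have "(\<Sum>k\<in>I. K i k * mid I k j) = (\<Sum>k\<in>I. if k = j then K i k else 0)"
      by (intro sum.cong) (auto simp: mid_def)
    then have r: "mm I K (mid I) i j = K i j" using ij by (simp add: mm_def)
    show "gr b F U i j = (mm I M K - mm I K M) i j"
      unfolding gr_FU[OF ij(1)] mm_diff_left mm_diff_right minus_apply l r by simp
  qed
  then show ?thesis using fn_mm_comm by simp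
qed

lemma gr_tm_right_in: "j \<in> I \<Longrightarrow> gr b Z (tm I Y A) i j = mm I (gr b Z Y) A i j"
  by (simp add: gr_def mm_def tm_def B.sum_right B.scale_right mult.commute)

text \<open>Substituting G U = F + U K - G U M leaves the pairing of \<open>F\<close> with itself,
  the small pairing with \<open>U\<close>, and a term with \<open>M\<close>: quadratic in
  \<open>F\<close> instead of linear.\<close>

lemma fn_gr_FGU: "fn (gr b F (GT U)) \<le> c^2 * (nA F)^2 + 4 * c^10 * m"
proof -
  have GU: "GT U = F + tm I U K - tm I (GT U) M" unfolding Aop_def tm_GP by simp
  have e: "gr b F (GT U) = gr b F F + gr b F (tm I U K) - gr b F (tm I (GT U) M)"
  proof -
    have "gr b F (GT U) = gr b F (F + tm I U K - tm I (GT U) M)" using GU by (rule arg_cong)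
    then show ?thesis by (simp only: B.gr_add_right B.gr_diff_right)
  qed
  have 1: "fn (gr b F F) \<le> c^2 * (nA F)^2" using grc[of F F] by (simp add: power2_eq_square mult.assoc)
  have 2: "fn (gr b F (tm I U K)) \<le> 2 * c^5 * m * c^5"
  proof -
    have "fn (gr b F (tm I U K)) = fn (mm I (gr b F U) K)" by (rule mnm_cong) (rule gr_tm_right_in)
    also have "\<dots> \<le> 2 * c^5 * m * c^5"
      by (rule order_trans[OF mnm_mm]) (intro mult_mono fn_gr_FU fnK, auto)
    finally show ?thesis .
  qed
  have 3: "fn (gr b F (tm I (GT U) M)) \<le> c^2 * (2 * c^6) * (c^2 * m)"
    by (intro grc' nAF tmc nAGU order_refl)
  have "fn (gr b F (GT U)) \<le> fn (gr b F F) + fn (gr b F (tm I U K)) + fn (gr b F (tm I (GT U) M))"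
    unfolding e using MD.nm_triangle_diff[of I "gr b F F + gr b F (tm I U K)" "gr b F (tm I (GT U) M)"]
      MD.nm_triangle[of I "gr b F F" "gr b F (tm I U K)"] by linarith
  also have "\<dots> \<le> c^2 * (nA F)^2 + 2 * c^5 * m * c^5 + c^2 * (2 * c^6) * (c^2 * m)" using 1 2 3 by linarith
  also have "\<dots> = c^2 * (nA F)^2 + 4 * c^10 * m" by algebra
  finally show ?thesis .
qed

text \<open>A bound linear in \<open>F\<close> would spoil the coefficient of \<tau> in the
  contraction factor. By \<open>fn_gr_FGU\<close> the part of first order in \<tau> is quadratic in
  \<open>F\<close> up to the defect.\<close>

lemma fn_K'_diff_sharp: "fn (K' - K) \<le> \<tau> * (2 * c^2 * (nA F)^2 + 8 * c^10 * m) + 12 * c^9 * \<tau>^2 * nA F"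
proof -
  have S: "fn (gr b D (GT U)) \<le> c^2 * (nA F)^2 + 4 * c^10 * m + c^2 * (\<tau> * (2 * c^5 * nA F)) * c^2"
  proof -
    have "gr b D (GT U) = gr b F (GT U) + gr b (D - F) (GT U)" by (simp only: B.gr_diff_left) simp
    then have "fn (gr b D (GT U)) \<le> fn (gr b F (GT U)) + fn (gr b (D - F) (GT U))" using MD.nm_triangle by metis
    moreover have "fn (gr b (D - F) (GT U)) \<le> c^2 * (\<tau> * (2 * c^5 * nA F)) * c^2" by (intro grc' nDF nAGU)
    ultimately show ?thesis using fn_gr_FGU by linarith
  qed
  have ST: "fn (gr b U (GT D)) = fn (gr b D (GT U))"
  proof -
    have "gr b U (GT D) = (\<lambda>i j. gr b D (GT U) j i)"
      by (intro ext) (simp only: gr_def GT_nth bG[symmetric] B.psd_sym[of "G (U _)"])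
    then have "fn (gr b U (GT D)) = fn (\<lambda>i j. gr b D (GT U) j i)" by (rule arg_cong)
    also have "\<dots> = fn (gr b D (GT U))" by (rule mnm_transpose)
    finally show ?thesis .
  qed
  have "fn (K' - K) \<le> \<tau> * (fn (gr b D (GT U)) + fn (gr b U (GT D))) + \<tau>^2 * fn (gr b D (GT D))"
    unfolding K'_diff using t0
    by (intro order_trans[OF MD.nm_triangle] add_mono) (auto simp: MD.nm_scale intro!: mult_left_mono MD.nm_triangle)
  also have "\<dots> \<le> \<tau> * (2 * (c^2 * (nA F)^2 + 4 * c^10 * m + c^2 * (\<tau> * (2 * c^5 * nA F)) * c^2)) + \<tau>^2 * (8 * c^9 * nA F)"
  proof (rule add_mono)
    show "\<tau> * (fn (gr b D (GT U)) + fn (gr b U (GT D)))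
        \<le> \<tau> * (2 * (c^2 * (nA F)^2 + 4 * c^10 * m + c^2 * (\<tau> * (2 * c^5 * nA F)) * c^2))"
      unfolding ST using add_mono[OF S S] by (intro mult_left_mono[OF _ t0]) (simp only: mult_2)
  qed (rule fn_gr_DGD)
  also have "\<dots> = \<tau> * (2 * c^2 * (nA F)^2 + 8 * c^10 * m) + 12 * c^9 * \<tau>^2 * nA F" by algebra
  finally show ?thesis .
qed


end

lemma abs_lower: "\<bar>x\<bar> \<le> b \<Longrightarrow> - b \<le> (x::real)"
  by simp

text \<open>Here \<open>f\<close> is the old field, \<open>p\<close> the linearised part and
  \<open>r\<close> the rest. Each product is brought to one of the orders \<tau> (m + R) f^2,
  \<tau>^2 f^2 or \<tau> m by spending surplus factors through \<open>FR\<close>, \<open>f6\<close>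
  and \<open>m4\<close>.\<close>

lemma predictor_arith:
  fixes f c m R \<tau> r p q :: real
  assumes c1: "1 \<le> c" and f0: "0 \<le> f" and f6: "f \<le> 2 * c^6" and m0: "0 \<le> m" and m4: "m \<le> 2 * c^4"
    and R0: "0 \<le> R" and t0: "0 \<le> \<tau>" and t1: "\<tau> * (10^6 * c^40) \<le> 1"
    and r: "0 \<le> r" "r \<le> \<tau> * (2 * c^3 * f^2 + 10 * c^11 * m) + 32 * c^10 * \<tau>^2 * f"
    and FR: "f \<le> 5 * c^10 * (m + R)"
    and L0: "0 \<le> p" "p \<le> 2 * f"
    and L: "p^2 \<le> f^2 + 2 * \<tau> * (- \<delta> * f^2 + (8 * c^14 * m + 2 * c^8 * R * f^2) + (c * m + 2 * c^7 * R) * f^2) + \<tau>^2 * (2 * c^5 * f)^2"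
  shows "(p + r)^2 \<le> (1 - 2 * \<tau> * \<delta> + 1000 * c^30 * \<tau> * (m + R) + 10000 * c^30 * \<tau>^2) * f^2 + 10000 * c^40 * \<tau> * m"
proof -
  have c0: "0 \<le> c" using c1 by simp
  have cp: "c^i \<le> c^j" if "i \<le> j" for i j using that c1 by (rule power_increasing)
  have cn: "0 \<le> c^i" "1 \<le> c^i" for i using c0 c1 by auto
  have tc: "\<tau> * c^n * 10^6 \<le> 1" if "n \<le> 40" for n
    using mult_left_mono[OF mult_right_mono[OF cp[OF that], of "10^6"] t0] t1 by (simp add: ac_simps)
  have tt1: "\<tau> \<le> 1" using tc[of 0] t0 by simp
  define x where "x = 2 * c^3 * \<tau> * f^2"
  define y where "y = 10 * c^11 * \<tau> * m"
  define z where "z = 32 * c^10 * \<tau>^2 * f"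
  have xyz: "r \<le> x + y + z" using r(2) by (simp add: x_def y_def z_def algebra_simps)
  have nn: "0 \<le> x" "0 \<le> y" "0 \<le> z" using c0 t0 f0 m0 by (auto simp: x_def y_def z_def)
  have "r^2 \<le> (x + y + z)^2" using xyz r(1) by (intro power_mono) auto
  also have "\<dots> \<le> 3 * (x^2 + y^2 + z^2)"
  proof -
    have "0 \<le> (x - y)^2 + (y - z)^2 + (x - z)^2" by simp
    then show ?thesis by (simp add: power2_eq_square algebra_simps)
  qed
  finally have r2: "r^2 \<le> 3 * x^2 + 3 * y^2 + 3 * z^2" by simp
  have pr: "2 * p * r \<le> 4 * f * x + 4 * f * y + 4 * f * z"
  proof -
    have "p * r \<le> (2 * f) * (x + y + z)" using L0 r(1) xyz f0 by (intro mult_mono) auto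
    then show ?thesis by (simp add: algebra_simps)
  qed
  have f2: "f^2 \<le> 4 * c^12"
  proof -
    have "f^2 \<le> (2 * c^6)^2" by (rule power_mono[OF f6 f0])
    also have "\<dots> = 4 * c^12" by algebra
    finally show ?thesis .
  qed
  have tmf: "0 \<le> \<tau> * m" "0 \<le> \<tau>^2 * f^2" "0 \<le> \<tau> * (m + R) * f^2" using t0 m0 R0 by auto
  have b1: "3 * x^2 \<le> 48 * c^18 * (\<tau>^2 * f^2)"
  proof -
    have "3 * x^2 = 12 * c^6 * \<tau>^2 * f^2 * f^2" unfolding x_def by algebra
    also have "\<dots> \<le> 12 * c^6 * \<tau>^2 * f^2 * (4 * c^12)" by (intro mult_left_mono f2) (use cn in auto)
    also have "\<dots> = 48 * c^18 * (\<tau>^2 * f^2)" by algebra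
    finally show ?thesis .
  qed
  have b2: "3 * y^2 \<le> 600 * c^26 * (\<tau> * m)"
  proof -
    have "3 * y^2 = 300 * c^22 * (\<tau> * m) * (\<tau> * m)" unfolding y_def by algebra
    also have "\<dots> \<le> 300 * c^22 * (\<tau> * m) * (1 * (2 * c^4))"
      by (intro mult_left_mono mult_mono tt1 m4) (use cn tmf m0 in auto)
    also have "\<dots> = 600 * c^26 * (\<tau> * m)" by algebra
    finally show ?thesis .
  qed
  have b3: "3 * z^2 \<le> 3072 * c^20 * (\<tau>^2 * f^2)"
  proof -
    have "3 * z^2 = 3072 * c^20 * (\<tau>^2 * f^2) * \<tau>^2" unfolding z_def by algebra
    also have "\<dots> \<le> 3072 * c^20 * (\<tau>^2 * f^2) * 1"
      using tt1 t0 cn by (intro mult_left_mono) (auto simp: power_le_one)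
    finally show ?thesis by simp
  qed
  have b4: "4 * f * x \<le> 40 * c^13 * (\<tau> * (m + R) * f^2)"
  proof -
    have "4 * f * x = 8 * c^3 * \<tau> * f^2 * f" unfolding x_def by algebra
    also have "\<dots> \<le> 8 * c^3 * \<tau> * f^2 * (5 * c^10 * (m + R))" by (intro mult_left_mono FR) (use c0 t0 m0 f0 tmf in \<open>auto intro!: mult_nonneg_nonneg\<close>)
    also have "\<dots> = 40 * c^13 * (\<tau> * (m + R) * f^2)" by algebra
    finally show ?thesis .
  qed
  have b5: "4 * f * y \<le> 80 * c^17 * (\<tau> * m)"
  proof -
    have "4 * f * y = 40 * c^11 * (\<tau> * m) * f" unfolding y_def by algebra
    also have "\<dots> \<le> 40 * c^11 * (\<tau> * m) * (2 * c^6)" by (intro mult_left_mono f6) (use c0 t0 m0 f0 tmf in \<open>auto intro!: mult_nonneg_nonneg\<close>)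
    also have "\<dots> = 80 * c^17 * (\<tau> * m)" by algebra
    finally show ?thesis .
  qed
  have b6: "4 * f * z = 128 * c^10 * (\<tau>^2 * f^2)" unfolding z_def by algebra
  have b7: "2 * \<tau> * (c * m * f^2) \<le> 8 * c^13 * (\<tau> * m)"
  proof -
    have "2 * \<tau> * (c * m * f^2) = 2 * c * (\<tau> * m) * f^2" by algebra
    also have "\<dots> \<le> 2 * c * (\<tau> * m) * (4 * c^12)" by (intro mult_left_mono f2) (use c0 t0 m0 f0 tmf in \<open>auto intro!: mult_nonneg_nonneg\<close>)
    also have "\<dots> = 8 * c^13 * (\<tau> * m)" by algebra
    finally show ?thesis .
  qed
  have b8: "\<tau> * R * f^2 \<le> \<tau> * (m + R) * f^2"
    using t0 m0 by (intro mult_right_mono mult_left_mono) auto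
  define A where "A = \<tau>^2 * f^2"
  define B where "B = \<tau> * m"
  define E where "E = \<tau> * (m + R) * f^2"
  have nnA: "0 \<le> A" "0 \<le> B" "0 \<le> E" using tmf by (auto simp: A_def B_def E_def)
  have "p^2 \<le> f^2 - 2 * \<tau> * \<delta> * f^2 + 16 * c^14 * B + 4 * c^8 * (\<tau> * R * f^2) + 2 * \<tau> * (c * m * f^2) + 4 * c^7 * (\<tau> * R * f^2) + 4 * c^10 * A"
  proof -
    have "f^2 + 2 * \<tau> * (- \<delta> * f^2 + (8 * c^14 * m + 2 * c^8 * R * f^2) + (c * m + 2 * c^7 * R) * f^2) + \<tau>^2 * (2 * c^5 * f)^2
      = f^2 - 2 * \<tau> * \<delta> * f^2 + 16 * c^14 * B + 4 * c^8 * (\<tau> * R * f^2) + 2 * \<tau> * (c * m * f^2) + 4 * c^7 * (\<tau> * R * f^2) + 4 * c^10 * A"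
      unfolding A_def B_def by algebra
    then show ?thesis using L by (simp only:)
  qed
  also have "\<dots> \<le> f^2 - 2 * \<tau> * \<delta> * f^2 + 16 * c^14 * B + 4 * c^8 * E + 8 * c^13 * B + 4 * c^7 * E + 4 * c^10 * A"
    unfolding B_def E_def by (intro add_mono order_refl b7 mult_left_mono b8) (use cn c0 in auto)
  finally have P: "p^2 \<le> f^2 - 2 * \<tau> * \<delta> * f^2 + 16 * c^14 * B + 4 * c^8 * E + 8 * c^13 * B + 4 * c^7 * E + 4 * c^10 * A" .
  have "(p + r)^2 = p^2 + 2 * p * r + r^2" by (simp add: power2_sum)
  also have "\<dots> \<le> (f^2 - 2 * \<tau> * \<delta> * f^2 + 16 * c^14 * B + 4 * c^8 * E + 8 * c^13 * B + 4 * c^7 * E + 4 * c^10 * A)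
     + (40 * c^13 * E + 80 * c^17 * B + 128 * c^10 * A) + (48 * c^18 * A + 600 * c^26 * B + 3072 * c^20 * A)"
    using P pr r2 b1 b2 b3 b4 b5 b6 unfolding A_def[symmetric] B_def[symmetric] E_def[symmetric] by linarith
  also have "\<dots> \<le> (f^2 - 2 * \<tau> * \<delta> * f^2 + 16 * c^30 * B + 4 * c^30 * E + 8 * c^30 * B + 4 * c^30 * E + 4 * c^30 * A)
     + (40 * c^30 * E + 80 * c^30 * B + 128 * c^30 * A) + (48 * c^30 * A + 600 * c^30 * B + 3072 * c^30 * A)"
    by (intro add_mono order_refl mult_right_mono mult_left_mono cp nnA) auto
  also have "\<dots> \<le> (f^2 - 2 * \<tau> * \<delta> * f^2) + 1000 * c^30 * E + 10000 * c^30 * A + 10000 * c^30 * B"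
    using mult_nonneg_nonneg[OF cn(1)[of 30] nnA(1)] mult_nonneg_nonneg[OF cn(1)[of 30] nnA(2)]
      mult_nonneg_nonneg[OF cn(1)[of 30] nnA(3)] by linarith
  also have "\<dots> \<le> (f^2 - 2 * \<tau> * \<delta> * f^2) + 1000 * c^30 * E + 10000 * c^30 * A + 10000 * c^40 * B"
    by (intro add_left_mono mult_right_mono mult_left_mono cp nnA) auto
  also have "\<dots> = (1 - 2 * \<tau> * \<delta> + 1000 * c^30 * \<tau> * (m + R) + 10000 * c^30 * \<tau>^2) * f^2 + 10000 * c^40 * \<tau> * m"
    unfolding A_def B_def E_def by algebra
  finally show ?thesis .
qed

context step
begin

lemma nrest: "nA rest \<le> \<tau> * (2 * c^3 * (nA F)^2 + 10 * c^11 * m) + 32 * c^10 * \<tau>^2 * nA F"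
proof -
  have f0: "0 \<le> nA F" by simp
  have 1: "nA (tm I (GT (D - F)) P) \<le> (c * (\<tau> * (2 * c^5 * nA F))) * c^4"
    by (intro tmc fnP order_trans[OF nAGc] mult_left_mono nDF) simp
  have 2: "nA (tm I (GT F) M) \<le> (c * (2 * c^6)) * m"
    by (intro tmc order_refl order_trans[OF nAGc] mult_left_mono nAF) simp
  have 3: "nA (tm I (D - F) K') \<le> (\<tau> * (2 * c^5 * nA F)) * (4 * c^5)"
    by (intro tmc nDF fnK')
  have 4: "nA (tm I F (K' - K)) \<le> (2 * c^6) * (5 * c^4 * (\<tau> * nA F))"
    by (intro tmc nAF fn_K'_diff)
  have 5: "nA (tm I U (K' - K)) \<le> c * (\<tau> * (2 * c^2 * (nA F)^2 + 8 * c^10 * m) + 12 * c^9 * \<tau>^2 * nA F)"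
    by (intro tmc nAU fn_K'_diff_sharp)
  let ?Z = "tm I (GT (D - F)) P + tm I (GT F) M - tm I (D - F) K' - tm I F (K' - K)"
  have Z: "nA ?Z \<le> (c * (\<tau> * (2 * c^5 * nA F))) * c^4 + (c * (2 * c^6)) * m + (\<tau> * (2 * c^5 * nA F)) * (4 * c^5)
      + (2 * c^6) * (5 * c^4 * (\<tau> * nA F))"
    by (intro order_trans[OF TA.nm_triangle_diff] order_trans[OF TA.nm_triangle] add_mono 1 2 3 4)
  have "nA rest \<le> nA (\<tau> *\<^sub>R ?Z) + nA (tm I U (K' - K))" by (rule TA.nm_triangle_diff)
  also have "nA (\<tau> *\<^sub>R ?Z) = \<tau> * nA ?Z" unfolding TA.nm_scale using t0 by simp
  also have "\<tau> * nA ?Z + nA (tm I U (K' - K)) \<le> \<tau> * ((c * (\<tau> * (2 * c^5 * nA F))) * c^4 + (c * (2 * c^6)) * m + (\<tau> * (2 * c^5 * nA F)) * (4 * c^5)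
      + (2 * c^6) * (5 * c^4 * (\<tau> * nA F))) + c * (\<tau> * (2 * c^2 * (nA F)^2 + 8 * c^10 * m) + 12 * c^9 * \<tau>^2 * nA F)"
    by (rule add_mono[OF mult_left_mono[OF Z t0] 5])
  also have "\<dots> = \<tau> * (2 * c^3 * (nA F)^2 + 8 * c^11 * m + 2 * c^7 * m) + 32 * c^10 * \<tau>^2 * nA F" by algebra
  also have "\<dots> \<le> \<tau> * (2 * c^3 * (nA F)^2 + 8 * c^11 * m + 2 * c^11 * m) + 32 * c^10 * \<tau>^2 * nA F"
    by (intro add_right_mono mult_left_mono[OF _ t0] add_left_mono mult_right_mono mult_left_mono cp) auto
  also have "\<dots> = \<tau> * (2 * c^3 * (nA F)^2 + 10 * c^11 * m) + 32 * c^10 * \<tau>^2 * nA F" by algebra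
  finally show ?thesis .
qed

lemma nGFK: "nA (GT F - tm I F K) \<le> 2 * c^5 * nA F"
proof -
  have "nA (tm I F K) \<le> nA F * c^5" by (intro tmc order_refl fnK)
  then have "nA (GT F - tm I F K) \<le> c * nA F + nA F * c^5"
    using TA.nm_triangle_diff[of "GT F" "tm I F K"] nAGc[of F] by linarith
  also have "\<dots> \<le> c^5 * nA F + nA F * c^5"
    using cp[of 1 5] by (intro add_right_mono mult_right_mono) auto
  finally show ?thesis by (simp add: mult.commute)
qed

text \<open>With Y the coordinate matrix of \<open>F\<close>, Y^T = Y^T (I - X X^T) + (Y^T X) X^T.
  The first term is small by \<open>fnS\<close>; Y^T X is \<open>gr b F U\<close> less its
  complement share. So \<open>F\<close> lies almost in the complement.\<close>

lemma nXF: "nX F \<le> 4 * c^7 * m + 2 * c^7 * R * nA F"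
proof -
  let ?A = "mm I (\<lambda>i k. Xm F k i) X"
  have XF: "fn (\<lambda>i k. Xm F k i) = nX F" by (rule trans[OF mnm_transpose fn_Xm])
  have nXFc: "nX F \<le> c * nA F" using order_trans[OF nX_le nBc] .
  have A: "fn ?A \<le> 2 * c^5 * m + c^3 * R * nA F"
  proof -
    have eq: "?A = gr b F U - Yg F U"
    proof (intro ext)
      fix i j show "?A i j = (gr b F U - Yg F U) i j"
        unfolding mm_def Xm_def minus_apply gr_def Yg_def using b_decomp[of "F i" "U j"] by (simp add: PX_def)
    qed
    have Yb: "fn (Yg F U) \<le> c^3 * R * nA F"
    proof -
      have "fn (Yg F U) \<le> g * (nY F * nY U)" using fn_Yg[of F U] by (simp add: mult.assoc)
      also have "\<dots> \<le> c * (nA F * (R * c^2))" using g1 by (intro mult_mono cg nY_le nYU) auto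
      also have "\<dots> = c^3 * R * nA F" by algebra
      finally show ?thesis .
    qed
    show ?thesis unfolding eq by (rule order_trans[OF MD.nm_triangle_diff add_mono[OF fn_gr_FU Yb]])
  qed
  have e1: "nX F = fn (mm I (\<lambda>i k. Xm F k i) (mid I - mm I X XT) + mm I ?A XT)"
    unfolding XF[symmetric]
  proof (rule mnm_cong)
    fix i j assume ij: "i \<in> I" "j \<in> I"
    have "(\<Sum>k\<in>I. Xm F k i * mid I k j) = (\<Sum>k\<in>I. if k = j then Xm F k i else 0)"
      by (intro sum.cong) (auto simp: mid_def)
    then have "mm I (\<lambda>i k. Xm F k i) (mid I) i j = Xm F j i" using ij by (simp add: mm_def)
    then show "Xm F j i = (mm I (\<lambda>i k. Xm F k i) (mid I - mm I X XT) + mm I ?A XT) i j"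
      unfolding mm_diff_right mm_assoc plus_fun_apply minus_apply by simp
  qed
  have e0: "nX F \<le> fn (mm I (\<lambda>i k. Xm F k i) (mid I - mm I X XT)) + fn (mm I ?A XT)"
    by (rule order_trans[OF eq_refl[OF e1] MD.nm_triangle])
  have b1: "fn (mm I (\<lambda>i k. Xm F k i) (mid I - mm I X XT)) \<le> (c * nA F) * (m + c^6 * R)"
  proof (rule order_trans[OF mnm_mm], rule mult_mono)
    show "fn (\<lambda>i k. Xm F k i) \<le> c * nA F" unfolding XF by (rule nXFc)
    show "fn (mid I - mm I X XT) \<le> m + c^6 * R"
      using fnS(2) c5R2 MD.nm_minus[of I "mm I X XT - mid I"] by simp
  qed auto
  have b2: "fn (mm I ?A XT) \<le> (2 * c^5 * m + c^3 * R * nA F) * c^2"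
  proof (rule order_trans[OF mnm_mm], rule mult_mono[OF A])
    show "fn XT \<le> c^2" by (rule order_trans[OF eq_refl[OF trans[OF mnm_transpose fn_Xm]] nXU])
  qed (auto simp: R0)
  have "nX F \<le> (c * nA F) * (m + c^6 * R) + (2 * c^5 * m + c^3 * R * nA F) * c^2"
    by (rule order_trans[OF e0 add_mono[OF b1 b2]])
  also have "(c * nA F) * (m + c^6 * R) + (2 * c^5 * m + c^3 * R * nA F) * c^2
      = c * nA F * m + c^7 * R * nA F + 2 * c^7 * m + c^5 * R * nA F" by algebra
  also have "\<dots> \<le> c * (2 * c^6) * m + c^7 * R * nA F + 2 * c^7 * m + c^7 * R * nA F"
    by (intro add_mono mult_right_mono mult_left_mono nAF cp order_refl R0) auto
  also have "\<dots> = 4 * c^7 * m + 2 * c^7 * R * nA F" by algebra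
  finally show ?thesis .
qed

lemma TA_FGF: "tform I a F (GT F) \<le> (nA F)^2 / l (N+1) + (8 * c^14 * m + 2 * c^8 * R * (nA F)^2)"
proof -
  have "tform I a F (GT F) = tform I b F F"
    unfolding tform_def by (intro sum.cong refl) (simp only: GT_nth aG_right)
  also have "\<dots> \<le> (nX F)^2 + (nY F)^2 / l (N+1)"
    unfolding TX.nm_sq TY.nm_sq unfolding tform_def sum_divide_distrib sum.distrib[symmetric] by (intro sum_mono b_le)
  also have "(nY F)^2 / l (N+1) \<le> (nA F)^2 / l (N+1)"
    using l_pos'(3) by (intro divide_right_mono power_mono nY_le) auto
  also have "(nX F)^2 \<le> (4 * c^7 * m + 2 * c^7 * R * nA F) * (c * nA F)"
    unfolding power2_eq_square by (rule mult_mono[OF nXF order_trans[OF nX_le nBc]]) (auto simp: R0)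
  also have "\<dots> = 4 * c^8 * m * nA F + 2 * c^8 * R * (nA F)^2" by algebra
  also have "4 * c^8 * m * nA F \<le> 4 * c^8 * m * (2 * c^6)" by (intro mult_left_mono nAF) auto
  also have "4 * c^8 * m * (2 * c^6) = 8 * c^14 * m" by algebra
  finally show ?thesis by (simp only: ac_simps)
qed

lemma tform_tm: "tform I a Z (tm I Z A) = (\<Sum>i\<in>I. \<Sum>j\<in>I. A i j * a (Z i) (Z j))"
proof -
  have "tform I a Z (tm I Z A) = (\<Sum>j\<in>I. \<Sum>i\<in>I. A i j * a (Z j) (Z i))"
    unfolding tform_def by (intro sum.cong refl) (simp add: tm_def A.sum_right A.scale_right)
  also have "\<dots> = (\<Sum>i\<in>I. \<Sum>j\<in>I. A i j * a (Z j) (Z i))" by (rule sum.swap)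
  finally show ?thesis using A.psd_sym by simp
qed

lemma tform_tm_bound: "\<bar>tform I a Z (tm I Z A)\<bar> \<le> fn A * (nA Z)^2"
proof -
  have "\<bar>tform I a Z (tm I Z A)\<bar> \<le> nA Z * nA (tm I Z A)" by (rule TA.Cauchy_Schwarz)
  also have "\<dots> \<le> nA Z * (nA Z * fn A)" by (intro mult_left_mono tmc order_refl) auto
  finally show ?thesis by (simp add: power2_eq_square ac_simps)
qed

lemma a_ap_ap: "a (ap I Z \<xi>) (ap I Z \<xi>) = (\<Sum>i\<in>I. \<Sum>j\<in>I. \<xi> i * \<xi> j * a (Z i) (Z j))"
  by (simp add: A.f_ap_ap tform_def mv_def gr_def sum_distrib_left ac_simps)

text \<open>With \<open>K\<close> split as X^T Lx + Ky the pairing becomes a sum of energies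
  weighted by 1/\<open>l k\<close>, each weight at least 1/\<open>l N\<close>; the unweighted sum is
  the energy of \<open>F\<close> up to the error of X^T X.\<close>

lemma TA_FFK: "(nA F)^2 / l N - (c * m + 2 * c^7 * R) * (nA F)^2 \<le> tform I a F (tm I F K)"
proof -
  let ?f = "nA F"
  have sw: "(\<Sum>i\<in>I. \<Sum>j\<in>I. (\<Sum>k\<in>I. w k * (X k i * X k j)) * a (F i) (F j)) = (\<Sum>k\<in>I. w k * a (ap I F (X k)) (ap I F (X k)))" for w
  proof -
    have "(\<Sum>i\<in>I. \<Sum>j\<in>I. (\<Sum>k\<in>I. w k * (X k i * X k j)) * a (F i) (F j))
      = (\<Sum>i\<in>I. \<Sum>j\<in>I. \<Sum>k\<in>I. w k * (X k i * X k j * a (F i) (F j)))"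
      by (simp only: sum_distrib_right mult.assoc)
    also have "\<dots> = (\<Sum>i\<in>I. \<Sum>k\<in>I. \<Sum>j\<in>I. w k * (X k i * X k j * a (F i) (F j)))"
      by (intro sum.cong refl sum.swap)
    also have "\<dots> = (\<Sum>k\<in>I. \<Sum>i\<in>I. \<Sum>j\<in>I. w k * (X k i * X k j * a (F i) (F j)))" by (rule sum.swap)
    finally show ?thesis by (simp only: a_ap_ap sum_distrib_left)
  qed
  have Kx: "tform I a F (tm I F (mm I XT Lx)) = (\<Sum>k\<in>I. (1 / l k) * a (ap I F (X k)) (ap I F (X k)))"
    unfolding sw[symmetric] tform_tm
  proof (intro sum.cong refl arg_cong2[where f="(*)"])
    fix i j
    show "mm I XT Lx i j = (\<Sum>k\<in>I. (1 / l k) * (X k i * X k j))"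
      unfolding mm_def by (intro sum.cong refl) (simp add: Lx_def)
  qed
  have XX: "tform I a F (tm I F (mm I XT X)) = (\<Sum>k\<in>I. 1 * a (ap I F (X k)) (ap I F (X k)))"
    unfolding sw[symmetric] tform_tm
    by (intro sum.cong refl arg_cong2[where f="(*)"]) (simp add: mm_def)
  have F0: "tm I F (mid I) = F" by (rule tm_mid) (auto simp: F_supp)
  have "tform I a F (tm I F (mm I XT X)) = tform I a F (tm I F (mid I)) + tform I a F (tm I F (mm I XT X - mid I))"
    unfolding tm_diff_right TA.diff_right by simp
  also have "\<dots> \<ge> ?f^2 - (m + c^5 * R^2) * ?f^2"
  proof -
    have "fn (mm I XT X - mid I) * ?f^2 \<le> (m + c^5 * R^2) * ?f^2" by (intro mult_right_mono fnS(1)) simp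
    then show ?thesis using tform_tm_bound[of F "mm I XT X - mid I"] unfolding F0 TA.nm_sq by linarith
  qed
  finally have 1: "?f^2 - (m + c^5 * R^2) * ?f^2 \<le> tform I a F (tm I F (mm I XT X))" .
  have "(1 / l N) * tform I a F (tm I F (mm I XT X)) \<le> tform I a F (tm I F (mm I XT Lx))"
    unfolding Kx XX sum_distrib_left
  proof (rule sum_mono)
    fix k assume k: "k \<in> I"
    have "1 / l N \<le> 1 / l k" using l_mono[OF k] l_pos'(1)[OF k] by (intro divide_left_mono) auto
    then show "1 / l N * (1 * a (ap I F (X k)) (ap I F (X k))) \<le> (1 / l k) * a (ap I F (X k)) (ap I F (X k))"
      using A.psd_nonneg by (simp only: mult_1_left mult_right_mono)
  qed
  moreover have "(1 / l N) * (?f^2 - (m + c^5 * R^2) * ?f^2) \<le> (1 / l N) * tform I a F (tm I F (mm I XT X))"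
    using l_pos'(2) by (intro mult_left_mono 1) auto
  ultimately have 2: "(1 / l N) * (?f^2 - (m + c^5 * R^2) * ?f^2) \<le> tform I a F (tm I F (mm I XT Lx))" by linarith
  have 3: "(1 / l N) * ((m + c^5 * R^2) * ?f^2) \<le> c * ((m + c^6 * R) * ?f^2)"
  proof (intro mult_mono)
    show "1 / l N \<le> c" using inv_l1(3)[of N] N1 cg by auto
  qed (use c5R2 R0 in auto)
  have 4: "fn Ky \<le> c^7 * R"
  proof -
    have "c^6 * R^2 \<le> c^6 * (c * R)" by (intro mult_left_mono R2) simp
    also have "\<dots> = c^7 * R" by algebra
    finally show ?thesis using fnKy by linarith
  qed
  have 5: "- (c^7 * R * ?f^2) \<le> tform I a F (tm I F Ky)"
    by (rule abs_lower, rule order_trans[OF tform_tm_bound mult_right_mono[OF 4]]) simp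
  have "tform I a F (tm I F K) = tform I a F (tm I F (mm I XT Lx)) + tform I a F (tm I F Ky)"
  proof -
    have "tform I a F (tm I F K) = tform I a F (tm I F (mm I XT Lx + Ky))" using K_split by (rule arg_cong)
    then show ?thesis by (simp only: tm_add_right TA.add_right)
  qed
  moreover have "(1 / l N) * (?f^2 - (m + c^5 * R^2) * ?f^2) = ?f^2 / l N - (1 / l N) * ((m + c^5 * R^2) * ?f^2)"
    by (simp add: right_diff_distrib)
  ultimately have "?f^2 / l N - c * ((m + c^6 * R) * ?f^2) - c^7 * R * ?f^2 \<le> tform I a F (tm I F K)"
    using 2 3 5 by argo
  moreover have "?f^2 / l N - c * ((m + c^6 * R) * ?f^2) - c^7 * R * ?f^2 = ?f^2 / l N - (c * m + 2 * c^7 * R) * ?f^2"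
    by algebra
  ultimately show ?thesis by (simp only:)
qed


lemma predictor_contraction:
  "(nA (Aop Uh Uh))^2 \<le> (1 - 2 * \<tau> * (1 / l N - 1 / l (N+1)) + 1000 * c^30 * \<tau> * (m + R) + 10000 * c^30 * \<tau>^2) * (nA F)^2
     + 10000 * c^40 * \<tau> * m"
proof -
  have Lp: "nA L \<le> 2 * nA F"
  proof -
    have 1: "nA L \<le> nA F + nA (\<tau> *\<^sub>R (GT F - tm I F K))" by (rule TA.nm_triangle)
    have "nA (\<tau> *\<^sub>R (GT F - tm I F K)) = \<tau> * nA (GT F - tm I F K)" unfolding TA.nm_scale using t0 by simp
    also have "\<dots> \<le> \<tau> * (2 * c^5 * nA F)" by (rule mult_left_mono[OF nGFK t0])
    also have "\<dots> = (\<tau> * c^5 * 2) * nA F" by algebra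
    also have "\<dots> \<le> 1 * nA F" using tc[of 5] by (intro mult_right_mono) auto
    finally have 2: "nA (\<tau> *\<^sub>R (GT F - tm I F K)) \<le> 1 * nA F" .
    have ar: "p \<le> 2 * f" if "p \<le> f + x" "x \<le> 1 * f" for p f x :: real using that by simp
    show ?thesis by (rule ar[OF 1 2])
  qed
  \<comment> \<open>The cross term supplies the gap: \<open>TA_FGF\<close> bounds the part with G F
    from above, \<open>TA_FFK\<close> the part with F K from below.\<close>
  have L2: "(nA L)^2 \<le> (nA F)^2 + 2 * \<tau> * (- (1 / l N - 1 / l (N+1)) * (nA F)^2 + (8 * c^14 * m + 2 * c^8 * R * (nA F)^2) + (c * m + 2 * c^7 * R) * (nA F)^2)
      + \<tau>^2 * (2 * c^5 * nA F)^2"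
  proof -
    have ex: "(nA (x + \<tau> *\<^sub>R y))^2 = (nA x)^2 + 2 * \<tau> * tform I a x y + \<tau>^2 * (nA y)^2" for x y
      unfolding TA.nm_sq TA.add_left TA.add_right TA.scale_left TA.scale_right TA.psd_sym[of y x]
      by (simp only: power2_eq_square algebra_simps)
    have 1: "tform I a F (GT F - tm I F K) \<le> - (1 / l N - 1 / l (N+1)) * (nA F)^2 + (8 * c^14 * m + 2 * c^8 * R * (nA F)^2) + (c * m + 2 * c^7 * R) * (nA F)^2"
    proof -
      have ar: "p - q \<le> - (1 / x - 1 / y) * w + e + d" if "p \<le> w / y + e" "w / x - d \<le> q" for p q x y w e d :: real
        using that by (simp add: left_diff_distrib)
      show ?thesis unfolding TA.diff_right by (rule ar[OF TA_FGF TA_FFK])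
    qed
    show ?thesis
      unfolding ex[of F "GT F - tm I F K"]
      by (intro add_mono order_refl mult_left_mono 1 power_mono nGFK mult_nonneg_nonneg t0) auto
  qed
  have "nA (Aop Uh Uh) \<le> nA L + nA rest" unfolding predictor_split by (rule TA.nm_triangle)
  then have "(nA (Aop Uh Uh))^2 \<le> (nA L + nA rest)^2" by (rule power_mono) (rule TA.nm_nonneg)
  also have "\<dots> \<le> (1 - 2 * \<tau> * (1 / l N - 1 / l (N+1)) + 1000 * c^30 * \<tau> * (m + R) + 10000 * c^30 * \<tau>^2) * (nA F)^2
     + 10000 * c^40 * \<tau> * m"
    by (rule predictor_arith[OF c1 TA.nm_nonneg nAF MD.nm_nonneg mle R0 t0 ts TA.nm_nonneg nrest nAF_small TA.nm_nonneg Lp L2])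
  finally show ?thesis .
qed

end

section \<open>The initial tuple\<close>

text \<open>More unknowns than equations: each induction step eliminates one equation together with
  a pivot unknown.\<close>

lemma homogeneous_solution:
  fixes h :: "'j \<Rightarrow> nat \<Rightarrow> real"
  assumes "finite K" and "finite J" and "card K < card J"
  shows "\<exists>\<xi>. (\<exists>i\<in>J. \<xi> i \<noteq> 0) \<and> (\<forall>k\<in>K. (\<Sum>i\<in>J. \<xi> i * h k i) = 0)"
  using assms
proof (induction K arbitrary: J h rule: finite_induct)
  case empty
  then have "J \<noteq> {}" by auto
  then show ?case by (intro exI[of _ "\<lambda>_. 1"]) auto
next
  case (insert q K)
  show ?case
  proof (cases "\<forall>i\<in>J. h q i = 0")
    case True
    have "card K < card J" using insert by simp
    from insert.IH[OF insert.prems(1) this, of h] obtain \<xi> where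
      "\<exists>i\<in>J. \<xi> i \<noteq> 0" "\<forall>k\<in>K. (\<Sum>i\<in>J. \<xi> i * h k i) = 0" by auto
    then show ?thesis using True by (intro exI[of _ \<xi>]) auto
  next
    case False
    then obtain p where p: "p \<in> J" "h q p \<noteq> 0" by auto
    have "card K < card (J - {p})" using insert p by simp
    from insert.IH[OF _ this, of "\<lambda>k i. h k i - h k p * h q i / h q p"] insert.prems(1)
    obtain \<xi> where \<xi>: "\<exists>i\<in>J - {p}. \<xi> i \<noteq> 0"
      and s: "\<And>k. k \<in> K \<Longrightarrow> (\<Sum>i\<in>J - {p}. \<xi> i * (h k i - h k p * h q i / h q p)) = 0" by auto
    \<comment> \<open>Back substitution: the eliminated equation \<open>q\<close> determines the
      pivot unknown.\<close>
    define s where "s = - (\<Sum>i\<in>J - {p}. \<xi> i * h q i) / h q p"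
    have sum: "(\<Sum>i\<in>J. (\<xi>(p := s)) i * f i) = s * f p + (\<Sum>i\<in>J - {p}. \<xi> i * f i)" for f
      using insert.prems(1) p(1) by (subst sum.remove[of _ p]) (auto intro!: sum.cong)
    have "(\<Sum>i\<in>J. (\<xi>(p := s)) i * h k i) = 0" if "k \<in> insert q K" for k
    proof (cases "k = q")
      case True
      then show ?thesis unfolding sum using p(2) by (simp add: s_def)
    next
      case False
      then have "(\<Sum>i\<in>J - {p}. \<xi> i * h k i) - h k p * (\<Sum>i\<in>J - {p}. \<xi> i * h q i) / h q p = 0"
        using s[of k] that by (simp add: right_diff_distrib sum_subtractf sum_distrib_left sum_divide_distrib ac_simps)
      then show ?thesis unfolding sum by (simp add: s_def field_simps)
    qed
    moreover have "\<exists>i\<in>J. (\<xi>(p := s)) i \<noteq> 0" using \<xi> by auto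
    ultimately show ?thesis by blast
  qed
qed

text \<open>A Householder reflection of the coefficient space turns \<open>\<xi>\<close> into the \<open>p\<close>-th unit vector; the
  sign of \<open>\<xi> p\<close> keeps the denominator away from 0.\<close>
lemma householder_tuple:
  assumes a: "psd_form a" and b: "psd_form b" and J: "finite J" "p \<in> J"
    and \<xi>: "(\<Sum>i\<in>J. (\<xi> i)^2) = 1" "\<xi> p \<le> 0"
    and gram: "\<And>\<eta>. (\<Sum>i\<in>J. (\<eta> i)^2) \<le> b (ap J U \<eta>) (ap J U \<eta>)"
  shows "\<exists>W. W p = ap J U \<xi> \<and> (\<Sum>i\<in>J. a (W i) (W i)) = (\<Sum>i\<in>J. a (U i) (U i)) \<and>
    (\<forall>\<eta>. (\<Sum>i\<in>J - {p}. (\<eta> i)^2) \<le> b (ap (J - {p}) W \<eta>) (ap (J - {p}) W \<eta>))"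
proof -
  interpret A: psd_form a by fact
  \<comment> \<open>The mirror vector e_p - \<xi>, of squared length 2d.\<close>
  define w where "w i = (if i = p then 1 else 0) - \<xi> i" for i
  define d where "d = 1 - \<xi> p"
  define z where "z = ap J U w"
  have d: "0 < d" using \<xi>(2) by (simp add: d_def)
  have wsq: "(w i)^2 = (if i = p then 1 - 2 * \<xi> i else 0) + (\<xi> i)^2" for i
    by (simp add: w_def power2_eq_square algebra_simps)
  have ww: "(\<Sum>i\<in>J. (w i)^2) = 2 * d"
    unfolding wsq sum.distrib using J \<xi>(1) by (simp add: d_def)
  have wp: "w p = d" by (simp add: w_def d_def)
  define W where "W i = U i - (w i / d) *\<^sub>R z" for i
  have zU: "z = U p - ap J U \<xi>"
  proof -
    have "z = (\<Sum>i\<in>J. (if i = p then U i else 0) - \<xi> i *\<^sub>R U i)"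
      unfolding z_def ap_def by (intro sum.cong) (auto simp: w_def scaleR_diff_left)
    then show ?thesis using J by (simp add: sum_subtractf ap_def)
  qed
  show ?thesis
  proof (intro exI[of _ W] conjI allI)
    show "W p = ap J U \<xi>" using d by (simp add: W_def wp zU)
    have "a (W i) (W i) = a (U i) (U i) - 2 / d * (w i * a (U i) z) + (w i)^2 * (a z z / d^2)" for i
      using A.psd_sym[of z "U i"] by (simp add: W_def A.expand power2_eq_square algebra_simps)
    then have "(\<Sum>i\<in>J. a (W i) (W i)) = (\<Sum>i\<in>J. a (U i) (U i)) - 2 / d * (\<Sum>i\<in>J. w i * a (U i) z) + (\<Sum>i\<in>J. (w i)^2) * (a z z / d^2)"
      by (simp only: sum.distrib sum_subtractf sum_distrib_left sum_distrib_right)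
    moreover have "(\<Sum>i\<in>J. w i * a (U i) z) = a z z"
      unfolding z_def by (subst (2) ap_def) (simp add: A.sum_left A.scale_left)
    ultimately show "(\<Sum>i\<in>J. a (W i) (W i)) = (\<Sum>i\<in>J. a (U i) (U i))"
      unfolding ww using d by (simp add: field_simps power2_eq_square)
    show "(\<Sum>i\<in>J - {p}. (\<eta> i)^2) \<le> b (ap (J - {p}) W \<eta>) (ap (J - {p}) W \<eta>)" for \<eta>
    proof -
      define \<zeta> where "\<zeta> = \<eta>(p := 0)"
      define s where "s = (\<Sum>i\<in>J. \<zeta> i * w i)"
      have "ap (J - {p}) W \<eta> = (\<Sum>i\<in>J. \<zeta> i *\<^sub>R W i)"
        unfolding ap_def by (subst sum.remove[OF J]) (simp add: \<zeta>_def)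
      also have "\<dots> = (\<Sum>i\<in>J. \<zeta> i *\<^sub>R U i) - (s / d) *\<^sub>R z"
        by (simp add: W_def scaleR_diff_right sum_subtractf s_def sum_divide_distrib scaleR_sum_left)
      also have "\<dots> = ap J U (\<lambda>i. \<zeta> i - (s / d) * w i)"
        unfolding z_def ap_def by (simp add: scaleR_diff_left sum_subtractf scaleR_sum_right)
      finally have eq: "ap (J - {p}) W \<eta> = ap J U (\<lambda>i. \<zeta> i - (s / d) * w i)" .
      have "(\<zeta> i - (s / d) * w i)^2 = (\<zeta> i)^2 - 2 * (s / d) * (\<zeta> i * w i) + (s / d)^2 * (w i)^2" for i
        by algebra
      then have "(\<Sum>i\<in>J. (\<zeta> i - (s / d) * w i)^2) = (\<Sum>i\<in>J. (\<zeta> i)^2) - 2 * (s / d) * s + (s / d)^2 * (2 * d)"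
        unfolding s_def ww[symmetric] by (simp only: sum.distrib sum_subtractf sum_distrib_left)
      also have "\<dots> = (\<Sum>i\<in>J. (\<zeta> i)^2)" using d by (simp add: field_simps power2_eq_square)
      also have "\<dots> = (\<Sum>i\<in>J - {p}. (\<eta> i)^2)" by (subst sum.remove[OF J]) (simp add: \<zeta>_def)
      finally show ?thesis unfolding eq using gram[of "\<lambda>i. \<zeta> i - (s / d) * w i"] by simp
    qed
  qed
qed

context spectral
begin

text \<open>Courant-Fischer: the coordinates below \<open>k\<close> vanish, the others carry
  eigenvalues at least \<open>l k\<close>, and the gap covers the complement.\<close>

lemma a_lower_perp:
  assumes sorted: "\<And>i j. i \<in> I \<Longrightarrow> j \<in> I \<Longrightarrow> i \<le> j \<Longrightarrow> l i \<le> l j"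
    and k: "k \<in> I" and perp: "\<And>j. j \<in> I \<Longrightarrow> j < k \<Longrightarrow> xc j u = 0"
  shows "l k * b u u \<le> a u u"
proof -
  have "l k * PX u u = (\<Sum>j\<in>I. l k * (xc j u * xc j u))" by (simp add: PX_def sum_distrib_left)
  also have "\<dots> \<le> (\<Sum>j\<in>I. l j * (xc j u * xc j u))"
  proof (rule sum_mono)
    fix j assume j: "j \<in> I"
    show "l k * (xc j u * xc j u) \<le> l j * (xc j u * xc j u)"
      using perp[OF j] sorted[OF k j] by (cases "j < k") (auto intro: mult_right_mono)
  qed
  finally have 1: "l k * PX u u \<le> (\<Sum>j\<in>I. l j * xc j u * xc j u)" by (simp add: mult.assoc)
  have "l k * b (yy u) (yy u) \<le> l (N+1) * b (yy u) (yy u)"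
    using l_mono[OF k] l_gap B.psd_nonneg by (intro mult_right_mono) auto
  then have "l k * b (yy u) (yy u) \<le> PY u u" using b_yy[of u] by linarith
  then show ?thesis using 1 a_decomp[of u u] b_decomp[of u u] by (simp add: distrib_left)
qed

text \<open>By dimension count some unit combination of the tuple is orthogonal to the first eigenvectors; rotating it into
  one slot reduces the size, and this works with \<open>\<langle>U, U\<rangle> \<ge> I\<close> in place of orthonormality.\<close>
lemma ky_fan:
  assumes sorted: "\<And>i j. i \<in> I \<Longrightarrow> j \<in> I \<Longrightarrow> i \<le> j \<Longrightarrow> l i \<le> l j"
    and "finite J" "card J \<le> N"
    and gram: "\<And>\<eta>. (\<Sum>i\<in>J. (\<eta> i)^2) \<le> b (ap J U \<eta>) (ap J U \<eta>)"
  shows "(\<Sum>k\<in>{1..card J}. l k) \<le> (\<Sum>i\<in>J. a (U i) (U i))"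
  using assms(2-)
proof (induction "card J" arbitrary: J U)
  case 0
  then show ?case by simp
next
  case (Suc n)
  have fin: "finite J" by fact
  have "card {1..n} < card J" using Suc.hyps(2) by simp
  from homogeneous_solution[OF _ fin this, of "\<lambda>k i. xc k (U i)"] obtain \<xi>0
    where \<xi>0: "\<exists>i\<in>J. \<xi>0 i \<noteq> 0" and z0: "\<forall>k\<in>{1..n}. (\<Sum>i\<in>J. \<xi>0 i * xc k (U i)) = 0" by auto
  obtain p where p: "p \<in> J" using \<xi>0 by auto
  define s where "s = sqrt (\<Sum>i\<in>J. (\<xi>0 i)^2)"
  have "0 < (\<Sum>i\<in>J. (\<xi>0 i)^2)" using \<xi>0 fin by (simp add: sum_nonneg_eq_0_iff sum_nonneg order_less_le)
  then have s: "0 < s" "s^2 = (\<Sum>i\<in>J. (\<xi>0 i)^2)" by (auto simp: s_def)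
  \<comment> \<open>Normalises \<xi>0, with the sign that makes its entry at \<open>p\<close>
    nonpositive as the reflection requires.\<close>
  define r where "r = (if \<xi>0 p \<le> 0 then 1 / s else - 1 / s)"
  have r2: "r^2 = 1 / s^2" by (simp add: r_def power_divide)
  define \<xi> where "\<xi> i = r * \<xi>0 i" for i
  have \<xi>1: "(\<Sum>i\<in>J. (\<xi> i)^2) = 1"
    unfolding \<xi>_def power_mult_distrib sum_distrib_left[symmetric] s(2)[symmetric] r2 using s(1) by simp
  have \<xi>p: "\<xi> p \<le> 0" using s(1) by (auto simp: \<xi>_def r_def divide_nonpos_pos)
  obtain W where "W p = ap J U \<xi> \<and> (\<Sum>i\<in>J. a (W i) (W i)) = (\<Sum>i\<in>J. a (U i) (U i)) \<and>
    (\<forall>\<eta>. (\<Sum>i\<in>J - {p}. (\<eta> i)^2) \<le> b (ap (J - {p}) W \<eta>) (ap (J - {p}) W \<eta>))"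
    using householder_tuple[OF psds(1,2) fin p \<xi>1 \<xi>p Suc.prems(3)] ..
  note W = this[THEN conjunct1] this[THEN conjunct2, THEN conjunct1] this[THEN conjunct2, THEN conjunct2, rule_format]
  have c1: "card (J - {p}) = n" using Suc.hyps(2) p fin by simp
  have IH: "(\<Sum>k\<in>{1..n}. l k) \<le> (\<Sum>i\<in>J - {p}. a (W i) (W i))"
    using Suc.hyps(1)[of "J - {p}" W] W(3) fin c1 Suc.prems(2) Suc.hyps(2) by simp
  have SN: "Suc n \<in> I" using Suc.prems(2) Suc.hyps(2) by simp
  have perp: "xc k (ap J U \<xi>) = 0" if "k \<in> I" "k < Suc n" for k
  proof -
    have "xc k (ap J U \<xi>) = (\<Sum>i\<in>J. \<xi> i * xc k (U i))"
      by (simp add: xc_def ap_def B.sum_right B.scale_right)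
    also have "\<dots> = r * (\<Sum>i\<in>J. \<xi>0 i * xc k (U i))" by (simp add: \<xi>_def sum_distrib_left mult.assoc)
    also have "\<dots> = 0" using z0 that by simp
    finally show ?thesis .
  qed
  \<comment> \<open>The Gram hypothesis at the unit vector \<xi> gives
    \<open>b (W p) (W p) \<ge> 1\<close>.\<close>
  have "l (Suc n) * 1 \<le> l (Suc n) * b (W p) (W p)"
    using Suc.prems(3)[of \<xi>] \<xi>1 l_pos'(1)[OF SN] by (intro mult_left_mono) (auto simp: W(1))
  also have "\<dots> \<le> a (W p) (W p)" unfolding W(1) by (rule a_lower_perp[OF sorted SN perp])
  finally have 2: "l (Suc n) \<le> a (W p) (W p)" by simp
  have "(\<Sum>k\<in>{1..card J}. l k) = (\<Sum>k\<in>{1..n}. l k) + l (Suc n)" unfolding Suc.hyps(2)[symmetric] by (simp add: One_nat_def)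
  also have "\<dots> \<le> (\<Sum>i\<in>J. a (W i) (W i))" unfolding sum.remove[OF fin p] using IH 2 by linarith
  finally show ?case unfolding W(2) .
qed

text \<open>The normalised combination is rotated into slot \<open>N\<close>. By
  \<open>ky_fan\<close> the other slots cost at least the first N - 1 eigenvalues, so at most
  (\<open>l N\<close> + \<open>l (N+1)\<close>)/2 is left for this one. Its \<open>b\<close>-length
  is at least 1 and its complement part costs \<open>l (N+1)\<close> per unit, so half the gap must
  be made up by the eigenspace part.\<close>

lemma initial_px:
  assumes sorted: "\<And>i j. i \<in> I \<Longrightarrow> j \<in> I \<Longrightarrow> i \<le> j \<Longrightarrow> l i \<le> l j"
    and gram: "\<And>\<eta>. (vn \<eta>)^2 \<le> b (ap I U \<eta>) (ap I U \<eta>)"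
    and E: "(nA U)^2 \<le> (\<Sum>k\<in>I. l k) + (l (N+1) - l N) / 2"
  shows "(l (N+1) - l N) / (2 * l (N+1)) * (vn \<xi>)^2 \<le> PX (ap I U \<xi>) (ap I U \<xi>)"
proof (cases "vn \<xi> = 0")
  case True
  then show ?thesis using PX.psd_nonneg by simp
next
  case False
  have NI: "N \<in> I" using N1 by simp
  have s: "0 < vn \<xi>" using False VD.nm_nonneg[of I \<xi>] by linarith
  define r where "r = (if \<xi> N \<le> 0 then 1 / vn \<xi> else - 1 / vn \<xi>)"
  have r2: "r^2 = 1 / (vn \<xi>)^2" by (simp add: r_def power_divide)
  have gr: "(\<Sum>i\<in>I. (\<eta> i)^2) \<le> b (ap I U \<eta>) (ap I U \<eta>)" for \<eta>
    using gram[of \<eta>] by (simp add: VD.nm_sq vdot_self)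
  have \<xi>1: "(\<Sum>i\<in>I. ((r *\<^sub>R \<xi>) i)^2) = 1"
  proof -
    have "(\<Sum>i\<in>I. ((r *\<^sub>R \<xi>) i)^2) = r^2 * (vn \<xi>)^2"
      by (simp add: VD.nm_sq vdot_self power_mult_distrib sum_distrib_left)
    then show ?thesis using s by (simp add: r2)
  qed
  have \<xi>p: "(r *\<^sub>R \<xi>) N \<le> 0" using s by (auto simp: r_def divide_nonpos_pos)
  obtain W where "W N = ap I U (r *\<^sub>R \<xi>) \<and> (\<Sum>i\<in>I. a (W i) (W i)) = (\<Sum>i\<in>I. a (U i) (U i)) \<and>
    (\<forall>\<eta>. (\<Sum>i\<in>I - {N}. (\<eta> i)^2) \<le> b (ap (I - {N}) W \<eta>) (ap (I - {N}) W \<eta>))"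
    using householder_tuple[OF psds(1,2) finite_atLeastAtMost NI \<xi>1 \<xi>p gr] ..
  note W = this[THEN conjunct1] this[THEN conjunct2, THEN conjunct1] this[THEN conjunct2, THEN conjunct2, rule_format]
  have "(\<Sum>k\<in>{1..card (I - {N})}. l k) \<le> (\<Sum>i\<in>I - {N}. a (W i) (W i))"
    by (rule ky_fan[OF sorted _ _ W(3)]) (use NI in \<open>simp_all add: card_Diff_singleton\<close>)
  then have 1: "(\<Sum>k\<in>I - {N}. l k) \<le> (\<Sum>i\<in>I - {N}. a (W i) (W i))"
  proof -
    have "I - {N} = {1..card (I - {N})}" using N1 by auto
    then show ?thesis using \<open>(\<Sum>k\<in>{1..card (I - {N})}. l k) \<le> _\<close> by simp
  qed
  have tot: "a (W N) (W N) + (\<Sum>i\<in>I - {N}. a (W i) (W i)) \<le> l N + (\<Sum>k\<in>I - {N}. l k) + (l (N+1) - l N) / 2"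
    using E W(2) unfolding TA.nm_sq tform_def by (simp add: sum.remove[OF _ NI])
  have "l (N+1) * (1 - PX (W N) (W N)) \<le> l (N+1) * b (yy (W N)) (yy (W N))"
    using gr[of "r *\<^sub>R \<xi>"] \<xi>1 b_decomp[of "W N" "W N"] l_pos'(3) by (intro mult_left_mono) (auto simp: W(1))
  then have "l (N+1) * (1 - PX (W N) (W N)) \<le> a (W N) (W N)"
    using b_yy[of "W N"] PY_le_a[of "W N"] by linarith
  then have "(l (N+1) - l N) / 2 \<le> l (N+1) * PX (W N) (W N)"
    using tot 1 by (simp add: right_diff_distrib field_simps)
  then have "(l (N+1) - l N) / (2 * l (N+1)) \<le> PX (W N) (W N)"
    using l_pos'(3) by (simp add: field_simps)
  also have "PX (W N) (W N) = r^2 * PX (ap I U \<xi>) (ap I U \<xi>)"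
    unfolding W(1) ap_scale_right by (simp add: PX.scale_left PX.scale_right power2_eq_square)
  finally show ?thesis using s by (simp add: r2 pos_le_divide_eq)
qed

end

section \<open>Global dynamics\<close>

lemma geometric_rate:
  fixes x :: "nat \<Rightarrow> real"
  assumes r: "0 < r" and x0: "0 \<le> x n0" and step: "\<And>n. n \<ge> n0 \<Longrightarrow> x (Suc n) \<le> r * x n"
  shows "\<exists>A\<ge>0. \<forall>n\<ge>n0. x n \<le> A * r ^ n"
proof (intro exI[of _ "x n0 / r ^ n0"] conjI allI impI)
  show "0 \<le> x n0 / r ^ n0" using r x0 by simp
  fix n assume "n0 \<le> n"
  then show "x n \<le> x n0 / r ^ n0 * r ^ n"
  proof (induction n rule: dec_induct)
    case base then show ?case using r by simp
  next
    case (step n)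
    have "x (Suc n) \<le> r * (x n0 / r ^ n0 * r ^ n)"
      by (rule order_trans[OF assms(3)[OF step.hyps(1)] mult_left_mono[OF step.IH]]) (use r in simp)
    then show ?case by (simp add: ac_simps)
  qed
qed

text \<open>The factor q^2 leaves the margin q - q^2 = q (1 - q), which absorbs a forcing bounded by
  q^n.\<close>

lemma forced_geometric_rate:
  fixes x :: "nat \<Rightarrow> real"
  assumes q: "0 < q" "q < 1" and C: "0 \<le> C"
    and step: "\<And>n. n \<ge> n0 \<Longrightarrow> x (Suc n) \<le> q^2 * x n + C * (q^4) ^ n"
  shows "\<exists>A\<ge>0. \<forall>n\<ge>n0. x n \<le> A * q ^ n"
proof -
  \<comment> \<open>Covers the value at \<open>n0\<close> and the forcing constant divided by the
    margin.\<close>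
  define A where "A = max (max (x n0 / q ^ n0) (C / (q * (1 - q)))) 0"
  have A: "0 \<le> A" "x n0 / q ^ n0 \<le> A" "C / (q * (1 - q)) \<le> A" by (auto simp: A_def)
  have CA: "C \<le> A * (q * (1 - q))" using A(3) q by (simp add: pos_divide_le_eq)
  have "x n \<le> A * q ^ n" if "n0 \<le> n" for n
    using that
  proof (induction n rule: dec_induct)
    case base then show ?case using A(2) q by (simp add: pos_divide_le_eq)
  next
    case (step n)
    have "(q^4) ^ n \<le> q ^ n" unfolding power_mult[symmetric] using q by (intro power_decreasing) auto
    then have 1: "C * (q^4) ^ n \<le> A * (q * (1 - q)) * q ^ n"
      using CA C A(1) q by (intro mult_mono) auto
    have 2: "q^2 * x n \<le> q^2 * (A * q ^ n)" using step.IH by (intro mult_left_mono) auto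
    have "q^2 * (A * q ^ n) + A * (q * (1 - q)) * q ^ n = A * q ^ Suc n"
      by (simp add: power2_eq_square algebra_simps)
    then show ?case using assms(4)[OF step.hyps(1)] 1 2 by linarith
  qed
  then show ?thesis using A(1) by blast
qed

lemma geometric_increments_converge:
  fixes x :: "nat \<Rightarrow> real"
  assumes q: "0 < q" "q < 1" and step: "\<And>n. n \<ge> n0 \<Longrightarrow> \<bar>x (Suc n) - x n\<bar> \<le> C * q ^ n"
  shows "\<exists>L. x \<longlonglongrightarrow> L \<and> (\<forall>n\<ge>n0. \<bar>x n - L\<bar> \<le> C / (1 - q) * q ^ n)"
proof -
  have "0 \<le> C * q ^ n0" by (rule order_trans[OF abs_ge_zero step]) simp
  moreover have "0 < q ^ n0" using q(1) by simp
  ultimately have C: "0 \<le> C" by (simp add: zero_le_mult_iff not_le)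
  define A where "A = C / (1 - q)"
  have A: "0 \<le> A" "A * (1 - q) = C" using C q by (auto simp: A_def)
  have tail: "\<bar>x (n + p) - x n\<bar> \<le> A * q ^ n - A * q ^ (n + p)" if n: "n \<ge> n0" for n p
  proof (induction p)
    case (Suc p)
    have "\<bar>x (Suc (n + p)) - x (n + p)\<bar> \<le> A * (1 - q) * q ^ (n + p)" using step[of "n + p"] n A(2) by simp
    also have "\<dots> = A * q ^ (n + p) - A * q ^ (n + Suc p)" by (simp add: algebra_simps)
    finally show ?case using Suc.IH by simp
  qed simp
  have tail': "\<bar>x k - x n\<bar> \<le> A * q ^ n" if "n0 \<le> n" "n \<le> k" for n k
  proof -
    have "0 \<le> A * q ^ k" using A(1) q by simp
    then show ?thesis using tail[OF that(1), of "k - n"] that(2) by simp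
  qed
  have Aq: "(\<lambda>n. A * q ^ n) \<longlonglongrightarrow> 0"
    using tendsto_mult_right_zero[OF LIMSEQ_realpow_zero[of q]] q by simp
  have "Cauchy x"
  proof (rule CauchyI')
    fix e :: real assume e: "0 < e"
    have "\<forall>\<^sub>F n in sequentially. A * q ^ n < e \<and> n0 \<le> n"
      by (intro eventually_conj order_tendstoD(2)[OF Aq e] eventually_ge_at_top)
    from eventually_happens'[OF _ this] obtain n where n: "A * q ^ n < e" "n0 \<le> n" by auto
    have mono: "A * q ^ m \<le> A * q ^ n" if "n \<le> m" for m
      using that q A(1) by (intro mult_left_mono power_decreasing) auto
    show "\<exists>M. \<forall>m\<ge>M. \<forall>n>m. dist (x m) (x n) < e"
    proof (intro exI[of _ n] allI impI)
      fix m k assume mk: "n \<le> m" "m < k"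
      have "\<bar>x k - x m\<bar> \<le> A * q ^ m" by (rule tail') (use mk n in auto)
      then show "dist (x m) (x k) < e" using mono[OF mk(1)] n(1) by (simp add: dist_real_def abs_minus_commute)
    qed
  qed
  then obtain L where L: "x \<longlonglongrightarrow> L" unfolding Cauchy_convergent_iff convergent_def ..
  have "\<bar>x n - L\<bar> \<le> A * q ^ n" if n: "n0 \<le> n" for n
  proof (rule Lim_bounded[of "\<lambda>k. \<bar>x n - x k\<bar>" _ n])
    show "(\<lambda>k. \<bar>x n - x k\<bar>) \<longlonglongrightarrow> \<bar>x n - L\<bar>" by (intro tendsto_intros L)
    show "\<forall>k\<ge>n. \<bar>x n - x k\<bar> \<le> A * q ^ n" using tail'[OF n] by (simp add: abs_minus_commute)
  qed
  then show ?thesis using L unfolding A_def by blast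
qed

lemma fn_le_entries:
  assumes "finite I" "0 \<le> e" "\<And>i j. i \<in> I \<Longrightarrow> j \<in> I \<Longrightarrow> \<bar>A i j\<bar> \<le> e"
  shows "MD.nm I A \<le> real (card I) * e"
proof (rule power2_le_imp_le)
  have "(A i j)^2 \<le> e^2" if "i \<in> I" "j \<in> I" for i j
    using power_mono[OF assms(3)[OF that], of 2] by simp
  then have "(\<Sum>i\<in>I. \<Sum>j\<in>I. (A i j)^2) \<le> (\<Sum>i\<in>I. \<Sum>j\<in>I. e^2)" by (intro sum_mono)
  also have "\<dots> = (real (card I) * e)^2" by (simp add: power2_eq_square)
  finally show "(MD.nm I A)^2 \<le> (real (card I) * e)^2" unfolding MD.nm_sq mdot_self .
qed (use assms in simp)

lemma midpoint_eq:
  fixes x u :: "'w::real_vector"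
  assumes "t \<noteq> 0"
  shows "(1/2) *\<^sub>R (x + u) = u + (t / 2) *\<^sub>R ((1 / t) *\<^sub>R (x - u))"
proof -
  have "u + (t / 2) *\<^sub>R ((1 / t) *\<^sub>R (x - u)) = (1/2) *\<^sub>R (u + u) + (1/2) *\<^sub>R (x - u)"
    using assms by simp
  also have "\<dots> = (1/2) *\<^sub>R (u + u + (x - u))" by (simp only: scaleR_add_right)
  finally show ?thesis by (simp add: add.commute)
qed

lemma scaled_diff:
  fixes x u :: "'w::real_vector"
  assumes "t \<noteq> 0" "x = u + t *\<^sub>R y"
  shows "(1 / t) *\<^sub>R (x - u) = y"
  using assms by simp

lemma add_scaled_diff:
  fixes x u :: "'w::real_vector"
  assumes "t \<noteq> 0"
  shows "x = u + t *\<^sub>R ((1 / t) *\<^sub>R (x - u))"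
  using assms by simp

text \<open>The squared slope factor is 1 - 2td + O(t^2). With \<eta> \<le> d, and \<open>K\<close>
  above the second-order coefficients, it lies below the contraction factor; the cubic term has the
  favourable sign.\<close>

lemma contraction_square_le:
  fixes t d B K \<eta> :: real
  assumes "0 \<le> t" "t \<le> 1" "0 \<le> d" "0 \<le> B" "\<eta> \<le> d" "2 * B + d^2 + B^2 \<le> K"
  shows "(1 - t * d + B * t^2)^2 \<le> 1 - 2 * t * \<eta> + K * t^2"
proof -
  have "(1 - t * d + B * t^2)^2 = 1 - 2 * t * d + (2 * B + d^2) * t^2 - 2 * (d * B) * t^3 + B^2 * t^4"
    by algebra
  moreover have "B^2 * t^4 \<le> B^2 * t^2" using assms by (intro mult_left_mono power_decreasing) auto
  moreover have "0 \<le> 2 * (d * B) * t^3" using assms by simp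
  moreover have "(2 * B + d^2 + B^2) * t^2 \<le> K * t^2" using assms(6) by (intro mult_right_mono) auto
  moreover have "2 * t * \<eta> \<le> 2 * t * d" using assms by (intro mult_left_mono) auto
  moreover have "(2 * B + d^2 + B^2) * t^2 = (2 * B + d^2) * t^2 + B^2 * t^2" by algebra
  ultimately show ?thesis by linarith
qed

lemma half_absorb: "(x::real) \<le> g / 2 * t \<Longrightarrow> 1 - t * g + x \<le> 1 - t * g / 2"
  by (simp add: mult.commute)

lemma cancel_factor: "0 < z \<Longrightarrow> k * (t * (x * z)) / z \<le> y \<Longrightarrow> k * x * t \<le> (y::real)"
  by (simp add: ac_simps)

text \<open>\<open>mk\<close> packages the choice of \<open>c\<close>: slope at most
  \<open>2 * R0\<close>, defect at most \<open>m0\<close> and defect form at least -1/2 make a tuple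
  a \<open>state\<close>. The clauses \<open>T\<close> state how small the steps are against the
  constants.\<close>

locale flow = spectral a b G N l v for a b :: "'v::real_vector \<Rightarrow> 'v \<Rightarrow> real" and G N l v +
  fixes c R0 m0 T \<eta> K \<tau>l \<tau>u :: real and \<tau> :: "nat \<Rightarrow> real" and U Uh :: "nat \<Rightarrow> nat \<Rightarrow> 'v"
  assumes mk: "(\<And>i. i \<notin> I \<Longrightarrow> W i = 0) \<Longrightarrow> 0 \<le> R \<Longrightarrow> R \<le> 2 * R0 \<Longrightarrow>
      (\<And>\<xi>. PY.nm (ap I W \<xi>) \<le> R * PX.nm (ap I W \<xi>)) \<Longrightarrow> fn (gr b W W - mid I) \<le> m0 \<Longrightarrow>
      (\<And>\<xi>. - (1/2) * (vn \<xi>)^2 \<le> vdot I \<xi> (mv I (gr b W W - mid I) \<xi>)) \<Longrightarrow> state a b G N l v c R W"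
    and supp: "i \<notin> I \<Longrightarrow> U n i = 0"
    and predictor: "Uh (Suc n) = U n + \<tau> n *\<^sub>R Aop (U n) ((1/2) *\<^sub>R (Uh (Suc n) + U n))"
    and corrector: "U (Suc n) = Uh (Suc n) - \<tau> n *\<^sub>R tm I (GT (Uh (Suc n))) (gr b (Uh (Suc n)) (Uh (Suc n)) - mid I)"
    and \<tau>l: "0 < \<tau>l" and \<tau>: "\<tau>l \<le> \<tau> n" "\<tau> n \<le> \<tau>u" and \<tau>u: "\<tau>u \<le> T"
    and c1: "1 \<le> c" and R0: "0 \<le> R0"
    and T: "T * (10^6 * c^40) \<le> 1" "400 * c^30 * T \<le> (1 / l N - 1 / l (N+1)) / 2"
      "400 * c^33 * T * m0 \<le> R0" "400 * c^33 * T * m0 \<le> 1 / 2" "K * T \<le> \<eta>" "2 * T * \<eta> < 1"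
    and K: "2 * (400 * c^30) + (1 / l N - 1 / l (N+1))^2 + (400 * c^30)^2 \<le> K" "10000 * c^30 \<le> K"
    and \<eta>: "0 < \<eta>" "\<eta> < 1 / l N - 1 / l (N+1)"
    and init: "PY.nm (ap I (U 0) \<xi>) \<le> R0 * PX.nm (ap I (U 0) \<xi>)" "fn (gr b (U 0) (U 0) - mid I) \<le> m0"
      "0 \<le> vdot I \<xi> (mv I (gr b (U 0) (U 0) - mid I) \<xi>)"
begin

abbreviation "gp \<equiv> 1 / l N - 1 / l (N+1)"

definition Ms :: "nat \<Rightarrow> nat \<Rightarrow> nat \<Rightarrow> real" where "Ms n = gr b (U n) (U n) - mid I"
definition ms :: "nat \<Rightarrow> real" where "ms n = fn (Ms n)"
definition Dn :: "nat \<Rightarrow> nat \<Rightarrow> 'v" where "Dn n = (1 / \<tau> n) *\<^sub>R (Uh (Suc n) - U n)"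
definition kap :: "real \<Rightarrow> real" where "kap t = 1 - 2 * t * \<eta> + K * t^2"

text \<open>An upper bound for the slope rather than the slope itself, propagated by the factor from
  \<open>cone_step\<close>.\<close>

primrec Rs :: "nat \<Rightarrow> real" where
  "Rs 0 = R0"
| "Rs (Suc n) = (1 - \<tau> n * gp + 400 * c^30 * (\<tau> n)^2) * Rs n + 400 * c^30 * (\<tau> n)^2 * ms n"

abbreviation st :: "nat \<Rightarrow> bool" where "st n \<equiv> state a b G N l v c (Rs n) (U n)"

lemma ms_nonneg: "0 \<le> ms n" unfolding ms_def by (rule MD.nm_nonneg)

lemma \<tau>T: "0 < \<tau> n" "\<tau> n \<le> T" "0 < T"
proof -
  show "0 < \<tau> n" "\<tau> n \<le> T" using \<tau>l \<tau>[of n] \<tau>u by linarith+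
  then show "0 < T" by linarith
qed

lemma c0: "0 \<le> c" "0 < c" "0 \<le> c ^ n" "0 < c ^ n" using c1 by auto

lemma cp: "i \<le> j \<Longrightarrow> c ^ i \<le> c ^ j" by (rule power_increasing) (use c1 in auto)

lemma Tc: "n \<le> 40 \<Longrightarrow> T * c^n * 10^6 \<le> 1"
proof -
  assume "n \<le> 40"
  then have "T * c^n * 10^6 \<le> T * c^40 * 10^6" using \<tau>T(3) by (intro mult_right_mono mult_left_mono cp) auto
  also have "\<dots> = T * (10^6 * c^40)" by algebra
  finally show ?thesis using T(1) by linarith
qed

lemma T1: "T \<le> 1" using Tc[of 0] \<tau>T(3) by simp

lemma \<tau>c: "n \<le> 40 \<Longrightarrow> \<tau> k * c^n * 10^6 \<le> 1"
  by (rule order_trans[OF mult_right_mono[OF mult_right_mono[OF \<tau>T(2)]] Tc]) (auto simp: c0)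

lemma K0: "0 \<le> K" using K(2) c0(3)[of 30] by linarith

lemma gp0: "0 < gp" using \<eta> by linarith

lemma Uh_eq: "Uh (Suc n) = U n + \<tau> n *\<^sub>R Dn n"
  unfolding Dn_def by (rule add_scaled_diff) (use \<tau>T(1)[of n] in simp)

lemma Dn_eq: "Dn n = Aop (U n) (U n + (\<tau> n / 2) *\<^sub>R Dn n)"
proof -
  have t: "\<tau> n \<noteq> 0" using \<tau>T(1)[of n] by simp
  have "Dn n = Aop (U n) ((1/2) *\<^sub>R (Uh (Suc n) + U n))"
    unfolding Dn_def by (rule scaled_diff[OF t predictor])
  also have "(1/2) *\<^sub>R (Uh (Suc n) + U n) = U n + (\<tau> n / 2) *\<^sub>R Dn n"
    unfolding Dn_def by (rule midpoint_eq[OF t])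
  finally show ?thesis .
qed

lemma step_n:
  assumes "st n" shows "step a b G N l v c (Rs n) (U n) (\<tau> n) (Dn n)"
proof (rule step.intro[OF assms], rule step_axioms.intro)
  show "0 \<le> \<tau> n" using \<tau>T(1)[of n] by simp
  show "\<tau> n * (10 ^ 6 * c ^ 40) \<le> 1" using \<tau>c[of 40 n] by (simp add: ac_simps)
  show "Dn n = Aop (U n) (U n + (\<tau> n / 2) *\<^sub>R Dn n)" by (rule Dn_eq)
qed

lemma U_Suc: "st n \<Longrightarrow> U (Suc n) = U n + \<tau> n *\<^sub>R Dn n - \<tau> n *\<^sub>R tm I (GT (U n + \<tau> n *\<^sub>R Dn n)) (gr b (U n) (U n) - mid I)"
  unfolding corrector[of n] Uh_eq step.gram_preserved[OF step_n] by (rule refl)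

lemma ms_step:
  assumes "st n" "\<And>\<xi>. k * (vn \<xi>)^2 \<le> vdot I \<xi> (mv I (gr b (U n) (GT (U n))) \<xi>)" "0 \<le> k" "k \<le> c^5"
  shows "ms (Suc n) \<le> (1 - 2 * k * \<tau> n + 60 * c^10 * (\<tau> n)^2) * ms n"
  unfolding ms_def Ms_def U_Suc[OF assms(1)] by (rule step.M'_contraction[OF step_n[OF assms(1)] assms(2-)])

text \<open>\<open>K_lower\<close> yields the linear gain 2 \<tau>/c^3, and half of it pays for the
  quadratic term.\<close>

lemma ms_decay:
  assumes "st n" shows "ms (Suc n) \<le> (1 - \<tau> n / c^3) * ms n"
proof -
  have "ms (Suc n) \<le> (1 - 2 * (1 / c^3) * \<tau> n + 60 * c^10 * (\<tau> n)^2) * ms n"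
  proof (rule ms_step[OF assms])
    show "1 / c^3 * (vn \<xi>)^2 \<le> vdot I \<xi> (mv I (gr b (U n) (GT (U n))) \<xi>)" for \<xi>
      using state.K_lower[OF assms, of \<xi>] by simp
    have "1 / c^3 \<le> 1" using c1 c0(4)[of 3] by (simp add: one_le_power)
    then show "1 / c^3 \<le> c^5" using one_le_power[OF c1, of 5] by linarith
  qed (simp add: c0)
  also have "\<dots> \<le> (1 - \<tau> n / c^3) * ms n"
  proof (rule mult_right_mono[OF _ ms_nonneg])
    have "60 * (\<tau> n * c^13) \<le> 1" using \<tau>c[of 13 n] \<tau>T(1)[of n] by simp
    then have "60 * (\<tau> n * c^13) / c^3 \<le> 1 / c^3" by (rule divide_right_mono) (simp add: c0)
    moreover have "c^13 = c^10 * c^3" by algebra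
    ultimately have "60 * (\<tau> n * (c^10 * c^3)) / c^3 \<le> 1 / c^3" by (simp only:)
    then have "60 * c^10 * \<tau> n \<le> 1 / c^3" by (rule cancel_factor[OF c0(4)])
    then have "60 * c^10 * \<tau> n * \<tau> n \<le> 1 / c^3 * \<tau> n" using \<tau>T(1)[of n] by (intro mult_right_mono) auto
    then show "1 - 2 * (1 / c^3) * \<tau> n + 60 * c^10 * (\<tau> n)^2 \<le> 1 - \<tau> n / c^3"
      by (simp add: power2_eq_square mult.assoc)
  qed
  finally show ?thesis .
qed

lemma \<tau>_ms: "st n \<Longrightarrow> \<tau> n * ms n \<le> c^3 * (ms n - ms (Suc n))"
proof -
  assume "st n"
  from ms_decay[OF this] have "\<tau> n / c^3 * ms n \<le> ms n - ms (Suc n)" by (simp add: left_diff_distrib)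
  then have "c^3 * (\<tau> n / c^3 * ms n) \<le> c^3 * (ms n - ms (Suc n))" by (rule mult_left_mono) (rule c0)
  then show ?thesis using c0(2) by simp
qed

lemma ms_mono: "st n \<Longrightarrow> ms (Suc n) \<le> ms n"
proof -
  assume "st n"
  have "0 \<le> \<tau> n * ms n" using \<tau>T(1)[of n] ms_nonneg[of n] by simp
  then have "0 \<le> c^3 * (ms n - ms (Suc n))" using \<tau>_ms[OF \<open>st n\<close>] by linarith
  then show ?thesis using c0(4)[of 3] by (simp add: zero_le_mult_iff)
qed

lemma Rs_Suc_le:
  assumes "0 \<le> Rs n"
  shows "Rs (Suc n) \<le> (1 - \<tau> n * gp / 2) * Rs n + 400 * c^30 * T * (\<tau> n * ms n)" "0 \<le> Rs (Suc n)"
proof -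
  have "400 * c^30 * \<tau> n \<le> gp / 2"
    by (rule order_trans[OF mult_left_mono[OF \<tau>T(2)] T(2)]) (simp add: c0)
  then have "400 * c^30 * \<tau> n * \<tau> n \<le> gp / 2 * \<tau> n" using \<tau>T(1)[of n] by (intro mult_right_mono) auto
  then have 1: "1 - \<tau> n * gp + 400 * c^30 * (\<tau> n)^2 \<le> 1 - \<tau> n * gp / 2"
    unfolding power2_eq_square mult.assoc[symmetric] by (rule half_absorb)
  have "400 * c^30 * (\<tau> n)^2 * ms n = 400 * c^30 * \<tau> n * (\<tau> n * ms n)" by algebra
  also have "\<dots> \<le> 400 * c^30 * T * (\<tau> n * ms n)"
    using \<tau>T(1,2)[of n] ms_nonneg[of n] c0(3)[of 30] by (intro mult_right_mono mult_left_mono) auto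
  finally show "Rs (Suc n) \<le> (1 - \<tau> n * gp / 2) * Rs n + 400 * c^30 * T * (\<tau> n * ms n)"
    using mult_right_mono[OF 1 assms] by simp
  have "\<tau> n * gp \<le> 1"
  proof -
    have "gp^2 \<le> K" using K(1) c0(3)[of 30] zero_le_power2[of "400 * c^30"] by linarith
    then have "gp^2 * T \<le> gp" using T(5) \<eta>(2) mult_right_mono[of "gp^2" K T] \<tau>T(3) by linarith
    then have "gp * T \<le> 1" using gp0 by (simp add: power2_eq_square mult.assoc)
    then have "T * gp \<le> 1" by (simp only: mult.commute)
    then show ?thesis by (rule order_trans[OF mult_right_mono[OF \<tau>T(2) less_imp_le[OF gp0]]])
  qed
  then have "0 \<le> 1 - \<tau> n * gp + 400 * c^30 * (\<tau> n)^2" using c0(3)[of 30] by simp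
  then have "0 \<le> (1 - \<tau> n * gp + 400 * c^30 * (\<tau> n)^2) * Rs n" using assms by (rule mult_nonneg_nonneg)
  moreover have "0 \<le> 400 * c^30 * (\<tau> n)^2 * ms n" using ms_nonneg[of n] c0(3)[of 30] by simp
  ultimately show "0 \<le> Rs (Suc n)" by simp
qed

text \<open>The errors of order \<open>\<tau>\<^sup>2 m\<close> telescope, since \<open>\<tau> m\<close> is dominated by the decrease of \<open>m\<close>; therefore the slope
  and the negative part of \<open>M\<close> never grow beyond a fixed multiple of the step-size bound.\<close>
lemma invariant:
  "st n \<and> 0 \<le> Rs n \<and> Rs n \<le> R0 + 400 * c^33 * T * (m0 - ms n) \<and> ms n \<le> m0 \<and>
   (\<forall>\<xi>. PY.nm (ap I (U n) \<xi>) \<le> Rs n * PX.nm (ap I (U n) \<xi>)) \<and>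
   (\<forall>\<xi>. - (400 * c^33 * T * (m0 - ms n)) * (vn \<xi>)^2 \<le> vdot I \<xi> (mv I (Ms n) \<xi>))"
proof -
  let ?B = "400 * c^33 * T"
  have B0: "0 \<le> ?B" using \<tau>T(3) by (simp add: c0)
  \<comment> \<open>The telescoped bounds meet the hypotheses of \<open>mk\<close>:
    \<open>T(3)\<close> at most doubles \<open>R0\<close>, and \<open>T(4)\<close> keeps the defect
    form above -1/2.\<close>
  have mkn: "st n" if R: "0 \<le> Rs n" "Rs n \<le> R0 + ?B * (m0 - ms n)" and m: "ms n \<le> m0"
    and cone: "\<forall>\<xi>. PY.nm (ap I (U n) \<xi>) \<le> Rs n * PX.nm (ap I (U n) \<xi>)"
    and low: "\<forall>\<xi>. - (?B * (m0 - ms n)) * (vn \<xi>)^2 \<le> vdot I \<xi> (mv I (Ms n) \<xi>)" for n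
  proof (rule mk)
    have Bm: "?B * (m0 - ms n) \<le> ?B * m0" using B0 ms_nonneg[of n] by (intro mult_left_mono) auto
    show "Rs n \<le> 2 * R0" using R(2) Bm T(3) by linarith
    show "fn (gr b (U n) (U n) - mid I) \<le> m0" using m unfolding ms_def Ms_def .
    show "- (1/2) * (vn \<xi>)^2 \<le> vdot I \<xi> (mv I (gr b (U n) (U n) - mid I) \<xi>)" for \<xi>
    proof -
      have "- (1/2) * (vn \<xi>)^2 \<le> - (?B * (m0 - ms n)) * (vn \<xi>)^2"
        using Bm T(4) by (intro mult_right_mono) auto
      then show ?thesis using low[rule_format, of \<xi>] unfolding Ms_def by (rule order_trans)
    qed
    show "PY.nm (ap I (U n) \<xi>) \<le> Rs n * PX.nm (ap I (U n) \<xi>)" for \<xi> using cone by (rule spec)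
  qed (use R supp in auto)
  show ?thesis
  proof (induction n)
    case 0
    have m: "ms 0 \<le> m0" using init(2) unfolding ms_def Ms_def .
    have R: "Rs 0 \<le> R0 + ?B * (m0 - ms 0)" "0 \<le> Rs 0" using m B0 R0 by (auto intro: mult_nonneg_nonneg)
    have cone: "\<forall>\<xi>. PY.nm (ap I (U 0) \<xi>) \<le> Rs 0 * PX.nm (ap I (U 0) \<xi>)" unfolding Rs.simps using init(1) by (rule allI)
    have low: "\<forall>\<xi>. - (?B * (m0 - ms 0)) * (vn \<xi>)^2 \<le> vdot I \<xi> (mv I (Ms 0) \<xi>)"
    proof
      fix \<xi>
      have "- (?B * (m0 - ms 0)) * (vn \<xi>)^2 \<le> 0" using m B0 by (simp add: mult_nonneg_nonneg)
      then show "- (?B * (m0 - ms 0)) * (vn \<xi>)^2 \<le> vdot I \<xi> (mv I (Ms 0) \<xi>)"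
        using init(3)[of \<xi>] unfolding Ms_def by (rule order_trans)
    qed
    show ?case by (intro conjI mkn m R cone low)
  next
    case (Suc n)
    then have st: "st n" and R: "0 \<le> Rs n" "Rs n \<le> R0 + ?B * (m0 - ms n)" and m: "ms n \<le> m0"
      and low: "\<And>\<xi>. - (?B * (m0 - ms n)) * (vn \<xi>)^2 \<le> vdot I \<xi> (mv I (Ms n) \<xi>)" by simp_all
    have m': "ms (Suc n) \<le> m0" using ms_mono[OF st] m by linarith
    have "400 * c^30 * T * (\<tau> n * ms n) \<le> 400 * c^30 * T * (c^3 * (ms n - ms (Suc n)))"
      using \<tau>T(3) by (intro mult_left_mono \<tau>_ms[OF st]) (simp add: c0)
    also have "\<dots> = ?B * (ms n - ms (Suc n))" by algebra
    finally have d: "400 * c^30 * T * (\<tau> n * ms n) \<le> ?B * (ms n - ms (Suc n))" .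
    have "(1 - \<tau> n * gp / 2) * Rs n \<le> 1 * Rs n" using \<tau>T(1)[of n] gp0 R(1) by (intro mult_right_mono) auto
    then have "Rs (Suc n) \<le> Rs n + ?B * (ms n - ms (Suc n))" using Rs_Suc_le(1)[OF R(1)] d by linarith
    also have "\<dots> \<le> R0 + ?B * (m0 - ms (Suc n))" using R(2) by (simp add: right_diff_distrib)
    finally have R': "Rs (Suc n) \<le> R0 + ?B * (m0 - ms (Suc n))" .
    have cone: "\<forall>\<xi>. PY.nm (ap I (U (Suc n)) \<xi>) \<le> Rs (Suc n) * PX.nm (ap I (U (Suc n)) \<xi>)"
      unfolding U_Suc[OF st] Rs.simps ms_def Ms_def by (intro allI step.cone_step step_n st)
    have "16 * c^10 * (\<tau> n)^2 * ms n \<le> ?B * (ms n - ms (Suc n))"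
    proof -
      have "16 * c^10 * (\<tau> n)^2 * ms n = 16 * c^10 * \<tau> n * (\<tau> n * ms n)" by algebra
      also have "\<dots> \<le> 400 * c^30 * T * (\<tau> n * ms n)"
        by (intro mult_right_mono mult_mono) (use \<tau>T(1,2)[of n] ms_nonneg[of n] cp[of 10 30] c0(3) in auto)
      finally show ?thesis using d by linarith
    qed
    then have le: "?B * (m0 - ms n) + 16 * c^10 * (\<tau> n)^2 * ms n \<le> ?B * (m0 - ms (Suc n))"
      by (simp add: right_diff_distrib)
    have low': "\<forall>\<xi>. - (?B * (m0 - ms (Suc n))) * (vn \<xi>)^2 \<le> vdot I \<xi> (mv I (Ms (Suc n)) \<xi>)"
    proof
      fix \<xi>
      have "- (?B * (m0 - ms n) + 16 * c^10 * (\<tau> n)^2 * ms n) * (vn \<xi>)^2 \<le> vdot I \<xi> (mv I (Ms (Suc n)) \<xi>)"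
        unfolding Ms_def[of "Suc n"] U_Suc[OF st] ms_def Ms_def
      proof (rule step.M'_lower[OF step_n[OF st]])
        show "0 \<le> ?B * (m0 - fn (gr b (U n) (U n) - mid I))"
          using m B0 unfolding ms_def Ms_def by simp
        show "- (?B * (m0 - fn (gr b (U n) (U n) - mid I))) * (vn \<xi>)^2 \<le> vdot I \<xi> (mv I (gr b (U n) (U n) - mid I) \<xi>)" for \<xi>
          using low[of \<xi>] unfolding ms_def Ms_def .
      qed
      moreover have "- (?B * (m0 - ms (Suc n))) * (vn \<xi>)^2 \<le> - (?B * (m0 - ms n) + 16 * c^10 * (\<tau> n)^2 * ms n) * (vn \<xi>)^2"
        using le by (intro mult_right_mono) auto
      ultimately show "- (?B * (m0 - ms (Suc n))) * (vn \<xi>)^2 \<le> vdot I \<xi> (mv I (Ms (Suc n)) \<xi>)" by linarith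
    qed
    show ?case by (intro conjI mkn m' R' Rs_Suc_le(2)[OF R(1)] cone low')
  qed
qed

lemma st: "st n" and Rs0: "0 \<le> Rs n" using invariant[of n] by simp_all

text \<open>Half of the decay of the defect pays for its forcing of the slope, so the sum contracts
  by a fixed factor. The rate is crude; it leads into the regime where the sharp rates hold.\<close>

lemma z_decay: "Rs (Suc n) + ms (Suc n) \<le> (1 - \<tau>l * min (gp / 2) (1 / (2 * c^3))) * (Rs n + ms n)"
proof -
  let ?s = "min (gp / 2) (1 / (2 * c^3))"
  have "400 * (T * c^33) \<le> 1/2" using Tc[of 33] \<tau>T(3) by simp
  then have "400 * (T * c^33) / c^3 \<le> (1/2) / c^3" by (rule divide_right_mono) (simp add: c0)
  moreover have "c^33 = c^30 * c^3" by algebra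
  ultimately have "400 * (T * (c^30 * c^3)) / c^3 \<le> (1/2) / c^3" by (simp only:)
  then have "400 * c^30 * T \<le> (1/2) / c^3" by (rule cancel_factor[OF c0(4)])
  then have "400 * c^30 * T \<le> 1 / (2 * c^3)" by simp
  then have 1: "400 * c^30 * T * (\<tau> n * ms n) \<le> 1 / (2 * c^3) * (\<tau> n * ms n)"
    using \<tau>T(1)[of n] ms_nonneg[of n] by (intro mult_right_mono) auto
  have "Rs (Suc n) + ms (Suc n) \<le> (1 - \<tau> n * gp / 2) * Rs n + 1 / (2 * c^3) * (\<tau> n * ms n) + (1 - \<tau> n / c^3) * ms n"
    using Rs_Suc_le(1)[OF Rs0[of n]] 1 ms_decay[OF st[of n]] by linarith
  also have "\<dots> = (Rs n + ms n) - (\<tau> n * (gp / 2) * Rs n + \<tau> n * (1 / (2 * c^3)) * ms n)"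
    by (simp add: field_simps)
  also have "\<dots> \<le> (Rs n + ms n) - (\<tau>l * ?s * Rs n + \<tau>l * ?s * ms n)"
    using \<tau>(1)[of n] \<tau>l \<tau>T(1)[of n] gp0 c0(4)[of 3] ms_nonneg[of n] Rs0[of n]
    by (intro diff_left_mono add_mono mult_right_mono mult_mono) (auto simp: min_def)
  finally show ?thesis by (simp add: algebra_simps)
qed

lemma z_tendsto: "(\<lambda>n. Rs n + ms n) \<longlonglongrightarrow> 0"
proof -
  let ?r = "1 - \<tau>l * min (gp / 2) (1 / (2 * c^3))"
  have pos: "0 < min (gp / 2) (1 / (2 * c^3))" using gp0 c0(4)[of 3] by simp
  have "1 / (2 * c^3) \<le> 1/2" using c1 by (simp add: field_simps)
  then have "min (gp / 2) (1 / (2 * c^3)) \<le> 1/2" by (rule order_trans[OF min.cobounded2])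
  then have "\<tau>l * min (gp / 2) (1 / (2 * c^3)) \<le> 1 * (1/2)"
    using \<tau>(1)[of 0] \<tau>T(2)[of 0] T1 \<tau>l pos by (intro mult_mono) auto
  then have r: "0 < ?r" by simp
  have r1: "?r < 1" using \<tau>l pos by simp
  have z0: "0 \<le> Rs n + ms n" for n using Rs0[of n] ms_nonneg[of n] by simp
  obtain A where A: "\<forall>n\<ge>0. Rs n + ms n \<le> A * ?r ^ n"
    using geometric_rate[of ?r "\<lambda>n. Rs n + ms n" 0, OF r z0 z_decay] by auto
  show ?thesis
  proof (rule tendsto_sandwich[of "\<lambda>_. 0" _ _ "\<lambda>n. A * ?r ^ n"])
    show "(\<lambda>n. A * ?r ^ n) \<longlonglongrightarrow> 0"
      using tendsto_mult_right_zero[OF LIMSEQ_realpow_zero[OF less_imp_le[OF r] r1]] .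
  qed (use A z0 in auto)
qed

section \<open>Sharp rates and the limit\<close>

definition kmax :: real where "kmax = (SUP t\<in>{\<tau>l..\<tau>u}. kap t)"
definition q :: real where "q = kmax powr (1/4)"

lemma kap_le: "0 < t \<Longrightarrow> t \<le> T \<Longrightarrow> kap t \<le> 1 - t * \<eta>"
proof -
  assume t: "0 < t" "t \<le> T"
  have "K * t \<le> \<eta>" using mult_left_mono[OF t(2) K0] T(5) by linarith
  then have "K * t * t \<le> \<eta> * t" using t by (intro mult_right_mono) auto
  then show ?thesis by (simp add: kap_def power2_eq_square algebra_simps)
qed

lemma kap_pos: "0 < t \<Longrightarrow> t \<le> T \<Longrightarrow> 0 < kap t"
proof -
  assume t: "0 < t" "t \<le> T"
  have "2 * t * \<eta> \<le> 2 * T * \<eta>" using t \<eta> by (intro mult_right_mono) auto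
  moreover have "0 \<le> K * t^2" using K0 by simp
  ultimately show ?thesis using T(6) by (simp add: kap_def)
qed

lemma kap_kmax: "kap (\<tau> n) \<le> kmax" and kmax: "0 < kmax" "kmax < 1"
proof -
  have b: "kap t \<le> 1 - \<tau>l * \<eta>" if "t \<in> {\<tau>l..\<tau>u}" for t
  proof -
    have "kap t \<le> 1 - t * \<eta>" using that \<tau>l \<tau>u by (intro kap_le) auto
    also have "\<dots> \<le> 1 - \<tau>l * \<eta>" using that \<eta> by (simp add: mult_right_mono)
    finally show ?thesis .
  qed
  have bdd: "bdd_above (kap ` {\<tau>l..\<tau>u})" by (rule bdd_aboveI2[OF b])
  show le: "kap (\<tau> n) \<le> kmax" for n
    unfolding kmax_def by (intro cSUP_upper bdd) (use \<tau> in auto)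
  show "0 < kmax" using le[of 0] kap_pos[OF \<tau>T(1,2)[of 0]] by linarith
  have "kmax \<le> 1 - \<tau>l * \<eta>" unfolding kmax_def
    by (intro cSUP_least b) (use \<tau>[of 0] in auto)
  then show "kmax < 1" using mult_pos_pos[OF \<tau>l \<eta>(1)] by linarith
qed

lemma q: "0 < q" "q < 1" "q^4 = kmax"
proof -
  show "0 < q" using kmax by (simp add: q_def)
  show "q^4 = kmax" using kmax by (simp add: q_def powr_power)
  then show "q < 1" using kmax \<open>0 < q\<close> one_le_power[of q 4] by fastforce
qed

text \<open>The squared slope factor is at most \<open>kap\<close>, hence at most kmax = q^4; a
  square root leaves q^2.\<close>

lemma Rs_rate: "Rs (Suc n) \<le> q^2 * Rs n + 400 * c^30 * ms n"
proof -
  have t: "0 \<le> \<tau> n" "\<tau> n \<le> 1" using \<tau>T(1,2)[of n] T1 by auto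
  have "(1 - \<tau> n * gp + 400 * c^30 * (\<tau> n)^2)^2 \<le> kap (\<tau> n)"
    unfolding kap_def by (rule contraction_square_le[OF t _ _ _ K(1)]) (use gp0 \<eta> c0(3)[of 30] in auto)
  also have "\<dots> \<le> (q^2)^2" using kap_kmax[of n] q(3) by (simp flip: power_mult)
  finally have "1 - \<tau> n * gp + 400 * c^30 * (\<tau> n)^2 \<le> q^2" by (rule power2_le_imp_le) simp
  then have 1: "(1 - \<tau> n * gp + 400 * c^30 * (\<tau> n)^2) * Rs n \<le> q^2 * Rs n" using Rs0 by (rule mult_right_mono)
  have "(\<tau> n)^2 \<le> 1" using t by (simp add: power_le_one)
  then have "400 * c^30 * (\<tau> n)^2 * ms n \<le> 400 * c^30 * 1 * ms n"
    using ms_nonneg[of n] c0(3)[of 30] by (intro mult_right_mono mult_left_mono) auto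
  then show ?thesis using 1 by simp
qed

text \<open>Since \<eta> < 1/\<open>l N\<close>, smallness of slope and defect puts the sharp lower
  bound of \<open>K\<close> above \<eta>; the defect then contracts by \<open>kap\<close>
  itself.\<close>

lemma ms_rate:
  assumes small: "c^6 * (Rs n + ms n) \<le> 1 - \<eta> * l N"
  shows "ms (Suc n) \<le> q^4 * ms n"
proof -
  have gc: "1 / l N \<le> c"
    using inv_l1(3)[of N] N1 state.cg[OF st[of 0]] by simp
  have "\<eta> \<le> 1 / l N" using \<eta>(2) l_pos'(3) by (smt (verit) divide_pos_pos)
  then have "\<eta> \<le> c^5" using gc cp[of 1 5] by simp
  have "c^5 * (Rs n)^2 \<le> c^6 * Rs n" by (rule state.c5R2[OF st])
  moreover have "1 * ms n \<le> c^6 * ms n" using c1 ms_nonneg by (intro mult_right_mono) auto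
  ultimately have "ms n + c^5 * (Rs n)^2 \<le> c^6 * (Rs n + ms n)" by (simp add: distrib_left)
  then have "\<eta> * l N \<le> 1 - ms n - c^5 * (Rs n)^2" using small by linarith
  then have k: "\<eta> \<le> (1 - ms n - c^5 * (Rs n)^2) / l N" using l_pos'(2) by (simp add: pos_le_divide_eq)
  have "ms (Suc n) \<le> (1 - 2 * \<eta> * \<tau> n + 60 * c^10 * (\<tau> n)^2) * ms n"
  proof (rule ms_step[OF st _ _ \<open>\<eta> \<le> c^5\<close>])
    show "\<eta> * (vn \<xi>)^2 \<le> vdot I \<xi> (mv I (gr b (U n) (GT (U n))) \<xi>)" for \<xi>
      by (rule order_trans[OF mult_right_mono[OF k[unfolded ms_def Ms_def]] state.K_lower_sharp[OF st]]) simp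
  qed (use \<eta> in simp)
  also have "\<dots> \<le> q^4 * ms n"
  proof (rule mult_right_mono[OF _ ms_nonneg])
    have "60 * c^10 \<le> K" using K(2) cp[of 10 30] c0(3)[of 30] by linarith
    then have "60 * c^10 * (\<tau> n)^2 \<le> K * (\<tau> n)^2" by (intro mult_right_mono) auto
    then show "1 - 2 * \<eta> * \<tau> n + 60 * c^10 * (\<tau> n)^2 \<le> q^4"
      using kap_kmax[of n] unfolding q(3) kap_def by (simp add: ac_simps)
  qed
  finally show ?thesis .
qed

end

lemma lim_abs_le_zero:
  fixes x :: "nat \<Rightarrow> real"
  assumes "x \<longlonglongrightarrow> L" "e \<longlonglongrightarrow> 0" "\<And>n. \<bar>x n - d\<bar> \<le> e n"
  shows "L = d"
proof -
  have "(\<lambda>n. x n - d) \<longlonglongrightarrow> 0"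
    by (rule Lim_null_comparison[OF _ assms(2)]) (simp add: assms(3))
  then have "x \<longlonglongrightarrow> d" by (simp add: LIM_zero_iff)
  then show ?thesis using assms(1) LIMSEQ_unique by blast
qed

lemma factor_le:
  fixes t :: real
  assumes "0 \<le> t" "C \<le> K" "D \<le> 2 * (d - h)"
  shows "1 - 2 * t * d + D * t + C * t^2 \<le> 1 - 2 * t * h + K * t^2"
  using mult_right_mono[OF assms(2), of "t^2"] mult_right_mono[OF assms(3,1)]
  by (simp add: algebra_simps)

lemma factor_apply:
  fixes s :: real
  assumes "x \<le> (p + y + z) * s + e" "y = y'" "p + y' + z \<le> k" "0 \<le> s"
  shows "x \<le> k * s + e"
  using assms(1,2) mult_right_mono[OF assms(3,4)] by simp

context flow
begin

lemma eventually_small: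
  assumes "0 < e" shows "\<forall>\<^sub>F n in sequentially. C * (Rs n + ms n) \<le> e"
  using order_tendstoD(2)[OF tendsto_mult_right_zero[OF z_tendsto, of C] assms]
  by (rule eventually_mono) simp

lemma rates:
  "\<exists>n0 A. 0 \<le> A \<and> (\<forall>n\<ge>n0. Rs n + ms n \<le> A * q ^ n \<and> ms n + (Rs n)^2 \<le> A * q ^ (2 * n))"
proof -
  have "\<eta> < 1 / l N" using \<eta>(2) divide_pos_pos[OF zero_less_one l_pos'(3)] by linarith
  then have "0 < 1 - \<eta> * l N" using l_pos'(2) by (simp add: pos_less_divide_eq)
  from eventually_small[OF this, of "c^6"] obtain n0
    where n0: "\<And>n. n0 \<le> n \<Longrightarrow> c^6 * (Rs n + ms n) \<le> 1 - \<eta> * l N"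
    unfolding eventually_sequentially by auto
  have q4: "0 < q^4" using q(1) by simp
  obtain A1 where A1: "0 \<le> A1" "\<And>n. n0 \<le> n \<Longrightarrow> ms n \<le> A1 * (q^4) ^ n"
    using geometric_rate[where x = ms and ?n0.0 = n0, OF q4 ms_nonneg ms_rate[OF n0]] by auto
  have C: "0 \<le> 400 * c^30 * A1" using A1(1) c0(3)[of 30] by simp
  have "Rs (Suc n) \<le> q^2 * Rs n + 400 * c^30 * A1 * (q^4) ^ n" if "n0 \<le> n" for n
    using Rs_rate[of n] mult_left_mono[OF A1(2)[OF that], of "400 * c^30"] c0(3)[of 30] by simp
  from forced_geometric_rate[OF q(1,2) C this] obtain A2
    where A2: "0 \<le> A2" "\<And>n. n0 \<le> n \<Longrightarrow> Rs n \<le> A2 * q ^ n" by auto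
  show ?thesis
  proof (intro exI[of _ n0] exI[of _ "A1 + A2 + A2^2"] conjI allI impI)
    show "0 \<le> A1 + A2 + A2^2" using A1(1) A2(1) by simp
    fix n assume n: "n0 \<le> n"
    have p1: "(q^4) ^ n \<le> q ^ (2 * n)" and p2: "(q^4) ^ n \<le> q ^ n"
      unfolding power_mult[symmetric] using q by (intro power_decreasing; simp)+
    have m1: "ms n \<le> A1 * q ^ n" by (rule order_trans[OF A1(2)[OF n] mult_left_mono[OF p2 A1(1)]])
    have m2: "ms n \<le> A1 * q ^ (2 * n)" by (rule order_trans[OF A1(2)[OF n] mult_left_mono[OF p1 A1(1)]])
    have R2: "(Rs n)^2 \<le> A2^2 * q ^ (2 * n)"
      using power_mono[OF A2(2)[OF n] Rs0, of 2] by (simp add: power_mult_distrib mult.commute flip: power_mult)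
    have "0 \<le> A2^2 * q ^ n" "0 \<le> A2 * q ^ (2 * n)" using q A2(1) by auto
    then show "Rs n + ms n \<le> (A1 + A2 + A2^2) * q ^ n" "ms n + (Rs n)^2 \<le> (A1 + A2 + A2^2) * q ^ (2 * n)"
      using m1 m2 R2 A2(2)[OF n] by (simp_all add: distrib_right)
  qed
qed

lemma increment: "nA (U (Suc n) - U n) \<le> 5 * c^10 * \<tau> n * (ms n + Rs n)"
  unfolding U_Suc[OF st] ms_def Ms_def by (rule step.increment[OF step_n[OF st]])

lemma Xm_increment:
  assumes "k \<in> I" "i \<in> I"
  shows "\<bar>Xm (U (Suc n)) k i - Xm (U n) k i\<bar> \<le> 5 * c^11 * (Rs n + ms n)"
proof -
  have "Xm (U (Suc n)) k i - Xm (U n) k i = Xm (U (Suc n) - U n) k i" by (simp add: Xm_def xc_diff)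
  then have "\<bar>Xm (U (Suc n)) k i - Xm (U n) k i\<bar> \<le> nX (U (Suc n) - U n)"
    using mnm_entry[OF _ assms, of "Xm (U (Suc n) - U n)"] unfolding fn_Xm by simp
  also have "\<dots> \<le> c * nA (U (Suc n) - U n)" by (rule order_trans[OF nX_le state.nBc[OF st]])
  also have "\<dots> \<le> c * (5 * c^10 * 1 * (ms n + Rs n))"
    using \<tau>T(1,2)[of n] T1 ms_nonneg[of n] Rs0[of n] c0(3)[of 10]
    by (intro mult_left_mono c0(1) order_trans[OF increment] mult_right_mono) auto
  also have "\<dots> = 5 * c^11 * (Rs n + ms n)" by algebra
  finally show ?thesis .
qed

text \<open>The coordinate matrices have geometrically small increments and converge; the limit is
  orthogonal because X^T X - I tends to 0. The distance splits into the complement part and the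
  error of the coordinates.\<close>

lemma limit:
  "\<exists>C Q n0. 0 \<le> C \<and> (\<forall>i\<in>I. \<forall>j\<in>I. (\<Sum>k\<in>I. Q k i * Q k j) = (if i = j then 1 else 0)) \<and>
    (\<forall>n\<ge>n0. nA (U n - tm I v Q) \<le> C * q ^ n)"
proof -
  obtain n0 A where A: "0 \<le> A" "\<And>n. n0 \<le> n \<Longrightarrow> Rs n + ms n \<le> A * q ^ n" using rates by auto
  define D where "D = 5 * c^11 * A / (1 - q)"
  have D: "0 \<le> D" using A(1) q c0(3)[of 11] by (simp add: D_def)
  define Q where "Q k i = lim (\<lambda>n. Xm (U n) k i)" for k i
  have Q: "(\<lambda>n. Xm (U n) k i) \<longlonglongrightarrow> Q k i \<and> (\<forall>n\<ge>n0. \<bar>Xm (U n) k i - Q k i\<bar> \<le> D * q ^ n)"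
    if ki: "k \<in> I" "i \<in> I" for k i
  proof -
    have "\<bar>Xm (U (Suc n)) k i - Xm (U n) k i\<bar> \<le> (5 * c^11 * A) * q ^ n" if "n0 \<le> n" for n
    proof -
      have "5 * c^11 * (Rs n + ms n) \<le> 5 * c^11 * (A * q ^ n)" using A(2)[OF that] c0(3)[of 11] by (intro mult_left_mono) auto
      then show ?thesis using Xm_increment[OF ki, of n] by (simp add: mult.assoc)
    qed
    from geometric_increments_converge[OF q(1,2) this] obtain L where
      L: "(\<lambda>n. Xm (U n) k i) \<longlonglongrightarrow> L" "\<forall>n\<ge>n0. \<bar>Xm (U n) k i - L\<bar> \<le> 5 * c^11 * A / (1 - q) * q ^ n" by auto
    have "Q k i = L" unfolding Q_def by (rule limI[OF L(1)])
    then show ?thesis using L unfolding D_def by simp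
  qed
  have orth: "(\<Sum>k\<in>I. Q k i * Q k j) = (if i = j then 1 else 0)" if ij: "i \<in> I" "j \<in> I" for i j
  proof (rule lim_abs_le_zero)
    show "(\<lambda>n. \<Sum>k\<in>I. Xm (U n) k i * Xm (U n) k j) \<longlonglongrightarrow> (\<Sum>k\<in>I. Q k i * Q k j)"
      using Q ij by (intro tendsto_sum tendsto_mult) auto
    show "(\<lambda>n. c^6 * (Rs n + ms n)) \<longlonglongrightarrow> 0" by (rule tendsto_mult_right_zero[OF z_tendsto])
    show "\<bar>(\<Sum>k\<in>I. Xm (U n) k i * Xm (U n) k j) - (if i = j then 1 else 0)\<bar> \<le> c^6 * (Rs n + ms n)" for n
    proof -
      have "\<bar>(mm I (\<lambda>i j. Xm (U n) j i) (Xm (U n)) - mid I) i j\<bar> \<le> ms n + c^5 * (Rs n)^2"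
        unfolding ms_def Ms_def by (rule order_trans[OF mnm_entry[OF _ ij] state.fnS(1)[OF st]]) simp
      also have "\<dots> \<le> 1 * ms n + c^6 * Rs n" using state.c5R2[OF st, of n] by simp
      also have "\<dots> \<le> c^6 * ms n + c^6 * Rs n" using c1 ms_nonneg Rs0 by (intro add_mono mult_right_mono) auto
      finally show ?thesis using ij by (simp add: mm_def mid_def distrib_left)
    qed
  qed
  have dist: "nA (U n - tm I v Q) \<le> (c^2 * A + nA v * (real (card I) * D)) * q ^ n" if n: "n0 \<le> n" for n
  proof -
    have fn: "fn (Xm (U n) - Q) \<le> real (card I) * (D * q ^ n)"
      using Q n D q by (intro fn_le_entries) auto
    have "U n - tm I v Q = (U n - tm I v (Xm (U n))) + tm I v (Xm (U n) - Q)"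
      unfolding tm_diff_right by simp
    then have "nA (U n - tm I v Q) \<le> nA (U n - tm I v (Xm (U n))) + nA (tm I v (Xm (U n) - Q))"
      using TA.nm_triangle[of "U n - tm I v (Xm (U n))" "tm I v (Xm (U n) - Q)"] by (simp only:)
    moreover have "nA (U n - tm I v (Xm (U n))) \<le> c^2 * Rs n" by (rule state.dist_to_rotation[OF st])
    moreover have "c^2 * Rs n \<le> c^2 * (A * q ^ n)"
      using A(2)[OF n] ms_nonneg[of n] by (intro mult_left_mono c0(3)) linarith
    moreover have "nA (tm I v (Xm (U n) - Q)) \<le> nA v * (real (card I) * (D * q ^ n))"
      by (rule order_trans[OF A.tnm_tm mult_left_mono[OF fn TA.nm_nonneg]])
    moreover have "(c^2 * A + nA v * (real (card I) * D)) * q ^ n = c^2 * (A * q ^ n) + nA v * (real (card I) * (D * q ^ n))"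
      by algebra
    ultimately show ?thesis by linarith
  qed
  show ?thesis
    using orth dist A(1) D c0(3)[of 2]
    by (intro exI[of _ "c^2 * A + nA v * (real (card I) * D)"] exI[of _ Q] exI[of _ n0] conjI ballI allI impI)
      (simp_all only: mult_nonneg_nonneg add_nonneg_nonneg of_nat_0_le_iff TA.nm_nonneg)
qed

lemma predictor_contraction:
  assumes "1000 * c^30 * (Rs n + ms n) \<le> 2 * (gp - \<eta>)"
  shows "(nA (Aop (Uh (Suc n)) (Uh (Suc n))))^2 \<le> kap (\<tau> n) * (nA (Aop (U n) (U n)))^2 + 10000 * c^40 * \<tau> n * ms n"
proof -
  have "(nA (Aop (Uh (Suc n)) (Uh (Suc n))))^2 \<le>
    (1 - 2 * \<tau> n * gp + 1000 * c^30 * \<tau> n * (ms n + Rs n) + 10000 * c^30 * (\<tau> n)^2) * (nA (Aop (U n) (U n)))^2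
     + 10000 * c^40 * \<tau> n * ms n"
    unfolding Uh_eq ms_def Ms_def by (rule step.predictor_contraction[OF step_n[OF st]])
  moreover have "1000 * c^30 * \<tau> n * (ms n + Rs n) = (1000 * c^30 * (Rs n + ms n)) * \<tau> n" by algebra
  moreover have "1 - 2 * \<tau> n * gp + (1000 * c^30 * (Rs n + ms n)) * \<tau> n + 10000 * c^30 * (\<tau> n)^2 \<le> kap (\<tau> n)"
    unfolding kap_def by (rule factor_le[OF less_imp_le[OF \<tau>T(1)] K(2) assms])
  ultimately show ?thesis by (rule factor_apply) simp
qed

lemma conclusion:
  "0 < q \<and> q < 1 \<and>
   (\<exists>C>0. \<forall>\<^sub>F n in sequentially. (nA (Aop (Uh (Suc n)) (Uh (Suc n))))^2
      \<le> kap (\<tau> n) * (nA (Aop (U n) (U n)))^2 + C * \<tau> n * fn (gr b (U n) (U n) - mid I)) \<and>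
   (\<exists>C>0. \<exists>Q. (\<forall>i\<in>I. \<forall>j\<in>I. (\<Sum>k\<in>I. Q k i * Q k j) = (if i = j then 1 else 0)) \<and>
     (\<forall>\<^sub>F n in sequentially.
       nA (GT (U n) - tm I (U n) (gr b (U n) (GT (U n)))) \<le> C * q ^ n \<and>
       nA (U n - tm I v Q) \<le> C * q ^ n \<and>
       (nA (U n))^2 / 2 - (\<Sum>k\<in>I. l k) / 2 \<le> C * q ^ (2 * n)))"
proof (intro conjI q)
  have "0 < gp - \<eta>" using \<eta>(2) by (simp only: diff_gt_0_iff_gt)
  then have "0 < 2 * (gp - \<eta>)" by (rule mult_pos_pos[rotated]) simp
  from eventually_small[OF this, of "1000 * c^30"]
  have "\<forall>\<^sub>F n in sequentially. (nA (Aop (Uh (Suc n)) (Uh (Suc n))))^2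
      \<le> kap (\<tau> n) * (nA (Aop (U n) (U n)))^2 + 10000 * c^40 * \<tau> n * fn (gr b (U n) (U n) - mid I)"
    by (rule eventually_mono) (drule predictor_contraction, simp only: ms_def Ms_def)
  moreover have "0 < 10000 * c^40" using c0(4)[of 40] by simp
  ultimately show "\<exists>C>0. \<forall>\<^sub>F n in sequentially. (nA (Aop (Uh (Suc n)) (Uh (Suc n))))^2
      \<le> kap (\<tau> n) * (nA (Aop (U n) (U n)))^2 + C * \<tau> n * fn (gr b (U n) (U n) - mid I)" by (intro exI conjI)
next
  obtain n0 A where A: "0 \<le> A" "\<And>n. n0 \<le> n \<Longrightarrow> Rs n + ms n \<le> A * q ^ n"
    "\<And>n. n0 \<le> n \<Longrightarrow> ms n + (Rs n)^2 \<le> A * q ^ (2 * n)" using rates by auto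
  obtain B Q n1 where B: "0 \<le> B" "\<forall>i\<in>I. \<forall>j\<in>I. (\<Sum>k\<in>I. Q k i * Q k j) = (if i = j then 1 else 0)"
    "\<And>n. n1 \<le> n \<Longrightarrow> nA (U n - tm I v Q) \<le> B * q ^ n" using limit by auto
  define C where "C = 4 * c^10 * A + B + c^7 * A + 1"
  have nn: "0 \<le> 4 * c^10 * A" "0 \<le> c^7 * A" using mult_nonneg_nonneg[OF c0(3)[of 10] A(1)] mult_nonneg_nonneg[OF c0(3)[of 7] A(1)] by (simp_all add: mult.assoc)
  have ev: "nA (GT (U n) - tm I (U n) (gr b (U n) (GT (U n)))) \<le> C * q ^ n \<and>
       nA (U n - tm I v Q) \<le> C * q ^ n \<and>
       (nA (U n))^2 / 2 - (\<Sum>k\<in>I. l k) / 2 \<le> C * q ^ (2 * n)" if n: "max n0 n1 \<le> n" for n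
  proof (intro conjI)
    have CI: "x \<le> C * q ^ k" if "x \<le> y * q ^ k" "y \<le> C" for x y k
      using that q(1) by (meson mult_right_mono order_trans zero_le_power less_imp_le)
    have "nA (GT (U n) - tm I (U n) (gr b (U n) (GT (U n)))) \<le> 4 * c^10 * (ms n + Rs n)"
      unfolding ms_def Ms_def by (rule state.nAH[OF st])
    moreover have "4 * c^10 * (Rs n + ms n) \<le> 4 * c^10 * (A * q ^ n)"
      using A(2)[of n] n c0(3)[of 10] by (intro mult_left_mono) auto
    ultimately have "nA (GT (U n) - tm I (U n) (gr b (U n) (GT (U n)))) \<le> 4 * c^10 * A * q ^ n"
      by (simp only: mult.assoc add.commute)
    then show "nA (GT (U n) - tm I (U n) (gr b (U n) (GT (U n)))) \<le> C * q ^ n"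
      by (rule CI) (use nn B(1) in \<open>simp add: C_def\<close>)
    show "nA (U n - tm I v Q) \<le> C * q ^ n"
      by (rule CI[OF B(3)]) (use n nn B(1) in \<open>auto simp: C_def\<close>)
    have "(nA (U n))^2 - (\<Sum>k\<in>I. l k) \<le> 2 * c^7 * (ms n + (Rs n)^2)"
      unfolding ms_def Ms_def by (rule order_trans[OF abs_ge_self state.energy_bound[OF st]])
    moreover have "2 * c^7 * (ms n + (Rs n)^2) \<le> 2 * c^7 * (A * q ^ (2 * n))"
      using A(3)[of n] n c0(3)[of 7] by (intro mult_left_mono) auto
    moreover have "2 * c^7 * (A * q ^ (2 * n)) = 2 * (c^7 * A * q ^ (2 * n))" by algebra
    ultimately have "(nA (U n))^2 / 2 - (\<Sum>k\<in>I. l k) / 2 \<le> c^7 * A * q ^ (2 * n)" by argo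
    then show "(nA (U n))^2 / 2 - (\<Sum>k\<in>I. l k) / 2 \<le> C * q ^ (2 * n)"
      by (rule CI) (use nn B(1) in \<open>simp add: C_def\<close>)
  qed
  have C0: "0 < C" unfolding C_def using nn B(1) by linarith
  have "\<forall>\<^sub>F n in sequentially. nA (GT (U n) - tm I (U n) (gr b (U n) (GT (U n)))) \<le> C * q ^ n \<and>
       nA (U n - tm I v Q) \<le> C * q ^ n \<and>
       (nA (U n))^2 / 2 - (\<Sum>k\<in>I. l k) / 2 \<le> C * q ^ (2 * n)"
    by (rule eventually_sequentiallyI[OF ev])
  then show "\<exists>C>0. \<exists>Q. (\<forall>i\<in>I. \<forall>j\<in>I. (\<Sum>k\<in>I. Q k i * Q k j) = (if i = j then 1 else 0)) \<and>
     (\<forall>\<^sub>F n in sequentially.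
       nA (GT (U n) - tm I (U n) (gr b (U n) (GT (U n)))) \<le> C * q ^ n \<and>
       nA (U n - tm I v Q) \<le> C * q ^ n \<and>
       (nA (U n))^2 / 2 - (\<Sum>k\<in>I. l k) / 2 \<le> C * q ^ (2 * n))"
    using B(2) C0 by (intro exI[of _ C] exI[of _ Q] conjI)
qed

end

lemma inverse_scale: "0 < S \<Longrightarrow> 0 < y \<Longrightarrow> x / y \<le> S \<Longrightarrow> x * (1 / S) \<le> (y :: real)"
  by (simp add: field_simps)

lemma half_gap_pos: "0 \<le> s \<Longrightarrow> x < y \<Longrightarrow> 0 < s + (y - x) / (2::real)"
  by (simp add: add_nonneg_pos)

lemma constant_dominates:
  fixes g n w r X Y :: real
  assumes "1 \<le> g" "0 \<le> n" "0 \<le> w" "0 < r" "0 \<le> X" "0 \<le> Y"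
  defines "c \<equiv> 2 + g + n + w + 2 * r + X + 2 * (1 + Y)"
  shows "1 \<le> c" "g \<le> c" "n \<le> c" "w \<le> c" "2 * r \<le> c" "X \<le> c" "2 * (1 + Y) \<le> c"
  unfolding c_def using assms(1-6) by simp_all

context spectral
begin

text \<open>\<open>c_nA\<close> and \<open>c_low\<close> come from two computations. In the cone the
  energy is at most \<open>l N + (2 * R0)^2\<close> times the eigenspace part. The form bound -1/2
  leaves at least half of the squared coefficient length in \<open>b\<close>, which the cone bounds
  by the eigenspace part.\<close>

lemma state_intro:
  assumes c: "1 \<le> c" "g \<le> c" "real N \<le> c" "l N \<le> c" "2 * R0 \<le> c"
    and c_nA: "real N * ((l N + (2 * R0)^2) * (1 + m0)) \<le> c" and c_low: "2 * (1 + (2 * R0)^2 / l (N+1)) \<le> c"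
    and supp: "\<And>i. i \<notin> I \<Longrightarrow> W i = 0" and R: "0 \<le> R" "R \<le> 2 * R0"
    and cone: "\<And>\<xi>. PY.nm (ap I W \<xi>) \<le> R * PX.nm (ap I W \<xi>)"
    and m: "fn (gr b W W - mid I) \<le> m0"
    and low: "\<And>\<xi>. - (1/2) * (vn \<xi>)^2 \<le> vdot I \<xi> (mv I (gr b W W - mid I) \<xi>)"
  shows "state a b G N l v c R W"
proof -
  have cone2: "PY (ap I W \<xi>) (ap I W \<xi>) \<le> (2 * R0)^2 * PX (ap I W \<xi>) (ap I W \<xi>)" for \<xi>
  proof -
    have "PY.nm (ap I W \<xi>) \<le> 2 * R0 * PX.nm (ap I W \<xi>)"
      by (rule order_trans[OF cone mult_right_mono[OF R(2) PX.nm_nonneg]])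
    then have "(PY.nm (ap I W \<xi>))^2 \<le> (2 * R0 * PX.nm (ap I W \<xi>))^2" by (rule power_mono) (rule PY.nm_nonneg)
    then show ?thesis unfolding power_mult_distrib[of "2 * R0"] PX.nm_sq PY.nm_sq .
  qed
  have cc: "c \<le> c^2" using mult_left_mono[OF c(1), of c] c(1) by (simp add: power2_eq_square)
  have nA: "nA W \<le> c"
  proof (rule power2_le_imp_le)
    have ai: "a (W i) (W i) \<le> (l N + (2 * R0)^2) * (1 + m0)" if i: "i \<in> I" for i
    proof -
      have W: "W i = ap I W (\<lambda>j. if j = i then 1 else 0)" using ap_unit[OF _ i, of W] by simp
      have "a (W i) (W i) \<le> l N * PX (W i) (W i) + (2 * R0)^2 * PX (W i) (W i)"
        using a_le[of "W i"] cone2[of "\<lambda>j. if j = i then 1 else 0"] unfolding W[symmetric] by linarith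
      also have "\<dots> = (l N + (2 * R0)^2) * PX (W i) (W i)" by (simp only: distrib_right)
      also have "\<dots> \<le> (l N + (2 * R0)^2) * (1 + m0)"
      proof (rule mult_left_mono)
        have "\<bar>(gr b W W - mid I) i i\<bar> \<le> m0" by (rule order_trans[OF mnm_entry[OF _ i i] m]) simp
        then have "b (W i) (W i) \<le> 1 + m0" using i by (simp add: gr_def mid_def)
        then show "PX (W i) (W i) \<le> 1 + m0" using PX_le_b[of "W i"] by linarith
      qed (use l_pos'(2) in simp)
      finally show ?thesis .
    qed
    have "(nA W)^2 = (\<Sum>i\<in>I. a (W i) (W i))" unfolding TA.nm_sq tform_def ..
    also have "\<dots> \<le> (\<Sum>i\<in>I. (l N + (2 * R0)^2) * (1 + m0))" by (rule sum_mono) (rule ai)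
    also have "\<dots> = real N * ((l N + (2 * R0)^2) * (1 + m0))" by simp
    also have "\<dots> \<le> c" by (rule c_nA)
    finally show "(nA W)^2 \<le> c^2" using cc by linarith
  qed (use c in simp)
  have vl: "vn \<xi> \<le> c * PX.nm (ap I W \<xi>)" for \<xi>
  proof (rule power2_le_imp_le)
    let ?u = "ap I W \<xi>"
    have "b ?u ?u = vdot I \<xi> (mv I (mid I) \<xi>) + vdot I \<xi> (mv I (gr b W W - mid I) \<xi>)"
      using B.f_ap_ap[of I W \<xi> W \<xi>] by (simp add: VD.add_right[symmetric] mv_add[symmetric])
    then have "(vn \<xi>)^2 / 2 \<le> b ?u ?u" using low[of \<xi>] by (simp add: vdot_mv_mid)
    moreover have "PY ?u ?u / l (N+1) \<le> (2 * R0)^2 * PX ?u ?u / l (N+1)"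
      using l_pos'(3) by (intro divide_right_mono cone2) simp
    ultimately have "(vn \<xi>)^2 \<le> 2 * (1 + (2 * R0)^2 / l (N+1)) * PX ?u ?u"
      using b_le[of ?u] by (simp add: algebra_simps)
    also have "\<dots> \<le> c^2 * PX ?u ?u" using c_low cc by (intro mult_right_mono PX.psd_nonneg) linarith
    finally show "(vn \<xi>)^2 \<le> (c * PX.nm ?u)^2" unfolding power_mult_distrib PX.nm_sq .
  qed (use c in simp)
  have Rc: "R \<le> c" using c(5) R(2) R(1) by linarith
  show ?thesis
    by (rule state.intro[OF spectral_axioms], rule state_axioms.intro)
      (fact c(1), fact c(2), fact c(3), fact c(4), erule supp, fact nA, fact R(1), fact Rc, rule cone, rule vl)
qed

text \<open>The energy bounds the complement part of a combination by E |\<xi>|^2 from above,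
  \<open>initial_px\<close> its eigenspace part by p |\<xi>|^2 from below; the root of the quotient
  is a slope bound uniform in \<open>U\<close>.\<close>

lemma initial_cone:
  assumes sorted: "\<And>i j. i \<in> I \<Longrightarrow> j \<in> I \<Longrightarrow> i \<le> j \<Longrightarrow> l i \<le> l j"
    and gram: "\<And>\<eta>. (vn \<eta>)^2 \<le> b (ap I U \<eta>) (ap I U \<eta>)"
    and E: "(nA U)^2 \<le> E" and E_def: "E = (\<Sum>k\<in>I. l k) + (l (N+1) - l N) / 2"
    and p_def: "p = (l (N+1) - l N) / (2 * l (N+1))"
  shows "PY.nm (ap I U \<xi>) \<le> sqrt (E / p) * PX.nm (ap I U \<xi>)"
proof (rule power2_le_imp_le)
  have p: "0 < p" using l_gap l_pos'(3) by (simp add: p_def)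
  have "0 \<le> (\<Sum>k\<in>I. l k)" by (intro sum_nonneg less_imp_le l_pos'(1))
  then have E0: "0 \<le> E" using l_gap by (simp add: E_def)
  have 1: "p * (vn \<xi>)^2 \<le> (PX.nm (ap I U \<xi>))^2"
    unfolding PX.nm_sq p_def by (rule initial_px[OF sorted gram E[unfolded E_def]])
  have "(PY.nm (ap I U \<xi>))^2 \<le> (A.nm (ap I U \<xi>))^2" unfolding PY.nm_sq A.nm_sq by (rule PY_le_a)
  also have "\<dots> \<le> (nA U * vn \<xi>)^2" by (intro power_mono A.nm_ap A.nm_nonneg)
  also have "\<dots> = (nA U)^2 * (vn \<xi>)^2" by (rule power_mult_distrib)
  also have "\<dots> \<le> E * (vn \<xi>)^2" by (rule mult_right_mono[OF E]) simp
  also have "\<dots> = E / p * (p * (vn \<xi>)^2)" using p by simp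
  also have "\<dots> \<le> E / p * (PX.nm (ap I U \<xi>))^2" using E0 p by (intro mult_left_mono 1) simp
  also have "\<dots> = (sqrt (E / p) * PX.nm (ap I U \<xi>))^2" using E0 p by (simp add: power_mult_distrib)
  finally show "(PY.nm (ap I U \<xi>))^2 \<le> (sqrt (E / p) * PX.nm (ap I U \<xi>))^2" .
  show "0 \<le> sqrt (E / p) * PX.nm (ap I U \<xi>)" using E0 p by simp
qed

text \<open>Fixes \<open>K\<close> and \<open>T\<close> before step sizes and iterates.
  \<open>q\<close> is a variable tied by an equation so that the supremum is written only
  once.\<close>

definition convergent_below :: "real \<Rightarrow> real \<Rightarrow> real \<Rightarrow> bool" where
  "convergent_below \<eta> K T \<longleftrightarrow> 0 < T \<and> (\<forall>t. 0 < t \<and> t \<le> T \<longrightarrow> 0 < 1 - 2 * t * \<eta> + K * t^2 \<and> 1 - 2 * t * \<eta> + K * t^2 < 1) \<and>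
    (\<forall>\<tau>l \<tau>u \<tau> U Uh q. 0 < \<tau>l \<longrightarrow> \<tau>u \<le> T \<longrightarrow> (\<forall>n. \<tau>l \<le> \<tau> n \<and> \<tau> n \<le> \<tau>u) \<longrightarrow>
      (\<forall>n i. i \<notin> I \<longrightarrow> U n i = 0) \<longrightarrow>
      (\<forall>n. Uh (Suc n) = U n + \<tau> n *\<^sub>R Aop (U n) ((1/2) *\<^sub>R (Uh (Suc n) + U n))) \<longrightarrow>
      (\<forall>n. U (Suc n) = Uh (Suc n) - \<tau> n *\<^sub>R tm I (GT (Uh (Suc n))) (gr b (Uh (Suc n)) (Uh (Suc n)) - mid I)) \<longrightarrow>
      (\<forall>\<xi>. (vn \<xi>)^2 \<le> b (ap I (U 0) \<xi>) (ap I (U 0) \<xi>)) \<longrightarrow>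
      (nA (U 0))^2 \<le> (\<Sum>k\<in>I. l k) + (l (N+1) - l N) / 2 \<longrightarrow>
      q = (SUP t\<in>{\<tau>l..\<tau>u}. 1 - 2 * t * \<eta> + K * t^2) powr (1/4) \<longrightarrow>
      0 < q \<and> q < 1 \<and>
      (\<exists>C>0. \<forall>\<^sub>F n in sequentially. (nA (Aop (Uh (Suc n)) (Uh (Suc n))))^2
         \<le> (1 - 2 * \<tau> n * \<eta> + K * (\<tau> n)^2) * (nA (Aop (U n) (U n)))^2 + C * \<tau> n * fn (gr b (U n) (U n) - mid I)) \<and>
      (\<exists>C>0. \<exists>Q. (\<forall>i\<in>I. \<forall>j\<in>I. (\<Sum>k\<in>I. Q k i * Q k j) = (if i = j then 1 else 0)) \<and>
        (\<forall>\<^sub>F n in sequentially.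
          nA (GT (U n) - tm I (U n) (gr b (U n) (GT (U n)))) \<le> C * q ^ n \<and>
          nA (U n - tm I v Q) \<le> C * q ^ n \<and>
          (nA (U n))^2 / 2 - (\<Sum>k\<in>I. l k) / 2 \<le> C * q ^ (2 * n))))"

theorem two_stage_convergence:
  assumes sorted: "\<And>i j. i \<in> I \<Longrightarrow> j \<in> I \<Longrightarrow> i \<le> j \<Longrightarrow> l i \<le> l j"
    and \<eta>: "0 < \<eta>" "\<eta> < 1 / l N - 1 / l (N+1)"
  shows "\<exists>K T. convergent_below \<eta> K T"
proof -
  define E where "E = (\<Sum>k\<in>I. l k) + (l (N+1) - l N) / 2"
  define p where "p = (l (N+1) - l N) / (2 * l (N+1))"
  define R0 where "R0 = sqrt (E / p)"
  \<comment> \<open>Bounds the initial defect: g^2 E for the Gram matrix, N for the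
    identity.\<close>
  define m0 where "m0 = g^2 * E + real N"
  define X where "X = real N * ((l N + (2 * R0)^2) * (1 + m0))"
  define Y where "Y = (2 * R0)^2 / l (N+1)"
  define c where "c = 2 + g + real N + l N + 2 * R0 + X + 2 * (1 + Y)"
  define d where "d = 1 / l N - 1 / l (N+1)"
  define K where "K = 2 * (400 * c^30) + d^2 + (400 * c^30)^2 + 10000 * c^30"
  \<comment> \<open>T = 1/S has to satisfy conditions of the form x T \<le> y, each of which
    contributes a summand x/y; the summand 4 \<eta> yields the strict bound 2 T \<eta> < 1.\<close>
  define S where "S = 10^6 * c^40 + 400 * c^30 / (d / 2) + 400 * c^33 * m0 / R0 + 400 * c^33 * m0 / (1/2) + K / \<eta> + 4 * \<eta> + 1"
  have p: "0 < p" using l_gap l_pos'(3) by (simp add: p_def)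
  have "0 \<le> (\<Sum>k\<in>I. l k)" by (intro sum_nonneg less_imp_le l_pos'(1))
  then have E0: "0 < E" unfolding E_def by (rule half_gap_pos[OF _ l_gap])
  have R0: "0 < R0" using E0 p by (simp add: R0_def)
  have m0: "0 \<le> m0" using E0 by (simp add: m0_def)
  have nn: "0 \<le> real N" "0 \<le> l N" "0 \<le> X" "0 \<le> Y"
    using l_pos' m0 by (simp_all add: X_def Y_def)
  have c: "1 \<le> c" "g \<le> c" "real N \<le> c" "l N \<le> c" "2 * R0 \<le> c"
    "X \<le> c" "2 * (1 + Y) \<le> c"
    unfolding c_def by (rule constant_dominates[OF g1 nn(1,2) R0 nn(3,4)])+
  have cn: "0 \<le> c ^ n" for n using c(1) by simp
  have d: "0 < d" using \<eta> by (simp add: d_def)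
  have K: "2 * (400 * c^30) + d^2 + (400 * c^30)^2 \<le> K" "10000 * c^30 \<le> K" "0 \<le> K"
    using cn[of 30] zero_le_power2[of d] zero_le_power2[of "400 * c^30"] unfolding K_def by linarith+
  have Sn: "0 \<le> 10^6 * c^40" "0 \<le> 400 * c^30 / (d / 2)" "0 \<le> 400 * c^33 * m0 / R0" "0 \<le> 400 * c^33 * m0 / (1/2)" "0 \<le> K / \<eta>"
    using cn d R0 m0 \<eta> K by (auto intro!: mult_nonneg_nonneg divide_nonneg_nonneg)
  have S: "10^6 * c^40 / 1 \<le> S" "400 * c^30 / (d / 2) \<le> S" "400 * c^33 * m0 / R0 \<le> S" "400 * c^33 * m0 / (1/2) \<le> S" "K / \<eta> \<le> S"
    "4 * \<eta> / 1 \<le> S" "0 < S"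
    using Sn \<eta>(1) unfolding S_def by linarith+
  define T where "T = 1 / S"
  have T0: "0 < T" using S(7) by (simp add: T_def)
  have TS: "0 < y \<Longrightarrow> x / y \<le> S \<Longrightarrow> x * T \<le> y" for x y unfolding T_def by (rule inverse_scale[OF S(7)])
  have T1: "T * (10^6 * c^40) \<le> 1" using TS[OF _ S(1)] by (simp add: mult.commute)
  have T2: "400 * c^30 * T \<le> d / 2" using TS[OF _ S(2)] d by simp
  have T3: "400 * c^33 * T * m0 \<le> R0" using TS[OF _ S(3)] R0 by (simp add: ac_simps)
  have T4: "400 * c^33 * T * m0 \<le> 1 / 2" using TS[OF _ S(4)] by (simp add: ac_simps)
  have T5: "K * T \<le> \<eta>" using TS[OF _ S(5)] \<eta> by simp
  have T6: "2 * T * \<eta> < 1" using TS[OF _ S(6)] T0 \<eta> by (simp add: ac_simps)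
  have flow: "flow a b G N l v c R0 m0 T \<eta> K \<tau>l \<tau>u \<tau> U Uh"
    if \<tau>: "0 < \<tau>l" "\<tau>u \<le> T" "\<forall>n. \<tau>l \<le> \<tau> n \<and> \<tau> n \<le> \<tau>u" and supp: "\<forall>n i. i \<notin> I \<longrightarrow> U n i = 0"
      and pred: "\<forall>n. Uh (Suc n) = U n + \<tau> n *\<^sub>R Aop (U n) ((1/2) *\<^sub>R (Uh (Suc n) + U n))"
      and corr: "\<forall>n. U (Suc n) = Uh (Suc n) - \<tau> n *\<^sub>R tm I (GT (Uh (Suc n))) (gr b (Uh (Suc n)) (Uh (Suc n)) - mid I)"
      and gram: "\<forall>\<xi>. (vn \<xi>)^2 \<le> b (ap I (U 0) \<xi>) (ap I (U 0) \<xi>)"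
      and En: "(nA (U 0))^2 \<le> (\<Sum>k\<in>I. l k) + (l (N+1) - l N) / 2" for \<tau>l \<tau>u \<tau> U Uh
  proof (rule flow.intro[OF spectral_axioms], rule flow_axioms.intro)
    show "state a b G N l v c R W" if "\<And>i. i \<notin> I \<Longrightarrow> W i = 0" "0 \<le> R" "R \<le> 2 * R0"
      "\<And>\<xi>. PY.nm (ap I W \<xi>) \<le> R * PX.nm (ap I W \<xi>)" "fn (gr b W W - mid I) \<le> m0"
      "\<And>\<xi>. - (1/2) * (vn \<xi>)^2 \<le> vdot I \<xi> (mv I (gr b W W - mid I) \<xi>)" for W R
      by (rule state_intro[OF c[unfolded X_def Y_def] that])
    show "U n i = 0" if "i \<notin> I" for n i using supp that by simp
    show "Uh (Suc n) = U n + \<tau> n *\<^sub>R Aop (U n) ((1/2) *\<^sub>R (Uh (Suc n) + U n))" for n using pred by (rule spec)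
    show "U (Suc n) = Uh (Suc n) - \<tau> n *\<^sub>R tm I (GT (Uh (Suc n))) (gr b (Uh (Suc n)) (Uh (Suc n)) - mid I)" for n
      using corr by (rule spec)
    show "0 < \<tau>l" "\<tau>u \<le> T" "\<tau>l \<le> \<tau> n" "\<tau> n \<le> \<tau>u" for n using \<tau> by simp_all
    show "0 \<le> R0" using R0 by simp
    have PI: "b (ap I (U 0) \<xi>) (ap I (U 0) \<xi>) = (vn \<xi>)^2 + vdot I \<xi> (mv I (gr b (U 0) (U 0) - mid I) \<xi>)" for \<xi>
    proof -
      have "b (ap I (U 0) \<xi>) (ap I (U 0) \<xi>) = vdot I \<xi> (mv I (mid I) \<xi>) + vdot I \<xi> (mv I (gr b (U 0) (U 0) - mid I) \<xi>)"
        using B.f_ap_ap[of I "U 0" \<xi> "U 0" \<xi>] by (simp add: VD.add_right[symmetric] mv_add[symmetric])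
      then show ?thesis by (simp only: vdot_mv_mid[OF finite_atLeastAtMost])
    qed
    show "0 \<le> vdot I \<xi> (mv I (gr b (U 0) (U 0) - mid I) \<xi>)" for \<xi> using gram[rule_format, of \<xi>] PI[of \<xi>] by linarith
    show "PY.nm (ap I (U 0) \<xi>) \<le> R0 * PX.nm (ap I (U 0) \<xi>)" for \<xi>
      unfolding R0_def by (rule initial_cone[OF sorted gram[rule_format] En[folded E_def] E_def p_def])
    show "fn (gr b (U 0) (U 0) - mid I) \<le> m0"
    proof -
      have "fn (gr b (U 0) (U 0)) \<le> nB (U 0) * nB (U 0)" by (rule B.mnm_gr)
      also have "\<dots> \<le> (g * nA (U 0)) * (g * nA (U 0))"
        using g1 by (intro mult_mono nB_le TB.nm_nonneg mult_nonneg_nonneg TA.nm_nonneg) auto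
      also have "\<dots> = g^2 * (nA (U 0))^2" by algebra
      also have "\<dots> \<le> g^2 * E" by (intro mult_left_mono En[folded E_def]) simp
      finally have 1: "fn (gr b (U 0) (U 0)) \<le> g^2 * E" .
      have "fn (mid I) \<le> real (card I) * 1" by (rule fn_le_entries) (auto simp: mid_def)
      then show ?thesis unfolding m0_def using 1 MD.nm_triangle_diff[of I "gr b (U 0) (U 0)" "mid I"] by simp
    qed
  qed (fact c(1) T1 T2[unfolded d_def] T3 T4 T5 T6 K(1)[unfolded d_def] K(2) \<eta>)+
  have kap: "0 < 1 - 2 * t * \<eta> + K * t^2 \<and> 1 - 2 * t * \<eta> + K * t^2 < 1" if t: "0 < t" "t \<le> T" for t
  proof
    have "2 * t * \<eta> \<le> 2 * T * \<eta>" using t \<eta> by (intro mult_right_mono) auto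
    moreover have "0 \<le> K * t^2" using K(3) by simp
    ultimately show "0 < 1 - 2 * t * \<eta> + K * t^2" using T6 by linarith
    have "K * t \<le> \<eta>" using mult_left_mono[OF t(2) K(3)] T5 by linarith
    then have "K * t * t \<le> \<eta> * t" using t by (intro mult_right_mono) auto
    moreover have "K * t^2 = K * t * t" "2 * t * \<eta> = \<eta> * t + \<eta> * t" by algebra+
    moreover have "0 < \<eta> * t" using t \<eta> by simp
    ultimately show "1 - 2 * t * \<eta> + K * t^2 < 1" by linarith
  qed
  show ?thesis unfolding convergent_below_def
  proof (rule exI[of _ K], rule exI[of _ T], intro conjI[of "0 < T"] conjI[of "\<forall>t. _ t"] allI impI)
    show "0 < T" by (rule T0)
    show "0 < 1 - 2 * t * \<eta> + K * t^2 \<and> 1 - 2 * t * \<eta> + K * t^2 < 1" if "0 < t \<and> t \<le> T" for t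
      using kap that by simp
    fix \<tau>l \<tau>u \<tau> U Uh and q :: real
    assume *: "0 < \<tau>l" "\<tau>u \<le> T" "\<forall>n. \<tau>l \<le> \<tau> n \<and> \<tau> n \<le> \<tau>u" "\<forall>n i. i \<notin> I \<longrightarrow> U n i = 0"
      "\<forall>n. Uh (Suc n) = U n + \<tau> n *\<^sub>R Aop (U n) ((1/2) *\<^sub>R (Uh (Suc n) + U n))"
      "\<forall>n. U (Suc n) = Uh (Suc n) - \<tau> n *\<^sub>R tm I (GT (Uh (Suc n))) (gr b (Uh (Suc n)) (Uh (Suc n)) - mid I)"
      "\<forall>\<xi>. (vn \<xi>)^2 \<le> b (ap I (U 0) \<xi>) (ap I (U 0) \<xi>)"
      "(nA (U 0))^2 \<le> (\<Sum>k\<in>I. l k) + (l (N+1) - l N) / 2"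
      and q: "q = (SUP t\<in>{\<tau>l..\<tau>u}. 1 - 2 * t * \<eta> + K * t^2) powr (1/4)"
    note fl = flow[OF *]
    have kf: "flow.kap \<eta> K = (\<lambda>t. 1 - 2 * t * \<eta> + K * t^2)" by (rule ext) (rule flow.kap_def[OF fl])
    have qf: "flow.q \<eta> K \<tau>l \<tau>u = q" unfolding flow.q_def[OF fl] flow.kmax_def[OF fl] kf q ..
    show "0 < q \<and> q < 1 \<and>
      (\<exists>C>0. \<forall>\<^sub>F n in sequentially. (nA (Aop (Uh (Suc n)) (Uh (Suc n))))^2
         \<le> (1 - 2 * \<tau> n * \<eta> + K * (\<tau> n)^2) * (nA (Aop (U n) (U n)))^2 + C * \<tau> n * fn (gr b (U n) (U n) - mid I)) \<and>
      (\<exists>C>0. \<exists>Q. (\<forall>i\<in>I. \<forall>j\<in>I. (\<Sum>k\<in>I. Q k i * Q k j) = (if i = j then 1 else 0)) \<and>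
        (\<forall>\<^sub>F n in sequentially.
          nA (GT (U n) - tm I (U n) (gr b (U n) (GT (U n)))) \<le> C * q ^ n \<and>
          nA (U n - tm I v Q) \<le> C * q ^ n \<and>
          (nA (U n))^2 / 2 - (\<Sum>k\<in>I. l k) / 2 \<le> C * q ^ (2 * n)))"
      using flow.conclusion[OF fl] unfolding qf kf .
  qed
qed

end

section \<open>Transfer to function tuples\<close>

lemma tm_cong: "(\<And>i j. i \<in> I \<Longrightarrow> j \<in> I \<Longrightarrow> A i j = B i j) \<Longrightarrow> tm I U A = tm I U B"
  by (auto simp: tm_def intro!: sum.cong)

lemma sum_fun_apply: "(\<Sum>i\<in>A. f i) x = (\<Sum>i\<in>A. f i x)"
  by (induction A rule: infinite_finite_induct) (simp_all add: zero_fun_def)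

lemma linear_growth_zero:
  fixes A B :: real
  assumes "\<And>t. 0 \<le> A + 2 * t * B" shows "B = 0"
proof (rule ccontr)
  assume "B \<noteq> 0"
  then have "A + 2 * (- (A + 1) / (2 * B)) * B = - 1" by (simp add: field_simps)
  then show False using assms[of "- (A + 1) / (2 * B)"] by simp
qed

context schroedinger
begin

lemma coercive: "\<exists>\<alpha>>0. \<forall>u\<in>H01 \<Omega>. \<alpha> * l2ip \<Omega> u u \<le> aform \<Omega> V u u"
proof -
  obtain \<alpha> where \<alpha>: "\<alpha> > 0" "\<And>u. u \<in> H01 \<Omega> \<Longrightarrow> \<alpha> * (H1norm \<Omega> u)^2 \<le> aform \<Omega> V u u"
    using pot unfolding admissible_potential_def by blast
  have "\<alpha> * l2ip \<Omega> u u \<le> aform \<Omega> V u u" if u: "u \<in> H01 \<Omega>" for u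
  proof -
    have "0 \<le> gn u" unfolding gn_def by (intro sum_nonneg) simp
    then have "l2ip \<Omega> u u \<le> (H1norm \<Omega> u)^2" unfolding H1norm_sq[OF u] l2ip_nrm2 by simp
    then have "\<alpha> * l2ip \<Omega> u u \<le> \<alpha> * (H1norm \<Omega> u)^2" using \<alpha>(1) by (intro mult_left_mono) auto
    then show ?thesis using \<alpha>(2)[OF u] by linarith
  qed
  then show ?thesis using \<alpha>(1) by blast
qed

lemma l2ip_nonneg: "0 \<le> l2ip \<Omega> u u"
  unfolding l2ip_nrm2 by simp

lemma aform_nonneg: "u \<in> H01 \<Omega> \<Longrightarrow> 0 \<le> aform \<Omega> V u u"
proof -
  assume u: "u \<in> H01 \<Omega>"
  obtain \<alpha> where "\<alpha> > 0" "\<alpha> * l2ip \<Omega> u u \<le> aform \<Omega> V u u" using coercive u by blast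
  then show ?thesis using mult_nonneg_nonneg[of \<alpha> "l2ip \<Omega> u u"] l2ip_nonneg[of u] by linarith
qed

text \<open>A null vector of a semidefinite form is orthogonal to everything, since the form at w +
  t u is affine in t and nonnegative. Coercivity carries nullity from the energy to L2.\<close>

lemma aform_null:
  assumes u: "u \<in> H01 \<Omega>" "aform \<Omega> V u u = 0" and w: "w \<in> H01 \<Omega>"
  shows "aform \<Omega> V u w = 0" "l2ip \<Omega> u w = 0"
proof -
  have m: "w + t *\<^sub>R u \<in> H01 \<Omega>" for t by (rule H01_lincomb[OF w u(1)])
  have e: "aform \<Omega> V (w + t *\<^sub>R u) (w + t *\<^sub>R u) = aform \<Omega> V w w + 2 * t * aform \<Omega> V u w + t^2 * aform \<Omega> V u u" for t
    unfolding aform_lincomb[OF w u(1) m] aform_sym[OF w m] aform_sym[OF u(1) m]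
      aform_lincomb[OF w u(1) w] aform_lincomb[OF w u(1) u(1)] aform_sym[OF w u(1)]
    by (simp add: power2_eq_square algebra_simps)
  show "aform \<Omega> V u w = 0"
    by (rule linear_growth_zero[of "aform \<Omega> V w w"]) (use e u(2) aform_nonneg[OF m] in simp)
  obtain \<alpha> where \<alpha>: "\<alpha> > 0" "\<alpha> * l2ip \<Omega> u u \<le> aform \<Omega> V u u" using coercive u(1) by blast
  then have l0: "l2ip \<Omega> u u = 0" using u(2) l2ip_nonneg[of u] by (simp add: mult_le_0_iff)
  have e2: "l2ip \<Omega> (w + t *\<^sub>R u) (w + t *\<^sub>R u) = l2ip \<Omega> w w + 2 * t * l2ip \<Omega> u w + t^2 * l2ip \<Omega> u u" for t
    unfolding l2ip_lincomb[OF w u(1) m] l2ip_sym[of w "w + t *\<^sub>R u"] l2ip_sym[of u "w + t *\<^sub>R u"]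
      l2ip_lincomb[OF w u(1) w] l2ip_lincomb[OF w u(1) u(1)] l2ip_sym[of w u]
    by (simp add: power2_eq_square algebra_simps)
  show "l2ip \<Omega> u w = 0"
    by (rule linear_growth_zero[of "l2ip \<Omega> w w"]) (use e2 l0 l2ip_nonneg in \<open>metis add.right_neutral mult_zero_right\<close>)
qed

lemma H01_diff: "u \<in> H01 \<Omega> \<Longrightarrow> w \<in> H01 \<Omega> \<Longrightarrow> u - w \<in> H01 \<Omega>"
  using H01_lincomb[of u w "-1"] by simp

text \<open>Elements of \<open>H01\<close> are genuine functions, so the forms only separate them up to null functions. A
  linear projection onto a complement of the null functions inside \<open>H01\<close> turns them into forms on the
  whole function space.\<close>
lemma projection_ex:
  "\<exists>p. (\<forall>u c w. p (u + c *\<^sub>R w) = p u + c *\<^sub>R p w) \<and> (\<forall>u. p u \<in> H01 \<Omega>) \<and>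
    (\<forall>u\<in>H01 \<Omega>. aform \<Omega> V (p u - u) (p u - u) = 0) \<and> (\<forall>u\<in>H01 \<Omega>. aform \<Omega> V u u = 0 \<longrightarrow> p u = 0)"
proof -
  define Z where "Z = {u \<in> H01 \<Omega>. aform \<Omega> V u u = 0}"
  have Z: "u + c *\<^sub>R w \<in> Z" if "u \<in> Z" "w \<in> Z" for u w c
  proof -
    have u: "u \<in> H01 \<Omega>" "aform \<Omega> V u u = 0" and w: "w \<in> H01 \<Omega>" "aform \<Omega> V w w = 0"
      using that by (auto simp: Z_def)
    have m: "u + c *\<^sub>R w \<in> H01 \<Omega>" by (rule H01_lincomb[OF u(1) w(1)])
    have "aform \<Omega> V (u + c *\<^sub>R w) (u + c *\<^sub>R w) = 0"
      unfolding aform_lincomb[OF u(1) w(1) m] using aform_null(1)[OF u m] aform_null(1)[OF w m] by simp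
    then show ?thesis using m by (simp add: Z_def)
  qed
  have z0: "0 \<in> H01 \<Omega>" using H01_subspace by (rule subspace_0)
  have "aform \<Omega> V 0 0 = 0" using aform_lincomb[OF z0 z0 z0, of "-1"] by simp
  then have Z0: "0 \<in> Z" using z0 by (simp add: Z_def)
  have Zs: "subspace Z"
  proof (rule subspaceI)
    show "0 \<in> Z" by (rule Z0)
    show "x + y \<in> Z" if "x \<in> Z" "y \<in> Z" for x y using Z[OF that, of 1] by simp
    show "c *\<^sub>R x \<in> Z" if "x \<in> Z" for c x using Z[OF Z0 that, of c] by simp
  qed
  have id: "linear (\<lambda>x :: 'd fn. x)" by (rule linear_ident)
  \<comment> \<open>\<open>p1\<close> retracts all functions onto \<open>H01\<close> and
    \<open>p0\<close> onto the null functions; subtracting p0 after p1 removes the null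
    part.\<close>
  obtain p1 where p1: "range p1 \<subseteq> H01 \<Omega>" "linear p1" "\<And>u. u \<in> H01 \<Omega> \<Longrightarrow> p1 u = u"
    using linear_exists_left_inverse_on[OF id H01_subspace] by (auto simp: inj_on_def)
  obtain p0 where p0: "range p0 \<subseteq> Z" "linear p0" "\<And>u. u \<in> Z \<Longrightarrow> p0 u = u"
    using linear_exists_left_inverse_on[OF id Zs] by (auto simp: inj_on_def)
  have ZH: "Z \<subseteq> H01 \<Omega>" by (auto simp: Z_def)
  have p0Z: "p0 u \<in> Z" and p1H: "p1 u \<in> H01 \<Omega>" for u using p0(1) p1(1) by auto
  have lin: "f (u + c *\<^sub>R w) = f u + c *\<^sub>R f w" if "linear f" for f :: "'d fn \<Rightarrow> 'd fn" and u c w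
    using that by (simp only: linear_add linear_scale)
  show ?thesis
  proof (intro exI[of _ "\<lambda>u. p1 u - p0 (p1 u)"] conjI allI ballI impI)
    show "p1 (u + c *\<^sub>R w) - p0 (p1 (u + c *\<^sub>R w)) = p1 u - p0 (p1 u) + c *\<^sub>R (p1 w - p0 (p1 w))" for u c w
      unfolding lin[OF p1(2)] lin[OF p0(2)] scaleR_diff_right by simp
    show "p1 u - p0 (p1 u) \<in> H01 \<Omega>" for u by (rule H01_diff[OF p1H subsetD[OF ZH p0Z]])
    show "aform \<Omega> V (p1 u - p0 (p1 u) - u) (p1 u - p0 (p1 u) - u) = 0" if u: "u \<in> H01 \<Omega>" for u
    proof -
      have "p1 u - p0 (p1 u) - u = 0 + (-1) *\<^sub>R p0 (p1 u)" unfolding p1(3)[OF u] by simp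
      then have "p1 u - p0 (p1 u) - u \<in> Z" using Z[OF Z0 p0Z, of "-1" "p1 u"] by (simp only:)
      then show ?thesis by (simp add: Z_def)
    qed
    show "p1 u - p0 (p1 u) = 0" if u: "u \<in> H01 \<Omega>" "aform \<Omega> V u u = 0" for u
    proof -
      have "u \<in> Z" using u by (simp add: Z_def)
      then show ?thesis unfolding p1(3)[OF u(1)] using p0(3) by simp
    qed
  qed
qed

end

locale projected = schroedinger \<Omega> V for \<Omega> :: "(real^'d::finite) set" and V :: "'d fn" +
  fixes p :: "'d fn \<Rightarrow> 'd fn" and N :: nat and lam :: "nat \<Rightarrow> real" and Vs :: "'d tuple"
  assumes p_lin: "p (u + c *\<^sub>R w) = p u + c *\<^sub>R p w" and p_H: "p u \<in> H01 \<Omega>"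
    and p_null: "u \<in> H01 \<Omega> \<Longrightarrow> aform \<Omega> V (p u - u) (p u - u) = 0"
    and p_zero: "u \<in> H01 \<Omega> \<Longrightarrow> aform \<Omega> V u u = 0 \<Longrightarrow> p u = 0"
    and N: "N \<ge> 1" and eig: "eigenvalue_seq \<Omega> V lam" and lam_gap: "lam N < lam (N+1)"
    and Vs_eig: "\<forall>i\<in>{1..N}. is_eigfun \<Omega> V (lam i) (Vs i)"
    and Vs_on: "\<forall>i\<in>{1..N}. \<forall>j\<in>{1..N}. l2ip \<Omega> (Vs i) (Vs j) = idm i j"
begin

lemma p_diff: "p (u - w) = p u - p w" and p_add: "p (u + w) = p u + p w"
  and p_0: "p 0 = 0" and p_scale: "p (c *\<^sub>R w) = c *\<^sub>R p w"
proof -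
  show 0: "p 0 = 0" using p_lin[of 0 "-1" 0] by simp
  show "p (u - w) = p u - p w" using p_lin[of u "-1" w] by simp
  show "p (u + w) = p u + p w" using p_lin[of u 1 w] by simp
  show "p (c *\<^sub>R w) = c *\<^sub>R p w" using p_lin[of 0 c w] 0 by simp
qed

lemma p_sum: "p (sum f J) = (\<Sum>i\<in>J. p (f i))"
  by (induction J rule: infinite_finite_induct) (simp_all only: sum.infinite sum.empty sum.insert p_0 p_add not_False_eq_True)

lemma p_eqI: "u \<in> H01 \<Omega> \<Longrightarrow> w \<in> H01 \<Omega> \<Longrightarrow> aform \<Omega> V (u - w) (u - w) = 0 \<Longrightarrow> p u = p w"
  using p_zero[OF H01_diff, of u w] unfolding p_diff by simp

lemma aform_p: "u \<in> H01 \<Omega> \<Longrightarrow> w \<in> H01 \<Omega> \<Longrightarrow> aform \<Omega> V (p u) w = aform \<Omega> V u w"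
  and l2ip_p: "u \<in> H01 \<Omega> \<Longrightarrow> w \<in> H01 \<Omega> \<Longrightarrow> l2ip \<Omega> (p u) w = l2ip \<Omega> u w"
proof -
  assume u: "u \<in> H01 \<Omega>" and w: "w \<in> H01 \<Omega>"
  have d: "p u - u \<in> H01 \<Omega>" by (rule H01_diff[OF p_H u])
  have e: "p u = u + 1 *\<^sub>R (p u - u)" by simp
  have "aform \<Omega> V (p u) w = aform \<Omega> V (u + 1 *\<^sub>R (p u - u)) w" using e by (rule arg_cong)
  also have "\<dots> = aform \<Omega> V u w" unfolding aform_lincomb[OF u d w] aform_null(1)[OF d p_null[OF u] w] by simp
  finally show "aform \<Omega> V (p u) w = aform \<Omega> V u w" .
  have "l2ip \<Omega> (p u) w = l2ip \<Omega> (u + 1 *\<^sub>R (p u - u)) w" using e by (rule arg_cong)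
  also have "\<dots> = l2ip \<Omega> u w" unfolding l2ip_lincomb[OF u d w] aform_null(2)[OF d p_null[OF u] w] by simp
  finally show "l2ip \<Omega> (p u) w = l2ip \<Omega> u w" .
qed

definition pa :: "'d fn \<Rightarrow> 'd fn \<Rightarrow> real" where "pa u w = aform \<Omega> V (p u) (p w)"
definition pb :: "'d fn \<Rightarrow> 'd fn \<Rightarrow> real" where "pb u w = l2ip \<Omega> (p u) (p w)"
definition pG :: "'d fn \<Rightarrow> 'd fn" where "pG u = p (Gop \<Omega> V (p u))"

lemma pa_eq: "u \<in> H01 \<Omega> \<Longrightarrow> w \<in> H01 \<Omega> \<Longrightarrow> pa u w = aform \<Omega> V u w"
  unfolding pa_def using aform_p[of u "p w"] aform_p[of w u] aform_sym[of u "p w"] aform_sym[of w u] p_H by simp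

lemma pb_eq: "u \<in> H01 \<Omega> \<Longrightarrow> w \<in> H01 \<Omega> \<Longrightarrow> pb u w = l2ip \<Omega> u w"
  unfolding pb_def using l2ip_p[of u "p w"] l2ip_p[of w u] l2ip_sym[of u "p w"] l2ip_sym[of w u] p_H by simp

lemma p_p: "p (p u) = p u" if "u \<in> H01 \<Omega>"
  by (rule p_eqI[OF p_H that p_null[OF that]])

text \<open>Two solutions of one weak equation differ by a null function, which \<open>p\<close>
  removes. This makes the choice inside \<open>Gop\<close> linear after projection.\<close>

lemma Gop_eqI:
  assumes "u \<in> H01 \<Omega>" "w \<in> H01 \<Omega>" "\<And>z. z \<in> H01 \<Omega> \<Longrightarrow> aform \<Omega> V w z = l2ip \<Omega> u z"
  shows "p (Gop \<Omega> V u) = p w"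
proof (rule p_eqI[OF Gop(1)[OF assms(1)] assms(2)])
  let ?d = "Gop \<Omega> V u + (-1) *\<^sub>R w"
  have d: "?d \<in> H01 \<Omega>" by (rule H01_lincomb[OF Gop(1)[OF assms(1)] assms(2)])
  have "aform \<Omega> V ?d ?d = 0"
    unfolding aform_lincomb[OF Gop(1)[OF assms(1)] assms(2) d] Gop(2)[OF assms(1) d] assms(3)[OF d] by simp
  then show "aform \<Omega> V (Gop \<Omega> V u - w) (Gop \<Omega> V u - w) = 0" by simp
qed

lemma pG_eq: "u \<in> H01 \<Omega> \<Longrightarrow> pG (p u) = p (Gop \<Omega> V u)"
  unfolding pG_def p_p by (rule Gop_eqI[OF p_H Gop(1)]) (simp_all add: Gop(2) l2ip_p)

lemma Vs_H: "k \<in> {1..N} \<Longrightarrow> Vs k \<in> H01 \<Omega>"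
  using Vs_eig unfolding is_eigfun_def by blast

lemma lam_mono: "1 \<le> i \<Longrightarrow> i \<le> j \<Longrightarrow> lam i \<le> lam j"
  using eig unfolding eigenvalue_seq_def by blast

sublocale S: spectral pa pb pG N lam Vs
proof unfold_locales
  have Hl: "p u + c *\<^sub>R p w \<in> H01 \<Omega>" for u c w by (rule H01_lincomb[OF p_H p_H])
  show "pa u w = pa w u" for u w unfolding pa_def by (rule aform_sym[OF p_H p_H])
  show "pb u w = pb w u" for u w unfolding pb_def by (rule l2ip_sym)
  show "pa (u + c *\<^sub>R w) z = pa u z + c * pa w z" for u w z c
    unfolding pa_def p_lin by (rule aform_lincomb[OF p_H p_H p_H])
  show "pb (u + c *\<^sub>R w) z = pb u z + c * pb w z" for u w z c
    unfolding pb_def p_lin by (rule l2ip_lincomb[OF p_H p_H p_H])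
  show "0 \<le> pa u u" for u unfolding pa_def by (rule aform_nonneg[OF p_H])
  show "0 \<le> pb u u" for u unfolding pb_def by (rule l2ip_nonneg)
  show "pG (u + c *\<^sub>R w) = pG u + c *\<^sub>R pG w" for u c w
  proof -
    have "p (Gop \<Omega> V (p u + c *\<^sub>R p w)) = p (Gop \<Omega> V (p u) + c *\<^sub>R Gop \<Omega> V (p w))"
    proof (rule Gop_eqI[OF Hl H01_lincomb[OF Gop(1)[OF p_H] Gop(1)[OF p_H]]])
      fix z assume z: "z \<in> H01 \<Omega>"
      show "aform \<Omega> V (Gop \<Omega> V (p u) + c *\<^sub>R Gop \<Omega> V (p w)) z = l2ip \<Omega> (p u + c *\<^sub>R p w) z"
        unfolding aform_lincomb[OF Gop(1)[OF p_H] Gop(1)[OF p_H] z] l2ip_lincomb[OF p_H p_H z] Gop(2)[OF p_H z] ..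
    qed
    then show ?thesis unfolding pG_def p_lin .
  qed
  show "pa (pG u) w = pb u w" for u w
    unfolding pa_def pb_def pG_def p_p[OF Gop(1)[OF p_H]] aform_p[OF Gop(1)[OF p_H] p_H] by (rule Gop(2)[OF p_H p_H])
  show "1 \<le> N" by (rule N)
  have ev: "aform \<Omega> V (Vs k) w = lam k * l2ip \<Omega> (Vs k) w" if "k \<in> {1..N}" "w \<in> H01 \<Omega>" for k w
    using Vs_eig that unfolding is_eigfun_def by blast
  show "pa (Vs k) u = lam k * pb (Vs k) u" if "k \<in> {1..N}" for k u
    unfolding pa_def pb_def aform_p[OF Vs_H[OF that] p_H] l2ip_p[OF Vs_H[OF that] p_H] by (rule ev[OF that p_H])
  show "pb (Vs j) (Vs k) = (if j = k then 1 else 0)" if "j \<in> {1..N}" "k \<in> {1..N}" for j k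
    unfolding pb_eq[OF Vs_H[OF that(1)] Vs_H[OF that(2)]] using Vs_on that by (simp add: idm_def)
  have one: "1 \<in> {1..N}" using N by simp
  obtain \<alpha> where \<alpha>: "\<alpha> > 0" "\<alpha> * l2ip \<Omega> (Vs 1) (Vs 1) \<le> aform \<Omega> V (Vs 1) (Vs 1)" using coercive Vs_H[OF one] by blast
  have "l2ip \<Omega> (Vs 1) (Vs 1) = 1" using Vs_on one by (simp add: idm_def)
  then show "0 < lam 1" using \<alpha> ev[OF one Vs_H[OF one]] by simp
  show "lam 1 \<le> lam k \<and> lam k \<le> lam N" if "k \<in> {1..N}" for k using that lam_mono by simp
  show "lam N < lam (N + 1)" by (rule lam_gap)
  show "lam (N + 1) * pb y y \<le> pa y y" if y: "\<And>k. k \<in> {1..N} \<Longrightarrow> pb (Vs k) y = 0" for y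
    unfolding pa_def pb_def
  proof (rule spectral_gap[OF eig Vs_eig Vs_on p_H])
    show "l2ip \<Omega> (Vs k) (p y) = 0" if "k \<in> {1..N}" for k
      using y[OF that] l2ip_p[OF Vs_H[OF that] p_H, of y] unfolding pb_def by simp
  qed
qed

text \<open>Carries a tuple of functions to the abstract side; the value 0 outside
  \<open>{1..N}\<close> fits the scheme, which is prescribed on these indices only.\<close>

definition J :: "'d tuple \<Rightarrow> 'd tuple" where "J U = (\<lambda>i. if i \<in> {1..N} then p (U i) else 0)"

abbreviation HT :: "'d tuple \<Rightarrow> bool" where "HT U \<equiv> \<forall>i\<in>{1..N}. U i \<in> H01 \<Omega>"

lemma J_cong: "(\<And>i. i \<in> {1..N} \<Longrightarrow> U i = W i) \<Longrightarrow> J U = J W"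
  by (auto simp: J_def)

lemma J_tadd: "J (tadd U W) = J U + J W" and J_tdiff: "J (tdiff U W) = J U - J W"
  and J_tscale: "J (tscale c U) = c *\<^sub>R J U"
proof -
  have e: "tadd U W i = U i + W i" "tdiff U W i = U i - W i" "tscale c U i = c *\<^sub>R U i" for i
    by (auto simp: tadd_def tdiff_def tscale_def)
  show "J (tadd U W) = J U + J W" "J (tdiff U W) = J U - J W" "J (tscale c U) = c *\<^sub>R J U"
    unfolding J_def e by (auto simp: fun_eq_iff p_add p_diff p_scale)
qed

lemma tmul_eq: "tmul N U A j = (\<Sum>i\<in>{1..N}. A i j *\<^sub>R U i)"
  by (rule ext) (simp add: tmul_def sum_fun_apply mult.commute)

lemma J_tmul: "J (tmul N U A) = tm {1..N} (J U) A"
  by (rule ext) (simp add: J_def tm_def tmul_eq p_sum p_scale)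

lemma J_tGop: "HT U \<Longrightarrow> J (tGop \<Omega> V U) = S.GT (J U)"
  by (rule ext) (simp add: J_def tGop_def S.GT_def pG_eq)

lemma pb_J: "HT U \<Longrightarrow> HT W \<Longrightarrow> i \<in> {1..N} \<Longrightarrow> j \<in> {1..N} \<Longrightarrow> gram \<Omega> U W i j = gr pb (J U) (J W) i j"
  by (simp add: gram_def gr_def J_def pb_eq[OF p_H p_H]) (simp add: pb_eq flip: pb_def)

lemma HT_tGop: "HT U \<Longrightarrow> HT (tGop \<Omega> V U)"
  by (simp add: tGop_def Gop(1))

lemma HT_tmul: "HT U \<Longrightarrow> HT (tmul N U A)"
  unfolding tmul_eq by (intro ballI subspace_sum[OF H01_subspace] subspace_scale[OF H01_subspace]) auto

lemma HT_tdiff: "HT U \<Longrightarrow> HT W \<Longrightarrow> HT (tdiff U W)"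
proof
  fix i assume "HT U" "HT W" "i \<in> {1..N}"
  then have "U i - W i \<in> H01 \<Omega>" by (intro H01_diff) auto
  moreover have "U i - W i = tdiff U W i" by (auto simp: tdiff_def)
  ultimately show "tdiff U W i \<in> H01 \<Omega>" by simp
qed

lemma HT_tadd: "HT U \<Longrightarrow> HT W \<Longrightarrow> HT (tadd U (tscale c W))"
proof
  fix i assume "HT U" "HT W" "i \<in> {1..N}"
  then have "U i + c *\<^sub>R W i \<in> H01 \<Omega>" by (intro H01_lincomb) auto
  moreover have "U i + c *\<^sub>R W i = tadd U (tscale c W) i" by (auto simp: tadd_def tscale_def)
  ultimately show "tadd U (tscale c W) i \<in> H01 \<Omega>" by simp
qed

lemma HT_tscale: "HT W \<Longrightarrow> HT (tscale c W)"
proof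
  fix i assume "HT W" "i \<in> {1..N}"
  then have "c *\<^sub>R W i \<in> H01 \<Omega>" by (intro subspace_scale[OF H01_subspace]) auto
  moreover have "c *\<^sub>R W i = tscale c W i" by (auto simp: tscale_def)
  ultimately show "tscale c W i \<in> H01 \<Omega>" by simp
qed

lemma HT_Aop: "HT U \<Longrightarrow> HT (Aop \<Omega> V N U W)"
  unfolding Aop_def by (intro HT_tdiff HT_tmul HT_tGop)

lemma J_Aop:
  assumes U: "HT U" and W: "HT W" shows "J (Aop \<Omega> V N U W) = S.Aop (J U) (J W)"
proof -
  have "tm {1..N} (S.GT (J U)) (gram \<Omega> U W) = tm {1..N} (S.GT (J U)) (gr pb (J U) (J W))"
    by (rule tm_cong) (rule pb_J[OF U W])
  moreover have "tm {1..N} (J U) (gram \<Omega> U (tGop \<Omega> V W)) = tm {1..N} (J U) (gr pb (J U) (S.GT (J W)))"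
    by (rule tm_cong) (rule pb_J[OF U HT_tGop[OF W], unfolded J_tGop[OF W]])
  ultimately show ?thesis unfolding Aop_def S.Aop_def J_tdiff J_tmul J_tGop[OF U] by simp
qed

lemma J_gradE:
  assumes U: "HT U"
  shows "J (gradE \<Omega> V N U) = S.GT (J U) - tm {1..N} (J U) (gr pb (J U) (S.GT (J U)))"
proof -
  have "tm {1..N} (J U) (gram \<Omega> (tGop \<Omega> V U) U) = tm {1..N} (J U) (gr pb (S.GT (J U)) (J U))"
    by (rule tm_cong) (rule pb_J[OF HT_tGop[OF U] U, unfolded J_tGop[OF U]])
  then show ?thesis unfolding gradE_def J_tdiff J_tmul J_tGop[OF U] S.gr_G by simp
qed

lemma anorm_J:
  assumes U: "HT U" shows "anorm \<Omega> V N U = S.TA.nm (J U)"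
proof -
  have "aform \<Omega> V (U i) (U i) = pa (J U i) (J U i)" if "i \<in> {1..N}" for i
    using U that by (simp add: J_def pa_def p_p) (simp add: pa_eq flip: pa_def)
  then show ?thesis unfolding anorm_def S.TA.S.nm_def tform_def by (metis (no_types, lifting) sum.cong)
qed

lemma frob_gram:
  assumes U: "HT U"
  shows "frob N (mdiff (gram \<Omega> U U) idm) = MD.nm {1..N} (gr pb (J U) (J U) - mid {1..N})"
proof -
  have "frob N A = MD.nm {1..N} A" for A unfolding frob_def MD.S.nm_def mdot_self ..
  also have "MD.nm {1..N} (mdiff (gram \<Omega> U U) idm) = MD.nm {1..N} (gr pb (J U) (J U) - mid {1..N})"
    by (rule mnm_cong) (simp add: mdiff_def idm_def mid_def pb_J[OF U U])
  finally show ?thesis .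
qed

lemma HT_Vs: "HT Vs" using Vs_H by blast

text \<open>\<open>J Vs\<close> and \<open>Vs\<close> differ by null functions on
  \<open>{1..N}\<close>, and the abstract limit is expressed with \<open>Vs\<close>.\<close>

lemma J_Vs_dist: "S.TA.nm (J U - tm {1..N} (J Vs) Q) = S.TA.nm (J U - tm {1..N} Vs Q)" if U: "HT U"
proof -
  have "pa ((J U - tm {1..N} (J Vs) Q) i) w = pa ((J U - tm {1..N} Vs Q) i) w" if "i \<in> {1..N}" for i w
  proof -
    have "pa (J Vs k) w = pa (Vs k) w" if "k \<in> {1..N}" for k
      using that Vs_H[OF that] by (simp add: J_def pa_def p_p)
    then have "pa (tm {1..N} (J Vs) Q i) w = pa (tm {1..N} Vs Q i) w"
      using that by (simp add: tm_def S.A.sum_left S.A.scale_left)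
    then show ?thesis by (simp add: S.A.diff_left)
  qed
  then have "pa ((J U - tm {1..N} (J Vs) Q) i) ((J U - tm {1..N} (J Vs) Q) i) = pa ((J U - tm {1..N} Vs Q) i) ((J U - tm {1..N} Vs Q) i)"
    if "i \<in> {1..N}" for i using that S.A.psd_sym by metis
  then show ?thesis unfolding S.TA.S.nm_def tform_def by (metis (no_types, lifting) sum.cong)
qed

lemma energy_Vs: "energy \<Omega> V N Vs = (\<Sum>k\<in>{1..N}. lam k) / 2"
proof -
  have "aform \<Omega> V (Vs k) (Vs k) = lam k" if "k \<in> {1..N}" for k
    using Vs_eig Vs_on that Vs_H[OF that] unfolding is_eigfun_def by (simp add: idm_def)
  then have "(\<Sum>k\<in>{1..N}. aform \<Omega> V (Vs k) (Vs k)) = (\<Sum>k\<in>{1..N}. lam k)" by (rule sum.cong[OF refl])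
  moreover have "0 \<le> (\<Sum>k\<in>{1..N}. lam k)" by (intro sum_nonneg less_imp_le S.l_pos'(1))
  ultimately show ?thesis by (simp add: energy_def anorm_def)
qed

text \<open>The condition that the Gram matrix dominates the identity is invariant under rotation.
  Testing with \<zeta> = Q^T \<xi> uses Q Q^T = I, which \<open>mnm_gram_commute\<close> derives
  from Q^T Q = I.\<close>

lemma Sset_gram:
  assumes U: "HT U" and Q: "orthogonal_mat N Q" "Defs.psd N (mdiff (gram \<Omega> (tmul N U Q) (tmul N U Q)) idm)"
  shows "(VD.nm {1..N} \<xi>)^2 \<le> pb (ap {1..N} (J U) \<xi>) (ap {1..N} (J U) \<xi>)"
proof -
  let ?I = "{1..N}" and ?Qt = "\<lambda>i j. Q j i"
  define \<zeta> where "\<zeta> = mv ?I ?Qt \<xi>"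
  have "MD.nm ?I (mm ?I ?Qt Q - mid ?I) = 0"
  proof -
    have "MD.nm ?I (mm ?I ?Qt Q - mid ?I) = MD.nm ?I 0"
      by (rule mnm_cong) (use Q(1) in \<open>simp add: orthogonal_mat_def mm_def mid_def idm_def\<close>)
    then show ?thesis by (simp add: MD.nm_zero)
  qed
  then have "MD.nm ?I (mm ?I Q ?Qt - mid ?I) = 0" using mnm_gram_commute[of ?I Q] by simp
  then have QQ: "mm ?I Q ?Qt i j = mid ?I i j" if "i \<in> ?I" "j \<in> ?I" for i j
    using mnm_entry[OF _ that, of "mm ?I Q ?Qt - mid ?I"] by simp
  have mvmv: "mv ?I Q \<zeta> i = \<xi> i" if i: "i \<in> ?I" for i
  proof -
    have "mv ?I Q \<zeta> i = (\<Sum>j\<in>?I. \<Sum>k\<in>?I. Q i j * (Q k j * \<xi> k))"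
      using i by (simp add: \<zeta>_def mv_def sum_distrib_left)
    also have "\<dots> = (\<Sum>k\<in>?I. \<Sum>j\<in>?I. Q i j * (Q k j * \<xi> k))" by (rule sum.swap)
    also have "\<dots> = (\<Sum>k\<in>?I. mm ?I Q ?Qt i k * \<xi> k)" by (simp add: mm_def sum_distrib_right mult.assoc)
    also have "\<dots> = (\<Sum>k\<in>?I. (if i = k then \<xi> k else 0))"
      by (rule sum.cong) (use i in \<open>auto simp: QQ mid_def\<close>)
    finally show ?thesis using i by simp
  qed
  have ap: "ap ?I (tm ?I (J U) Q) \<zeta> = ap ?I (J U) \<xi>"
    unfolding ap_tm unfolding ap_def by (rule sum.cong) (simp_all only: mvmv)
  have zz: "(VD.nm ?I \<zeta>)^2 = (VD.nm ?I \<xi>)^2"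
  proof -
    have "(VD.nm ?I \<zeta>)^2 = (\<Sum>i\<in>?I. \<Sum>k\<in>?I. \<zeta> i * (Q k i * \<xi> k))"
      unfolding VD.nm_sq tform_def by (intro sum.cong refl) (simp add: \<zeta>_def mv_def sum_distrib_left)
    also have "\<dots> = (\<Sum>k\<in>?I. \<Sum>i\<in>?I. \<zeta> i * (Q k i * \<xi> k))" by (rule sum.swap)
    also have "\<dots> = (\<Sum>k\<in>?I. mv ?I Q \<zeta> k * \<xi> k)"
      by (intro sum.cong refl) (simp add: mv_def sum_distrib_left sum_distrib_right ac_simps)
    also have "\<dots> = (VD.nm ?I \<xi>)^2" unfolding VD.nm_sq tform_def by (rule sum.cong) (simp_all only: mvmv)
    finally show ?thesis .
  qed
  have W: "HT (tmul N U Q)" by (rule HT_tmul[OF U])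
  have "0 \<le> (\<Sum>i\<in>?I. \<Sum>j\<in>?I. \<zeta> i * mdiff (gram \<Omega> (tmul N U Q) (tmul N U Q)) idm i j * \<zeta> j)"
    using Q(2) unfolding Defs.psd_def by blast
  also have "\<dots> = (\<Sum>i\<in>?I. \<Sum>j\<in>?I. \<zeta> i * (gr pb (tm ?I (J U) Q) (tm ?I (J U) Q) i j * \<zeta> j) - (if i = j then (\<zeta> i)^2 else 0))"
    by (intro sum.cong refl) (simp add: mdiff_def idm_def pb_J[OF W W] J_tmul power2_eq_square algebra_simps)
  also have "\<dots> = pb (ap ?I (tm ?I (J U) Q) \<zeta>) (ap ?I (tm ?I (J U) Q) \<zeta>) - (VD.nm ?I \<zeta>)^2"
    unfolding S.B.f_ap_ap VD.nm_sq vdot_self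
    by (simp add: sum_subtractf tform_def mv_def sum_distrib_left)
  finally show ?thesis unfolding ap zz by simp
qed

text \<open>\<open>E_ES\<close> exchanges \<open>lam N\<close> for \<open>lam (N+1)\<close>, so
  twice the averaged threshold is the eigenvalue sum plus half the gap.\<close>

lemma Sset_energy:
  assumes U: "HT U" and E: "energy \<Omega> V N U \<le> (energy \<Omega> V N Vs + E_ES N lam) / 2"
  shows "(S.TA.nm (J U))^2 \<le> (\<Sum>k\<in>{1..N}. lam k) + (lam (N+1) - lam N) / 2"
proof -
  have "{1..N} = insert N {1..N-1}" "N \<notin> {1..N-1}" using N by auto
  then have "(\<Sum>k\<in>{1..N}. lam k) = lam N + (\<Sum>k\<in>{1..N-1}. lam k)" by simp
  then show ?thesis using E unfolding energy_Vs E_ES_def unfolding energy_def anorm_J[OF U] by (simp add: field_simps)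
qed

end

text \<open>\<kappa> is the explicit quadratic 1 - 2t\<eta> + K t^2 with \<eta> the gap less
  \<epsilon>, so the second-order clause holds with |K|. Its predictor contraction property is part
  of the conclusion, which ties \<kappa> to the scheme.\<close>

theorem theorem4p11:
  fixes \<Omega> :: "(real^'d) set" and V :: "'d fn" and N :: nat
    and lam :: "nat \<Rightarrow> real" and Vs :: "'d tuple"
  assumes dom: "is_domain \<Omega>"
    and pot: "admissible_potential \<Omega> V"
    and N: "N \<ge> 1"
    and eig: "eigenvalue_seq \<Omega> V lam"
    and gap: "lam N < lam (N+1)"
    and Vs_eig: "\<forall>i\<in>{1..N}. is_eigfun \<Omega> V (lam i) (Vs i)"
    and Vs_on: "\<forall>i\<in>{1..N}. \<forall>j\<in>{1..N}. l2ip \<Omega> (Vs i) (Vs j) = idm i j"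
  shows "\<forall>\<epsilon>. 0 < \<epsilon> \<and> \<epsilon> < 1 / lam N - 1 / lam (N+1) \<longrightarrow>
    (\<exists>(\<kappa>::real \<Rightarrow> real) K \<tau>0. \<tau>0 > 0 \<and>
      (\<forall>\<tau>. 0 < \<tau> \<and> \<tau> \<le> \<tau>0 \<longrightarrow>
         \<bar>\<kappa> \<tau> - (1 - 2 * \<tau> * (1 / lam N - 1 / lam (N+1) - \<epsilon>))\<bar> \<le> K * \<tau>^2
         \<and> 0 < \<kappa> \<tau> \<and> \<kappa> \<tau> < 1) \<and>
      (\<forall>\<tau>min \<tau>max. 0 < \<tau>min \<and> \<tau>min \<le> \<tau>max \<and> \<tau>max \<le> \<tau>0 \<longrightarrow>
        (\<forall>(\<tau>::nat \<Rightarrow> real) (U::nat \<Rightarrow> 'd tuple) (Uh::nat \<Rightarrow> 'd tuple).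
          U 0 \<in> Sset \<Omega> V N lam Vs \<and>
          (\<forall>n. \<tau>min \<le> \<tau> n \<and> \<tau> n \<le> \<tau>max) \<and>
          (\<forall>n. \<forall>i\<in>{1..N}. Uh (Suc n) i = tadd (U n)
               (tscale (\<tau> n) (Aop \<Omega> V N (U n) (tscale (1/2) (tadd (Uh (Suc n)) (U n))))) i) \<and>
          (\<forall>n. \<forall>i\<in>{1..N}. U (Suc n) i = tdiff (Uh (Suc n))
               (tscale (\<tau> n) (tmul N (tGop \<Omega> V (Uh (Suc n)))
                  (mdiff (gram \<Omega> (Uh (Suc n)) (Uh (Suc n))) idm))) i)
          \<longrightarrow>
          (let \<kappa>hat = (SUP t\<in>{\<tau>min..\<tau>max}. \<kappa> t) powr (1/4) in
            0 < \<kappa>hat \<and> \<kappa>hat < 1 \<and>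
            (\<exists>c>0. \<forall>\<^sub>F n in sequentially.
               (anorm \<Omega> V N (Aop \<Omega> V N (Uh (Suc n)) (Uh (Suc n))))^2
                 \<le> \<kappa> (\<tau> n) * (anorm \<Omega> V N (Aop \<Omega> V N (U n) (U n)))^2
                   + c * \<tau> n * frob N (mdiff (gram \<Omega> (U n) (U n)) idm)) \<and>
            (\<exists>C>0. \<exists>Q. orthogonal_mat N Q \<and>
               (\<forall>\<^sub>F n in sequentially.
                  anorm \<Omega> V N (gradE \<Omega> V N (U n)) \<le> C * \<kappa>hat ^ n \<and>
                  anorm \<Omega> V N (tdiff (U n) (tmul N Vs Q)) \<le> C * \<kappa>hat ^ n \<and>
                  energy \<Omega> V N (U n) - energy \<Omega> V N Vs \<le> C * \<kappa>hat ^ (2*n)))))))"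
proof (intro allI impI)
  fix \<epsilon> assume \<epsilon>: "0 < \<epsilon> \<and> \<epsilon> < 1 / lam N - 1 / lam (N+1)"
  have sch: "schroedinger \<Omega> V" by unfold_locales (fact dom pot)+
  obtain p where p: "(\<forall>u c w. p (u + c *\<^sub>R w) = p u + c *\<^sub>R p w) \<and> (\<forall>u. p u \<in> H01 \<Omega>) \<and>
    (\<forall>u\<in>H01 \<Omega>. aform \<Omega> V (p u - u) (p u - u) = 0) \<and> (\<forall>u\<in>H01 \<Omega>. aform \<Omega> V u u = 0 \<longrightarrow> p u = 0)"
    using schroedinger.projection_ex[OF sch] ..
  note p' = p[THEN conjunct1, rule_format] p[THEN conjunct2, THEN conjunct1, rule_format]
    p[THEN conjunct2, THEN conjunct2, THEN conjunct1, rule_format] p[THEN conjunct2, THEN conjunct2, THEN conjunct2, rule_format]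
  interpret P: projected \<Omega> V p N lam Vs
    by (rule projected.intro[OF sch], rule projected_axioms.intro)
      (rule p'(1), rule p'(2), erule p'(3), erule (1) p'(4), fact N, fact eig, fact gap, fact Vs_eig, fact Vs_on)
  define \<eta> where "\<eta> = 1 / lam N - 1 / lam (N+1) - \<epsilon>"
  have \<eta>: "0 < \<eta>" "\<eta> < 1 / lam N - 1 / lam (N+1)" using \<epsilon> by (simp_all add: \<eta>_def)
  have sorted: "i \<in> {1..N} \<Longrightarrow> j \<in> {1..N} \<Longrightarrow> i \<le> j \<Longrightarrow> lam i \<le> lam j" for i j
    using P.lam_mono by simp
  obtain K T where KT: "P.S.convergent_below \<eta> K T"
    using P.S.two_stage_convergence[OF sorted \<eta>] by blast
  note T = KT[unfolded P.S.convergent_below_def, THEN conjunct1]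
    and kap = KT[unfolded P.S.convergent_below_def, THEN conjunct2, THEN conjunct1]
    and conv = KT[unfolded P.S.convergent_below_def, THEN conjunct2, THEN conjunct2]
  let ?\<kappa> = "\<lambda>t. 1 - 2 * t * \<eta> + K * t^2"
  have main: "let \<kappa>hat = (SUP t\<in>{\<tau>min..\<tau>max}. ?\<kappa> t) powr (1/4) in
            0 < \<kappa>hat \<and> \<kappa>hat < 1 \<and>
            (\<exists>c>0. \<forall>\<^sub>F n in sequentially.
               (anorm \<Omega> V N (Aop \<Omega> V N (Uh (Suc n)) (Uh (Suc n))))^2
                 \<le> ?\<kappa> (\<tau> n) * (anorm \<Omega> V N (Aop \<Omega> V N (U n) (U n)))^2
                   + c * \<tau> n * frob N (mdiff (gram \<Omega> (U n) (U n)) idm)) \<and>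
            (\<exists>C>0. \<exists>Q. orthogonal_mat N Q \<and>
               (\<forall>\<^sub>F n in sequentially.
                  anorm \<Omega> V N (gradE \<Omega> V N (U n)) \<le> C * \<kappa>hat ^ n \<and>
                  anorm \<Omega> V N (tdiff (U n) (tmul N Vs Q)) \<le> C * \<kappa>hat ^ n \<and>
                  energy \<Omega> V N (U n) - energy \<Omega> V N Vs \<le> C * \<kappa>hat ^ (2*n)))"
    if \<tau>: "0 < \<tau>min" "\<tau>max \<le> T" "\<forall>n. \<tau>min \<le> \<tau> n \<and> \<tau> n \<le> \<tau>max"
      and U0: "U 0 \<in> Sset \<Omega> V N lam Vs"
      and pred: "\<forall>n. \<forall>i\<in>{1..N}. Uh (Suc n) i = tadd (U n)
               (tscale (\<tau> n) (Aop \<Omega> V N (U n) (tscale (1/2) (tadd (Uh (Suc n)) (U n))))) i"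
      and corr: "\<forall>n. \<forall>i\<in>{1..N}. U (Suc n) i = tdiff (Uh (Suc n))
               (tscale (\<tau> n) (tmul N (tGop \<Omega> V (Uh (Suc n)))
                  (mdiff (gram \<Omega> (Uh (Suc n)) (Uh (Suc n))) idm))) i"
    for \<tau>min \<tau>max \<tau> U Uh
  proof -
    \<comment> \<open>The value of the field is a combination of \<open>U n\<close> and its image
      under \<open>Gop\<close>, whatever the second argument; hence the implicit
      \<open>Uh (Suc n)\<close> lies in \<open>H01\<close>.\<close>
    have HUh: "P.HT (Uh (Suc n))" if "P.HT (U n)" for n
      using P.HT_tadd[OF that P.HT_Aop[OF that]] pred by simp
    have HU: "P.HT (U n)" for n
    proof (induction n)
      case 0
      then show ?case using U0 by (simp add: Sset_def)
    next
      case (Suc n)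
      then show ?case
        using P.HT_tdiff[OF HUh[OF Suc] P.HT_tscale[OF P.HT_tmul[OF P.HT_tGop[OF HUh[OF Suc]]]]] corr by simp
    qed
    note HUh = HUh[OF HU]
    obtain Q0 where Q0: "orthogonal_mat N Q0" "Defs.psd N (mdiff (gram \<Omega> (tmul N (U 0) Q0) (tmul N (U 0) Q0)) idm)"
      and E: "energy \<Omega> V N (U 0) \<le> (energy \<Omega> V N Vs + E_ES N lam) / 2" using U0 unfolding Sset_def by blast
    let ?q = "(SUP t\<in>{\<tau>min..\<tau>max}. ?\<kappa> t) powr (1/4)"
    have 1: "\<forall>n i. i \<notin> {1..N} \<longrightarrow> P.J (U n) i = 0" by (simp add: P.J_def)
    have 2: "\<forall>n. P.J (Uh (Suc n)) = P.J (U n) + \<tau> n *\<^sub>R P.S.Aop (P.J (U n)) ((1/2) *\<^sub>R (P.J (Uh (Suc n)) + P.J (U n)))"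
    proof
      fix n
      have H1: "P.HT (tadd (Uh (Suc n)) (U n))"
      proof -
        have "tscale 1 (U n) = U n" by (simp add: tscale_def)
        then show ?thesis using P.HT_tadd[OF HUh[of n] HU[of n], of 1] by simp
      qed
      have "P.J (Uh (Suc n)) = P.J (tadd (U n) (tscale (\<tau> n) (Aop \<Omega> V N (U n) (tscale (1/2) (tadd (Uh (Suc n)) (U n))))))"
        by (rule P.J_cong) (use pred in blast)
      then show "P.J (Uh (Suc n)) = P.J (U n) + \<tau> n *\<^sub>R P.S.Aop (P.J (U n)) ((1/2) *\<^sub>R (P.J (Uh (Suc n)) + P.J (U n)))"
        unfolding P.J_tadd P.J_tscale P.J_Aop[OF HU P.HT_tscale[OF H1]] .
    qed
    have 3: "\<forall>n. P.J (U (Suc n)) = P.J (Uh (Suc n)) - \<tau> n *\<^sub>R tm {1..N} (P.S.GT (P.J (Uh (Suc n)))) (gr P.pb (P.J (Uh (Suc n))) (P.J (Uh (Suc n))) - mid {1..N})"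
    proof
      fix n
      have "P.J (U (Suc n)) = P.J (tdiff (Uh (Suc n)) (tscale (\<tau> n) (tmul N (tGop \<Omega> V (Uh (Suc n))) (mdiff (gram \<Omega> (Uh (Suc n)) (Uh (Suc n))) idm))))"
        by (rule P.J_cong) (use corr in blast)
      also have "\<dots> = P.J (Uh (Suc n)) - \<tau> n *\<^sub>R tm {1..N} (P.S.GT (P.J (Uh (Suc n)))) (mdiff (gram \<Omega> (Uh (Suc n)) (Uh (Suc n))) idm)"
        unfolding P.J_tdiff P.J_tscale P.J_tmul P.J_tGop[OF HUh] ..
      also have "tm {1..N} (P.S.GT (P.J (Uh (Suc n)))) (mdiff (gram \<Omega> (Uh (Suc n)) (Uh (Suc n))) idm)
        = tm {1..N} (P.S.GT (P.J (Uh (Suc n)))) (gr P.pb (P.J (Uh (Suc n))) (P.J (Uh (Suc n))) - mid {1..N})"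
        by (rule tm_cong) (simp add: mdiff_def idm_def mid_def P.pb_J[OF HUh HUh])
      finally show "P.J (U (Suc n)) = P.J (Uh (Suc n)) - \<tau> n *\<^sub>R tm {1..N} (P.S.GT (P.J (Uh (Suc n)))) (gr P.pb (P.J (Uh (Suc n))) (P.J (Uh (Suc n))) - mid {1..N})" .
    qed
    have 4: "\<forall>\<xi>. (VD.nm {1..N} \<xi>)^2 \<le> P.pb (ap {1..N} (P.J (U 0)) \<xi>) (ap {1..N} (P.J (U 0)) \<xi>)"
      by (rule allI, rule P.Sset_gram[OF HU Q0])
    have 5: "(P.S.TA.nm (P.J (U 0)))^2 \<le> (\<Sum>k\<in>{1..N}. lam k) + (lam (N+1) - lam N) / 2"
      by (rule P.Sset_energy[OF HU E])
    note c = conv[THEN spec[where x = \<tau>min], THEN spec[where x = \<tau>max], THEN spec[where x = \<tau>],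
      THEN spec[where x = "\<lambda>n. P.J (U n)"], THEN spec[where x = "\<lambda>n. P.J (Uh n)"], THEN spec[where x = ?q],
      THEN mp, OF \<tau>(1), THEN mp, OF \<tau>(2), THEN mp, OF \<tau>(3), THEN mp, OF 1, THEN mp, OF 2, THEN mp, OF 3,
      THEN mp, OF 4, THEN mp, OF 5, THEN mp, OF refl]
    have e1: "P.S.Aop (P.J (U n)) (P.J (U n)) = P.J (Aop \<Omega> V N (U n) (U n))" for n by (rule P.J_Aop[OF HU HU, symmetric])
    have e2: "P.S.Aop (P.J (Uh (Suc n))) (P.J (Uh (Suc n))) = P.J (Aop \<Omega> V N (Uh (Suc n)) (Uh (Suc n)))" for n
      by (rule P.J_Aop[OF HUh HUh, symmetric])
    have e3: "P.S.TA.nm (P.J (U n) - tm {1..N} Vs Q) = anorm \<Omega> V N (tdiff (U n) (tmul N Vs Q))" for n Q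
      unfolding P.anorm_J[OF P.HT_tdiff[OF HU P.HT_tmul[OF P.HT_Vs]]] P.J_tdiff P.J_tmul by (rule P.J_Vs_dist[OF HU, symmetric])
    have e4: "energy \<Omega> V N (U n) - energy \<Omega> V N Vs = (P.S.TA.nm (P.J (U n)))^2 / 2 - (\<Sum>k\<in>{1..N}. lam k) / 2" for n
      unfolding P.energy_Vs unfolding energy_def P.anorm_J[OF HU] ..
    have e5: "P.HT (gradE \<Omega> V N (U n))" for n
      unfolding gradE_def by (intro P.HT_tdiff P.HT_tGop P.HT_tmul HU)
    have e6: "P.S.TA.nm (P.S.GT (P.J (U n)) - tm {1..N} (P.J (U n)) (gr P.pb (P.J (U n)) (P.S.GT (P.J (U n))))) = anorm \<Omega> V N (gradE \<Omega> V N (U n))" for n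
      unfolding P.anorm_J[OF e5] P.J_gradE[OF HU] ..
    show ?thesis
      unfolding Let_def e4 orthogonal_mat_def idm_def[THEN fun_cong, THEN fun_cong]
        P.frob_gram[OF HU]
      using c unfolding e1 e2 e3 e6 P.anorm_J[OF P.HT_Aop[OF HU], symmetric] P.anorm_J[OF P.HT_Aop[OF HUh], symmetric] .
  qed
  show "\<exists>(\<kappa>::real \<Rightarrow> real) K \<tau>0. \<tau>0 > 0 \<and>
      (\<forall>\<tau>. 0 < \<tau> \<and> \<tau> \<le> \<tau>0 \<longrightarrow>
         \<bar>\<kappa> \<tau> - (1 - 2 * \<tau> * (1 / lam N - 1 / lam (N+1) - \<epsilon>))\<bar> \<le> K * \<tau>^2
         \<and> 0 < \<kappa> \<tau> \<and> \<kappa> \<tau> < 1) \<and>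
      (\<forall>\<tau>min \<tau>max. 0 < \<tau>min \<and> \<tau>min \<le> \<tau>max \<and> \<tau>max \<le> \<tau>0 \<longrightarrow>
        (\<forall>(\<tau>::nat \<Rightarrow> real) (U::nat \<Rightarrow> 'd tuple) (Uh::nat \<Rightarrow> 'd tuple).
          U 0 \<in> Sset \<Omega> V N lam Vs \<and>
          (\<forall>n. \<tau>min \<le> \<tau> n \<and> \<tau> n \<le> \<tau>max) \<and>
          (\<forall>n. \<forall>i\<in>{1..N}. Uh (Suc n) i = tadd (U n)
               (tscale (\<tau> n) (Aop \<Omega> V N (U n) (tscale (1/2) (tadd (Uh (Suc n)) (U n))))) i) \<and>
          (\<forall>n. \<forall>i\<in>{1..N}. U (Suc n) i = tdiff (Uh (Suc n))
               (tscale (\<tau> n) (tmul N (tGop \<Omega> V (Uh (Suc n)))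
                  (mdiff (gram \<Omega> (Uh (Suc n)) (Uh (Suc n))) idm))) i)
          \<longrightarrow>
          (let \<kappa>hat = (SUP t\<in>{\<tau>min..\<tau>max}. \<kappa> t) powr (1/4) in
            0 < \<kappa>hat \<and> \<kappa>hat < 1 \<and>
            (\<exists>c>0. \<forall>\<^sub>F n in sequentially.
               (anorm \<Omega> V N (Aop \<Omega> V N (Uh (Suc n)) (Uh (Suc n))))^2
                 \<le> \<kappa> (\<tau> n) * (anorm \<Omega> V N (Aop \<Omega> V N (U n) (U n)))^2
                   + c * \<tau> n * frob N (mdiff (gram \<Omega> (U n) (U n)) idm)) \<and>
            (\<exists>C>0. \<exists>Q. orthogonal_mat N Q \<and>
               (\<forall>\<^sub>F n in sequentially.
                  anorm \<Omega> V N (gradE \<Omega> V N (U n)) \<le> C * \<kappa>hat ^ n \<and>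
                  anorm \<Omega> V N (tdiff (U n) (tmul N Vs Q)) \<le> C * \<kappa>hat ^ n \<and>
                  energy \<Omega> V N (U n) - energy \<Omega> V N Vs \<le> C * \<kappa>hat ^ (2*n))))))"
  proof (rule exI[of _ ?\<kappa>], rule exI[of _ "\<bar>K\<bar>"], rule exI[of _ T], intro conjI)
    show "\<forall>t. 0 < t \<and> t \<le> T \<longrightarrow>
         \<bar>?\<kappa> t - (1 - 2 * t * (1 / lam N - 1 / lam (N+1) - \<epsilon>))\<bar> \<le> \<bar>K\<bar> * t^2 \<and> 0 < ?\<kappa> t \<and> ?\<kappa> t < 1"
      unfolding \<eta>_def[symmetric] using kap by (simp add: abs_mult)
    show "0 < T" by (rule T)
  qed (intro allI impI, elim conjE, (rule main; assumption))
qed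

end
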